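(* Let $p$ be a prime, let $\mathbf{F}$ be a field of characteristic $p$, let $G\cong\mathbf{Z}/p^2$ and let $d$ be any non-negative integer. In the decomposition of $\mathbf{F}[V_{p+1}]_d$ into a direct sum of indecomposable $\mathbf{F}G$-modules there is at most one indecomposable summand $V_m$ which is not induced from a representation of a proper subgroup. In particular, writing $d=ap^2+bp+c$ where $a\ge 0$ and $0\le b,c<p$, there is exactly one non-induced indecomposable summand when $b\le p-2$, and $\mathbf{F}[V_{p+1}]_d$ is an induced module when $b=p-1$. Moreover, if $b\le p-2$ then the non-induced indecomposable summand is isomorphic to $V_{cp+b+1}$, and we may choose the decomposition of $\mathbf{F}[V_{p+1}]_d$ such that the socle of this summand, $V_{cp+b+1}^G$, is spanned by the invariant $N^G(x_{p+1})^aN^G(x_p)^bx_1^c$.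
   Context: Let $\sigma$ be a generator of $G\cong\mathbf{Z}/p^2$. For $1\le m\le p^2$, $V_m$ is the indecomposable $\mathbf{F}G$-module of dimension $m$ on which $\sigma$ acts by a single Jordan block with eigenvalue $1$; these are, up to isomorphism, all the indecomposable $\mathbf{F}G$-modules. The socle of $V_m$ is the one-dimensional fixed space $V_m^G$. $V_m$ is induced from a representation of a proper subgroup of $G$ if and only if $p$ divides $m$; an induced module is a direct sum of such indecomposables. $\mathbf{F}[V_{p+1}]:=S(V_{p+1}^* )$, with $G$ acting by algebra automorphisms, and $\mathbf{F}[V_{p+1}]_d$ is its homogeneous component of degree $d$. Put $\Delta:=\sigma-1\in\mathbf{F}G$; $x_{p+1}$ is an $\mathbf{F}G$-module generator of $V_{p+1}^*$ and $x_i:=\Delta^{p+1-i}(x_{p+1})$ for $1\le i\le p$, so that $\mathbf{F}[V_{p+1}]=\mathbf{F}[x_1,\ldots,x_{p+1}]$. For $f\in\mathbf{F}[V_{p+1}]$, the norm $N^G(f)$ is the product of the elements of the $G$-orbit of $f$. *)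

theory Defs
  imports
    "HOL-Computational_Algebra.Computational_Algebra"
    "HOL-Algebra.Elementary_Groups"
    "HOL-Algebra.Left_Coset"
    "HOL-Library.Poly_Mapping"
begin

section \<open>Modules over a group algebra\<close>

text \<open>An \<open>FG\<close>-module is a subspace \<open>M\<close> of an ambient vector space together with a linear action of
  \<open>G\<close> on it; the behaviour of \<open>act\<close> outside \<open>M\<close> is irrelevant. In this way a submodule of \<open>M\<close> is
  simply an \<open>FG\<close>-module contained in \<open>M\<close>, with the same \<open>scale\<close> and \<open>act\<close>.\<close>

locale FG_module = vector_space scale + G: group G
  for scale :: "'f::field \<Rightarrow> 'v::ab_group_add \<Rightarrow> 'v"
  and G :: "('g, 'x) monoid_scheme" +
  fixes act :: "'g \<Rightarrow> 'v \<Rightarrow> 'v"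
  and M :: "'v set"
  assumes subspace: "module.subspace scale M"
  and act_closed: "\<lbrakk>g \<in> carrier G; v \<in> M\<rbrakk> \<Longrightarrow> act g v \<in> M"
  and act_add: "\<lbrakk>g \<in> carrier G; v \<in> M; w \<in> M\<rbrakk> \<Longrightarrow> act g (v + w) = act g v + act g w"
  and act_scale: "\<lbrakk>g \<in> carrier G; v \<in> M\<rbrakk> \<Longrightarrow> act g (scale c v) = scale c (act g v)"
  and act_one: "v \<in> M \<Longrightarrow> act \<one>\<^bsub>G\<^esub> v = v"
  and act_mult: "\<lbrakk>g \<in> carrier G; h \<in> carrier G; v \<in> M\<rbrakk>
    \<Longrightarrow> act (g \<otimes>\<^bsub>G\<^esub> h) v = act g (act h v)"

definition FG_isomorphic ::
  "('g, 'x) monoid_scheme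
    \<Rightarrow> ('f::field \<Rightarrow> 'v::ab_group_add \<Rightarrow> 'v) \<Rightarrow> ('g \<Rightarrow> 'v \<Rightarrow> 'v) \<Rightarrow> 'v set
    \<Rightarrow> ('f \<Rightarrow> 'w::ab_group_add \<Rightarrow> 'w) \<Rightarrow> ('g \<Rightarrow> 'w \<Rightarrow> 'w) \<Rightarrow> 'w set \<Rightarrow> bool"
  where "FG_isomorphic G scale act M scale' act' M' \<longleftrightarrow>
    FG_module scale G act M \<and> FG_module scale' G act' M' \<and>
    (\<exists>\<phi>. bij_betw \<phi> M M' \<and>
       (\<forall>v\<in>M. \<forall>w\<in>M. \<phi> (v + w) = \<phi> v + \<phi> w) \<and>
       (\<forall>c. \<forall>v\<in>M. \<phi> (scale c v) = scale' c (\<phi> v)) \<and>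
       (\<forall>g\<in>carrier G. \<forall>v\<in>M. \<phi> (act g v) = act' g (\<phi> v)))"

text \<open>Internal direct sum: every element of \<open>M\<close> is in exactly one way a sum of elements of the
  \<open>N i\<close>.\<close>

definition direct_sum :: "'i set \<Rightarrow> ('i \<Rightarrow> 'v::ab_group_add set) \<Rightarrow> 'v set \<Rightarrow> bool"
  where "direct_sum I N M \<longleftrightarrow> finite I \<and> bij_betw (\<lambda>f. \<Sum>i\<in>I. f i) (Pi\<^sub>E I N) M"

definition indecomposable ::
  "('f::field \<Rightarrow> 'v::ab_group_add \<Rightarrow> 'v) \<Rightarrow> ('g, 'x) monoid_scheme \<Rightarrow> ('g \<Rightarrow> 'v \<Rightarrow> 'v) \<Rightarrow> 'v set \<Rightarrow> bool"
  where "indecomposable scale G act M \<longleftrightarrow>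
    FG_module scale G act M \<and> M \<noteq> {0} \<and>
    (\<forall>A B. FG_module scale G act A \<and> FG_module scale G act B \<and>
       A \<inter> B = {0} \<and> M = {a + b | a b. a \<in> A \<and> b \<in> B} \<longrightarrow> A = {0} \<or> B = {0})"

definition indecomposable_decomposition ::
  "('f::field \<Rightarrow> 'v::ab_group_add \<Rightarrow> 'v) \<Rightarrow> ('g, 'x) monoid_scheme \<Rightarrow> ('g \<Rightarrow> 'v \<Rightarrow> 'v) \<Rightarrow> 'v set
    \<Rightarrow> nat \<Rightarrow> (nat \<Rightarrow> 'v set) \<Rightarrow> bool"
  where "indecomposable_decomposition scale G act M k N \<longleftrightarrow>
    direct_sum {..<k} N M \<and> (\<forall>i<k. indecomposable scale G act (N i))"

text \<open>\<open>M\<close> is induced from the representation \<open>W\<close> of the subgroup \<open>H\<close> if it is the direct sum of the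
  translates \<open>gW\<close>, where \<open>g\<close> runs over representatives of the left cosets of \<open>H\<close>. As \<open>W\<close> is
  \<open>H\<close>-stable, \<open>gW\<close> depends only on the coset \<open>C = gH\<close> and equals the union of all \<open>cW\<close>, \<open>c \<in> C\<close>.\<close>

definition induced_from ::
  "('f::field \<Rightarrow> 'v::ab_group_add \<Rightarrow> 'v) \<Rightarrow> ('g, 'x) monoid_scheme \<Rightarrow> ('g \<Rightarrow> 'v \<Rightarrow> 'v) \<Rightarrow> 'v set
    \<Rightarrow> 'g set \<Rightarrow> 'v set \<Rightarrow> bool"
  where "induced_from scale G act M H W \<longleftrightarrow>
    FG_module scale G act M \<and> subgroup H G \<and>
    W \<subseteq> M \<and> FG_module scale (G\<lparr>carrier := H\<rparr>) act W \<and>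
    direct_sum (lcosets\<^bsub>G\<^esub> H) (\<lambda>C. \<Union>g\<in>C. act g ` W) M"

definition properly_induced ::
  "('f::field \<Rightarrow> 'v::ab_group_add \<Rightarrow> 'v) \<Rightarrow> ('g, 'x) monoid_scheme \<Rightarrow> ('g \<Rightarrow> 'v \<Rightarrow> 'v) \<Rightarrow> 'v set \<Rightarrow> bool"
  where "properly_induced scale G act M \<longleftrightarrow>
    (\<exists>H W. H \<noteq> carrier G \<and> induced_from scale G act M H W)"

definition fixed_space :: "('g, 'x) monoid_scheme \<Rightarrow> ('g \<Rightarrow> 'v \<Rightarrow> 'v) \<Rightarrow> 'v set \<Rightarrow> 'v set"
  where "fixed_space G act M = {v \<in> M. \<forall>g\<in>carrier G. act g v = v}"

definition simple_module ::
  "('f::field \<Rightarrow> 'v::ab_group_add \<Rightarrow> 'v) \<Rightarrow> ('g, 'x) monoid_scheme \<Rightarrow> ('g \<Rightarrow> 'v \<Rightarrow> 'v) \<Rightarrow> 'v set \<Rightarrow> bool"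
  where "simple_module scale G act M \<longleftrightarrow>
    FG_module scale G act M \<and> M \<noteq> {0} \<and>
    (\<forall>A. FG_module scale G act A \<and> A \<subseteq> M \<longrightarrow> A = {0} \<or> A = M)"

definition socle ::
  "('f::field \<Rightarrow> 'v::ab_group_add \<Rightarrow> 'v) \<Rightarrow> ('g, 'x) monoid_scheme \<Rightarrow> ('g \<Rightarrow> 'v \<Rightarrow> 'v) \<Rightarrow> 'v set \<Rightarrow> 'v set"
  where "socle scale G act M =
    module.span scale (\<Union>{S. S \<subseteq> M \<and> simple_module scale G act S})"

definition module_generator ::
  "('f::field \<Rightarrow> 'v::ab_group_add \<Rightarrow> 'v) \<Rightarrow> ('g, 'x) monoid_scheme \<Rightarrow> ('g \<Rightarrow> 'v \<Rightarrow> 'v) \<Rightarrow> 'v set \<Rightarrow> 'v \<Rightarrow> bool"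
  where "module_generator scale G act M y \<longleftrightarrow>
    y \<in> M \<and> module.span scale ((\<lambda>g. act g y) ` carrier G) = M"


section \<open>The modules \<open>V\<^sub>m\<close>\<close>

text \<open>Both vectors (\<open>nat \<Rightarrow>\<^sub>0 'f\<close>) and polynomials (\<open>(nat \<Rightarrow>\<^sub>0 nat) \<Rightarrow>\<^sub>0 'f\<close>) are finitely supported
  functions, so they share one scalar multiplication.\<close>

definition fscale :: "'f::field \<Rightarrow> ('k \<Rightarrow>\<^sub>0 'f) \<Rightarrow> ('k \<Rightarrow>\<^sub>0 'f)"
  where "fscale c v = Poly_Mapping.map ((*) c) v"

lemma lookup_fscale [simp]: "Poly_Mapping.lookup (fscale c v) k = c * Poly_Mapping.lookup v k"
  by (auto simp: fscale_def Poly_Mapping.map.rep_eq when_def)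

lemma vector_space_fscale: "vector_space fscale"
  by unfold_locales (auto intro!: poly_mapping_eqI simp: lookup_add algebra_simps)

abbreviation basis_vec :: "nat \<Rightarrow> (nat \<Rightarrow>\<^sub>0 'f::field)"
  where "basis_vec i \<equiv> Poly_Mapping.single i 1"

definition V_space :: "nat \<Rightarrow> (nat \<Rightarrow>\<^sub>0 'f::field) set"
  where "V_space m = {v. Poly_Mapping.keys v \<subseteq> {..<m}}"

text \<open>The Jordan block with eigenvalue 1 sends the vector \<open>v\<close> to the vector with coordinates
  \<open>v\<^sub>i + v\<^bsub>i+1\<^esub>\<close>. It preserves every \<open>V_space m\<close>.\<close>

definition jordan :: "(nat \<Rightarrow>\<^sub>0 'f::field) \<Rightarrow> (nat \<Rightarrow>\<^sub>0 'f)"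
  where "jordan v = v + Poly_Mapping.map_key Suc v"

lemma lookup_jordan:
  "Poly_Mapping.lookup (jordan v) i = Poly_Mapping.lookup v i + Poly_Mapping.lookup v (Suc i)"
  by (simp add: jordan_def lookup_add Poly_Mapping.map_key.rep_eq)

lemma jordan_basis_vec:
  "jordan (basis_vec 0) = basis_vec 0"
  "jordan (basis_vec (Suc i)) = basis_vec (Suc i) + basis_vec i"
  by (auto intro!: poly_mapping_eqI simp: lookup_jordan lookup_add lookup_single lookup_one when_def)

text \<open>The exponent of \<open>g\<close> with respect to the generator \<open>\<sigma>\<close>; thus \<open>\<sigma>\<close> acts by \<^const>\<open>jordan\<close>.\<close>

definition exponent :: "('g, 'x) monoid_scheme \<Rightarrow> 'g \<Rightarrow> 'g \<Rightarrow> nat"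
  where "exponent G \<sigma> g = (LEAST k. \<sigma> [^]\<^bsub>G\<^esub> k = g)"

definition V_act :: "('g, 'x) monoid_scheme \<Rightarrow> 'g \<Rightarrow> 'g \<Rightarrow> (nat \<Rightarrow>\<^sub>0 'f::field) \<Rightarrow> (nat \<Rightarrow>\<^sub>0 'f)"
  where "V_act G \<sigma> g v = (jordan ^^ exponent G \<sigma> g) v"


section \<open>The symmetric algebra \<open>S(V\<^sup>*)\<close>\<close>

type_synonym 'f mpoly = "(nat \<Rightarrow>\<^sub>0 nat) \<Rightarrow>\<^sub>0 'f"

definition Var :: "nat \<Rightarrow> 'f::field mpoly"
  where "Var i = Poly_Mapping.single (Poly_Mapping.single i 1) 1"

definition poly_subst :: "(nat \<Rightarrow> 'f::field mpoly) \<Rightarrow> 'f mpoly \<Rightarrow> 'f mpoly"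
  where "poly_subst h f =
    (\<Sum>m\<in>Poly_Mapping.keys f. fscale (Poly_Mapping.lookup f m)
      (\<Prod>i\<in>Poly_Mapping.keys m. h i ^ Poly_Mapping.lookup m i))"

text \<open>For \<open>V = F\<^sup>n\<close> with coordinate functions \<open>Var 0, \<dots>, Var (n - 1)\<close>, the algebra \<open>S(V\<^sup>*)\<close> is the
  polynomial ring in these variables, and \<open>V\<^sup>*\<close> is its component of degree 1.\<close>

definition sym_component :: "nat \<Rightarrow> nat \<Rightarrow> 'f::field mpoly set"
  where "sym_component n d =
    {f. \<forall>m\<in>Poly_Mapping.keys f. Poly_Mapping.keys m \<subseteq> {..<n} \<and> (\<Sum>i<n. Poly_Mapping.lookup m i) = d}"

text \<open>The contragredient action \<open>(g\<cdot>f)(v) = f(g\<^sup>-\<^sup>1\<cdot>v)\<close> on \<open>V\<^sup>*\<close>, extended to algebra automorphisms: the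
  \<open>i\<close>-th coordinate function is sent to \<open>\<Sum>\<^sub>j (g\<^sup>-\<^sup>1\<cdot>e\<^sub>j)\<^sub>i Var j\<close>.\<close>

definition sym_act ::
  "('g, 'x) monoid_scheme \<Rightarrow> ('g \<Rightarrow> (nat \<Rightarrow>\<^sub>0 'f) \<Rightarrow> (nat \<Rightarrow>\<^sub>0 'f)) \<Rightarrow> nat
    \<Rightarrow> 'g \<Rightarrow> 'f::field mpoly \<Rightarrow> 'f mpoly"
  where "sym_act G \<rho> n g =
    poly_subst (\<lambda>i. \<Sum>j<n. fscale (Poly_Mapping.lookup (\<rho> (inv\<^bsub>G\<^esub> g) (basis_vec j)) i) (Var j))"

definition Delta :: "('g \<Rightarrow> 'v \<Rightarrow> 'v) \<Rightarrow> 'g \<Rightarrow> 'v \<Rightarrow> 'v::ab_group_add"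
  where "Delta act \<sigma> f = act \<sigma> f - f"

definition orbit_norm :: "('g, 'x) monoid_scheme \<Rightarrow> ('g \<Rightarrow> 'r \<Rightarrow> 'r) \<Rightarrow> 'r \<Rightarrow> 'r::comm_monoid_mult"
  where "orbit_norm G act f = (\<Prod>h\<in>(\<lambda>g. act g f) ` carrier G. h)"

end

theory Submission
  imports Defs "HOL-Algebra.Multiplicative_Group"
begin

text \<open>Put \<open>\<Delta> = \<sigma> - 1\<close>. In characteristic \<open>p\<close> one has \<open>\<Delta>\<^bsup>p^2\<^esup> = \<sigma>\<^bsup>p^2\<^esup> - 1 = 0\<close>, so a module is a vector space with a
  nilpotent operator, its indecomposable summands are blocks \<open>w, \<Delta> w, \<dots>, \<Delta>\<^bsup>m-1\<^esup> w\<close>, and a block is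
  induced exactly if \<open>p\<close> divides \<open>m\<close> (\<open>block_properly_induced_iff\<close>). A block of size \<open>pj + r\<close> with
  \<open>0 < r < p\<close> can be seen without decomposing the module: its generator \<open>w\<close> satisfies
  \<open>\<Delta>\<^bsup>pj+p-1\<^esup> w = 0\<close>, but \<open>\<Delta>\<^bsup>pj\<^esup> w\<close> is not in the image of \<open>\<Delta>\<^bsup>pj+1\<^esup>\<close>. The vectors \<open>\<Delta>\<^bsup>pj\<^esup> x\<close> with
  \<open>\<Delta>\<^bsup>pj+p-1\<^esup> x = 0\<close>, taken modulo the image of \<open>\<Delta>\<^bsup>pj+1\<^esup>\<close>, are called the layer \<open>j\<close> here. In degree
  \<open>d = Bp + c\<close> with \<open>c < p\<close> and \<open>B = ap + b\<close>, all layers except \<open>c\<close> vanish, and the layer \<open>c\<close> is at most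
  one-dimensional. Hence there is at most one non-induced summand. For \<open>b = p - 1\<close> the layer \<open>c\<close> vanishes
  as well. For \<open>b \<le> p - 2\<close> an explicit \<open>w\<close> generates a block of size \<open>cp + b + 1\<close> whose bottom vector is not
  divisible by a higher power of \<open>\<Delta>\<close> in the whole component, and such a block is a direct summand
  (\<open>block_summand\<close>).

  The layers are computed in the coordinates \<open>t = x\<^sub>p\<^sub>+\<^sub>1\<close> and \<open>z\<^sub>i = \<sigma>\<^sup>i x\<^sub>p\<close> for \<open>0 \<le> i < p\<close>. In these, \<open>\<sigma>\<close> rotates
  the \<open>z\<^sub>i\<close> and sends \<open>t\<close> to \<open>t + z\<^sub>0\<close>. Therefore \<open>\<sigma>\<^sup>p\<close> fixes the \<open>z\<^sub>i\<close> and sends \<open>t\<close> to \<open>t + x\<^sub>1\<close>, where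
  \<open>x\<^sub>1 = \<Sum>z\<^sub>i\<close>, and the norm of \<open>x\<^sub>p\<close> is \<open>n = \<Prod>z\<^sub>i\<close>. Every \<open>\<Delta>\<^bsup>pj\<^esup> q\<close> is \<open>x\<^sub>1\<^sup>j f\<close> for some \<open>f\<close>, and conversely
  \<open>x\<^sub>1\<^sup>j f\<close> for a \<open>\<sigma>\<^sup>p\<close>-invariant \<open>f\<close> and \<open>j < p\<close> is \<open>\<Delta>\<^bsup>pj\<^esup>\<close> of \<open>t (t - x\<^sub>1) \<cdots> (t - (j - 1) x\<^sub>1) f / j!\<close>. So for \<open>j < p\<close>
  the layer \<open>j\<close> in degree \<open>d\<close> measures the difference between the kernel of \<open>\<Delta>\<^bsup>p-1\<^esup>\<close> and the image of \<open>\<Delta>\<close> on the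
  \<open>\<sigma>\<^sup>p\<close>-invariants of degree \<open>d - j\<close>. The other layers vanish because \<open>\<Delta>\<^bsup>p^2\<^esup> = 0\<close>.

  There is a \<open>\<sigma>\<^sup>p\<close>-invariant \<open>K\<close>, monic of degree \<open>p\<close> in \<open>t\<close>, with \<open>\<sigma> K = K + \<nu>\<close> for a nonzero multiple \<open>\<nu> = \<beta> n\<close>
  of \<open>n\<close> (\<open>exists_degree_p_generator\<close>). The products \<open>G\<^sub>j\<close> of a power of the norm of \<open>t\<close> with at most
  \<open>p - 1\<close> factors \<open>K, K - \<nu>, K - 2 \<nu>, \<dots>\<close>, of degree \<open>pj\<close> in \<open>t\<close>, are a basis of the \<open>\<sigma>\<^sup>p\<close>-invariants over the
  polynomials in the \<open>z\<^sub>i\<close>, and \<open>\<Delta> G\<^sub>j = j \<nu> G\<^sub>j\<^sub>-\<^sub>1\<close>. The monomials in the \<open>z\<^sub>i\<close> that the rotation moves span a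
  free module, and coefficients from there contribute nothing to a layer (\<open>free_comb_free\<close>). What is left
  are the powers of \<open>n\<close>. They occur only if \<open>p\<close> divides \<open>d - j\<close>, that is for \<open>j = c\<close>, and then they give the
  span of the \<open>G\<^sub>i n\<^bsup>B-i\<^esup>\<close> with \<open>i \<le> B\<close>. On it, \<open>\<Delta>\<close> is \<open>\<beta> d/dX\<close> on polynomials of degree at most \<open>B\<close>. The
  polynomials killed by the \<open>(p-1)\<close>-st derivative are derivatives up to multiples of \<open>X\<^sup>B\<close>, and \<open>X\<^sup>B\<close> itself is
  killed unless \<open>b = p - 1\<close>. Its derivative of order \<open>b\<close> is a multiple of \<open>X\<^bsup>ap\<^esup>\<close>, which stands
  for the \<open>a\<close>-th power of the norm of \<open>t\<close> times \<open>n\<^sup>b\<close>; multiplied by \<open>x\<^sub>1\<^sup>c\<close> this is the bottom vector of the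
  non-induced summand.\<close>

section \<open>Nilpotent operators and their blocks\<close>

locale vector_operator = vector_space scale
  for scale :: "'f::field \<Rightarrow> 'v::ab_group_add \<Rightarrow> 'v" (infixr \<open>*s\<close> 75) +
  fixes \<Delta> :: "'v \<Rightarrow> 'v"
  assumes op_add: "\<Delta> (x + y) = \<Delta> x + \<Delta> y"
    and op_scale: "\<Delta> (c *s x) = c *s \<Delta> x"
begin

lemma pow_add: "(\<Delta> ^^ k) (x + y) = (\<Delta> ^^ k) x + (\<Delta> ^^ k) y"
  by (induction k) (auto simp: op_add)

lemma pow_scale: "(\<Delta> ^^ k) (c *s x) = c *s (\<Delta> ^^ k) x"
  by (induction k) (auto simp: op_scale)

lemma pow_zero [simp]: "(\<Delta> ^^ k) 0 = 0"
  using pow_scale[of k 0 0] by simp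

lemma pow_diff: "(\<Delta> ^^ k) (x - y) = (\<Delta> ^^ k) x - (\<Delta> ^^ k) y"
  using pow_add[of k "x - y" y] by simp

lemma pow_sum: "(\<Delta> ^^ k) (\<Sum>i\<in>I. f i) = (\<Sum>i\<in>I. (\<Delta> ^^ k) (f i))"
  by (induction I rule: infinite_finite_induct) (auto simp: pow_add)

lemma pow_pow: "(\<Delta> ^^ i) ((\<Delta> ^^ j) x) = (\<Delta> ^^ (i + j)) x"
  by (simp add: funpow_add)

lemma pow_eq_0_mono: "(\<Delta> ^^ i) x = 0 \<Longrightarrow> i \<le> j \<Longrightarrow> (\<Delta> ^^ j) x = 0"
  using pow_pow[of "j - i" i x] by simp

definition stable :: "'v set \<Rightarrow> bool"
  where "stable U \<longleftrightarrow> subspace U \<and> \<Delta> ` U \<subseteq> U"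

lemma stable_pow: "stable U \<Longrightarrow> x \<in> U \<Longrightarrow> (\<Delta> ^^ k) x \<in> U"
  by (induction k) (auto simp: stable_def)

lemma stableD: assumes "stable U"
  shows "subspace U" "0 \<in> U" "\<And>x y. x \<in> U \<Longrightarrow> y \<in> U \<Longrightarrow> x + y \<in> U"
    "\<And>x y. x \<in> U \<Longrightarrow> y \<in> U \<Longrightarrow> x - y \<in> U" "\<And>c x. x \<in> U \<Longrightarrow> c *s x \<in> U"
    "\<And>x. x \<in> U \<Longrightarrow> \<Delta> x \<in> U"
  using assms by (auto simp: stable_def subspace_0 subspace_add subspace_diff subspace_scale)

definition cyc :: "'v \<Rightarrow> nat \<Rightarrow> 'v set"
  where "cyc w m = span ((\<lambda>i. (\<Delta> ^^ i) w) ` {..<m})"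

definition block_gen :: "'v \<Rightarrow> nat \<Rightarrow> bool"
  where "block_gen w m \<longleftrightarrow> 0 < m \<and> (\<Delta> ^^ m) w = 0 \<and> (\<Delta> ^^ (m - 1)) w \<noteq> 0"

lemma cyc_iff: "x \<in> cyc w m \<longleftrightarrow> (\<exists>a. x = (\<Sum>i<m. a i *s (\<Delta> ^^ i) w))"
proof
  let ?S = "{x. \<exists>a. x = (\<Sum>i<m. a i *s (\<Delta> ^^ i) w)}"
  assume x: "x \<in> cyc w m"
  have "subspace ?S"
  proof (rule subspaceI)
    show "0 \<in> ?S" by (auto intro!: exI[of _ "\<lambda>_. 0"])
  next
    fix x y assume "x \<in> ?S" "y \<in> ?S"
    then obtain a b where "x = (\<Sum>i<m. a i *s (\<Delta> ^^ i) w)" "y = (\<Sum>i<m. b i *s (\<Delta> ^^ i) w)"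
      by auto
    then show "x + y \<in> ?S"
      by (auto intro!: exI[of _ "\<lambda>i. a i + b i"] simp: scale_left_distrib sum.distrib)
  next
    fix c x assume "x \<in> ?S"
    then obtain a where "x = (\<Sum>i<m. a i *s (\<Delta> ^^ i) w)" by auto
    then show "c *s x \<in> ?S"
      by (auto intro!: exI[of _ "\<lambda>i. c * a i"] simp: scale_sum_right)
  qed
  moreover have "(\<lambda>i. (\<Delta> ^^ i) w) ` {..<m} \<subseteq> ?S"
  proof clarify
    fix i assume "i < m"
    then have "(\<Sum>j<m. (if j = i then 1 else 0) *s (\<Delta> ^^ j) w) = (\<Delta> ^^ i) w"
      by (simp add: if_distrib[of "\<lambda>c. c *s _"] cong: if_cong)
    then show "\<exists>a. (\<Delta> ^^ i) w = (\<Sum>j<m. a j *s (\<Delta> ^^ j) w)"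
      by metis
  qed
  ultimately show "\<exists>a. x = (\<Sum>i<m. a i *s (\<Delta> ^^ i) w)"
    using x span_minimal unfolding cyc_def by blast
next
  assume "\<exists>a. x = (\<Sum>i<m. a i *s (\<Delta> ^^ i) w)"
  then show "x \<in> cyc w m"
    unfolding cyc_def by (auto intro!: span_sum span_scale intro: span_base)
qed

lemma cyc_stable: assumes "(\<Delta> ^^ m) w = 0" shows "stable (cyc w m)"
proof -
  have "\<Delta> x \<in> cyc w m" if x: "x \<in> cyc w m" for x
  proof -
    obtain a where a: "x = (\<Sum>i<m. a i *s (\<Delta> ^^ i) w)"
      using x cyc_iff by auto
    have "\<Delta> x = (\<Sum>i<m. a i *s (\<Delta> ^^ Suc i) w)"
      using pow_sum[of 1 "\<lambda>i. a i *s (\<Delta> ^^ i) w" "{..<m}"] pow_scale[of 1] by (simp add: a)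
    also have "\<dots> \<in> cyc w m"
      unfolding cyc_def
    proof (rule span_sum, rule span_scale)
      fix i assume "i \<in> {..<m}"
      then have "Suc i < m \<or> (\<Delta> ^^ Suc i) w = 0"
        using assms by (cases "Suc i = m") auto
      then show "(\<Delta> ^^ Suc i) w \<in> span ((\<lambda>i. (\<Delta> ^^ i) w) ` {..<m})"
        using span_base[of "(\<Delta> ^^ Suc i) w"] span_zero by (metis imageI lessThan_iff)
    qed
    finally show ?thesis .
  qed
  then show ?thesis
    by (auto simp: stable_def cyc_def)
qed

lemma cyc_subset: "stable U \<Longrightarrow> w \<in> U \<Longrightarrow> cyc w m \<subseteq> U"
  unfolding cyc_def by (rule span_minimal) (auto simp: stable_pow stableD)

lemma gen_in_cyc: "i < m \<Longrightarrow> (\<Delta> ^^ i) w \<in> cyc w m"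
  unfolding cyc_def by (auto intro!: span_base)

text \<open>The power of \<open>\<Delta>\<close> kills every term above the lowest one.\<close>

lemma coeff_extract:
  assumes "(\<Delta> ^^ m) w = 0" "i < m" "\<And>l. l < i \<Longrightarrow> a l = 0"
  shows "(\<Delta> ^^ (m - 1 - i)) (\<Sum>l<m. a l *s (\<Delta> ^^ l) w) = a i *s (\<Delta> ^^ (m - 1)) w"
proof -
  have "(\<Delta> ^^ (m - 1 - i)) (\<Sum>l<m. a l *s (\<Delta> ^^ l) w)
      = (\<Sum>l<m. a l *s (\<Delta> ^^ (m - 1 - i + l)) w)"
    by (simp add: pow_sum pow_scale pow_pow)
  also have "\<dots> = (\<Sum>l<m. if l = i then a i *s (\<Delta> ^^ (m - 1)) w else 0)"
  proof (rule sum.cong)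
    fix l assume "l \<in> {..<m}"
    show "a l *s (\<Delta> ^^ (m - 1 - i + l)) w = (if l = i then a i *s (\<Delta> ^^ (m - 1)) w else 0)"
    proof (cases l i rule: linorder_cases)
      case greater
      then have "(\<Delta> ^^ (m - 1 - i + l)) w = 0"
        using assms by (intro pow_eq_0_mono[OF assms(1)]) auto
      then show ?thesis using greater by simp
    qed (use assms in auto)
  qed simp
  finally show ?thesis using assms by simp
qed

lemma block_independent:
  assumes "block_gen w m" "(\<Sum>i<m. a i *s (\<Delta> ^^ i) w) = 0" "i < m"
  shows "a i = 0"
  using assms(3)
proof (induction i rule: less_induct)
  case (less i)
  then have "a i *s (\<Delta> ^^ (m - 1)) w = 0"
    using coeff_extract[of m w i a] assms by (simp add: block_gen_def)
  then show ?case using assms by (simp add: block_gen_def)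
qed

text \<open>Apply to a nonzero combination of the \<open>\<Delta>\<^sup>i w\<close> the power of \<open>\<Delta>\<close> that kills all but its lowest
  term. Hence the bottom vector spans the only simple submodule of a block, and a block is
  indecomposable.\<close>

lemma block_bottom_in_stable:
  assumes "block_gen w m" "stable A" "A \<subseteq> cyc w m" "x \<in> A" "x \<noteq> 0"
  shows "(\<Delta> ^^ (m - 1)) w \<in> A"
proof -
  obtain a where a: "x = (\<Sum>i<m. a i *s (\<Delta> ^^ i) w)"
    using assms cyc_iff by blast
  have "\<exists>i<m. a i \<noteq> 0"
    using assms(5) unfolding a by (metis (no_types, lifting) lessThan_iff scale_eq_0_iff sum.neutral)
  define i where "i = (LEAST i. i < m \<and> a i \<noteq> 0)"
  have i: "i < m \<and> a i \<noteq> 0"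
    unfolding i_def by (rule LeastI_ex) fact
  have l: "a l = 0" if "l < i" for l
    using that i not_less_Least[of l "\<lambda>i. i < m \<and> a i \<noteq> 0"] unfolding i_def by auto
  have "(\<Delta> ^^ (m - 1 - i)) x = a i *s (\<Delta> ^^ (m - 1)) w"
    unfolding a using assms(1) i l by (intro coeff_extract) (auto simp: block_gen_def)
  then have "(\<Delta> ^^ (m - 1)) w = inverse (a i) *s (\<Delta> ^^ (m - 1 - i)) x"
    using i by simp
  then show ?thesis
    using assms by (simp add: stable_pow stableD)
qed

definition complement :: "'v set \<Rightarrow> 'v set \<Rightarrow> 'v set \<Rightarrow> bool"
  where "complement U A C \<longleftrightarrow> stable A \<and> stable C \<and> A \<inter> C = {0} \<and> U = {a + c | a c. a \<in> A \<and> c \<in> C}"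

lemma complement_subset: assumes "complement U A C" shows "A \<subseteq> U" "C \<subseteq> U"
proof -
  have 0: "0 \<in> A" "0 \<in> C"
    using assms by (auto simp: complement_def stableD)
  show "A \<subseteq> U"
    using assms 0(2) unfolding complement_def by (smt (verit) add.right_neutral mem_Collect_eq subsetI)
  show "C \<subseteq> U"
    using assms 0(1) unfolding complement_def by (smt (verit) add.left_neutral mem_Collect_eq subsetI)
qed

lemma complement_unique:
  assumes "complement U A C" "a \<in> A" "a' \<in> A" "c \<in> C" "c' \<in> C" "a + c = a' + c'"
  shows "a = a'" "c = c'"
proof -
  have "a - a' = c' - c"
    using assms(6) by (simp add: algebra_simps)
  moreover have "a - a' \<in> A" "c' - c \<in> C"
    using assms by (auto simp: complement_def stableD)
  ultimately have "a - a' \<in> A \<inter> C"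
    by simp
  then have "a - a' = 0"
    using assms(1) unfolding complement_def by blast
  then show "a = a'" by simp
  then show "c = c'" using assms by simp
qed

lemma functional_exists:
  assumes "subspace V" "s \<notin> V"
  shows "\<exists>\<phi>. Vector_Spaces.linear scale (*) \<phi> \<and> \<phi> s = 1 \<and> (\<forall>x\<in>V. \<phi> x = 0)"
proof -
  interpret F: vector_space "(*) :: 'f \<Rightarrow> 'f \<Rightarrow> 'f"
    by unfold_locales (auto simp: algebra_simps)
  interpret P: vector_space_pair scale "(*) :: 'f \<Rightarrow> 'f \<Rightarrow> 'f" ..
  obtain B where B: "B \<subseteq> V" "independent B" "V \<subseteq> span B"
    using maximal_independent_subset[of V] by auto
  have "span B = V"
    using B assms(1) span_minimal by blast
  then have "independent (insert s B)"
    using B assms(2) by (intro independent_insertI) auto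
  then obtain \<phi> where \<phi>: "Vector_Spaces.linear scale (*) \<phi>"
      "\<forall>x\<in>insert s B. \<phi> x = (if x = s then 1 else 0)"
    using P.linear_independent_extend[of "insert s B" "\<lambda>x. if x = s then 1 else 0"] by auto
  have "\<phi> x = 0" if "x \<in> V" for x
  proof -
    have "x \<in> span B" using that B by auto
    moreover have "\<phi> b = 0" if "b \<in> B" for b
      using \<phi>(2) that B(1) assms(2) by auto
    ultimately show ?thesis
      using P.linear_eq_0_on_span[OF \<phi>(1)] by blast
  qed
  then show ?thesis using \<phi> by auto
qed

text \<open>A block is a direct summand as soon as its bottom vector is not more divisible by \<open>\<Delta>\<close> in the
  whole space than it is in the block. A functional \<open>\<phi>\<close> separating this vector from the image of
  \<open>\<Delta>\<^sup>m\<close> gives the complement, the largest stable subspace on which \<open>\<phi>\<close> vanishes.\<close>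

lemma block_summand:
  assumes U: "stable U" and w: "w \<in> U" and m: "0 < m" "(\<Delta> ^^ m) w = 0"
    and pure: "(\<Delta> ^^ (m - 1)) w \<notin> (\<Delta> ^^ m) ` U"
  shows "\<exists>C. complement U (cyc w m) C"
proof -
  have sub: "subspace ((\<Delta> ^^ m) ` U)"
  proof (rule subspaceI)
    show "0 \<in> (\<Delta> ^^ m) ` U" using stableD(2)[OF U] by (metis image_eqI pow_zero)
  next
    fix x y assume "x \<in> (\<Delta> ^^ m) ` U" "y \<in> (\<Delta> ^^ m) ` U"
    then show "x + y \<in> (\<Delta> ^^ m) ` U"
      using stableD(3)[OF U] by (auto simp flip: pow_add)
  next
    fix c x assume "x \<in> (\<Delta> ^^ m) ` U"
    then show "c *s x \<in> (\<Delta> ^^ m) ` U"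
      using stableD(5)[OF U] by (auto simp flip: pow_scale)
  qed
  obtain \<phi> where \<phi>: "Vector_Spaces.linear scale (*) \<phi>" and \<phi>1: "\<phi> ((\<Delta> ^^ (m - 1)) w) = 1"
      and \<phi>0: "\<And>x. x \<in> U \<Longrightarrow> \<phi> ((\<Delta> ^^ m) x) = 0"
    using functional_exists[OF sub pure] by auto
  have add: "\<phi> (x + y) = \<phi> x + \<phi> y" and sc: "\<phi> (c *s x) = c * \<phi> x" for x y c
    using module_hom.add[OF \<phi>[unfolded linear_iff_module_hom]]
      module_hom.scale[OF \<phi>[unfolded linear_iff_module_hom]] by auto
  have z: "\<phi> 0 = 0" using sc[of 0 0] by simp
  have dif: "\<phi> (x - y) = \<phi> x - \<phi> y" for x y
    using add[of "x - y" y] by simp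
  have \<phi>0': "\<phi> ((\<Delta> ^^ i) x) = 0" if "x \<in> U" "i \<ge> m" for x i
    using \<phi>0[OF stable_pow[OF U that(1), of "i - m"]] that(2) by (simp add: pow_pow)
  define C where "C = {x\<in>U. \<forall>i. \<phi> ((\<Delta> ^^ i) x) = 0}"
  have C: "stable C"
    unfolding stable_def
  proof (intro conjI subspaceI)
    show "\<Delta> ` C \<subseteq> C"
    proof clarify
      fix x assume x: "x \<in> C"
      have "\<phi> ((\<Delta> ^^ i) (\<Delta> x)) = 0" for i
        using x unfolding C_def by (metis (mono_tags, lifting) funpow_swap1 funpow.simps(2) mem_Collect_eq o_apply)
      then show "\<Delta> x \<in> C" using x U by (auto simp: C_def stableD)
    qed
  qed (use U z in \<open>auto simp: C_def stableD pow_add pow_scale add sc\<close>)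
  have bg: "block_gen w m"
    using m \<phi>1 z by (auto simp: block_gen_def)
  have cs: "stable (cyc w m)" and cU: "cyc w m \<subseteq> U"
    using cyc_stable m cyc_subset U w by auto
  have "x = 0" if "x \<in> cyc w m" "x \<in> C" for x
  proof (rule ccontr)
    assume "x \<noteq> 0"
    have "stable (cyc w m \<inter> C)"
      using cs C by (auto simp: stable_def subspace_inter)
    then have "(\<Delta> ^^ (m - 1)) w \<in> C"
      using block_bottom_in_stable[OF bg, of "cyc w m \<inter> C" x] that \<open>x \<noteq> 0\<close> by auto
    then have "\<phi> ((\<Delta> ^^ 0) ((\<Delta> ^^ (m - 1)) w)) = 0"
      unfolding C_def by blast
    then show False using \<phi>1 by simp
  qed
  moreover have "\<exists>u\<in>cyc w m. x - u \<in> C" if x: "x \<in> U" for x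
  proof -
    \<comment> \<open>Subtracting multiples of \<open>w, \<Delta> w, \<Delta>\<^sup>2 w, \<dots>\<close> makes \<open>\<phi> (\<Delta>\<^sup>i x)\<close> vanish for \<open>i = m - 1, m - 2, \<dots>, 0\<close> in turn.\<close>
    have "\<exists>u\<in>cyc w m. \<forall>i. m - k \<le> i \<longrightarrow> \<phi> ((\<Delta> ^^ i) (x - u)) = 0" if "k \<le> m" for k
      using that
    proof (induction k)
      case 0
      then show ?case using \<phi>0' x stableD(2)[OF cs] by (intro bexI[of _ 0]) auto
    next
      case (Suc k)
      then obtain u where u: "u \<in> cyc w m" "\<And>i. m - k \<le> i \<Longrightarrow> \<phi> ((\<Delta> ^^ i) (x - u)) = 0"
        by auto
      define c where "c = \<phi> ((\<Delta> ^^ (m - Suc k)) (x - u))"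
      let ?u = "u + c *s (\<Delta> ^^ k) w"
      have "?u \<in> cyc w m"
        using u(1) gen_in_cyc[of k m w] Suc.prems stableD[OF cs] by auto
      moreover have "\<phi> ((\<Delta> ^^ i) (x - ?u)) = 0" if "m - Suc k \<le> i" for i
      proof -
        have *: "\<phi> ((\<Delta> ^^ i) (x - ?u)) = \<phi> ((\<Delta> ^^ i) (x - u)) - c * \<phi> ((\<Delta> ^^ (i + k)) w)"
          by (simp add: diff_diff_eq[symmetric] pow_diff[of i "x - u"] pow_scale dif sc pow_pow)
        show ?thesis
        proof (cases "i = m - Suc k")
          case True
          then have "i + k = m - 1" using Suc.prems by simp
          then show ?thesis using * \<phi>1 True by (simp add: c_def)
        next
          case False
          then have "m - k \<le> i" "m \<le> i + k" using that Suc.prems by auto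
          then show ?thesis using * u(2) \<phi>0'[OF w] by simp
        qed
      qed
      ultimately show ?case by blast
    qed
    from this[of m] obtain u where u: "u \<in> cyc w m" "\<And>i. \<phi> ((\<Delta> ^^ i) (x - u)) = 0"
      by auto
    then have "x - u \<in> C"
      using x cU U by (auto simp: C_def stableD)
    then show ?thesis using u by auto
  qed
  then have "U \<subseteq> {a + c | a c. a \<in> cyc w m \<and> c \<in> C}"
    by (smt (verit, ccfv_SIG) add.commute diff_add_cancel mem_Collect_eq subsetI)
  moreover have "{a + c | a c. a \<in> cyc w m \<and> c \<in> C} \<subseteq> U"
    using cU U by (auto simp: C_def stableD)
  ultimately show ?thesis
    using cs C stableD(2)[OF cs] stableD(2)[OF C] unfolding complement_def by blast
qed

text \<open>For the exact index of nilpotency \<open>m\<close> the image of \<open>\<Delta>\<^sup>m\<close> is zero, so every vector that is not killed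
  by \<open>\<Delta>\<^bsup>m-1\<^esup>\<close> generates a summand.\<close>

lemma maximal_block_summand:
  assumes U: "stable U" and nil: "\<And>x. x \<in> U \<Longrightarrow> (\<Delta> ^^ n) x = 0" and "U \<noteq> {0}"
  shows "\<exists>w m C. w \<in> U \<and> block_gen w m \<and> m \<le> n \<and> complement U (cyc w m) C"
proof -
  define m where "m = (LEAST m. \<forall>x\<in>U. (\<Delta> ^^ m) x = 0)"
  have m: "\<forall>x\<in>U. (\<Delta> ^^ m) x = 0" and mn: "m \<le> n"
    unfolding m_def by (rule LeastI[of _ n], simp add: nil) (rule Least_le, simp add: nil)
  have "m \<noteq> 0" using m assms(3) stableD(2)[OF U] by auto
  then have "\<not> (\<forall>x\<in>U. (\<Delta> ^^ (m - 1)) x = 0)"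
    using not_less_Least[of "m - 1" "\<lambda>m. \<forall>x\<in>U. (\<Delta> ^^ m) x = 0"] unfolding m_def by auto
  then obtain w where w: "w \<in> U" "(\<Delta> ^^ (m - 1)) w \<noteq> 0" by auto
  then have "(\<Delta> ^^ (m - 1)) w \<notin> (\<Delta> ^^ m) ` U"
    using m by auto
  then obtain C where "complement U (cyc w m) C"
    using block_summand[OF U w(1), of m] m w \<open>m \<noteq> 0\<close> by auto
  then show ?thesis
    using w m mn \<open>m \<noteq> 0\<close> by (auto simp: block_gen_def)
qed

end

section \<open>Direct sums of subspaces\<close>

context vector_space begin

lemma direct_sum_mem: "direct_sum I N M \<Longrightarrow> (\<And>i. i \<in> I \<Longrightarrow> f i \<in> N i) \<Longrightarrow> (\<Sum>i\<in>I. f i) \<in> M"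
proof -
  assume "direct_sum I N M" and f: "\<And>i. i \<in> I \<Longrightarrow> f i \<in> N i"
  then have im: "(\<lambda>f. \<Sum>i\<in>I. f i) ` Pi\<^sub>E I N = M"
    by (auto simp: direct_sum_def bij_betw_def)
  have "restrict f I \<in> Pi\<^sub>E I N" using f by auto
  then have "(\<Sum>i\<in>I. restrict f I i) \<in> M" unfolding im[symmetric] by (rule imageI)
  then show ?thesis by simp
qed

lemma direct_sum_obtain:
  assumes "direct_sum I N M" "x \<in> M"
  obtains f where "\<And>i. i \<in> I \<Longrightarrow> f i \<in> N i" "x = (\<Sum>i\<in>I. f i)"
  using assms by (auto simp: direct_sum_def bij_betw_def PiE_iff)

lemma direct_sum_zero:
  assumes "direct_sum I N M" "\<And>i. i \<in> I \<Longrightarrow> subspace (N i)"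
    and "\<And>i. i \<in> I \<Longrightarrow> f i \<in> N i" "(\<Sum>i\<in>I. f i) = 0" "i \<in> I"
  shows "f i = 0"
proof -
  have inj: "inj_on (\<lambda>f. \<Sum>i\<in>I. f i) (Pi\<^sub>E I N)"
    using assms(1) by (auto simp: direct_sum_def bij_betw_def)
  have "restrict f I = restrict (\<lambda>_. 0) I"
    by (rule inj_onD[OF inj]) (use assms in \<open>auto simp: subspace_0\<close>)
  then show ?thesis using assms(5) by (metis restrict_apply')
qed

lemma direct_sumI:
  assumes fin: "finite I" and sub: "\<And>i. i \<in> I \<Longrightarrow> subspace (N i)"
    and ex: "\<And>x. x \<in> M \<Longrightarrow> \<exists>f. (\<forall>i\<in>I. f i \<in> N i) \<and> x = (\<Sum>i\<in>I. f i)"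
    and mem: "\<And>f. (\<And>i. i \<in> I \<Longrightarrow> f i \<in> N i) \<Longrightarrow> (\<Sum>i\<in>I. f i) \<in> M"
    and zero: "\<And>f i. (\<And>i. i \<in> I \<Longrightarrow> f i \<in> N i) \<Longrightarrow> (\<Sum>i\<in>I. f i) = 0 \<Longrightarrow> i \<in> I \<Longrightarrow> f i = 0"
  shows "direct_sum I N M"
proof -
  have "inj_on (\<lambda>f. \<Sum>i\<in>I. f i) (Pi\<^sub>E I N)"
  proof (rule inj_onI)
    fix f g assume f: "f \<in> Pi\<^sub>E I N" and g: "g \<in> Pi\<^sub>E I N" and eq: "(\<Sum>i\<in>I. f i) = (\<Sum>i\<in>I. g i)"
    have "f i - g i = 0" if "i \<in> I" for i
    proof (rule zero[OF _ _ that])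
      show "(\<Sum>i\<in>I. f i - g i) = 0" unfolding sum_subtractf eq by simp
    qed (use f g sub in \<open>auto simp: PiE_iff subspace_diff\<close>)
    then have "\<And>i. i \<in> I \<Longrightarrow> f i = g i" by simp
    then show "f = g"
      by (rule PiE_ext[OF f g])
  qed
  moreover have "(\<lambda>f. \<Sum>i\<in>I. f i) ` Pi\<^sub>E I N = M"
  proof
    show "(\<lambda>f. \<Sum>i\<in>I. f i) ` Pi\<^sub>E I N \<subseteq> M"
      using mem by (auto simp: PiE_iff)
    show "M \<subseteq> (\<lambda>f. \<Sum>i\<in>I. f i) ` Pi\<^sub>E I N"
    proof
      fix x assume "x \<in> M"
      then obtain f where "\<forall>i\<in>I. f i \<in> N i" "x = (\<Sum>i\<in>I. f i)" using ex by blast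
      then show "x \<in> (\<lambda>f. \<Sum>i\<in>I. f i) ` Pi\<^sub>E I N"
        by (intro image_eqI[of _ _ "restrict f I"]) auto
    qed
  qed
  ultimately show ?thesis using fin by (auto simp: direct_sum_def bij_betw_def)
qed

lemma direct_sum_reindex:
  assumes h: "bij_betw h J I" and sub: "\<And>i. i \<in> I \<Longrightarrow> subspace (N i)"
    and ds: "direct_sum J (\<lambda>j. N (h j)) M"
  shows "direct_sum I N M"
proof (rule direct_sumI)
  have hI: "h j \<in> I" if "j \<in> J" for j using h that by (auto simp: bij_betw_def)
  have inv: "the_inv_into J h (h j) = j" if "j \<in> J" for j
    using h that by (auto simp: bij_betw_def the_inv_into_f_f)
  have I: "\<exists>j\<in>J. i = h j" if "i \<in> I" for i
    using h that by (auto simp: bij_betw_def)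
  have re: "(\<Sum>i\<in>I. f i) = (\<Sum>j\<in>J. f (h j))" for f :: "_ \<Rightarrow> 'b"
    using sum.reindex_bij_betw[OF h, of f] by simp
  show "finite I" using h ds bij_betw_finite by (auto simp: direct_sum_def)
  show "\<exists>f. (\<forall>i\<in>I. f i \<in> N i) \<and> x = (\<Sum>i\<in>I. f i)" if x: "x \<in> M" for x
  proof -
    obtain f where f: "\<And>j. j \<in> J \<Longrightarrow> f j \<in> N (h j)" "x = (\<Sum>j\<in>J. f j)"
      using direct_sum_obtain[OF ds x] by metis
    have "x = (\<Sum>i\<in>I. f (the_inv_into J h i))" by (simp add: re f(2) inv)
    moreover have "\<forall>i\<in>I. f (the_inv_into J h i) \<in> N i" using I inv f(1) by metis
    ultimately show ?thesis by (intro exI[of _ "\<lambda>i. f (the_inv_into J h i)"]) simp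
  qed
  show "(\<Sum>i\<in>I. f i) \<in> M" if "\<And>i. i \<in> I \<Longrightarrow> f i \<in> N i" for f
    unfolding re by (rule direct_sum_mem[OF ds]) (use that hI in auto)
  show "f i = 0" if f: "\<And>i. i \<in> I \<Longrightarrow> f i \<in> N i" "(\<Sum>i\<in>I. f i) = 0" and i: "i \<in> I" for f i
  proof -
    obtain j where j: "j \<in> J" "i = h j" using I i by auto
    have "f (h j) = 0"
      by (rule direct_sum_zero[OF ds, of "\<lambda>j. f (h j)"]) (use f sub hI j in \<open>auto simp: re\<close>)
    then show ?thesis using j by simp
  qed
qed (fact sub)

lemma direct_sum_summand_subset:
  assumes "direct_sum I N M" "\<And>i. i \<in> I \<Longrightarrow> subspace (N i)" "i \<in> I"
  shows "N i \<subseteq> M"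
proof
  fix x assume x: "x \<in> N i"
  have "finite I" using assms(1) by (simp add: direct_sum_def)
  then have "(\<Sum>j\<in>I. if j = i then x else 0) = x" using assms(3) by simp
  moreover have "(\<Sum>j\<in>I. if j = i then x else 0) \<in> M"
    by (rule direct_sum_mem[OF assms(1)]) (use assms(2) x in \<open>auto simp: subspace_0\<close>)
  ultimately show "x \<in> M" by simp
qed

end

lemma (in vector_space) dim_direct_sum:
  assumes ds: "direct_sum I N M" and sub: "\<And>i. i \<in> I \<Longrightarrow> subspace (N i)"
    and fin: "finite B" "M \<subseteq> span B"
  shows "dim M = (\<Sum>i\<in>I. dim (N i))"
proof -
  have I: "finite I" using ds by (simp add: direct_sum_def)
  have NM: "N i \<subseteq> M" if "i \<in> I" for i
    by (rule direct_sum_summand_subset[OF ds sub that])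
  have "\<forall>i. \<exists>A. i \<in> I \<longrightarrow> A \<subseteq> N i \<and> independent A \<and> N i \<subseteq> span A \<and> card A = dim (N i)"
    using basis_exists by metis
  then obtain A where A: "\<And>i. i \<in> I \<Longrightarrow> A i \<subseteq> N i \<and> independent (A i) \<and> N i \<subseteq> span (A i) \<and> card (A i) = dim (N i)"
    by metis
  have Afin: "finite (A i)" if "i \<in> I" for i
    using independent_span_bound[OF fin(1), of "A i"] A[OF that] NM[OF that] fin(2) by auto
  have disj: "A i \<inter> A j = {}" if ij: "i \<in> I" "j \<in> I" "i \<noteq> j" for i j
  proof (rule ccontr)
    assume "A i \<inter> A j \<noteq> {}"
    then obtain x where x: "x \<in> A i" "x \<in> A j" by auto
    let ?f = "\<lambda>k. if k = i then x else if k = j then - x else 0"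
    have "(\<Sum>k\<in>I. ?f k) = (\<Sum>k\<in>{i,j}. ?f k)"
      using I ij by (intro sum.mono_neutral_right) auto
    also have "\<dots> = 0" using ij by simp
    finally have s0: "(\<Sum>k\<in>I. ?f k) = 0" .
    have "x \<in> N i" "x \<in> N j" using x A ij by auto
    then have "?f k \<in> N k" if "k \<in> I" for k
      using sub[OF that] by (auto simp: subspace_0 subspace_neg)
    then have "?f i = 0"
      using direct_sum_zero[OF ds sub _ s0 ij(1)] by blast
    then have "x = 0" using ij by auto
    then show False using x A[OF ij(1)] dependent_zero by blast
  qed
  let ?A = "\<Union>i\<in>I. A i"
  have ind: "independent ?A"
  proof (rule independent_if_scalars_zero)
    show "finite ?A" using I Afin by auto
    fix u x assume s: "(\<Sum>x\<in>?A. scale (u x) x) = 0" and x: "x \<in> ?A"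
    have "(\<Sum>i\<in>I. \<Sum>x\<in>A i. scale (u x) x) = 0"
      using s sum.UNION_disjoint[of I A "\<lambda>x. scale (u x) x"] I Afin disj by auto
    then have z: "(\<Sum>x\<in>A i. scale (u x) x) = 0" if "i \<in> I" for i
      by (rule direct_sum_zero[OF ds sub, rotated -2])
        (use that A sub in \<open>auto intro!: subspace_sum subspace_scale\<close>)
    obtain i where "i \<in> I" "x \<in> A i" using x by auto
    then show "u x = 0"
      using z A[of i] Afin[of i] independentD[of "A i" "A i" u x] by auto
  qed
  have "M \<subseteq> span ?A"
  proof
    fix x assume "x \<in> M"
    then obtain f where f: "\<And>i. i \<in> I \<Longrightarrow> f i \<in> N i" "x = (\<Sum>i\<in>I. f i)"
      using direct_sum_obtain[OF ds] by metis
    have "f i \<in> span ?A" if "i \<in> I" for i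
      using A[OF that] f(1) that span_mono[of "A i" ?A] by blast
    then show "x \<in> span ?A" using f(2) by (auto intro: span_sum)
  qed
  moreover have "?A \<subseteq> M" using A NM by blast
  ultimately have "dim M = card ?A"
    using basis_card_eq_dim[of ?A M] ind by simp
  also have "\<dots> = (\<Sum>i\<in>I. card (A i))"
    using I Afin disj by (intro card_UN_disjoint) auto
  finally show ?thesis using A by simp
qed

context vector_operator begin

lemma direct_sum_cons:
  assumes comp: "complement U A C" and ds: "direct_sum {..<k} N C"
    and st: "\<And>i. i < k \<Longrightarrow> stable (N i)"
  shows "direct_sum {..<Suc k} (N(k := A)) U"
proof (rule direct_sumI)
  have stA: "stable A" "stable C" using comp by (auto simp: complement_def)
  have sN: "\<And>i. i \<in> {..<k} \<Longrightarrow> subspace (N i)" using st stableD(1) by blast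
  show "subspace ((N(k := A)) i)" if "i \<in> {..<Suc k}" for i
    using that st stA by (auto simp: stableD less_Suc_eq)
  have parts: "f k \<in> A" "(\<Sum>i<k. f i) \<in> C" "\<And>i. i \<in> {..<k} \<Longrightarrow> f i \<in> N i"
    if "\<And>i. i \<in> {..<Suc k} \<Longrightarrow> f i \<in> (N(k := A)) i" for f
  proof -
    show "f k \<in> A" using that[of k] by simp
    show fi: "f i \<in> N i" if "i \<in> {..<k}" for i
      using \<open>\<And>i. i \<in> {..<Suc k} \<Longrightarrow> f i \<in> (N(k := A)) i\<close>[of i] that by auto
    show "(\<Sum>i<k. f i) \<in> C"
      by (rule direct_sum_mem[OF ds]) (rule fi)
  qed
  show "\<exists>f. (\<forall>i\<in>{..<Suc k}. f i \<in> (N(k := A)) i) \<and> x = (\<Sum>i<Suc k. f i)" if x: "x \<in> U" for x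
  proof -
    obtain a c where ac: "a \<in> A" "c \<in> C" "x = a + c" using comp x by (auto simp: complement_def)
    then obtain f where f: "\<And>i. i \<in> {..<k} \<Longrightarrow> f i \<in> N i" "c = (\<Sum>i<k. f i)"
      using direct_sum_obtain[OF ds] by metis
    have "(\<Sum>i<Suc k. (f(k := a)) i) = x" using ac f by (simp add: add.commute)
    moreover have "\<forall>i\<in>{..<Suc k}. (f(k := a)) i \<in> (N(k := A)) i" using ac f by auto
    ultimately show ?thesis by metis
  qed
  show "(\<Sum>i<Suc k. f i) \<in> U" if f: "\<And>i. i \<in> {..<Suc k} \<Longrightarrow> f i \<in> (N(k := A)) i" for f
  proof -
    have "(\<Sum>i<Suc k. f i) = f k + (\<Sum>i<k. f i)" by (simp add: add.commute)
    moreover have "f k + (\<Sum>i<k. f i) \<in> U"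
      using parts[OF f] comp unfolding complement_def by blast
    ultimately show ?thesis by (simp only:)
  qed
  show "f i = 0" if f: "\<And>i. i \<in> {..<Suc k} \<Longrightarrow> f i \<in> (N(k := A)) i" "(\<Sum>i<Suc k. f i) = 0"
    and i: "i \<in> {..<Suc k}" for f i
  proof -
    have eq: "f k + (\<Sum>i<k. f i) = 0 + 0" using f(2) by (simp add: add.commute)
    have z: "f k = 0" "(\<Sum>i<k. f i) = 0"
      using complement_unique[OF comp parts(1)[OF f(1)] _ parts(2)[OF f(1)] _ eq] stA by (auto simp: stableD)
    show ?thesis
    proof (cases "i = k")
      case False
      then show ?thesis
        using direct_sum_zero[OF ds sN parts(3)[OF f(1)] z(2), of i] i by auto
    qed (use z in simp)
  qed
qed simp

text \<open>As the summands are stable, the projection onto one of them commutes with \<open>\<Delta>\<close>.\<close>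

lemma direct_sum_projection:
  fixes k :: nat
  assumes ds: "direct_sum {..<k} N M" and st: "\<And>i. i < k \<Longrightarrow> stable (N i)" and i: "i < k"
  obtains \<pi> where "\<And>x. x \<in> M \<Longrightarrow> \<pi> x \<in> N i"
    and "\<And>x y. x \<in> M \<Longrightarrow> y \<in> M \<Longrightarrow> \<pi> (x + y) = \<pi> x + \<pi> y"
    and "\<And>x c. x \<in> M \<Longrightarrow> \<pi> (c *s x) = c *s \<pi> x"
    and "\<And>x n. x \<in> M \<Longrightarrow> \<pi> ((\<Delta> ^^ n) x) = (\<Delta> ^^ n) (\<pi> x)"
    and "\<And>x. x \<in> N i \<Longrightarrow> \<pi> x = x"
    and "\<And>x j. j < k \<Longrightarrow> j \<noteq> i \<Longrightarrow> x \<in> N j \<Longrightarrow> \<pi> x = 0"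
proof -
  have sN: "\<And>i. i \<in> {..<k} \<Longrightarrow> subspace (N i)" using st stableD(1) by blast
  have "\<forall>x. \<exists>f. x \<in> M \<longrightarrow> (\<forall>i\<in>{..<k}. f i \<in> N i) \<and> x = (\<Sum>i<k. f i)"
    using direct_sum_obtain[OF ds] by metis
  then obtain g where g: "\<And>x. x \<in> M \<Longrightarrow> (\<forall>i\<in>{..<k}. g x i \<in> N i) \<and> x = (\<Sum>i<k. g x i)"
    by metis
  have sumM: "(\<Sum>i<k. f i) \<in> M" if "\<forall>i\<in>{..<k}. f i \<in> N i" for f
    by (rule direct_sum_mem[OF ds]) (use that in auto)
  have uniq: "g x j = f j" if x: "x \<in> M" and f: "\<forall>i\<in>{..<k}. f i \<in> N i" "x = (\<Sum>i<k. f i)" and j: "j < k" for x f j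
  proof -
    have "g x j - f j = 0"
    proof (rule direct_sum_zero[OF ds sN])
      show "(\<Sum>i<k. g x i - f i) = 0" using g[OF x] f by (simp add: sum_subtractf)
    qed (use g[OF x] f st j in \<open>auto simp: stableD\<close>)
    then show ?thesis by simp
  qed
  have single: "x \<in> M \<and> g x i = (if i = j then x else 0)" if "x \<in> N j" "j < k" for x j
  proof -
    define f where "f l = (if l = j then x else 0)" for l
    have "(\<Sum>l<k. f l) = (if j \<in> {..<k} then x else 0)"
      unfolding f_def by (rule sum.delta) simp
    then have f: "\<forall>l\<in>{..<k}. f l \<in> N l" "x = (\<Sum>l<k. f l)"
      using that st by (auto simp: f_def stableD)
    have "x \<in> M" using sumM[OF f(1)] f(2) by simp
    then show ?thesis using uniq[OF _ f i] by (simp add: f_def)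
  qed
  show thesis
  proof (rule that[of "\<lambda>x. g x i"])
    show "g x i \<in> N i" if "x \<in> M" for x using g[OF that] i by auto
    show "g (x + y) i = g x i + g y i" if x: "x \<in> M" and y: "y \<in> M" for x y
    proof -
      have a: "\<forall>l\<in>{..<k}. g x l + g y l \<in> N l" using g[OF x] g[OF y] st by (auto simp: stableD)
      have b: "x + y = (\<Sum>l<k. g x l + g y l)" using g[OF x] g[OF y] by (simp add: sum.distrib)
      have c: "x + y \<in> M" using sumM[OF a] b by simp
      show ?thesis using uniq[OF c a b i] by simp
    qed
    show "g (c *s x) i = c *s g x i" if x: "x \<in> M" for x c
    proof -
      have a: "\<forall>l\<in>{..<k}. c *s g x l \<in> N l" using g[OF x] st by (auto simp: stableD)
      have b: "c *s x = (\<Sum>l<k. c *s g x l)" using g[OF x] by (metis scale_sum_right)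
      have d: "c *s x \<in> M" using sumM[OF a] b by simp
      show ?thesis using uniq[OF d a b i] by simp
    qed
    show "g ((\<Delta> ^^ n) x) i = (\<Delta> ^^ n) (g x i)" if x: "x \<in> M" for x n
    proof -
      have a: "\<forall>l\<in>{..<k}. (\<Delta> ^^ n) (g x l) \<in> N l" using g[OF x] st by (auto simp: stable_pow)
      have b: "(\<Delta> ^^ n) x = (\<Sum>l<k. (\<Delta> ^^ n) (g x l))" using g[OF x] by (metis pow_sum)
      have d: "(\<Delta> ^^ n) x \<in> M" using sumM[OF a] b by simp
      show ?thesis using uniq[OF d a b i] by simp
    qed
  qed (use single i in auto)
qed

text \<open>Splitting off one block at a time. The ambient space may be infinite-dimensional, so the size of a
  finite spanning set serves as the measure that decreases.\<close>

lemma nilpotent_summand_induct [consumes 4, case_names zero step]: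
  assumes M: "stable M" and fin: "finite B" "M \<subseteq> span B" and nil: "\<forall>x\<in>M. (\<Delta> ^^ n) x = 0"
    and zero: "P {0}"
    and step: "\<And>U w m C. U \<subseteq> M \<Longrightarrow> stable U \<Longrightarrow> w \<in> U \<Longrightarrow> block_gen w m \<Longrightarrow> m \<le> n \<Longrightarrow>
      complement U (cyc w m) C \<Longrightarrow> P C \<Longrightarrow> P U"
  shows "P M"
proof -
  have "U \<subseteq> M \<Longrightarrow> stable U \<Longrightarrow> finite D \<Longrightarrow> U \<subseteq> span D \<Longrightarrow> P U" for U D
  proof (induction "card D" arbitrary: U D rule: less_induct)
    case less
    show ?case
    proof (cases "U = {0}")
      case False
      then obtain w m C where w: "w \<in> U" "block_gen w m" "m \<le> n" "complement U (cyc w m) C"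
        using maximal_block_summand[OF less.prems(2), of n] nil less.prems(1) by blast
      have C: "stable C" "C \<subseteq> U" using w(4) complement_subset by (auto simp: complement_def)
      obtain E where E: "E \<subseteq> C" "independent E" "C \<subseteq> span E"
        using maximal_independent_subset[of C] by auto
      have "span E = C" using E C(1) span_minimal stableD(1) by blast
      have sw: "(\<Delta> ^^ (m - 1)) w \<in> cyc w m" "(\<Delta> ^^ (m - 1)) w \<noteq> 0"
        using w(2) gen_in_cyc[of "m - 1" m w] by (auto simp: block_gen_def)
      then have "(\<Delta> ^^ (m - 1)) w \<notin> C" using w(4) unfolding complement_def by blast
      then have "independent (insert ((\<Delta> ^^ (m - 1)) w) E)"
        using E \<open>span E = C\<close> by (intro independent_insertI) auto
      moreover have "insert ((\<Delta> ^^ (m - 1)) w) E \<subseteq> span D"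
        using E(1) C(2) less.prems(4) complement_subset(1)[OF w(4)] sw(1) by blast
      ultimately have "finite (insert ((\<Delta> ^^ (m - 1)) w) E)"
          "card (insert ((\<Delta> ^^ (m - 1)) w) E) \<le> card D"
        using independent_span_bound[OF less.prems(3), of "insert ((\<Delta> ^^ (m - 1)) w) E"] by simp_all
      moreover have "(\<Delta> ^^ (m - 1)) w \<notin> E" using \<open>_ \<notin> C\<close> E(1) by blast
      ultimately have "finite E" "card E < card D" by auto
      then have "P C"
        using less.hyps[of E C] E C less.prems(1) by blast
      then show ?thesis using step less.prems w by blast
    qed (use zero in simp)
  qed
  then show ?thesis using M fin by blast
qed

lemma complement_sym: "complement U A C \<Longrightarrow> complement U C A"
  unfolding complement_def by (auto simp: add.commute Int_commute) (metis add.commute)+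

section \<open>Blocks of size divisible by \<open>p\<close>\<close>

text \<open>A block of size \<open>pj + r\<close> with \<open>0 < r < p\<close> violates this condition at its generator, and all other
  blocks satisfy it. So it detects, without reference to a decomposition, the summands whose size is
  not divisible by \<open>p\<close> and has quotient \<open>j\<close> by \<open>p\<close>.\<close>

definition layer_induced :: "nat \<Rightarrow> nat \<Rightarrow> 'v set \<Rightarrow> bool"
  where "layer_induced p j U \<longleftrightarrow>
    (\<forall>x\<in>U. (\<Delta> ^^ (p * j + (p - 1))) x = 0 \<longrightarrow> (\<Delta> ^^ (p * j)) x \<in> (\<Delta> ^^ (p * j + 1)) ` U)"

lemma layer_inducedD: "layer_induced p j U \<Longrightarrow> x \<in> U \<Longrightarrow> (\<Delta> ^^ (p * j + (p - 1))) x = 0 \<Longrightarrow>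
    \<exists>y\<in>U. (\<Delta> ^^ (p * j)) x = (\<Delta> ^^ (p * j + 1)) y"
  unfolding layer_induced_def image_iff by simp

lemma layer_induced_summand:
  assumes "complement U A C" "layer_induced p j U" shows "layer_induced p j A"
  unfolding layer_induced_def
proof (intro ballI impI)
  fix x assume x: "x \<in> A" "(\<Delta> ^^ (p * j + (p - 1))) x = 0"
  have st: "stable A" "stable C" using assms(1) by (auto simp: complement_def)
  have "x \<in> U" using x complement_subset[OF assms(1)] by blast
  then obtain y where y: "y \<in> U" "(\<Delta> ^^ (p * j)) x = (\<Delta> ^^ (p * j + 1)) y"
    using layer_inducedD[OF assms(2) _ x(2)] by metis
  then obtain a c where ac: "a \<in> A" "c \<in> C" "y = a + c" using assms(1) by (auto simp: complement_def)
  have "(\<Delta> ^^ (p * j)) x + 0 = (\<Delta> ^^ (p * j + 1)) a + (\<Delta> ^^ (p * j + 1)) c"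
    unfolding y(2) ac(3) pow_add by simp
  then have "(\<Delta> ^^ (p * j)) x = (\<Delta> ^^ (p * j + 1)) a"
    using complement_unique(1)[OF assms(1) stable_pow[OF st(1) x(1)] stable_pow[OF st(1) ac(1)]
        stableD(2)[OF st(2)] stable_pow[OF st(2) ac(2)]] by metis
  then show "(\<Delta> ^^ (p * j)) x \<in> (\<Delta> ^^ (p * j + 1)) ` A" using ac by blast
qed

lemma block_not_in_image:
  assumes "block_gen w (n + r)" "0 < r"
  shows "(\<Delta> ^^ n) w \<notin> (\<Delta> ^^ (n + 1)) ` cyc w (n + r)"
proof
  assume "(\<Delta> ^^ n) w \<in> (\<Delta> ^^ (n + 1)) ` cyc w (n + r)"
  then obtain y where y: "y \<in> cyc w (n + r)" "(\<Delta> ^^ n) w = (\<Delta> ^^ (n + 1)) y" by blast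
  obtain a where a: "y = (\<Sum>i<n + r. a i *s (\<Delta> ^^ i) w)" using y(1) cyc_iff by blast
  have "(\<Delta> ^^ (n + r)) y = (\<Sum>i<n + r. a i *s (\<Delta> ^^ (n + r + i)) w)"
    by (simp add: a pow_sum pow_scale pow_pow)
  also have "\<dots> = 0"
    using assms(1) pow_eq_0_mono[of "n + r" w] by (intro sum.neutral) (auto simp: block_gen_def)
  finally have z: "(\<Delta> ^^ (n + r)) y = 0" .
  have "(\<Delta> ^^ (r - 1)) ((\<Delta> ^^ n) w) = (\<Delta> ^^ (r - 1)) ((\<Delta> ^^ (n + 1)) y)" using y(2) by simp
  moreover have "r - 1 + n = n + r - 1" "r - 1 + (n + 1) = n + r" using assms(2) by auto
  ultimately have "(\<Delta> ^^ (n + r - 1)) w = (\<Delta> ^^ (n + r)) y" by (simp only: pow_pow)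
  then show False using z assms(1) by (simp add: block_gen_def)
qed

lemma layer_induced_block:
  assumes "block_gen w m" "layer_induced p (m div p) (cyc w m)" "0 < p" shows "p dvd m"
proof (rule ccontr)
  assume nd: "\<not> p dvd m"
  define n r where "n = p * (m div p)" and "r = m mod p"
  have nr: "m = n + r" "0 < r" "r < p" using assms(3) nd by (auto simp: n_def r_def mod_greater_zero_iff_not_dvd)
  have "(\<Delta> ^^ m) w = 0" using assms(1) by (simp add: block_gen_def)
  then have "(\<Delta> ^^ (n + (p - 1))) w = 0"
    by (rule pow_eq_0_mono) (use nr in simp)
  moreover have "w \<in> cyc w m" using gen_in_cyc[of 0 m w] assms(1) by (simp add: block_gen_def)
  ultimately obtain y where "y \<in> cyc w m" "(\<Delta> ^^ n) w = (\<Delta> ^^ (n + 1)) y"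
    using layer_inducedD[OF assms(2), of w] unfolding n_def[symmetric] by metis
  then have "(\<Delta> ^^ n) w \<in> (\<Delta> ^^ (n + 1)) ` cyc w m" by (rule image_eqI[rotated])
  then show False using block_not_in_image[of w n r] assms(1) nr by simp
qed

text \<open>Freeness over the powers \<open>1, \<Delta>, \<dots>, \<Delta>\<^bsup>p-1\<^esup>\<close> with coefficients in a \<open>\<Delta>\<^sup>p\<close>-stable subspace. Passing from
  \<open>\<Delta>\<close> to \<open>T = 1 + \<Delta>\<close> is a unitriangular change of these powers, so this says that \<open>U\<close> is the direct sum
  of the translates \<open>T\<^sup>i W\<close>, \<open>i < p\<close>, of a \<open>T\<^sup>p\<close>-stable subspace.\<close>

definition shift_free :: "nat \<Rightarrow> 'v set \<Rightarrow> 'v set \<Rightarrow> bool"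
  where "shift_free p W U \<longleftrightarrow> subspace W \<and> W \<subseteq> U \<and> (\<Delta> ^^ p) ` W \<subseteq> W \<and>
    (\<forall>x\<in>U. \<exists>f. (\<forall>i<p. f i \<in> W) \<and> x = (\<Sum>i<p. (\<Delta> ^^ i) (f i))) \<and>
    (\<forall>f. (\<forall>i<p. f i \<in> W) \<longrightarrow> (\<Sum>i<p. (\<Delta> ^^ i) (f i)) = 0 \<longrightarrow> (\<forall>i<p. f i = 0))"

lemma shift_free_zero:
  "shift_free p W U \<Longrightarrow> (\<And>i. i < p \<Longrightarrow> f i \<in> W) \<Longrightarrow> (\<Sum>i<p. (\<Delta> ^^ i) (f i)) = 0 \<Longrightarrow> i < p \<Longrightarrow> f i = 0"
  unfolding shift_free_def by simp

lemma sum_lessThan_mult: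
  fixes f :: "nat \<Rightarrow> 'v"
  shows "(\<Sum>n<q * p. f n) = (\<Sum>i<p. \<Sum>l<q. f (l * p + i))"
proof (induction q)
  case (Suc q)
  have add: "(\<Sum>n<a + p. f n) = (\<Sum>n<a. f n) + (\<Sum>i<p. f (a + i))" for a
    by (induction p) (auto simp: algebra_simps)
  have "(\<Sum>n<Suc q * p. f n) = (\<Sum>n<q * p. f n) + (\<Sum>i<p. f (q * p + i))"
    using add[of "q * p"] by (simp add: add.commute)
  then show ?case by (simp add: Suc sum.distrib)
qed simp

text \<open>The vectors \<open>\<Delta>\<^bsup>lp\<^esup> w\<close> span a possible \<open>W\<close>.\<close>

lemma shift_free_block:
  assumes bg: "block_gen w (q * p)"
  shows "\<exists>W. shift_free p W (cyc w (q * p))"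
proof -
  have p: "0 < p" using bg by (cases p) (auto simp: block_gen_def)
  interpret P: vector_operator scale "\<Delta> ^^ p"
    by unfold_locales (auto simp: pow_add pow_scale)
  have Pp: "((\<Delta> ^^ p) ^^ l) x = (\<Delta> ^^ (l * p)) x" for l x
    by (simp add: funpow_mult mult.commute)
  define W where "W = P.cyc w q"
  have z: "(\<Delta> ^^ (q * p)) w = 0" using bg by (simp add: block_gen_def)
  have stW: "P.stable W" unfolding W_def by (rule P.cyc_stable) (simp only: Pp z)
  have stU: "stable (cyc w (q * p))" by (rule cyc_stable) (rule z)
  have W: "x \<in> W \<longleftrightarrow> (\<exists>a. x = (\<Sum>l<q. a l *s (\<Delta> ^^ (l * p)) w))" for x
    unfolding W_def P.cyc_iff Pp ..
  have sub: "subspace W" using stW by (simp add: P.stableD)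
  have WU: "W \<subseteq> cyc w (q * p)"
  proof
    fix x assume "x \<in> W"
    then obtain a where "x = (\<Sum>l<q. a l *s (\<Delta> ^^ (l * p)) w)" using W by blast
    then show "x \<in> cyc w (q * p)"
      using p stU by (auto intro!: subspace_sum subspace_scale gen_in_cyc simp: stableD)
  qed
  have ex: "\<exists>f. (\<forall>i<p. f i \<in> W) \<and> x = (\<Sum>i<p. (\<Delta> ^^ i) (f i))" if x: "x \<in> cyc w (q * p)" for x
  proof -
    obtain a where a: "x = (\<Sum>n<q * p. a n *s (\<Delta> ^^ n) w)" using x unfolding cyc_iff by blast
    define f where "f i = (\<Sum>l<q. a (l * p + i) *s (\<Delta> ^^ (l * p)) w)" for i
    have "x = (\<Sum>i<p. (\<Delta> ^^ i) (f i))"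
      unfolding a sum_lessThan_mult f_def by (simp add: pow_sum pow_scale pow_pow add.commute)
    moreover have "f i \<in> W" for i
      unfolding W f_def by (intro exI[of _ "\<lambda>l. a (l * p + i)"]) simp
    ultimately show ?thesis by (intro exI[of _ f]) simp
  qed
  have un: "f i = 0" if f: "\<forall>i<p. f i \<in> W" "(\<Sum>i<p. (\<Delta> ^^ i) (f i)) = 0" "i < p" for f i
  proof -
    have "\<forall>i. \<exists>a. i < p \<longrightarrow> f i = (\<Sum>l<q. a l *s (\<Delta> ^^ (l * p)) w)" using f(1) W by blast
    then obtain b where b: "\<And>i. i < p \<Longrightarrow> f i = (\<Sum>l<q. b i l *s (\<Delta> ^^ (l * p)) w)" by metis
    have "(\<Sum>n<q * p. b (n mod p) (n div p) *s (\<Delta> ^^ n) w) = (\<Sum>i<p. (\<Delta> ^^ i) (f i))"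
      unfolding sum_lessThan_mult
      by (intro sum.cong refl) (simp add: b pow_sum pow_scale pow_pow add.commute)
    then have "b (n mod p) (n div p) = 0" if "n < q * p" for n
      using block_independent[OF bg, of "\<lambda>n. b (n mod p) (n div p)" n] f(2) that by simp
    from this[of "l * p + i" for l] have "b i l = 0" if "l < q" for l
    proof -
      have "l * p + i < Suc l * p" using f(3) by simp
      also have "\<dots> \<le> q * p" using that by (intro mult_right_mono) auto
      finally show ?thesis using \<open>\<And>l. l * p + i < q * p \<Longrightarrow> _ l\<close>[of l] f(3) by simp
    qed
    then show ?thesis using b[OF f(3)] by simp
  qed
  have "shift_free p W (cyc w (q * p))"
    unfolding shift_free_def using sub WU ex un P.stableD(6)[OF stW] by blast
  then show ?thesis ..
qed

lemma shift_free_sum: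
  assumes comp: "complement U A C" and V: "shift_free p V A" and W: "shift_free p W C"
  shows "\<exists>X. shift_free p X U"
proof -
  define X where "X = {v + w | v w. v \<in> V \<and> w \<in> W}"
  have sV: "subspace V" "V \<subseteq> A" "\<And>v. v \<in> V \<Longrightarrow> (\<Delta> ^^ p) v \<in> V"
    and sW: "subspace W" "W \<subseteq> C" "\<And>v. v \<in> W \<Longrightarrow> (\<Delta> ^^ p) v \<in> W"
    using V W unfolding shift_free_def by auto
  have st: "stable A" "stable C" and U: "U = {a + c | a c. a \<in> A \<and> c \<in> C}"
    using comp by (auto simp: complement_def)
  have 1: "subspace X" unfolding X_def by (rule subspace_sums) (use sV sW in auto)
  have 2: "X \<subseteq> U" unfolding X_def U using sV sW by blast
  have 3: "(\<Delta> ^^ p) ` X \<subseteq> X"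
  proof clarify
    fix x assume "x \<in> X"
    then obtain v w where "v \<in> V" "w \<in> W" "x = v + w" unfolding X_def by blast
    then show "(\<Delta> ^^ p) x \<in> X" using sV(3) sW(3) unfolding X_def by (auto simp: pow_add)
  qed
  have 4: "\<exists>f. (\<forall>i<p. f i \<in> X) \<and> x = (\<Sum>i<p. (\<Delta> ^^ i) (f i))" if x: "x \<in> U" for x
  proof -
    obtain a c where ac: "a \<in> A" "c \<in> C" "x = a + c" using x U by blast
    obtain f where f: "\<forall>i<p. f i \<in> V" "a = (\<Sum>i<p. (\<Delta> ^^ i) (f i))"
      using V ac unfolding shift_free_def by blast
    obtain g where g: "\<forall>i<p. g i \<in> W" "c = (\<Sum>i<p. (\<Delta> ^^ i) (g i))"
      using W ac unfolding shift_free_def by blast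
    have "x = (\<Sum>i<p. (\<Delta> ^^ i) (f i + g i))" using ac f g by (simp add: pow_add sum.distrib)
    moreover have "\<forall>i<p. f i + g i \<in> X" using f g unfolding X_def by blast
    ultimately show ?thesis by (intro exI[of _ "\<lambda>i. f i + g i"]) simp
  qed
  have 5: "\<forall>i<p. h i = 0" if h: "\<forall>i<p. h i \<in> X" "(\<Sum>i<p. (\<Delta> ^^ i) (h i)) = 0" for h
  proof -
    have "\<forall>i. \<exists>v w. i < p \<longrightarrow> v \<in> V \<and> w \<in> W \<and> h i = v + w" using h unfolding X_def by blast
    then obtain f g where fg: "\<And>i. i < p \<Longrightarrow> f i \<in> V \<and> g i \<in> W \<and> h i = f i + g i" by metis
    have eq: "(\<Sum>i<p. (\<Delta> ^^ i) (f i)) + (\<Sum>i<p. (\<Delta> ^^ i) (g i)) = 0 + 0"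
      using h(2) fg by (simp add: pow_add sum.distrib)
    have inA: "(\<Sum>i<p. (\<Delta> ^^ i) (f i)) \<in> A"
      using fg sV st by (intro subspace_sum) (auto simp: stableD intro!: stable_pow)
    have inC: "(\<Sum>i<p. (\<Delta> ^^ i) (g i)) \<in> C"
      using fg sW st by (intro subspace_sum) (auto simp: stableD intro!: stable_pow)
    have "(\<Sum>i<p. (\<Delta> ^^ i) (f i)) = 0" "(\<Sum>i<p. (\<Delta> ^^ i) (g i)) = 0"
      using complement_unique[OF comp inA _ inC _ eq] st by (auto simp: stableD)
    then have "f i = 0 \<and> g i = 0" if "i < p" for i
      using shift_free_zero[OF V _ _ that, of f] shift_free_zero[OF W _ _ that, of g] fg by blast
    then show ?thesis using fg by auto
  qed
  show ?thesis unfolding shift_free_def using 1 2 3 4 5 by blast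
qed

text \<open>Blocks are split off one by one; all of them have size divisible by \<open>p\<close>.\<close>

lemma layers_induced_imp_shift_free:
  assumes M: "stable M" "finite B" "M \<subseteq> span B" "\<forall>x\<in>M. (\<Delta> ^^ n) x = 0"
    and layer_induced: "\<And>j. layer_induced p j M" and p: "0 < p"
  shows "\<exists>W. shift_free p W M"
proof -
  have "(\<forall>j. layer_induced p j M) \<longrightarrow> (\<exists>W. shift_free p W M)"
    using M
  proof (induction rule: nilpotent_summand_induct)
    case zero
    have "shift_free p {0} {0}"
      unfolding shift_free_def by (auto intro!: exI[of _ "\<lambda>_. 0"] simp: subspace_def)
    then show ?case by blast
  next
    case (step U w m C)
    show ?case
    proof
      assume s: "\<forall>j. layer_induced p j U"
      have C: "\<exists>W. shift_free p W C"
        using step.IH s layer_induced_summand[OF complement_sym[OF step.hyps(6)]] by blast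
      have "p dvd m"
        using layer_induced_block[OF step.hyps(4)] layer_induced_summand[OF step.hyps(6)] s p by blast
      then obtain q where "m = q * p" by (auto simp: dvd_def mult.commute)
      then have "\<exists>W. shift_free p W (cyc w m)"
        using shift_free_block step.hyps(4) by blast
      then show "\<exists>W. shift_free p W U" using shift_free_sum[OF step.hyps(6)] C by blast
    qed
  qed
  then show ?thesis using layer_induced by blast
qed

lemma dim_block:
  assumes bg: "block_gen w m" shows "dim (cyc w m) = m"
proof -
  let ?f = "\<lambda>i. (\<Delta> ^^ i) w"
  have inj: "inj_on ?f {..<m}"
  proof (rule inj_onI, rule ccontr)
    fix i j assume ij: "i \<in> {..<m}" "j \<in> {..<m}" "?f i = ?f j" "i \<noteq> j"
    define a :: "nat \<Rightarrow> 'f" where "a l = (if l = i then 1 else if l = j then - 1 else 0)" for l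
    have "(\<Sum>l<m. a l *s ?f l) = (\<Sum>l\<in>{i, j}. a l *s ?f l)"
      using ij by (intro sum.mono_neutral_right) (auto simp: a_def)
    also have "\<dots> = 0" using ij by (simp add: a_def)
    finally have "a i = 0" using block_independent[OF bg, of a i] ij by simp
    then show False by (simp add: a_def)
  qed
  have "independent (?f ` {..<m})"
  proof (rule independent_if_scalars_zero)
    fix u x assume u: "(\<Sum>x\<in>?f ` {..<m}. u x *s x) = 0" and x: "x \<in> ?f ` {..<m}"
    have "(\<Sum>i<m. u (?f i) *s ?f i) = 0" using u sum.reindex[OF inj, of "\<lambda>x. u x *s x"] by (simp add: o_def)
    then show "u x = 0" using block_independent[OF bg, of "\<lambda>i. u (?f i)"] x by auto
  qed simp
  then have "dim (cyc w m) = card (?f ` {..<m})"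
    unfolding cyc_def dim_span by (rule dim_eq_card_independent)
  then show ?thesis using inj by (simp add: card_image)
qed

end

section \<open>Modules over a cyclic group of order \<open>p\<^sup>2\<close>\<close>

lemma (in group) generator_pow:
  assumes "\<sigma> \<in> carrier G" "generate G {\<sigma>} = carrier G" "order G = n" "0 < n"
  shows "g \<in> carrier G \<Longrightarrow> \<sigma> [^] exponent G \<sigma> g = g"
    and "\<sigma> [^] (k::nat) = \<sigma> [^] (l::nat) \<longleftrightarrow> k mod n = l mod n"
proof -
  have fin: "finite (carrier G)" using assms(3,4) by (intro card_ge_0_finite) (simp add: order_def)
  have ord: "ord \<sigma> = n"
    using generate_pow_card[OF assms(1)] assms by (simp add: order_def)
  show "\<sigma> [^] exponent G \<sigma> g = g" if "g \<in> carrier G"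
  proof -
    have "\<exists>k::nat. \<sigma> [^] k = g"
      using generate_pow_on_finite_carrier[OF fin assms(1)] that assms(2) by auto
    then show ?thesis unfolding exponent_def by (rule LeastI_ex)
  qed
  show "\<sigma> [^] k = \<sigma> [^] l \<longleftrightarrow> k mod n = l mod n"
  proof -
    have "\<sigma> [^] int k = \<sigma> [^] int l \<longleftrightarrow> int n dvd int k - int l"
      using int_pow_eq[OF assms(1), of "int k" "int l"] ord by (simp add: dvd_diff_commute)
    also have "\<dots> \<longleftrightarrow> int k mod int n = int l mod int n" by (simp add: mod_eq_dvd_iff)
    also have "\<dots> \<longleftrightarrow> k mod n = l mod n" by (metis of_nat_eq_iff zmod_int)
    finally show ?thesis by (simp add: int_pow_int)
  qed
qed

context vector_operator begin

lemma unipotent_binomial: "((\<lambda>v. v + \<Delta> v) ^^ k) v = (\<Sum>i\<le>k. of_nat (k choose i) *s (\<Delta> ^^ i) v)"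
proof (induction k)
  case (Suc k)
  let ?c = "\<lambda>k i. of_nat (k choose i) :: 'f" and ?T = "\<lambda>v. v + \<Delta> v"
  have "(?T ^^ Suc k) v = \<Delta> ((?T ^^ k) v) + (?T ^^ k) v" by (simp add: add.commute)
  also have "\<Delta> ((?T ^^ k) v) = (\<Sum>i\<le>k. ?c k i *s (\<Delta> ^^ Suc i) v)"
    unfolding Suc using pow_sum[of 1 "\<lambda>i. ?c k i *s (\<Delta> ^^ i) v" "{..k}"] pow_scale[of 1] by simp
  also have "(?T ^^ k) v = (\<Sum>i\<le>Suc k. ?c k i *s (\<Delta> ^^ i) v)"
    unfolding Suc by (simp add: binomial_eq_0)
  also have "\<dots> = v + (\<Sum>i\<le>k. ?c k (Suc i) *s (\<Delta> ^^ Suc i) v)"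
    by (simp only: sum.atMost_Suc_shift) simp
  also have "(\<Sum>i\<le>k. ?c k i *s (\<Delta> ^^ Suc i) v) + (v + (\<Sum>i\<le>k. ?c k (Suc i) *s (\<Delta> ^^ Suc i) v))
      = v + (\<Sum>i\<le>k. ?c (Suc k) (Suc i) *s (\<Delta> ^^ Suc i) v)"
    by (simp add: scale_left_distrib sum.distrib del: funpow.simps)
  also have "\<dots> = (\<Sum>i\<le>Suc k. ?c (Suc k) i *s (\<Delta> ^^ i) v)"
    by (simp only: sum.atMost_Suc_shift) simp
  finally show ?case .
qed simp

lemma unipotent_frobenius:
  assumes p: "prime p" and char: "CHAR('f) = p"
  shows "((\<lambda>v. v + \<Delta> v) ^^ p) v = v + (\<Delta> ^^ p) v"
proof -
  have p0: "0 < p" using p prime_gt_0_nat by simp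
  have "(\<Sum>i\<le>p. of_nat (p choose i) *s (\<Delta> ^^ i) v) = (\<Sum>i\<in>{0,p}. of_nat (p choose i) *s (\<Delta> ^^ i) v)"
  proof (rule sum.mono_neutral_right)
    show "\<forall>i\<in>{..p} - {0, p}. of_nat (p choose i) *s (\<Delta> ^^ i) v = 0"
    proof
      fix i assume "i \<in> {..p} - {0, p}"
      then have "p dvd (p choose i)" using p by (intro dvd_choose_prime) auto
      then have "(of_nat (p choose i) :: 'f) = 0" using of_nat_eq_0_iff_char_dvd[where 'a = 'f] char by simp
      then show "of_nat (p choose i) *s (\<Delta> ^^ i) v = 0" by simp
    qed
  qed auto
  also have "\<dots> = v + (\<Delta> ^^ p) v" using p0 by simp
  finally show ?thesis using unipotent_binomial[of p v] by simp
qed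

lemma unipotent_frobenius2:
  assumes p: "prime p" and char: "CHAR('f) = p"
  shows "((\<lambda>v. v + \<Delta> v) ^^ (p ^ 2)) v = v + (\<Delta> ^^ (p ^ 2)) v"
proof -
  interpret P: vector_operator scale "\<Delta> ^^ p"
    by unfold_locales (auto simp: pow_add pow_scale)
  have "((\<lambda>v. v + \<Delta> v) ^^ (p ^ 2)) v = (((\<lambda>v. v + \<Delta> v) ^^ p) ^^ p) v"
    by (simp add: funpow_mult power2_eq_square)
  also have "(\<lambda>v. v + \<Delta> v) ^^ p = (\<lambda>v. v + (\<Delta> ^^ p) v)"
    using unipotent_frobenius[OF p char] by auto
  also have "(\<dots> ^^ p) v = v + ((\<Delta> ^^ p) ^^ p) v" by (rule P.unipotent_frobenius[OF p char])
  finally show ?thesis by (simp add: funpow_mult power2_eq_square)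
qed

end

text \<open>A module over a cyclic group of order \<open>p\<^sup>2\<close> in characteristic \<open>p\<close>. The action \<open>T\<close> of the generator is
  linear on the whole ambient space, so that \<open>\<Delta> = T - 1\<close> is an operator there. The set \<open>B\<close> only records
  that \<open>M\<close> has finite dimension.\<close>

locale p2_module = vector_space scale + G: group G
  for scale :: "'f::field \<Rightarrow> 'v::ab_group_add \<Rightarrow> 'v" (infixr \<open>*s\<close> 75)
    and G :: "('g, 'x) monoid_scheme" (structure) +
  fixes \<sigma> :: 'g and p :: nat and act :: "'g \<Rightarrow> 'v \<Rightarrow> 'v" and T :: "'v \<Rightarrow> 'v" and M :: "'v set" and B :: "'v set"
  assumes p: "prime p" and char: "CHAR('f) = p"
    and \<sigma>: "\<sigma> \<in> carrier G" and gen: "generate G {\<sigma>} = carrier G" and order: "order G = p ^ 2"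
    and T_add: "T (x + y) = T x + T y" and T_scale: "T (c *s x) = c *s T x"
    and act_eq: "g \<in> carrier G \<Longrightarrow> v \<in> M \<Longrightarrow> act g v = (T ^^ exponent G \<sigma> g) v"
    and subM: "subspace M" and TM: "v \<in> M \<Longrightarrow> T v \<in> M" and T_order: "v \<in> M \<Longrightarrow> (T ^^ (p ^ 2)) v = v"
    and finB: "finite B" and MB: "M \<subseteq> span B"
begin

sublocale vector_operator scale "\<lambda>v. T v - v"
  by unfold_locales (auto simp: T_add T_scale scale_right_diff_distrib)

abbreviation \<Delta> where "\<Delta> \<equiv> \<lambda>v. T v - v"

lemma p_gt: "0 < p" "1 < p" using p using prime_gt_0_nat prime_gt_1_nat by auto

lemma p2_gt: "0 < p ^ 2" using p_gt by simp

lemmas G_pow = G.generator_pow[OF \<sigma> gen order p2_gt]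

lemma Tpow_add: "(T ^^ k) (x + y) = (T ^^ k) x + (T ^^ k) y"
  by (induction k) (auto simp: T_add)

lemma Tpow_scale: "(T ^^ k) (c *s x) = c *s (T ^^ k) x"
  by (induction k) (auto simp: T_scale)

lemma Tpow_zero [simp]: "(T ^^ k) 0 = 0"
  using Tpow_scale[of k 0 0] by simp

lemma Tpow_sum: "(T ^^ k) (\<Sum>i\<in>I. f i) = (\<Sum>i\<in>I. (T ^^ k) (f i))"
  by (induction I rule: infinite_finite_induct) (auto simp: Tpow_add)

lemma Tpow_M: "v \<in> M \<Longrightarrow> (T ^^ k) v \<in> M"
  by (induction k) (auto simp: TM)

lemma Tpow_period: "v \<in> M \<Longrightarrow> (T ^^ (p ^ 2 * k)) v = v"
  by (induction k) (auto simp: funpow_add T_order)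

lemma Tpow_mod: assumes "v \<in> M" shows "(T ^^ (k mod p ^ 2)) v = (T ^^ k) v"
proof -
  have "(T ^^ k) v = (T ^^ (k mod p ^ 2 + p ^ 2 * (k div p ^ 2))) v" by simp
  also have "\<dots> = (T ^^ (k mod p ^ 2)) v"
    by (simp only: funpow_add o_apply Tpow_period[OF assms])
  finally show ?thesis ..
qed

lemma act_pow: assumes "v \<in> M" shows "act (\<sigma> [^] (k::nat)) v = (T ^^ k) v"
proof -
  have "exponent G \<sigma> (\<sigma> [^] k) mod p ^ 2 = k mod p ^ 2"
    using G_pow(1)[of "\<sigma> [^] k"] G_pow(2) \<sigma> by (metis G.nat_pow_closed)
  then show ?thesis
    using act_eq[OF _ assms, of "\<sigma> [^] k"] Tpow_mod[OF assms] \<sigma> by (metis G.nat_pow_closed)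
qed

lemma exists_pow: "g \<in> carrier G \<Longrightarrow> \<exists>k::nat. g = \<sigma> [^] k"
  using G_pow(1) by metis

lemma T_frobenius: "(T ^^ p) v = v + (\<Delta> ^^ p) v" "(T ^^ (p ^ 2)) v = v + (\<Delta> ^^ (p ^ 2)) v"
  using unipotent_frobenius[OF p char, of v] unipotent_frobenius2[OF p char, of v] by simp_all

lemma nilpotent: "v \<in> M \<Longrightarrow> (\<Delta> ^^ (p ^ 2)) v = 0"
  using T_frobenius(2)[of v] T_order[of v] by simp

lemma stable_iff: "stable U \<longleftrightarrow> subspace U \<and> (\<forall>x\<in>U. T x \<in> U)"
proof -
  have "T x - x \<in> U \<longleftrightarrow> T x \<in> U" if "subspace U" "x \<in> U" for x
    using subspace_add[OF that(1), of "T x - x" x] subspace_diff[OF that(1), of "T x" x] that(2) by auto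
  then show ?thesis unfolding stable_def by (auto simp: image_subset_iff)
qed

lemma stable_M: "stable M"
  using stable_iff subM TM by simp

lemma stable_Tpow: "stable U \<Longrightarrow> x \<in> U \<Longrightarrow> (T ^^ k) x \<in> U"
  by (induction k) (auto simp: stable_iff)

lemma FG_module_iff:
  assumes "A \<subseteq> M" shows "FG_module scale G act A \<longleftrightarrow> stable A"
proof
  assume "FG_module scale G act A"
  then interpret A: FG_module scale G act A .
  have "T x \<in> A" if "x \<in> A" for x
    using A.act_closed[OF \<sigma> that] act_pow[of x 1] that assms \<sigma> by auto
  then show "stable A" using A.subspace stable_iff by simp
next
  assume st: "stable A"
  show "FG_module scale G act A"
  proof unfold_locales
    show "subspace A" using st by (simp add: stableD)
    fix g v assume g: "g \<in> carrier G" and v: "v \<in> A"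
    then obtain k :: nat where k: "g = \<sigma> [^] k" using exists_pow by auto
    have vM: "v \<in> M" using v assms by auto
    show "act g v \<in> A" using stable_Tpow[OF st v] act_pow[OF vM] k by simp
    show "act g (c *s v) = c *s act g v" for c
      using act_pow[OF vM] act_pow[of "c *s v" k] stableD(5)[OF stable_M vM] k by (simp add: Tpow_scale)
    show "act g (v + w) = act g v + act g w" if "w \<in> A" for w
      using act_pow[OF vM] act_pow[of w k] act_pow[of "v + w" k] stableD(3)[OF stable_M vM, of w] that assms k
      by (auto simp: Tpow_add)
    show "act (g \<otimes> h) v = act g (act h v)" if h: "h \<in> carrier G" for h
    proof -
      obtain l :: nat where l: "h = \<sigma> [^] l" using exists_pow[OF h] by auto
      have "g \<otimes> h = \<sigma> [^] (k + l)" using k l \<sigma> by (simp add: G.nat_pow_mult)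
      then show ?thesis
        using act_pow[OF vM] act_pow[OF Tpow_M[OF vM]] k l by (simp add: funpow_add)
    qed
  next
    show "act \<one> v = v" if "v \<in> A" for v
      using act_pow[of v 0] that assms by auto
  qed
qed

lemma complement_FG:
  assumes "A \<inter> C = {0}" "U = {a + c | a c. a \<in> A \<and> c \<in> C}" "U \<subseteq> M"
    "FG_module scale G act A" "FG_module scale G act C"
  shows "complement U A C"
proof -
  have 0: "0 \<in> A" "0 \<in> C" using assms(1) by auto
  have "A \<subseteq> U" "C \<subseteq> U"
    unfolding assms(2) using 0 by (auto intro: exI[of _ 0])
      (metis add.right_neutral add.left_neutral)+
  then have "stable A" "stable C"
    using FG_module_iff[of A] FG_module_iff[of C] assms(3-5) by auto
  then show ?thesis using assms(1,2) unfolding complement_def by blast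
qed

lemma indecomposable_imp_block:
  assumes "indecomposable scale G act U" "U \<subseteq> M"
  shows "\<exists>w m. w \<in> U \<and> block_gen w m \<and> U = cyc w m"
proof -
  note ind = assms(1)[unfolded indecomposable_def]
  have st: "stable U" and U0: "U \<noteq> {0}"
    using conjunct1[OF ind] conjunct1[OF conjunct2[OF ind]] FG_module_iff[OF assms(2)] by simp_all
  have dec: "A = {0} \<or> C = {0}" if "FG_module scale G act A" "FG_module scale G act C" "A \<inter> C = {0}"
        "U = {a + c | a c. a \<in> A \<and> c \<in> C}" for A C
    by (intro conjunct2[OF conjunct2[OF ind], THEN spec[of _ A], THEN spec[of _ C], THEN mp] conjI that)
  have "\<And>x. x \<in> U \<Longrightarrow> (\<Delta> ^^ (p ^ 2)) x = 0" using nilpotent assms(2) by blast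
  then obtain w m C where w: "w \<in> U" "block_gen w m" "complement U (cyc w m) C"
    using maximal_block_summand[OF st _ U0, of "p ^ 2"] by blast
  have sub: "cyc w m \<subseteq> M" "C \<subseteq> M" using complement_subset[OF w(3)] assms(2) by auto
  have "cyc w m \<noteq> {0}"
    using gen_in_cyc[of "m - 1" m w] w(2) by (auto simp: block_gen_def)
  then have C: "C = {0}"
    using dec[of "cyc w m" C] w(3) FG_module_iff[OF sub(1)] FG_module_iff[OF sub(2)]
    unfolding complement_def by blast
  have "U = cyc w m" using w(3) unfolding complement_def C by auto
  then show ?thesis using w by blast
qed

lemma block_indecomposable:
  assumes bg: "block_gen w m" and sub: "cyc w m \<subseteq> M"
  shows "indecomposable scale G act (cyc w m)"
  unfolding indecomposable_def
proof (intro conjI allI impI)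
  have st: "stable (cyc w m)" using bg cyc_stable by (simp add: block_gen_def)
  then show "FG_module scale G act (cyc w m)" using FG_module_iff[OF sub] by simp
  show "cyc w m \<noteq> {0}"
    using gen_in_cyc[of "m - 1" m w] bg by (auto simp: block_gen_def)
  fix A C assume AC: "FG_module scale G act A \<and> FG_module scale G act C \<and> A \<inter> C = {0} \<and>
    cyc w m = {a + c | a c. a \<in> A \<and> c \<in> C}"
  then have comp: "complement (cyc w m) A C" using complement_FG sub by blast
  then have stA: "stable A" "stable C" by (auto simp: complement_def)
  show "A = {0} \<or> C = {0}"
  proof (rule ccontr)
    assume "\<not> (A = {0} \<or> C = {0})"
    then obtain a c where "a \<in> A" "a \<noteq> 0" "c \<in> C" "c \<noteq> 0"
      using stableD(2)[OF stA(1)] stableD(2)[OF stA(2)] by auto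
    then have "(\<Delta> ^^ (m - 1)) w \<in> A \<inter> C"
      using block_bottom_in_stable[OF bg stA(1) complement_subset(1)[OF comp]]
        block_bottom_in_stable[OF bg stA(2) complement_subset(2)[OF comp]] by auto
    then show False using AC bg by (auto simp: block_gen_def)
  qed
qed

text \<open>A fixed vector spans a stable line, which contains the bottom vector of the block.\<close>

lemma fixed_space_block:
  assumes bg: "block_gen w m" and sub: "cyc w m \<subseteq> M"
  shows "fixed_space G act (cyc w m) = span {(\<Delta> ^^ (m - 1)) w}"
proof (intro equalityI subsetI)
  let ?s = "(\<Delta> ^^ (m - 1)) w"
  have st: "stable (cyc w m)" using bg cyc_stable by (simp add: block_gen_def)
  have s: "?s \<in> cyc w m" using gen_in_cyc[of "m - 1" m w] bg by (simp add: block_gen_def)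
  fix x
  {
    assume x: "x \<in> fixed_space G act (cyc w m)"
    then have xc: "x \<in> cyc w m" and "act \<sigma> x = x" using \<sigma> by (auto simp: fixed_space_def)
    then have Tx: "T x = x" using act_pow[of x 1] sub \<sigma> by auto
    have "stable (span {x})"
      unfolding stable_iff using subspace_span[of "{x}"] by (auto simp: span_singleton T_scale Tx)
    moreover have "span {x} \<subseteq> cyc w m"
      using xc st by (auto simp: span_singleton stableD)
    ultimately have "?s \<in> span {x}" if "x \<noteq> 0"
      using block_bottom_in_stable[OF bg, of "span {x}" x] that by (auto intro: span_base)
    then obtain c where c: "x \<noteq> 0 \<Longrightarrow> ?s = c *s x" by (auto simp: span_singleton)
    have "x = inverse c *s ?s" if "x \<noteq> 0"
      using c[OF that] bg by (auto simp: block_gen_def)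
    then show "x \<in> span {?s}" by (cases "x = 0") (auto simp: span_singleton span_zero)
  }
  {
    assume "x \<in> span {?s}"
    then obtain c where c: "x = c *s ?s" by (auto simp: span_singleton)
    have "\<Delta> ?s = 0" using bg pow_pow[of 1 "m - 1" w] by (simp add: block_gen_def)
    then have Tx: "T x = x" using c by (simp add: T_scale)
    have xc: "x \<in> cyc w m" using c s st by (simp add: stableD)
    have Tk: "(T ^^ k) x = x" for k by (induction k) (auto simp: Tx)
    show "x \<in> fixed_space G act (cyc w m)"
      using xc act_eq[of _ x] Tk sub by (auto simp: fixed_space_def)
  }
qed

text \<open>Every simple submodule contains the bottom vector of the block.\<close>

lemma socle_block:
  assumes bg: "block_gen w m" and sub: "cyc w m \<subseteq> M"
  shows "socle scale G act (cyc w m) = span {(\<Delta> ^^ (m - 1)) w}"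
proof -
  let ?s = "(\<Delta> ^^ (m - 1)) w"
  have st: "stable (cyc w m)" using bg cyc_stable by (simp add: block_gen_def)
  have s: "?s \<in> cyc w m" "?s \<noteq> 0" using gen_in_cyc[of "m - 1" m w] bg by (auto simp: block_gen_def)
  have "\<Delta> ?s = 0" using bg pow_pow[of 1 "m - 1" w] by (simp add: block_gen_def)
  then have sts: "stable (span {?s})"
    unfolding stable_iff using subspace_span[of "{?s}"] by (auto simp: span_singleton T_scale)
  have ss: "span {?s} \<subseteq> cyc w m" using s st by (auto simp: span_singleton stableD)
  have "S \<subseteq> cyc w m \<and> simple_module scale G act S \<longleftrightarrow> S = span {?s}" for S
  proof
    assume S: "S \<subseteq> cyc w m \<and> simple_module scale G act S"
    then have stS: "stable S" using FG_module_iff[of S] sub by (auto simp: simple_module_def)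
    obtain x where "x \<in> S" "x \<noteq> 0" using S stableD(2)[OF stS] by (auto simp: simple_module_def)
    then have "?s \<in> S" using block_bottom_in_stable[OF bg stS] S by auto
    then have sub': "span {?s} \<subseteq> S" using stS by (auto simp: span_singleton stableD)
    have "span {?s} \<noteq> {0}" using s(2) span_base[of ?s "{?s}"] by auto
    then show "S = span {?s}"
      using S sub' FG_module_iff[of "span {?s}"] sts ss sub unfolding simple_module_def by blast
  next
    assume S: "S = span {?s}"
    have "simple_module scale G act (span {?s})"
      unfolding simple_module_def
    proof (intro conjI allI impI)
      show "FG_module scale G act (span {?s})" using FG_module_iff[of "span {?s}"] sts ss sub by auto
      show "span {?s} \<noteq> {0}" using s(2) span_base[of ?s "{?s}"] by auto
      fix A assume A: "FG_module scale G act A \<and> A \<subseteq> span {?s}"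
      then have stA: "stable A" using FG_module_iff[of A] ss sub by auto
      show "A = {0} \<or> A = span {?s}"
      proof (cases "A = {0}")
        case False
        then obtain x where "x \<in> A" "x \<noteq> 0" using stableD(2)[OF stA] by auto
        then have "?s \<in> A" using block_bottom_in_stable[OF bg stA] A ss by auto
        then have "span {?s} \<subseteq> A" using stA by (auto simp: span_singleton stableD)
        then show ?thesis using A by auto
      qed simp
    qed
    then show "S \<subseteq> cyc w m \<and> simple_module scale G act S" using S ss by simp
  qed
  then have "{S. S \<subseteq> cyc w m \<and> simple_module scale G act S} = {span {?s}}" by blast
  then show ?thesis unfolding socle_def by (simp add: span_span)
qed

section \<open>Induced modules\<close>

definition p_powers :: "'g set" where "p_powers = range (\<lambda>k::nat. \<sigma> [^] (p * k))"

lemma p_powers_mod: assumes "\<sigma> [^] (i + p * k) = \<sigma> [^] (j + p * l)" shows "i mod p = j mod p"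
proof -
  have "(i + p * k) mod p ^ 2 = (j + p * l) mod p ^ 2" using G_pow(2) assms by blast
  then have "(i + p * k) mod p ^ 2 mod p = (j + p * l) mod p ^ 2 mod p" by simp
  then show ?thesis by (simp add: mod_mod_cancel power2_eq_square)
qed

lemma p_powers_subgroup: "subgroup p_powers G"
proof (rule G.subgroupI)
  show "p_powers \<subseteq> carrier G" using \<sigma> by (auto simp: p_powers_def)
  show "p_powers \<noteq> {}" by (auto simp: p_powers_def)
  fix a assume "a \<in> p_powers"
  then obtain k where k: "a = \<sigma> [^] (p * k)" by (auto simp: p_powers_def)
  have "\<sigma> [^] (p * (k * (p ^ 2 - 1))) \<otimes> a = \<sigma> [^] (p * (k * (p ^ 2 - 1)) + p * k)"
    using \<sigma> k by (simp add: G.nat_pow_mult)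
  also have "p * (k * (p ^ 2 - 1)) + p * k = p ^ 2 * (p * k)"
    using p2_gt by (simp add: diff_mult_distrib2 algebra_simps)
  also have "\<sigma> [^] (p ^ 2 * (p * k)) = \<sigma> [^] (0::nat)" unfolding G_pow(2) by simp
  finally have "inv a = \<sigma> [^] (p * (k * (p ^ 2 - 1)))"
    using \<sigma> k by (intro G.inv_equality) auto
  then show "inv a \<in> p_powers" by (auto simp: p_powers_def)
  fix b assume "b \<in> p_powers"
  then obtain l where "b = \<sigma> [^] (p * l)" by (auto simp: p_powers_def)
  then have "a \<otimes> b = \<sigma> [^] (p * (k + l))" using k \<sigma> by (simp add: G.nat_pow_mult distrib_left)
  then show "a \<otimes> b \<in> p_powers" by (auto simp: p_powers_def)
qed

lemma p_powers_proper: "p_powers \<noteq> carrier G"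
proof
  assume "p_powers = carrier G"
  then obtain k where "\<sigma> = \<sigma> [^] (p * k)" using \<sigma> by (auto simp: p_powers_def)
  then have "\<sigma> [^] (1 + p * 0) = \<sigma> [^] (0 + p * k)" using \<sigma> by simp
  from p_powers_mod[OF this] show False using p_gt by simp
qed

lemma p_powers_coset: "(\<sigma> [^] (n::nat)) <# p_powers = range (\<lambda>k. \<sigma> [^] (n + p * k))"
  using \<sigma> by (auto simp: l_coset_def p_powers_def G.nat_pow_mult)

lemma p_powers_cosets: "bij_betw (\<lambda>i. (\<sigma> [^] (i::nat)) <# p_powers) {..<p} (lcosets p_powers)"
  unfolding bij_betw_def
proof
  show "inj_on (\<lambda>i. (\<sigma> [^] i) <# p_powers) {..<p}"
  proof (rule inj_onI)
    fix i j assume ij: "i \<in> {..<p}" "j \<in> {..<p}" "(\<sigma> [^] i) <# p_powers = (\<sigma> [^] j) <# p_powers"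
    have "\<sigma> [^] (i + p * 0) \<in> (\<sigma> [^] i) <# p_powers" unfolding p_powers_coset by blast
    then have "\<sigma> [^] (i + p * 0) \<in> (\<sigma> [^] j) <# p_powers" by (simp only: ij(3))
    then obtain k where "\<sigma> [^] (i + p * 0) = \<sigma> [^] (j + p * k)" unfolding p_powers_coset by blast
    from p_powers_mod[OF this] show "i = j" using ij by simp
  qed
  show "(\<lambda>i. (\<sigma> [^] i) <# p_powers) ` {..<p} = lcosets p_powers"
  proof (intro equalityI subsetI)
    fix C assume "C \<in> (\<lambda>i. (\<sigma> [^] i) <# p_powers) ` {..<p}"
    then show "C \<in> lcosets p_powers" using \<sigma> by (auto simp: LCOSETS_def)
  next
    fix C assume "C \<in> lcosets p_powers"
    then obtain g where g: "g \<in> carrier G" "C = g <# p_powers" by (auto simp: LCOSETS_def)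
    then obtain n :: nat where n: "g = \<sigma> [^] n" using exists_pow by blast
    have "\<sigma> [^] n = \<sigma> [^] (n mod p + p * (n div p))" by simp
    then have "\<sigma> [^] n \<in> (\<sigma> [^] (n mod p)) <# p_powers" unfolding p_powers_coset by blast
    then have "(\<sigma> [^] (n mod p)) <# p_powers = C"
      using G.l_repr_independence[OF _ _ p_powers_subgroup] \<sigma> n g(2) by simp
    then show "C \<in> (\<lambda>i. (\<sigma> [^] i) <# p_powers) ` {..<p}" using p_gt by (intro image_eqI[of _ _ "n mod p"]) auto
  qed
qed

lemma restrict_FG_module:
  assumes H: "subgroup H' G" and W: "subspace W" "W \<subseteq> M" "\<And>h w. h \<in> H' \<Longrightarrow> w \<in> W \<Longrightarrow> act h w \<in> W"
  shows "FG_module scale (G\<lparr>carrier := H'\<rparr>) act W"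
proof -
  interpret A: FG_module scale G act M using FG_module_iff[of M] stable_M by simp
  interpret K: group "G\<lparr>carrier := H'\<rparr>" using G.subgroup_imp_group[OF H] .
  have sub: "g \<in> carrier G" if "g \<in> H'" for g using subgroup.subset[OF H] that by auto
  show ?thesis
    by unfold_locales
      (use W sub A.act_add A.act_scale A.act_one A.act_mult in \<open>auto simp: subset_iff\<close>)
qed

text \<open>By the binomial expansion \<open>T\<^sup>i\<close> is \<open>\<Delta>\<^sup>i\<close> plus lower powers of \<open>\<Delta>\<close>. That the top coefficient is kept allows
  coefficients to be shown to vanish one after the other.\<close>

lemma shift_free_T_sum:
  assumes W: "subspace W" and f: "\<And>i. i < n \<Longrightarrow> f i \<in> W"
  shows "\<exists>g. (\<forall>i<n. g i \<in> W) \<and> (\<Sum>i<n. (T ^^ i) (f i)) = (\<Sum>i<n. (\<Delta> ^^ i) (g i)) \<and>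
    (0 < n \<longrightarrow> g (n - 1) = f (n - 1))"
  using f
proof (induction n)
  case (Suc n)
  then obtain g where g: "\<forall>i<n. g i \<in> W" "(\<Sum>i<n. (T ^^ i) (f i)) = (\<Sum>i<n. (\<Delta> ^^ i) (g i))"
    by (metis less_SucI)
  define h where "h i = (if i < n then g i + of_nat (n choose i) *s f n else f n)" for i
  have "(T ^^ n) (f n) = (\<Sum>i<n. of_nat (n choose i) *s (\<Delta> ^^ i) (f n)) + (\<Delta> ^^ n) (f n)"
    using unipotent_binomial[of n "f n"] by (simp add: lessThan_Suc_atMost[symmetric])
  then have "(\<Sum>i<Suc n. (T ^^ i) (f i)) = (\<Sum>i<Suc n. (\<Delta> ^^ i) (h i))"
    using g(2) by (simp add: h_def pow_add pow_scale sum.distrib)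
  moreover have "\<forall>i<Suc n. h i \<in> W"
    using g(1) Suc.prems W by (auto simp: h_def subspace_add subspace_scale)
  moreover have "h n = f n" by (simp add: h_def)
  ultimately show ?case by (intro exI[of _ h]) simp
qed simp

lemma shift_free_to_T:
  assumes W: "subspace W" and f: "\<And>i. i < n \<Longrightarrow> f i \<in> W"
  shows "\<exists>g. (\<forall>i<n. g i \<in> W) \<and> (\<Sum>i<n. (\<Delta> ^^ i) (f i)) = (\<Sum>i<n. (T ^^ i) (g i))"
  using f
proof (induction n arbitrary: f)
  case (Suc n)
  define h where "h i = f i - of_nat (n choose i) *s f n" for i
  have hW: "h i \<in> W" if "i < n" for i
    using Suc.prems W that by (auto simp: h_def subspace_diff subspace_scale)
  then obtain g where g: "\<forall>i<n. g i \<in> W" "(\<Sum>i<n. (\<Delta> ^^ i) (h i)) = (\<Sum>i<n. (T ^^ i) (g i))"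
    using Suc.IH[of h] by blast
  have "(T ^^ n) (f n) = (\<Sum>i<n. of_nat (n choose i) *s (\<Delta> ^^ i) (f n)) + (\<Delta> ^^ n) (f n)"
    using unipotent_binomial[of n "f n"] by (simp add: lessThan_Suc_atMost[symmetric])
  then have "(\<Sum>i<Suc n. (\<Delta> ^^ i) (f i)) = (\<Sum>i<n. (\<Delta> ^^ i) (h i)) + (T ^^ n) (f n)"
    by (simp add: h_def pow_diff pow_scale sum_subtractf)
  also have "\<dots> = (\<Sum>i<Suc n. (T ^^ i) ((g(n := f n)) i))" using g by simp
  finally show ?case using g(1) Suc.prems by (intro exI[of _ "g(n := f n)"]) auto
qed simp

lemma shift_free_properly_induced:
  assumes U: "stable U" "U \<subseteq> M" and sf: "shift_free p W U"
  shows "properly_induced scale G act U"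
proof -
  have W: "subspace W" "W \<subseteq> U" "\<And>w. w \<in> W \<Longrightarrow> (\<Delta> ^^ p) w \<in> W"
    and ex: "\<And>x. x \<in> U \<Longrightarrow> \<exists>f. (\<forall>i<p. f i \<in> W) \<and> x = (\<Sum>i<p. (\<Delta> ^^ i) (f i))"
    using sf unfolding shift_free_def by auto
  have WM: "W \<subseteq> M" using W U by blast
  have TW: "(T ^^ (p * k)) w \<in> W" if "w \<in> W" for w k
  proof (induction k)
    case (Suc k)
    have "(T ^^ (p * Suc k)) w = (T ^^ p) ((T ^^ (p * k)) w)" by (simp add: funpow_add)
    then show ?case using Suc W by (simp add: T_frobenius subspace_add)
  qed (use that in simp)
  have zero: "f i = 0" if "n \<le> p" "\<And>i. i < n \<Longrightarrow> f i \<in> W" "(\<Sum>i<n. (T ^^ i) (f i)) = 0" "i < n" for n f i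
    using that
  proof (induction n arbitrary: i)
    case (Suc n)
    obtain g where g: "\<forall>i<Suc n. g i \<in> W" "(\<Sum>i<Suc n. (T ^^ i) (f i)) = (\<Sum>i<Suc n. (\<Delta> ^^ i) (g i))" "g n = f n"
      using shift_free_T_sum[OF W(1), of "Suc n" f] Suc.prems(2) by auto
    define h where "h i = (if i < Suc n then g i else 0)" for i
    have "(\<Sum>i<p. (\<Delta> ^^ i) (h i)) = (\<Sum>i<Suc n. (\<Delta> ^^ i) (h i))"
      using Suc.prems(1) by (intro sum.mono_neutral_right) (auto simp: h_def)
    also have "\<dots> = 0" using g Suc.prems(3) by (simp add: h_def del: sum.lessThan_Suc)
    finally have "h n = 0"
      using shift_free_zero[OF sf, of h n] g(1) W(1) Suc.prems(1) by (auto simp: h_def subspace_0)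
    then have fn: "f n = 0" using g(3) by (simp add: h_def)
    show ?case
    proof (cases "i = n")
      case False
      then show ?thesis using Suc.IH[of i] Suc.prems fn by simp
    qed (use fn in simp)
  qed simp
  have subT: "subspace ((T ^^ k) ` W)" for k
  proof (rule subspaceI)
    show "0 \<in> (T ^^ k) ` W" using subspace_0[OF W(1)] by (metis Tpow_zero image_eqI)
    show "x + y \<in> (T ^^ k) ` W" if "x \<in> (T ^^ k) ` W" "y \<in> (T ^^ k) ` W" for x y
      using that subspace_add[OF W(1)] by (auto simp: Tpow_add[symmetric])
    show "c *s x \<in> (T ^^ k) ` W" if "x \<in> (T ^^ k) ` W" for c x
      using that subspace_scale[OF W(1)] by (auto simp flip: Tpow_scale)
  qed
  have ds: "direct_sum {..<p} (\<lambda>i. (T ^^ i) ` W) U"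
  proof (rule direct_sumI)
    show "\<exists>f. (\<forall>i\<in>{..<p}. f i \<in> (T ^^ i) ` W) \<and> x = (\<Sum>i<p. f i)" if x: "x \<in> U" for x
    proof -
      obtain f where f: "\<forall>i<p. f i \<in> W" "x = (\<Sum>i<p. (\<Delta> ^^ i) (f i))" using ex[OF x] by blast
      obtain g where "\<forall>i<p. g i \<in> W" "x = (\<Sum>i<p. (T ^^ i) (g i))"
        using shift_free_to_T[OF W(1), of p f] f by auto
      then show ?thesis by (intro exI[of _ "\<lambda>i. (T ^^ i) (g i)"]) auto
    qed
    show "(\<Sum>i<p. f i) \<in> U" if f: "\<And>i. i \<in> {..<p} \<Longrightarrow> f i \<in> (T ^^ i) ` W" for f
    proof (rule subspace_sum[OF stableD(1)[OF U(1)]])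
      fix i assume "i \<in> {..<p}"
      from f[OF this] obtain w where "w \<in> W" "f i = (T ^^ i) w" by (rule imageE)
      then show "f i \<in> U" using W(2) stable_Tpow[OF U(1), of w i] by auto
    qed
    show "f i = 0" if f: "\<And>i. i \<in> {..<p} \<Longrightarrow> f i \<in> (T ^^ i) ` W" "(\<Sum>i<p. f i) = 0" and i: "i \<in> {..<p}" for f i
    proof -
      have "\<forall>i. \<exists>w. i < p \<longrightarrow> w \<in> W \<and> f i = (T ^^ i) w" using f(1) by blast
      then obtain g where g: "\<And>i. i < p \<Longrightarrow> g i \<in> W \<and> f i = (T ^^ i) (g i)" by metis
      have "(\<Sum>i<p. (T ^^ i) (g i)) = 0" using f(2) g by simp
      then have "g i = 0" using zero[of p g i] g i by auto
      then show ?thesis using g[of i] i by simp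
    qed
  qed (use subT in auto)
  define N where "N C = (\<Union>g\<in>C. act g ` W)" for C
  have N: "N ((\<sigma> [^] (i::nat)) <# p_powers) = (T ^^ i) ` W" for i
  proof (intro equalityI subsetI)
    fix x assume "x \<in> N ((\<sigma> [^] i) <# p_powers)"
    then obtain k w where "w \<in> W" "x = act (\<sigma> [^] (i + p * k)) w" unfolding N_def p_powers_coset by blast
    then have "x = (T ^^ i) ((T ^^ (p * k)) w)" using act_pow[of w "i + p * k"] WM by (auto simp: funpow_add)
    then show "x \<in> (T ^^ i) ` W" using TW[OF \<open>w \<in> W\<close>] by blast
  next
    fix x assume "x \<in> (T ^^ i) ` W"
    then obtain w where w: "w \<in> W" "x = (T ^^ i) w" by blast
    then have "x = act (\<sigma> [^] (i + p * 0)) w" using act_pow[of w i] WM by auto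
    then show "x \<in> N ((\<sigma> [^] i) <# p_powers)" unfolding N_def p_powers_coset using w(1) by blast
  qed
  have "direct_sum (lcosets p_powers) N U"
  proof (rule direct_sum_reindex[OF p_powers_cosets])
    show "direct_sum {..<p} (\<lambda>i. N ((\<sigma> [^] i) <# p_powers)) U" unfolding N by (rule ds)
    fix C assume "C \<in> lcosets p_powers"
    then obtain i :: nat where "C = (\<sigma> [^] i) <# p_powers" using p_powers_cosets unfolding bij_betw_def by blast
    then show "subspace (N C)" using N subT by simp
  qed
  moreover have "FG_module scale (G\<lparr>carrier := p_powers\<rparr>) act W"
  proof (rule restrict_FG_module[OF p_powers_subgroup W(1) WM])
    fix h w assume "h \<in> p_powers" "w \<in> W"
    then show "act h w \<in> W" using TW act_pow[of w] WM by (auto simp: p_powers_def)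
  qed
  ultimately have "induced_from scale G act U p_powers W"
    unfolding induced_from_def N_def using FG_module_iff[OF U(2)] U(1) p_powers_subgroup W(2) by simp
  then show ?thesis unfolding properly_induced_def using p_powers_proper by blast
qed

lemma dim_T_image: assumes "W \<subseteq> M" shows "dim ((T ^^ n) ` W) = dim W"
proof -
  have le: "dim ((T ^^ n) ` W) \<le> dim W" if W: "W \<subseteq> M" for W n
  proof -
    obtain A where A: "A \<subseteq> W" "independent A" "W \<subseteq> span A" "card A = dim W" using basis_exists by blast
    have fin: "finite A"
      using independent_span_bound[OF finB A(2)] A(1) W MB by blast
    have "(T ^^ n) ` W \<subseteq> span ((T ^^ n) ` A)"
    proof clarify
      fix w assume "w \<in> W"
      then obtain u where "w = (\<Sum>a\<in>A. u a *s a)" using A(3) span_finite[OF fin] by auto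
      then have "(T ^^ n) w = (\<Sum>a\<in>A. u a *s (T ^^ n) a)" by (simp add: Tpow_sum Tpow_scale)
      then show "(T ^^ n) w \<in> span ((T ^^ n) ` A)"
        by (simp only:) (intro span_sum span_scale span_base imageI)
    qed
    then have "dim ((T ^^ n) ` W) \<le> card ((T ^^ n) ` A)" using fin by (intro dim_le_card) auto
    also have "\<dots> \<le> card A" using fin by (rule card_image_le)
    finally show ?thesis using A by simp
  qed
  have "(T ^^ ((p ^ 2 - 1) * n)) ` (T ^^ n) ` W = W"
  proof -
    have "(T ^^ ((p ^ 2 - 1) * n)) ((T ^^ n) w) = w" if "w \<in> W" for w
    proof -
      have "(T ^^ ((p ^ 2 - 1) * n)) ((T ^^ n) w) = (T ^^ ((p ^ 2 - 1) * n + n)) w" by (simp add: funpow_add)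
      also have "(p ^ 2 - 1) * n + n = p ^ 2 * n" using p2_gt by (simp add: diff_mult_distrib)
      finally show ?thesis using Tpow_period that assms by auto
    qed
    then show ?thesis by (auto simp: image_image)
  qed
  moreover have "(T ^^ n) ` W \<subseteq> M" using assms Tpow_M by auto
  ultimately show ?thesis using le[of "(T ^^ n) ` W" "(p ^ 2 - 1) * n"] le[OF assms, of n] by simp
qed

text \<open>The dimension of an induced module is a multiple of the index of the subgroup, and a proper subgroup
  of a group of order \<open>p\<^sup>2\<close> has index divisible by \<open>p\<close>.\<close>

lemma properly_induced_dvd_dim:
  assumes "properly_induced scale G act U" "U \<subseteq> M" shows "p dvd dim U"
proof -
  obtain K W where K: "K \<noteq> carrier G" "subgroup K G" and W: "W \<subseteq> U" "FG_module scale (G\<lparr>carrier := K\<rparr>) act W"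
    and ds: "direct_sum (lcosets K) (\<lambda>C. \<Union>g\<in>C. act g ` W) U"
    using assms(1) unfolding properly_induced_def induced_from_def by blast
  interpret W: FG_module scale "G\<lparr>carrier := K\<rparr>" act W by (rule W(2))
  interpret A: FG_module scale G act M using FG_module_iff[of M] stable_M by simp
  have WM: "W \<subseteq> M" using W assms by blast
  have N: "\<exists>n::nat. (\<Union>g\<in>C. act g ` W) = (T ^^ n) ` W" if "C \<in> lcosets K" for C
  proof -
    obtain a where a: "a \<in> carrier G" "C = a <# K" using \<open>C \<in> lcosets K\<close> by (auto simp: LCOSETS_def)
    obtain n :: nat where n: "a = \<sigma> [^] n" using exists_pow a by blast
    have "(\<Union>g\<in>C. act g ` W) = act a ` W"
    proof (intro equalityI subsetI)
      fix x assume "x \<in> (\<Union>g\<in>C. act g ` W)"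
      then obtain h w where hw: "h \<in> K" "w \<in> W" "x = act (a \<otimes> h) w" unfolding a(2) l_coset_def by blast
      then have "x = act a (act h w)" using A.act_mult[OF a(1), of h w] subgroup.mem_carrier[OF K(2)] WM by auto
      moreover have "act h w \<in> W" using W.act_closed[of h w] hw by simp
      ultimately show "x \<in> act a ` W" by blast
    next
      fix x assume "x \<in> act a ` W"
      moreover have "a \<in> C" unfolding a(2) l_coset_def
        using subgroup.one_closed[OF K(2)] a(1) by force
      ultimately show "x \<in> (\<Union>g\<in>C. act g ` W)" by blast
    qed
    also have "\<dots> = (T ^^ n) ` W" using act_pow[of _ n] WM n by (auto intro!: image_cong)
    finally show ?thesis ..
  qed
  have sub: "subspace (\<Union>g\<in>C. act g ` W)" if C: "C \<in> lcosets K" for C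
  proof -
    obtain n :: nat where n: "(\<Union>g\<in>C. act g ` W) = (T ^^ n) ` W" using N[OF C] by blast
    show ?thesis unfolding n
    proof (rule subspaceI)
      show "0 \<in> (T ^^ n) ` W" using subspace_0[OF W.subspace] by (metis Tpow_zero image_eqI)
      show "x + y \<in> (T ^^ n) ` W" if "x \<in> (T ^^ n) ` W" "y \<in> (T ^^ n) ` W" for x y
        using that subspace_add[OF W.subspace] by (auto simp flip: Tpow_add)
      show "c *s x \<in> (T ^^ n) ` W" if "x \<in> (T ^^ n) ` W" for c x
        using that subspace_scale[OF W.subspace] by (auto simp flip: Tpow_scale)
    qed
  qed
  have "dim U = (\<Sum>C\<in>lcosets K. dim (\<Union>g\<in>C. act g ` W))"
    using assms(2) MB by (intro dim_direct_sum[OF ds sub finB]) auto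
  also have "\<dots> = (\<Sum>C\<in>lcosets K. dim W)"
  proof (rule sum.cong[OF refl])
    fix C assume "C \<in> lcosets K"
    then obtain n :: nat where n: "(\<Union>g\<in>C. act g ` W) = (T ^^ n) ` W" using N by blast
    show "dim (\<Union>g\<in>C. act g ` W) = dim W" unfolding n by (rule dim_T_image[OF WM])
  qed
  finally have dU: "dim U = card (lcosets K) * dim W" by simp
  have finG: "finite (carrier G)" using order p2_gt by (intro card_ge_0_finite) (simp add: order_def)
  have cc: "card (lcosets K) * card K = p ^ 2"
    using G.l_lagrange[OF finG K(2)] order by simp
  have "card (lcosets K) \<noteq> 1"
  proof
    assume "card (lcosets K) = 1"
    then have "card K = card (carrier G)" using cc order by (simp add: order_def)
    then show False using K card_subset_eq[OF finG subgroup.subset[OF K(2)]] by blast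
  qed
  moreover have "card (lcosets K) dvd p ^ 2" using cc by (metis dvd_triv_left)
  then obtain i where "card (lcosets K) = p ^ i" using divides_primepow_nat[OF p] by blast
  ultimately have "p dvd card (lcosets K)" by (cases i) auto
  then show ?thesis using dU by simp
qed

lemma block_properly_induced_iff:
  assumes bg: "block_gen w m" and sub: "cyc w m \<subseteq> M"
  shows "properly_induced scale G act (cyc w m) \<longleftrightarrow> p dvd m"
proof
  assume "properly_induced scale G act (cyc w m)"
  then show "p dvd m" using properly_induced_dvd_dim[OF _ sub] dim_block[OF bg] by simp
next
  assume "p dvd m"
  then obtain q where "m = q * p" by (auto simp: dvd_def mult.commute)
  then obtain W where "shift_free p W (cyc w m)" using shift_free_block bg by blast
  moreover have "stable (cyc w m)" using bg cyc_stable by (simp add: block_gen_def)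
  ultimately show "properly_induced scale G act (cyc w m)" using shift_free_properly_induced sub by blast
qed

lemma layers_induced_properly_induced:
  assumes "\<And>j. layer_induced p j M" shows "properly_induced scale G act M"
proof -
  have "\<forall>x\<in>M. (\<Delta> ^^ (p ^ 2)) x = 0" using nilpotent by blast
  then obtain W where "shift_free p W M" using layers_induced_imp_shift_free[OF stable_M finB MB _ assms p_gt(1)] by blast
  then show ?thesis using shift_free_properly_induced[OF stable_M] by blast
qed

end

section \<open>Blocks as the modules \<open>V\<^sub>m\<close>\<close>

lemma jordan_add: "jordan (x + y) = jordan x + jordan y"
  by (rule poly_mapping_eqI) (simp add: lookup_jordan lookup_add algebra_simps)

lemma jordan_fscale: "jordan (fscale c x) = fscale c (jordan x)"
  by (rule poly_mapping_eqI) (simp add: lookup_jordan algebra_simps)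

interpretation fs: vector_space fscale by (rule vector_space_fscale)

interpretation jordan_op: vector_operator fscale "\<lambda>v. jordan v - v"
  by unfold_locales (auto simp: jordan_add jordan_fscale fs.scale_right_diff_distrib)

lemma lookup_jordan_nilpotent:
  "Poly_Mapping.lookup (((\<lambda>v. jordan v - v) ^^ k) v) i = Poly_Mapping.lookup v (i + k)"
  by (induction k arbitrary: i) (auto simp: lookup_minus lookup_jordan)

lemma V_space_iff: "v \<in> V_space m \<longleftrightarrow> (\<forall>i\<ge>m. Poly_Mapping.lookup v i = 0)"
  by (auto simp: V_space_def in_keys_iff subset_iff) (meson not_le)

lemma V_space_expand: assumes "v \<in> V_space m"
  shows "v = (\<Sum>i<m. fscale (Poly_Mapping.lookup v i) (basis_vec i))"
proof (rule poly_mapping_eqI)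
  fix k
  have "Poly_Mapping.lookup (\<Sum>i<m. fscale (Poly_Mapping.lookup v i) (basis_vec i)) k
     = (\<Sum>i<m. if i = k then Poly_Mapping.lookup v i else 0)"
    unfolding lookup_sum by (rule sum.cong) (auto simp: lookup_single when_def)
  then show "Poly_Mapping.lookup v k
     = Poly_Mapping.lookup (\<Sum>i<m. fscale (Poly_Mapping.lookup v i) (basis_vec i)) k"
    using assms by (auto simp: V_space_iff)
qed

lemma jordan_order:
  assumes "prime p" "CHAR('f::field) = p" "m \<le> p ^ 2" "v \<in> (V_space m :: (nat \<Rightarrow>\<^sub>0 'f) set)"
  shows "(jordan ^^ (p ^ 2)) v = v"
proof -
  have "((\<lambda>v. jordan v - v) ^^ (p ^ 2)) v = 0"
    using assms by (intro poly_mapping_eqI) (simp add: lookup_jordan_nilpotent V_space_iff)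
  then show ?thesis using jordan_op.unipotent_frobenius2[OF assms(1,2), of v] by simp
qed

lemma V_space_p2_module:
  assumes "prime p" "CHAR('f::field) = p" "group G" "\<sigma> \<in> carrier G" "generate G {\<sigma>} = carrier G" "order G = p ^ 2"
    and "m \<le> p ^ 2"
  shows "p2_module fscale G \<sigma> p (V_act G \<sigma>) jordan (V_space m :: (nat \<Rightarrow>\<^sub>0 'f) set) (basis_vec ` {..<m})"
proof -
  interpret G: group G by fact
  show ?thesis
  proof (unfold_locales)
    show "fs.subspace (V_space m :: (nat \<Rightarrow>\<^sub>0 'f) set)"
      by (auto simp: fs.subspace_def V_space_iff lookup_add)
    show "jordan v \<in> V_space m" if "v \<in> V_space m" for v :: "nat \<Rightarrow>\<^sub>0 'f"
      using that by (auto simp: V_space_iff lookup_jordan)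
    show "(jordan ^^ (p ^ 2)) v = v" if "v \<in> V_space m" for v :: "nat \<Rightarrow>\<^sub>0 'f"
      using jordan_order assms that by blast
    show "(V_space m :: (nat \<Rightarrow>\<^sub>0 'f) set) \<subseteq> fs.span (basis_vec ` {..<m})"
    proof
      fix v :: "nat \<Rightarrow>\<^sub>0 'f" assume "v \<in> V_space m"
      then show "v \<in> fs.span (basis_vec ` {..<m})"
        by (subst V_space_expand) (auto intro!: fs.span_sum fs.span_scale intro: fs.span_base)
    qed
  qed (use assms in \<open>auto simp: jordan_add jordan_fscale V_act_def\<close>)
qed

context p2_module begin

lemma block_isomorphic_V_space:
  assumes bg: "block_gen w m" and sub: "cyc w m \<subseteq> M"
  shows "FG_isomorphic G scale act (cyc w m) fscale (V_act G \<sigma>) (V_space m :: (nat \<Rightarrow>\<^sub>0 'f) set)"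
proof -
  \<comment> \<open>\<open>jordan - 1\<close> lowers the index of a basis vector, so the basis vector \<open>i\<close> corresponds to \<open>\<Delta>\<^bsup>m-1-i\<^esup> w\<close>.\<close>
  define \<psi> where "\<psi> v = (\<Sum>i<m. Poly_Mapping.lookup v i *s (\<Delta> ^^ (m - Suc i)) w)" for v :: "nat \<Rightarrow>\<^sub>0 'f"
  have m: "0 < m" "(\<Delta> ^^ m) w = 0" using bg by (auto simp: block_gen_def)
  have st: "stable (cyc w m)" using m cyc_stable by simp
  have "m \<le> p ^ 2"
  proof (rule ccontr)
    assume "\<not> m \<le> p ^ 2"
    moreover have "w \<in> M" using gen_in_cyc[of 0 m w] m sub by auto
    ultimately have "(\<Delta> ^^ (m - 1)) w = 0" using pow_eq_0_mono[OF nilpotent[of w], of "m - 1"] by simp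
    then show False using bg by (simp add: block_gen_def)
  qed
  then interpret V: p2_module fscale G \<sigma> p "V_act G \<sigma>" jordan "V_space m :: (nat \<Rightarrow>\<^sub>0 'f) set" "basis_vec ` {..<m}"
    by (intro V_space_p2_module p char \<sigma> gen order G.is_group)
  have flip: "(\<Sum>i<m. a i *s (\<Delta> ^^ (m - Suc i)) w) = (\<Sum>i<m. a (m - Suc i) *s (\<Delta> ^^ i) w)" for a
  proof -
    have "(\<Sum>i<m. a i *s (\<Delta> ^^ (m - Suc i)) w) = (\<Sum>i<m. a (m - Suc (m - Suc i)) *s (\<Delta> ^^ (m - Suc i)) w)"
      by (intro sum.cong) auto
    also have "\<dots> = (\<Sum>i<m. a (m - Suc i) *s (\<Delta> ^^ i) w)"
      by (rule sum.nat_diff_reindex)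
    finally show ?thesis .
  qed
  have add: "\<psi> (u + v) = \<psi> u + \<psi> v" for u v
    by (simp add: \<psi>_def lookup_add scale_left_distrib sum.distrib)
  have sc: "\<psi> (fscale c v) = c *s \<psi> v" for c v
    by (simp add: \<psi>_def scale_sum_right)
  have inj: "inj_on \<psi> (V_space m)"
  proof (rule inj_onI)
    fix u v :: "nat \<Rightarrow>\<^sub>0 'f" assume uv: "u \<in> V_space m" "v \<in> V_space m" "\<psi> u = \<psi> v"
    let ?a = "\<lambda>i. Poly_Mapping.lookup u i - Poly_Mapping.lookup v i"
    have "(\<Sum>i<m. ?a (m - Suc i) *s (\<Delta> ^^ i) w) = 0"
      using flip[of ?a] uv(3) by (simp add: \<psi>_def scale_left_diff_distrib sum_subtractf)
    then have z: "?a (m - Suc i) = 0" if "i < m" for i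
      using block_independent[OF bg, of "\<lambda>i. ?a (m - Suc i)"] that by blast
    show "u = v"
    proof (rule poly_mapping_eqI)
      fix k
      show "Poly_Mapping.lookup u k = Poly_Mapping.lookup v k"
        using z[of "m - Suc k"] uv(1,2) m by (cases "k < m") (auto simp: V_space_iff)
    qed
  qed
  have surj: "\<psi> ` V_space m = cyc w m"
  proof (intro equalityI subsetI)
    fix x assume "x \<in> \<psi> ` V_space m"
    then show "x \<in> cyc w m"
      using m by (auto simp: \<psi>_def intro!: subspace_sum[OF stableD(1)[OF st]] stableD(5)[OF st] gen_in_cyc)
  next
    fix x assume "x \<in> cyc w m"
    then obtain a where a: "x = (\<Sum>i<m. a i *s (\<Delta> ^^ i) w)" unfolding cyc_iff by blast
    define v where "v = (\<Sum>i<m. Poly_Mapping.single i (a (m - Suc i)))"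
    have lv: "Poly_Mapping.lookup v k = (if k < m then a (m - Suc k) else 0)" for k
      by (simp add: v_def lookup_sum lookup_single when_def)
    have "\<psi> v = x" unfolding \<psi>_def flip a by (intro sum.cong) (auto simp: lv)
    moreover have "v \<in> V_space m" by (simp add: V_space_iff lv)
    ultimately show "x \<in> \<psi> ` V_space m" by blast
  qed
  have T\<psi>: "\<psi> (jordan v) = T (\<psi> v)" if v: "v \<in> V_space m" for v
  proof -
    obtain n where n: "m = Suc n" using m by (cases m) auto
    have "(\<Delta> ^^ 1) (\<psi> v) = (\<Sum>i<m. Poly_Mapping.lookup v i *s (\<Delta> ^^ (1 + (m - Suc i))) w)"
      by (simp only: \<psi>_def pow_sum pow_scale pow_pow)
    also have "\<dots> = (\<Sum>i<m. Poly_Mapping.lookup v i *s (\<Delta> ^^ (m - i)) w)"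
      by (rule sum.cong) (auto simp: Suc_diff_Suc simp del: funpow.simps)
    finally have "T (\<psi> v) - \<psi> v = (\<Sum>i<m. Poly_Mapping.lookup v i *s (\<Delta> ^^ (m - i)) w)" by simp
    also have "\<dots> = (\<Sum>i<n. Poly_Mapping.lookup v (Suc i) *s (\<Delta> ^^ (n - i)) w)"
      unfolding n sum.lessThan_Suc_shift using m(2) n by simp
    also have "\<dots> = (\<Sum>i<m. Poly_Mapping.lookup v (Suc i) *s (\<Delta> ^^ (m - Suc i)) w)"
      using v n by (simp add: V_space_iff)
    finally have "T (\<psi> v) = (\<Sum>i<m. Poly_Mapping.lookup v (Suc i) *s (\<Delta> ^^ (m - Suc i)) w) + \<psi> v"
      by (simp add: algebra_simps)
    then show ?thesis by (simp add: \<psi>_def lookup_jordan scale_left_distrib sum.distrib add.commute)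
  qed
  have Tk\<psi>: "\<psi> ((jordan ^^ k) v) = (T ^^ k) (\<psi> v)" if v: "v \<in> V_space m" for v k
    by (induction k) (use T\<psi> V.Tpow_M[OF v] in auto)
  define \<phi> where "\<phi> = the_inv_into (V_space m) \<psi>"
  have bij: "bij_betw \<psi> (V_space m) (cyc w m)" using inj surj by (simp add: bij_betw_def)
  have \<psi>\<phi>: "\<psi> (\<phi> x) = x" "\<phi> x \<in> V_space m" if "x \<in> cyc w m" for x
    using that f_the_inv_into_f_bij_betw[OF bij] bij_betw_the_inv_into[OF bij]
    unfolding \<phi>_def by (auto simp: bij_betw_def)
  have \<phi>I: "\<phi> x = v" if "v \<in> V_space m" "\<psi> v = x" for v x
    unfolding \<phi>_def using the_inv_into_f_eq[OF inj that(2,1)] .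
  have "bij_betw \<phi> (cyc w m) (V_space m)" unfolding \<phi>_def by (rule bij_betw_the_inv_into[OF bij])
  moreover have "\<phi> (x + y) = \<phi> x + \<phi> y" if "x \<in> cyc w m" "y \<in> cyc w m" for x y
    using \<psi>\<phi> that jordan_op.stableD(3)[OF V.stable_M] by (intro \<phi>I) (auto simp: add)
  moreover have "\<phi> (c *s x) = fscale c (\<phi> x)" if "x \<in> cyc w m" for x c
    using \<psi>\<phi> that jordan_op.stableD(5)[OF V.stable_M] by (intro \<phi>I) (auto simp: sc)
  moreover have "\<phi> (act g x) = V_act G \<sigma> g (\<phi> x)" if "g \<in> carrier G" "x \<in> cyc w m" for g x
    using \<psi>\<phi> that V.Tpow_M act_eq[OF that(1), of x] sub
    by (intro \<phi>I) (auto simp: V_act_def Tk\<psi>)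
  ultimately show ?thesis
    unfolding FG_isomorphic_def
    using FG_module_iff[OF sub] st V.FG_module_iff[of "V_space m"] V.stable_M by blast
qed

section \<open>Non-induced summands of a decomposition\<close>

lemma indecomposable_subspace:
  assumes "indecomposable scale G act U" shows "FG_module scale G act U" "subspace U"
proof -
  show 1: "FG_module scale G act U"
    using assms unfolding indecomposable_def by (rule conjunct1)
  show "subspace U" by (rule FG_module.subspace[OF 1])
qed

lemma decomposition_cons:
  assumes bg: "block_gen w m" and comp: "complement U (cyc w m) C" and U: "U \<subseteq> M"
    and dec: "indecomposable_decomposition scale G act C k N"
  shows "indecomposable_decomposition scale G act U (Suc k) (N(k := cyc w m))"
proof -
  have N: "direct_sum {..<k} N C" "\<forall>i<k. indecomposable scale G act (N i)"
    using dec by (simp_all add: indecomposable_decomposition_def)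
  have sub: "C \<subseteq> M" "cyc w m \<subseteq> M" using complement_subset[OF comp] U by auto
  have sN: "subspace (N i)" if "i \<in> {..<k}" for i
    using N(2) that indecomposable_subspace(2) by simp
  have "stable (N i)" if "i < k" for i
    using FG_module_iff[of "N i"] direct_sum_summand_subset[OF N(1) sN, of i] that sub N(2)
      indecomposable_subspace(1)[of "N i"] by auto
  then have "direct_sum {..<Suc k} (N(k := cyc w m)) U" by (rule direct_sum_cons[OF comp N(1)])
  then show ?thesis
    unfolding indecomposable_decomposition_def
    using N(2) block_indecomposable[OF bg sub(2)] by (simp add: less_Suc_eq)
qed

lemma complement_decomposition:
  assumes U: "stable U" "U \<subseteq> M"
  shows "\<exists>k N. indecomposable_decomposition scale G act U k N"
proof -
  have fin: "U \<subseteq> span B" using U MB by blast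
  have nil: "\<forall>x\<in>U. (\<Delta> ^^ (p ^ 2)) x = 0" using nilpotent U by blast
  show ?thesis
    using U(1) finB fin nil
  proof (induction rule: nilpotent_summand_induct)
    case zero
    have "direct_sum {..<0::nat} (\<lambda>_. {0 :: 'v}) {0}"
      by (rule direct_sumI) auto
    then show ?case unfolding indecomposable_decomposition_def by (metis less_nat_zero_code)
  next
    case (step U' w m C)
    then obtain k N where N: "indecomposable_decomposition scale G act C k N" by blast
    show ?case
      using decomposition_cons[OF step.hyps(4,6) _ N] step.hyps(1) U(2) by blast
  qed
qed

lemma decompositionD:
  assumes "indecomposable_decomposition scale G act M k N"
  obtains w m where "\<And>i. i < k \<Longrightarrow> block_gen (w i) (m i)" "\<And>i. i < k \<Longrightarrow> N i = cyc (w i) (m i)"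
    "\<And>i. i < k \<Longrightarrow> N i \<subseteq> M" "\<And>i. i < k \<Longrightarrow> stable (N i)"
    "\<And>i. i < k \<Longrightarrow> properly_induced scale G act (N i) \<longleftrightarrow> p dvd m i" "direct_sum {..<k} N M"
proof -
  have ds: "direct_sum {..<k} N M" and ind: "\<And>i. i < k \<Longrightarrow> indecomposable scale G act (N i)"
    using assms by (auto simp: indecomposable_decomposition_def)
  have "subspace (N i)" if "i \<in> {..<k}" for i
    using ind[of i] that indecomposable_subspace(2) by simp
  then have sub: "N i \<subseteq> M" if "i < k" for i
    using direct_sum_summand_subset[OF ds] that by blast
  have "\<forall>i. \<exists>w m. i < k \<longrightarrow> block_gen w m \<and> N i = cyc w m"
    using indecomposable_imp_block[OF ind sub] by blast
  then obtain w m where wm: "\<And>i. i < k \<Longrightarrow> block_gen (w i) (m i) \<and> N i = cyc (w i) (m i)" by metis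
  moreover have "stable (N i)" if "i < k" for i
    using wm[OF that] cyc_stable by (simp add: block_gen_def)
  moreover have "properly_induced scale G act (N i) \<longleftrightarrow> p dvd m i" if "i < k" for i
    using wm[OF that] block_properly_induced_iff[of "w i" "m i"] sub[OF that] by simp
  ultimately show thesis using that[of w m] sub ds by blast
qed

text \<open>The projection onto the summand carries the condition on the layer \<open>m div p\<close> from \<open>M\<close> to the block,
  where it would force \<open>p\<close> to divide \<open>m\<close>.\<close>

lemma noninduced_block_layer:
  fixes k :: nat
  assumes dec: "direct_sum {..<k} N M" "\<And>i. i < k \<Longrightarrow> stable (N i)" and i: "i < k"
    and w: "block_gen w m" "N i = cyc w m" "\<not> p dvd m" and layer_induced: "\<And>j. j \<noteq> c \<Longrightarrow> layer_induced p j M"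
  shows "m = p * c + m mod p"
proof -
  have "m div p = c"
  proof (rule ccontr)
    assume "m div p \<noteq> c"
    then have sM: "layer_induced p (m div p) M" by (rule layer_induced)
    obtain \<pi> where pi: "\<And>x. x \<in> M \<Longrightarrow> \<pi> x \<in> N i" "\<And>x y. x \<in> M \<Longrightarrow> y \<in> M \<Longrightarrow> \<pi> (x + y) = \<pi> x + \<pi> y"
        "\<And>x c. x \<in> M \<Longrightarrow> \<pi> (c *s x) = c *s \<pi> x"
        "\<And>x n. x \<in> M \<Longrightarrow> \<pi> ((\<Delta> ^^ n) x) = (\<Delta> ^^ n) (\<pi> x)"
        "\<And>x. x \<in> N i \<Longrightarrow> \<pi> x = x" "\<And>x j. j < k \<Longrightarrow> j \<noteq> i \<Longrightarrow> x \<in> N j \<Longrightarrow> \<pi> x = 0"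
      by (rule direct_sum_projection[OF dec(1) _ i], erule dec(2), rule that)
    have NM: "N i \<subseteq> M"
      using direct_sum_summand_subset[OF dec(1), of i] dec(2) i stableD(1) by blast
    have "layer_induced p (m div p) (N i)"
      unfolding layer_induced_def
    proof (intro ballI impI)
      fix x assume x: "x \<in> N i" "(\<Delta> ^^ (p * (m div p) + (p - 1))) x = 0"
      then obtain y where y: "y \<in> M" "(\<Delta> ^^ (p * (m div p))) x = (\<Delta> ^^ (p * (m div p) + 1)) y"
        using layer_inducedD[OF sM _ x(2)] NM by blast
      have "(\<Delta> ^^ (p * (m div p))) x = \<pi> ((\<Delta> ^^ (p * (m div p))) x)"
        using pi(5) stable_pow[OF dec(2)[OF i] x(1)] by simp
      also have "\<dots> = (\<Delta> ^^ (p * (m div p) + 1)) (\<pi> y)" unfolding y(2) by (rule pi(4)[OF y(1)])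
      finally show "(\<Delta> ^^ (p * (m div p))) x \<in> (\<Delta> ^^ (p * (m div p) + 1)) ` N i"
        by (rule image_eqI) (rule pi(1)[OF y(1)])
    qed
    then have "p dvd m" using layer_induced_block[OF w(1), of p] w(2) p_gt by simp
    then show False using w(3) by simp
  qed
  then show ?thesis using mult_div_mod_eq[of p m] by simp
qed

text \<open>By hypothesis the generator \<open>w\<close> of any non-induced summand has \<open>\<Delta>\<^bsup>pc\<^esup> w\<close> in the span of \<open>u\<close> and the image
  of \<open>\<Delta>\<^bsup>pc+1\<^esup>\<close>. Two such summands would give a nontrivial combination of these vectors in that image.
  Projected to one of the two summands, this contradicts that the block has size \<open>pc + r\<close>, \<open>r > 0\<close>.\<close>

lemma at_most_one_noninduced:
  assumes dec: "indecomposable_decomposition scale G act M k N"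
    and layer_induced: "\<And>j. j \<noteq> c \<Longrightarrow> layer_induced p j M"
    and defect: "\<And>x. x \<in> M \<Longrightarrow> (\<Delta> ^^ (p * c + (p - 1))) x = 0 \<Longrightarrow>
      \<exists>y\<in>M. \<exists>\<alpha>. (\<Delta> ^^ (p * c)) x = (\<Delta> ^^ (p * c + 1)) y + \<alpha> *s u"
    and i: "i < k" "\<not> properly_induced scale G act (N i)" and j: "j < k" "\<not> properly_induced scale G act (N j)"
  shows "i = j"
proof (rule ccontr)
  assume ij: "i \<noteq> j"
  obtain w m where wm: "\<And>i. i < k \<Longrightarrow> block_gen (w i) (m i)" "\<And>i. i < k \<Longrightarrow> N i = cyc (w i) (m i)"
    and sub: "\<And>i. i < k \<Longrightarrow> N i \<subseteq> M" and st: "\<And>i. i < k \<Longrightarrow> stable (N i)"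
    and pi: "\<And>i. i < k \<Longrightarrow> properly_induced scale G act (N i) \<longleftrightarrow> p dvd m i" and ds: "direct_sum {..<k} N M"
    by (rule decompositionD[OF dec]) (rule that)
  have gen: "\<exists>y\<in>M. \<exists>\<alpha>. (\<Delta> ^^ (p * c)) (w l) = (\<Delta> ^^ (p * c + 1)) y + \<alpha> *s u"
    and ni: "(\<Delta> ^^ (p * c)) (w l) \<notin> (\<Delta> ^^ (p * c + 1)) ` N l"
    and wN: "w l \<in> N l"
    if l: "l < k" "\<not> properly_induced scale G act (N l)" for l
  proof -
    define r where "r = m l mod p"
    have m: "m l = p * c + r"
      using noninduced_block_layer[OF ds st l(1) wm(1,2)[OF l(1)] _ layer_induced] pi l r_def by blast
    have r: "0 < r" "r < p" using pi l p_gt by (auto simp: r_def mod_greater_zero_iff_not_dvd)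
    show wN: "w l \<in> N l" using gen_in_cyc[of 0 "m l" "w l"] wm[OF l(1)] by (simp add: block_gen_def)
    have "(\<Delta> ^^ m l) (w l) = 0" using wm(1)[OF l(1)] by (simp add: block_gen_def)
    then have "(\<Delta> ^^ (p * c + (p - 1))) (w l) = 0" by (rule pow_eq_0_mono) (use m r in simp)
    then show "\<exists>y\<in>M. \<exists>\<alpha>. (\<Delta> ^^ (p * c)) (w l) = (\<Delta> ^^ (p * c + 1)) y + \<alpha> *s u"
      using defect wN sub l by blast
    show "(\<Delta> ^^ (p * c)) (w l) \<notin> (\<Delta> ^^ (p * c + 1)) ` N l"
      using block_not_in_image[of "w l" "p * c" r] wm[OF l(1)] m r by simp
  qed
  obtain y \<alpha> where y: "y \<in> M" "(\<Delta> ^^ (p * c)) (w i) = (\<Delta> ^^ (p * c + 1)) y + \<alpha> *s u" using gen[OF i] by blast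
  obtain z \<beta> where z: "z \<in> M" "(\<Delta> ^^ (p * c)) (w j) = (\<Delta> ^^ (p * c + 1)) z + \<beta> *s u" using gen[OF j] by blast
  note sM = stableD[OF stable_M]
  \<comment> \<open>Projection to the summand \<open>a\<close>: the coefficient of its generator in such a combination vanishes.\<close>
  have key: "\<gamma> = 0"
    if a: "a < k" "\<not> properly_induced scale G act (N a)" and b: "b < k" "b \<noteq> a" "x' \<in> N b"
      and v: "v \<in> M" and eq: "\<gamma> *s (\<Delta> ^^ (p * c)) (w a) + (\<Delta> ^^ (p * c)) x' = (\<Delta> ^^ (p * c + 1)) v" for a b \<gamma> x' v
  proof (rule ccontr)
    assume "\<gamma> \<noteq> 0"
    obtain \<pi> where P: "\<And>x. x \<in> M \<Longrightarrow> \<pi> x \<in> N a" "\<And>x y. x \<in> M \<Longrightarrow> y \<in> M \<Longrightarrow> \<pi> (x + y) = \<pi> x + \<pi> y"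
        "\<And>x c. x \<in> M \<Longrightarrow> \<pi> (c *s x) = c *s \<pi> x"
        "\<And>x n. x \<in> M \<Longrightarrow> \<pi> ((\<Delta> ^^ n) x) = (\<Delta> ^^ n) (\<pi> x)"
        "\<And>x. x \<in> N a \<Longrightarrow> \<pi> x = x" "\<And>x j. j < k \<Longrightarrow> j \<noteq> a \<Longrightarrow> x \<in> N j \<Longrightarrow> \<pi> x = 0"
      by (rule direct_sum_projection[OF ds _ a(1)], erule st, rule that)
    have mem: "(\<Delta> ^^ (p * c)) (w a) \<in> N a" "(\<Delta> ^^ (p * c)) x' \<in> N b"
      using stable_pow[OF st[OF a(1)] wN[OF a]] stable_pow[OF st[OF b(1)] b(3)] by auto
    have memM: "(\<Delta> ^^ (p * c)) (w a) \<in> M" "(\<Delta> ^^ (p * c)) x' \<in> M"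
      using mem sub[OF a(1)] sub[OF b(1)] by auto
    have "\<pi> (\<gamma> *s (\<Delta> ^^ (p * c)) (w a) + (\<Delta> ^^ (p * c)) x') = \<gamma> *s (\<Delta> ^^ (p * c)) (w a)"
      using P(2)[OF sM(5)[OF memM(1)] memM(2)] P(3)[OF memM(1)] P(5)[OF mem(1)] P(6)[OF b(1,2) mem(2)] by simp
    then have "\<gamma> *s (\<Delta> ^^ (p * c)) (w a) = (\<Delta> ^^ (p * c + 1)) (\<pi> v)"
      unfolding eq using P(4)[OF v] by metis
    then have "inverse \<gamma> *s \<gamma> *s (\<Delta> ^^ (p * c)) (w a) = inverse \<gamma> *s (\<Delta> ^^ (p * c + 1)) (\<pi> v)"
      by (simp only:)
    then have "(\<Delta> ^^ (p * c)) (w a) = inverse \<gamma> *s (\<Delta> ^^ (p * c + 1)) (\<pi> v)"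
      using \<open>\<gamma> \<noteq> 0\<close> by (simp only: scale_scale left_inverse scale_one not_False_eq_True)
    then have "(\<Delta> ^^ (p * c)) (w a) = (\<Delta> ^^ (p * c + 1)) (inverse \<gamma> *s \<pi> v)"
      by (simp only: pow_scale)
    moreover have "inverse \<gamma> *s \<pi> v \<in> N a" using P(1)[OF v] stableD(5)[OF st[OF a(1)]] by blast
    ultimately have "(\<Delta> ^^ (p * c)) (w a) \<in> (\<Delta> ^^ (p * c + 1)) ` N a" by (rule image_eqI)
    then show False using ni[OF a] by blast
  qed
  have "\<beta> *s (\<Delta> ^^ (p * c)) (w i) + (\<Delta> ^^ (p * c)) ((- \<alpha>) *s w j) = (\<Delta> ^^ (p * c + 1)) (\<beta> *s y - \<alpha> *s z)"
    unfolding pow_scale pow_diff y(2) z(2) by (simp add: algebra_simps)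
  then have "\<beta> = 0"
    by (rule key[OF i j(1) ij[symmetric] stableD(5)[OF st[OF j(1)] wN[OF j]] sM(4)[OF sM(5)[OF y(1)] sM(5)[OF z(1)]]])
  have "1 *s (\<Delta> ^^ (p * c)) (w j) + (\<Delta> ^^ (p * c)) 0 = (\<Delta> ^^ (p * c + 1)) z"
    unfolding z(2) \<open>\<beta> = 0\<close> by simp
  then have "(1::'f) = 0"
    by (rule key[OF j i(1) ij stableD(2)[OF st[OF i(1)]] z(1)])
  then show False by simp
qed

text \<open>If no summand had dimension \<open>m\<close>, each component of \<open>w\<close> would have its image under
  \<open>\<Delta>\<^bsup>m-1\<^esup>\<close> in the image of \<open>\<Delta>\<^sup>m\<close>.\<close>

lemma summand_of_pure_size:
  assumes dec: "indecomposable_decomposition scale G act M k N"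
    and w: "w \<in> M" "0 < m" "(\<Delta> ^^ m) w = 0" "(\<Delta> ^^ (m - 1)) w \<notin> (\<Delta> ^^ m) ` M"
  shows "\<exists>i<k. \<exists>v. block_gen v m \<and> N i = cyc v m"
proof (rule ccontr)
  assume no: "\<not> (\<exists>i<k. \<exists>v. block_gen v m \<and> N i = cyc v m)"
  obtain v n where vn: "\<And>i. i < k \<Longrightarrow> block_gen (v i) (n i)" "\<And>i. i < k \<Longrightarrow> N i = cyc (v i) (n i)"
    and sub: "\<And>i. i < k \<Longrightarrow> N i \<subseteq> M" and st: "\<And>i. i < k \<Longrightarrow> stable (N i)"
    and pi: "\<And>i. i < k \<Longrightarrow> properly_induced scale G act (N i) \<longleftrightarrow> p dvd n i" and ds: "direct_sum {..<k} N M"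
    by (rule decompositionD[OF dec]) (rule that)
  have sN: "\<And>i. i \<in> {..<k} \<Longrightarrow> subspace (N i)" using st stableD(1) by blast
  obtain f where f: "\<And>i. i \<in> {..<k} \<Longrightarrow> f i \<in> N i" "w = (\<Sum>i<k. f i)"
    using direct_sum_obtain[OF ds w(1)] by metis
  have f0: "(\<Delta> ^^ m) (f i) = 0" if "i < k" for i
  proof (rule direct_sum_zero[OF ds sN])
    show "(\<Sum>i<k. (\<Delta> ^^ m) (f i)) = 0" using w(3) f(2) by (simp add: pow_sum)
  qed (use f st that in \<open>auto intro: stable_pow\<close>)
  have "\<exists>y\<in>N i. (\<Delta> ^^ (m - 1)) (f i) = (\<Delta> ^^ m) y" if i: "i < k" for i
  proof (cases "n i < m")
    case True
    have "(\<Delta> ^^ n i) (v i) = 0" using vn(1)[OF i] by (simp add: block_gen_def)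
    moreover obtain a where "f i = (\<Sum>l<n i. a l *s (\<Delta> ^^ l) (v i))" using f(1)[of i] i vn(2) cyc_iff by auto
    ultimately have "(\<Delta> ^^ (m - 1)) (f i) = 0"
      using True by (auto simp: pow_sum pow_scale pow_pow intro!: sum.neutral pow_eq_0_mono[of "n i"])
    then show ?thesis using stableD(2)[OF st[OF i]] by (intro bexI[of _ 0]) auto
  next
    case False
    have "n i \<noteq> m" using no vn i by blast
    then have nm: "m < n i" using False by simp
    obtain a where a: "f i = (\<Sum>l<n i. a l *s (\<Delta> ^^ l) (v i))" using f(1)[of i] i vn(2) cyc_iff by auto
    have n0: "(\<Delta> ^^ n i) (v i) = 0" using vn(1)[OF i] by (simp add: block_gen_def)
    have "(\<Delta> ^^ (n i - 1 - 0)) (f i) = a 0 *s (\<Delta> ^^ (n i - 1)) (v i)"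
      unfolding a using n0 nm by (intro coeff_extract) auto
    moreover have "(\<Delta> ^^ (n i - 1)) (f i) = 0" by (rule pow_eq_0_mono[OF f0[OF i]]) (use nm in simp)
    ultimately have a0: "a 0 = 0" using vn(1)[OF i] by (simp add: block_gen_def)
    obtain n' where n': "n i = Suc n'" using nm by (cases "n i") auto
    define y where "y = (\<Sum>l<n'. a (Suc l) *s (\<Delta> ^^ l) (v i))"
    have "f i = (\<Delta> ^^ 1) y"
      unfolding a n' sum.lessThan_Suc_shift y_def pow_sum pow_scale pow_pow by (simp add: a0)
    then have "(\<Delta> ^^ (m - 1)) (f i) = (\<Delta> ^^ (m - 1 + 1)) y" by (simp only: pow_pow)
    then have "(\<Delta> ^^ (m - 1)) (f i) = (\<Delta> ^^ m) y" using w(2) by simp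
    moreover have "y \<in> N i"
      unfolding y_def using sN[of i] i n' vn(2)[OF i] by (auto intro!: subspace_sum subspace_scale gen_in_cyc)
    ultimately show ?thesis by blast
  qed
  then obtain y where y: "\<And>i. i < k \<Longrightarrow> y i \<in> N i \<and> (\<Delta> ^^ (m - 1)) (f i) = (\<Delta> ^^ m) (y i)" by metis
  have "(\<Delta> ^^ (m - 1)) w = (\<Delta> ^^ m) (\<Sum>i<k. y i)"
    unfolding f(2) using y by (simp add: pow_sum)
  moreover have "(\<Sum>i<k. y i) \<in> M" by (rule direct_sum_mem[OF ds]) (use y in auto)
  ultimately show False using w(4) by blast
qed

lemma pure_block_decomposition:
  assumes w: "w \<in> M" "0 < m" "(\<Delta> ^^ m) w = 0" "(\<Delta> ^^ (m - 1)) w \<notin> (\<Delta> ^^ m) ` M"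
  shows "\<exists>k N i. indecomposable_decomposition scale G act M k N \<and> i < k \<and> N i = cyc w m \<and> block_gen w m"
proof -
  obtain C where C: "complement M (cyc w m) C" using block_summand[OF stable_M w] by blast
  have "(\<Delta> ^^ m) 0 \<in> (\<Delta> ^^ m) ` M" by (rule imageI) (rule stableD(2)[OF stable_M])
  then have "(\<Delta> ^^ (m - 1)) w \<noteq> 0" using w(4) by auto
  then have bg: "block_gen w m" using w(2,3) by (simp add: block_gen_def)
  have "stable C" "C \<subseteq> M" using C complement_subset by (auto simp: complement_def)
  then obtain k N where N: "indecomposable_decomposition scale G act C k N"
    using complement_decomposition by blast
  have "indecomposable_decomposition scale G act M (Suc k) (N(k := cyc w m))"
    by (rule decomposition_cons[OF bg C _ N]) simp
  then show ?thesis using bg by (intro exI[of _ "Suc k"] exI[of _ "N(k := cyc w m)"] exI[of _ k]) simp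
qed

end

section \<open>Polynomials, substitution and homogeneous components\<close>

lemma poly_mapping_expand: "f = (\<Sum>k\<in>Poly_Mapping.keys f. Poly_Mapping.single k (Poly_Mapping.lookup f k))"
proof (rule poly_mapping_eqI)
  fix k
  have "Poly_Mapping.lookup (\<Sum>k\<in>Poly_Mapping.keys f. Poly_Mapping.single k (Poly_Mapping.lookup f k)) k
      = (\<Sum>l\<in>Poly_Mapping.keys f. if l = k then Poly_Mapping.lookup f l else 0)"
    unfolding lookup_sum by (rule sum.cong) (auto simp: lookup_single when_def)
  also have "\<dots> = Poly_Mapping.lookup f k" by (simp add: in_keys_iff)
  finally show "Poly_Mapping.lookup f k
      = Poly_Mapping.lookup (\<Sum>k\<in>Poly_Mapping.keys f. Poly_Mapping.single k (Poly_Mapping.lookup f k)) k" ..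
qed

lemma fscale_eq_mult: "fscale c f = Poly_Mapping.single 0 c * (f :: ('k::comm_monoid_add) \<Rightarrow>\<^sub>0 'f::field)"
  unfolding fscale_def by (rule mult_map_scale_conv_mult)

lemma fscale_single: "fscale c (Poly_Mapping.single k a) = Poly_Mapping.single k (c * a)"
  by (rule poly_mapping_eqI) (simp add: lookup_single when_def)

abbreviation const :: "'f::field \<Rightarrow> 'f mpoly"
  where "const \<equiv> Poly_Mapping.single 0"

lemma CHAR_mpoly: "CHAR('f::field mpoly) = CHAR('f)"
proof (rule CHAR_eqI)
  have *: "(of_nat n :: 'f mpoly) = const (of_nat n)" for n
    by (rule poly_mapping_eqI) (simp add: lookup_of_nat lookup_single when_def)
  show "(of_nat CHAR('f) :: 'f mpoly) = 0" unfolding * by simp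
  show "CHAR('f) dvd n" if "(of_nat n :: 'f mpoly) = 0" for n
  proof -
    have "Poly_Mapping.lookup (const (of_nat n :: 'f)) 0 = 0" using that unfolding * by simp
    then have "(of_nat n :: 'f) = 0" by (simp only: lookup_single_eq)
    then show ?thesis by (simp add: of_nat_eq_0_iff_char_dvd)
  qed
qed

definition eval_monomial :: "(nat \<Rightarrow> 'a::comm_ring_1) \<Rightarrow> (nat \<Rightarrow>\<^sub>0 nat) \<Rightarrow> 'a"
  where "eval_monomial h m = (\<Prod>i\<in>Poly_Mapping.keys m. h i ^ Poly_Mapping.lookup m i)"

lemma eval_monomial_superset:
  assumes "finite A" "Poly_Mapping.keys m \<subseteq> A"
  shows "eval_monomial h m = (\<Prod>i\<in>A. h i ^ Poly_Mapping.lookup m i)"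
  unfolding eval_monomial_def
  by (rule prod.mono_neutral_left) (use assms in \<open>auto simp: in_keys_iff\<close>)

lemma eval_monomial_0 [simp]: "eval_monomial h 0 = 1"
  by (simp add: eval_monomial_def)

lemma eval_monomial_add: "eval_monomial h (m + n) = eval_monomial h m * eval_monomial h n"
proof -
  let ?A = "Poly_Mapping.keys m \<union> Poly_Mapping.keys n"
  have "Poly_Mapping.keys (m + n) \<subseteq> ?A" by (rule keys_add)
  then show ?thesis
    by (simp add: eval_monomial_superset[of ?A] lookup_add power_add prod.distrib)
qed

lemma eval_monomial_single [simp]: "eval_monomial h (Poly_Mapping.single i k) = h i ^ k"
  by (simp add: eval_monomial_superset[of "{i}"])

lemma poly_subst_superset:
  assumes "finite A" "Poly_Mapping.keys f \<subseteq> A"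
  shows "poly_subst h f = (\<Sum>m\<in>A. fscale (Poly_Mapping.lookup f m) (eval_monomial h m))"
  unfolding poly_subst_def eval_monomial_def
  by (rule sum.mono_neutral_left) (use assms in \<open>auto simp: in_keys_iff\<close>)

lemma poly_subst_add: "poly_subst h (f + g) = poly_subst h f + poly_subst h g"
proof -
  let ?A = "Poly_Mapping.keys f \<union> Poly_Mapping.keys g"
  have "Poly_Mapping.keys (f + g) \<subseteq> ?A" by (rule keys_add)
  then show ?thesis
    by (simp add: poly_subst_superset[of ?A] lookup_add fs.scale_left_distrib sum.distrib)
qed

lemma poly_subst_single: "poly_subst h (Poly_Mapping.single m c) = fscale c (eval_monomial h m)"
  by (simp add: poly_subst_superset[of "{m}"])

lemma poly_subst_0 [simp]: "poly_subst h 0 = 0"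
  by (simp add: poly_subst_def)

lemma poly_subst_sum: "poly_subst h (\<Sum>i\<in>I. f i) = (\<Sum>i\<in>I. poly_subst h (f i))"
  by (induction I rule: infinite_finite_induct) (auto simp: poly_subst_add)

lemma mpoly_induct [case_names add single]:
  assumes "\<And>f g. P f \<Longrightarrow> P g \<Longrightarrow> P (f + g)" "\<And>m c. P (Poly_Mapping.single m c)"
  shows "P (f :: 'a \<Rightarrow>\<^sub>0 'b::comm_monoid_add)"
proof -
  have "P (\<Sum>k\<in>A. Poly_Mapping.single k (g k))" if "finite A" for A g
    using that assms(2)[of _ 0] by (induction A rule: finite_induct) (auto intro: assms)
  from this[of "Poly_Mapping.keys f" "Poly_Mapping.lookup f"] show ?thesis
    by (simp add: poly_mapping_expand[symmetric])
qed

lemma poly_subst_mult: "poly_subst h (f * g) = poly_subst h f * poly_subst h g"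
proof (induction f rule: mpoly_induct)
  case (single m c)
  show ?case
    by (induction g rule: mpoly_induct)
      (auto simp: algebra_simps poly_subst_add mult_single poly_subst_single eval_monomial_add fscale_eq_mult)
qed (auto simp: algebra_simps poly_subst_add)

lemma poly_subst_const [simp]: "poly_subst h (const c) = const c"
  by (simp add: poly_subst_single fscale_eq_mult)

lemma poly_subst_1 [simp]: "poly_subst h 1 = 1"
  using poly_subst_const[of h 1] by simp

lemma poly_subst_fscale: "poly_subst h (fscale c f) = fscale c (poly_subst h f)"
  by (simp add: fscale_eq_mult poly_subst_mult)

lemma poly_subst_diff: "poly_subst h (f - g) = poly_subst h f - poly_subst h g"
  using poly_subst_add[of h "f - g" g] by simp

lemma poly_subst_power: "poly_subst h (f ^ n) = poly_subst h f ^ n"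
  by (induction n) (auto simp: poly_subst_mult)

lemma poly_subst_prod: "poly_subst h (\<Prod>i\<in>I. f i) = (\<Prod>i\<in>I. poly_subst h (f i))"
  by (induction I rule: infinite_finite_induct) (auto simp: poly_subst_mult)

lemma poly_subst_Var [simp]: "poly_subst h (Var i) = h i"
  by (simp add: Var_def poly_subst_single)

lemma poly_subst_eval_monomial: "poly_subst h (eval_monomial k m) = eval_monomial (\<lambda>i. poly_subst h (k i)) m"
  by (simp add: eval_monomial_def poly_subst_prod poly_subst_power)

lemma poly_subst_poly_subst: "poly_subst h (poly_subst k f) = poly_subst (\<lambda>i. poly_subst h (k i)) f"
  by (induction f rule: mpoly_induct)
    (auto simp: poly_subst_add poly_subst_single poly_subst_fscale poly_subst_eval_monomial)

lemma eval_monomial_Var: "eval_monomial Var m = (Poly_Mapping.single m 1 :: 'f::field mpoly)"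
proof (induction m rule: mpoly_induct)
  case (single i k)
  have "Var i ^ k = (Poly_Mapping.single (Poly_Mapping.single i k) 1 :: 'f mpoly)"
    by (induction k) (auto simp: Var_def mult_single single_add[symmetric])
  then show ?case by simp
qed (simp add: eval_monomial_add mult_single)

lemma poly_subst_Var_id: "poly_subst Var f = f"
  by (induction f rule: mpoly_induct) (auto simp: poly_subst_add poly_subst_single eval_monomial_Var fscale_single)

lemma poly_subst_cong:
  assumes "\<And>m i. m \<in> Poly_Mapping.keys f \<Longrightarrow> i \<in> Poly_Mapping.keys m \<Longrightarrow> h i = h' i"
  shows "poly_subst h f = poly_subst h' f"
  unfolding poly_subst_def using assms by (intro sum.cong refl arg_cong2[where f = fscale] prod.cong) auto

definition total_degree :: "nat \<Rightarrow> (nat \<Rightarrow>\<^sub>0 nat) \<Rightarrow> nat"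
  where "total_degree n m = (\<Sum>i<n. Poly_Mapping.lookup m i)"

definition monomials :: "nat \<Rightarrow> nat \<Rightarrow> (nat \<Rightarrow>\<^sub>0 nat) set"
  where "monomials n d = {m. Poly_Mapping.keys m \<subseteq> {..<n} \<and> total_degree n m = d}"

lemma sym_component_iff: "f \<in> sym_component n d \<longleftrightarrow> Poly_Mapping.keys f \<subseteq> monomials n d"
  by (auto simp: sym_component_def monomials_def total_degree_def)

lemma monomials_add: "m \<in> monomials n d \<Longrightarrow> m' \<in> monomials n e \<Longrightarrow> m + m' \<in> monomials n (d + e)"
  using keys_add[of m m'] by (auto simp: monomials_def total_degree_def lookup_add sum.distrib)

lemma sym_component_0 [simp]: "0 \<in> sym_component n d"
  by (simp add: sym_component_iff)

lemma sym_component_add: "f \<in> sym_component n d \<Longrightarrow> g \<in> sym_component n d \<Longrightarrow> f + g \<in> sym_component n d"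
  using keys_add[of f g] by (auto simp: sym_component_iff)

lemma sym_component_uminus: "(f :: 'f::field mpoly) \<in> sym_component n d \<Longrightarrow> - f \<in> sym_component n d"
  by (auto simp: sym_component_iff in_keys_iff)

lemma sym_component_diff:
  "(f :: 'f::field mpoly) \<in> sym_component n d \<Longrightarrow> g \<in> sym_component n d \<Longrightarrow> f - g \<in> sym_component n d"
  using sym_component_add[of f n d "- g"] sym_component_uminus by auto

lemma sym_component_sum: "(\<And>i. i \<in> I \<Longrightarrow> f i \<in> sym_component n d) \<Longrightarrow> (\<Sum>i\<in>I. f i) \<in> sym_component n d"
  by (induction I rule: infinite_finite_induct) (auto intro: sym_component_add)

lemma sym_component_fscale: "f \<in> sym_component n d \<Longrightarrow> fscale c f \<in> sym_component n d"
  by (auto simp: sym_component_iff in_keys_iff)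

lemma sym_component_single: "m \<in> monomials n d \<Longrightarrow> Poly_Mapping.single m c \<in> sym_component n d"
  by (auto simp: sym_component_iff)

lemma sym_component_mult:
  assumes "f \<in> sym_component n d" "g \<in> sym_component n e" shows "f * g \<in> sym_component n (d + e)"
  using keys_mult[of f g] assms monomials_add unfolding sym_component_iff by blast

lemma sym_component_1 [simp]: "1 \<in> sym_component n 0"
  by (auto simp: sym_component_iff monomials_def total_degree_def)

lemma sym_component_power: "f \<in> sym_component n d \<Longrightarrow> f ^ k \<in> sym_component n (k * d)"
  by (induction k) (auto intro: sym_component_mult)

lemma sym_component_prod:
  "(\<And>i. i \<in> I \<Longrightarrow> f i \<in> sym_component n (d i)) \<Longrightarrow> (\<Prod>i\<in>I. f i) \<in> sym_component n (\<Sum>i\<in>I. d i)"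
  by (induction I rule: infinite_finite_induct) (auto intro: sym_component_mult)

lemma sym_component_Var: "i < n \<Longrightarrow> Var i \<in> sym_component n 1"
  by (auto simp: Var_def sym_component_iff monomials_def total_degree_def lookup_single when_def)

lemma eval_monomial_in_component:
  assumes m: "m \<in> monomials n d" and h: "\<And>i. i < n \<Longrightarrow> h i \<in> sym_component k 1"
  shows "eval_monomial h m \<in> sym_component k d"
proof -
  have "eval_monomial h m = (\<Prod>i<n. h i ^ Poly_Mapping.lookup m i)"
    using m by (intro eval_monomial_superset) (auto simp: monomials_def)
  also have "\<dots> \<in> sym_component k (\<Sum>i<n. Poly_Mapping.lookup m i * 1)"
    using h by (intro sym_component_prod sym_component_power) auto
  finally show ?thesis using m by (simp add: monomials_def total_degree_def)
qed

lemma poly_subst_in_component: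
  assumes f: "f \<in> sym_component n d" and h: "\<And>i. i < n \<Longrightarrow> h i \<in> sym_component k 1"
  shows "poly_subst h f \<in> sym_component k d"
proof -
  have "poly_subst h f = (\<Sum>m\<in>Poly_Mapping.keys f. fscale (Poly_Mapping.lookup f m) (eval_monomial h m))"
    by (simp add: poly_subst_superset)
  also have "\<dots> \<in> sym_component k d"
    using f eval_monomial_in_component[OF _ h] unfolding sym_component_iff[of f]
    by (intro sym_component_sum sym_component_fscale) auto
  finally show ?thesis .
qed

lemma finite_monomials: "finite (monomials n d)"
proof -
  have "inj_on (\<lambda>m. \<lambda>i\<in>{..<n}. Poly_Mapping.lookup m i) (monomials n d)"
  proof (rule inj_onI)
    fix m m' assume m: "m \<in> monomials n d" "m' \<in> monomials n d"
      "(\<lambda>i\<in>{..<n}. Poly_Mapping.lookup m i) = (\<lambda>i\<in>{..<n}. Poly_Mapping.lookup m' i)"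
    show "m = m'"
    proof (rule poly_mapping_eqI)
      fix k
      show "Poly_Mapping.lookup m k = Poly_Mapping.lookup m' k"
      proof (cases "k < n")
        case True
        then show ?thesis using fun_cong[OF m(3), of k] by simp
      next
        case False
        then have "k \<notin> Poly_Mapping.keys m" "k \<notin> Poly_Mapping.keys m'" using m(1,2) by (auto simp: monomials_def)
        then show ?thesis by (simp add: in_keys_iff)
      qed
    qed
  qed
  moreover have "(\<lambda>m. \<lambda>i\<in>{..<n}. Poly_Mapping.lookup m i) ` monomials n d \<subseteq> Pi\<^sub>E {..<n} (\<lambda>_. {..d})"
  proof (clarsimp simp: PiE_iff)
    fix m i assume m: "m \<in> monomials n d" "i < n"
    then have "Poly_Mapping.lookup m i \<le> (\<Sum>i<n. Poly_Mapping.lookup m i)"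
      by (intro member_le_sum) auto
    then show "Poly_Mapping.lookup m i \<le> d" using m by (simp add: monomials_def total_degree_def)
  qed
  ultimately show ?thesis by (meson finite_PiE finite_atMost finite_imageD finite_lessThan finite_subset)
qed

lemma sym_component_span:
  "sym_component n d = fs.span ((\<lambda>m. Poly_Mapping.single m (1::'f::field)) ` monomials n d)"
proof (intro equalityI subsetI)
  fix f :: "'f mpoly" assume f: "f \<in> sym_component n d"
  have "f = (\<Sum>k\<in>Poly_Mapping.keys f. fscale (Poly_Mapping.lookup f k) (Poly_Mapping.single k 1))"
    using poly_mapping_expand[of f] by (simp add: fscale_single)
  also have "\<dots> \<in> fs.span ((\<lambda>m. Poly_Mapping.single m 1) ` monomials n d)"
    using f by (intro fs.span_sum fs.span_scale fs.span_base) (auto simp: sym_component_iff)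
  finally show "f \<in> fs.span ((\<lambda>m. Poly_Mapping.single m 1) ` monomials n d)" .
next
  fix f :: "'f mpoly" assume f: "f \<in> fs.span ((\<lambda>m. Poly_Mapping.single m 1) ` monomials n d)"
  have "fs.subspace (sym_component n d :: 'f mpoly set)"
    by (auto simp: fs.subspace_def sym_component_add sym_component_fscale)
  moreover have "(\<lambda>m. Poly_Mapping.single m 1) ` monomials n d \<subseteq> (sym_component n d :: 'f mpoly set)"
    by (auto intro: sym_component_single)
  ultimately show "f \<in> sym_component n d" using f fs.span_minimal by blast
qed

section \<open>Free permutation modules of prime order\<close>

text \<open>Higman's criterion: choosing a transversal of the orbits, the projection \<open>\<pi>\<close> onto its span
  satisfies \<open>\<Sum>\<rho>\<^sup>i\<pi>\<rho>\<^sup>-\<^sup>i = 1\<close>, which turns a vector of trace zero into a difference \<open>\<rho> g - g\<close>.\<close>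

lemma free_permutation_trace_zero:
  fixes r :: "'k \<Rightarrow> 'k" and \<rho> :: "('k \<Rightarrow>\<^sub>0 'f::field) \<Rightarrow> ('k \<Rightarrow>\<^sub>0 'f)"
  assumes p: "prime p" and rp: "\<And>m. (r ^^ p) m = m"
    and \<rho>: "\<And>f m. Poly_Mapping.lookup (\<rho> f) (r m) = Poly_Mapping.lookup f m"
    and \<rho>_add: "\<And>f g. \<rho> (f + g) = \<rho> f + \<rho> g"
    and D: "\<And>m. m \<in> D \<Longrightarrow> r m \<in> D" "\<And>m. m \<in> D \<Longrightarrow> r m \<noteq> m"
    and f: "Poly_Mapping.keys f \<subseteq> D" "(\<Sum>i<p. (\<rho> ^^ i) f) = 0"
  shows "\<exists>g. Poly_Mapping.keys g \<subseteq> D \<and> f = \<rho> g - g"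
proof -
  have p0: "0 < p" using p prime_gt_0_nat by blast
  have r_mod: "(r ^^ (k mod p)) m = (r ^^ k) m" for k m
  proof -
    have "(r ^^ (p * q)) m = m" for q by (induction q) (auto simp: funpow_add rp)
    moreover have "(r ^^ k) m = (r ^^ (k mod p)) ((r ^^ (p * (k div p))) m)"
      by (metis comp_apply funpow_add mod_mult_div_eq)
    ultimately show ?thesis by simp
  qed
  have \<rho>k: "Poly_Mapping.lookup ((\<rho> ^^ k) f) ((r ^^ k) m) = Poly_Mapping.lookup f m" for k f m
    by (induction k) (auto simp: \<rho>)
  have \<rho>k': "Poly_Mapping.lookup ((\<rho> ^^ k) f) m = Poly_Mapping.lookup f ((r ^^ (p - k)) m)" if "k \<le> p" for k f m
  proof -
    have "(r ^^ k) ((r ^^ (p - k)) m) = m" using that rp by (metis comp_apply funpow_add le_add_diff_inverse)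
    then show ?thesis using \<rho>k[of k f "(r ^^ (p - k)) m"] by simp
  qed
  have Dk: "m \<in> D \<Longrightarrow> (r ^^ k) m \<in> D" for k m by (induction k) (auto simp: D)
  have D': "m \<in> D" if "(r ^^ k) m \<in> D" for k m
  proof -
    have "(r ^^ (p - k mod p)) ((r ^^ k) m) = (r ^^ (p - k mod p)) ((r ^^ (k mod p)) m)" by (simp add: r_mod)
    also have "\<dots> = (r ^^ (p - k mod p + k mod p)) m" by (simp add: funpow_add)
    also have "p - k mod p + k mod p = p" using p0 by (simp add: less_imp_le_nat)
    finally show ?thesis using Dk[OF that, of "p - k mod p"] rp by simp
  qed
  \<comment> \<open>The representatives \<open>L\<close> are the chosen points \<open>t m\<close>, one in each orbit.\<close>
  define t where "t m = (SOME x. \<exists>i. x = (r ^^ i) m)" for m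
  have t: "\<exists>i. t m = (r ^^ i) m" for m unfolding t_def by (rule someI_ex) blast
  have t_orbit: "t ((r ^^ i) m) = t m" for i m
  proof -
    have "(\<exists>j. x = (r ^^ j) ((r ^^ i) m)) \<longleftrightarrow> (\<exists>j. x = (r ^^ j) m)" for x
    proof
      assume "\<exists>j. x = (r ^^ j) ((r ^^ i) m)"
      then show "\<exists>j. x = (r ^^ j) m" by (metis comp_apply funpow_add)
    next
      assume "\<exists>j. x = (r ^^ j) m"
      then obtain j where j: "x = (r ^^ j) m" by blast
      have "(r ^^ (j + (p - i mod p))) ((r ^^ i) m) = (r ^^ (j + (p - i mod p))) ((r ^^ (i mod p)) m)" by (simp add: r_mod)
      also have "\<dots> = (r ^^ (j + (p - i mod p) + i mod p)) m" by (simp add: funpow_add)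
      also have "j + (p - i mod p) + i mod p = j + p" using mod_less_divisor[OF p0, of i] by linarith
      also have "(r ^^ (j + p)) m = x" using j by (simp add: funpow_add rp)
      finally show "\<exists>j. x = (r ^^ j) ((r ^^ i) m)" by metis
    qed
    then show ?thesis unfolding t_def by simp
  qed
  define L where "L m \<longleftrightarrow> t m = m" for m
  have unique: "\<exists>!i. i < p \<and> L ((r ^^ i) m)" if m: "m \<in> D" for m
  proof -
    obtain i where i: "t m = (r ^^ i) m" using t by blast
    have "L ((r ^^ (i mod p)) m)" unfolding L_def by (simp add: t_orbit r_mod i)
    moreover have "a = b" if ab: "a < p" "b < p" "L ((r ^^ a) m)" "L ((r ^^ b) m)" for a b
    proof (rule ccontr)
      assume "a \<noteq> b"
      have key: False if c: "a < b" "b < p" "(r ^^ a) m = (r ^^ b) m" for a b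
      proof -
        define x where "x = (r ^^ a) m"
        have fix1: "(r ^^ (b - a)) x = x"
          using c unfolding x_def by (metis comp_apply diff_add_inverse2 funpow_add less_imp_le_nat le_add_diff_inverse2)
        have "coprime (b - a) p"
          using c p by (metis coprime_commute diff_is_0_eq dvd_imp_le less_imp_diff_less not_le prime_imp_coprime zero_less_diff)
        then obtain u v where uv: "(b - a) * u = p * v + 1"
          using coprime_bezout_strong[of "b - a" p] p prime_gt_1_nat by (metis less_irrefl)
        have "(r ^^ ((b - a) * u)) x = x"
          by (induction u) (auto simp: funpow_add fix1)
        moreover have "(r ^^ (p * v + 1)) x = (r ^^ 1) x" by (metis r_mod mod_mult_self4 add.commute mod_mult_self2)
        ultimately have "r x = x" using uv by simp
        moreover have "x \<in> D" unfolding x_def using Dk m by simp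
        ultimately show False using D(2) by blast
      qed
      have "(r ^^ a) m = (r ^^ b) m" using ab(3,4) unfolding L_def t_orbit by simp
      then show False using key[of a b] key[of b a] \<open>a \<noteq> b\<close> ab by (metis nat_neq_iff)
    qed
    ultimately show ?thesis using p0 by (metis mod_less_divisor)
  qed
  define \<pi> where "\<pi> h = (\<Sum>m\<in>{m \<in> Poly_Mapping.keys h. L m}. Poly_Mapping.single m (Poly_Mapping.lookup h m))"
    for h :: "'k \<Rightarrow>\<^sub>0 'f"
  have \<pi>: "Poly_Mapping.lookup (\<pi> h) m = (if L m then Poly_Mapping.lookup h m else 0)" for h m
  proof -
    have "Poly_Mapping.lookup (\<pi> h) m = (\<Sum>l\<in>{m \<in> Poly_Mapping.keys h. L m}. if l = m then Poly_Mapping.lookup h l else 0)"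
      unfolding \<pi>_def lookup_sum by (rule sum.cong) (auto simp: lookup_single when_def)
    then show ?thesis by (auto simp: in_keys_iff)
  qed
  have \<rho>_0: "\<rho> 0 = 0" using \<rho>_add[of 0 0] by simp
  have \<rho>_sum: "\<rho> (\<Sum>i\<in>I. h i) = (\<Sum>i\<in>I. \<rho> (h i))" for h :: "nat \<Rightarrow> _" and I
    by (induction I rule: infinite_finite_induct) (auto simp: \<rho>_add \<rho>_0)
  have \<pi>_sum: "(\<Sum>i\<in>I. \<pi> (h i)) = \<pi> (\<Sum>i\<in>I. h i)" for h :: "nat \<Rightarrow> _" and I
    by (rule poly_mapping_eqI) (simp add: lookup_sum \<pi>)
  \<comment> \<open>The inner sum is the quotient of \<open>\<rho>\<^sup>i - 1\<close> by \<open>\<rho> - 1\<close>.\<close>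
  define g where "g = (\<Sum>i<p. \<Sum>j<i. (\<rho> ^^ j) (\<pi> ((\<rho> ^^ (p - i)) f)))"
  have "\<rho> g - g = (\<Sum>i<p. (\<rho> ^^ i) (\<pi> ((\<rho> ^^ (p - i)) f)) - \<pi> ((\<rho> ^^ (p - i)) f))"
  proof -
    have "\<rho> (\<Sum>j<i. (\<rho> ^^ j) h) - (\<Sum>j<i. (\<rho> ^^ j) h) = (\<rho> ^^ i) h - h" for i h
    proof -
      have "\<rho> (\<Sum>j<i. (\<rho> ^^ j) h) + h = (\<Sum>j<Suc i. (\<rho> ^^ j) h)"
        unfolding \<rho>_sum sum.lessThan_Suc_shift by (simp add: add.commute)
      then show ?thesis by (simp add: algebra_simps)
    qed
    then show ?thesis unfolding g_def \<rho>_sum[of _ "{..<p}"] sum_subtractf[symmetric] by simp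
  qed
  also have "\<dots> = (\<Sum>i<p. (\<rho> ^^ i) (\<pi> ((\<rho> ^^ (p - i)) f))) - (\<Sum>i<p. \<pi> ((\<rho> ^^ (p - i)) f))"
    by (rule sum_subtractf)
  also have "(\<Sum>i<p. \<pi> ((\<rho> ^^ (p - i)) f)) = 0"
  proof -
    have \<rho>p: "(\<rho> ^^ p) f = f" by (rule poly_mapping_eqI) (simp add: \<rho>k')
    have "(\<Sum>i<p. (\<rho> ^^ (p - i)) f) = (\<Sum>i<p. (\<rho> ^^ (Suc i)) f)"
      using sum.nat_diff_reindex[of "\<lambda>i. (\<rho> ^^ Suc i) f" p] by (simp add: Suc_diff_Suc del: funpow.simps)
    also have "\<dots> + f = (\<Sum>i<Suc p. (\<rho> ^^ i) f)" unfolding sum.lessThan_Suc_shift by (simp add: add.commute)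
    then have "(\<Sum>i<p. (\<rho> ^^ (Suc i)) f) = (\<Sum>i<p. (\<rho> ^^ i) f)" using \<rho>p by simp
    finally have "(\<Sum>i<p. (\<rho> ^^ (p - i)) f) = 0" using f(2) by simp
    then show ?thesis unfolding \<pi>_sum by (simp add: \<pi>_def)
  qed
  also have "(\<Sum>i<p. (\<rho> ^^ i) (\<pi> ((\<rho> ^^ (p - i)) f))) = f"
  proof (rule poly_mapping_eqI)
    fix m
    have lk: "Poly_Mapping.lookup ((\<rho> ^^ i) (\<pi> ((\<rho> ^^ (p - i)) f))) m
        = (if L ((r ^^ (p - i)) m) then Poly_Mapping.lookup f m else 0)" if "i < p" for i
      using that \<rho>k[of "p - i" f m] by (simp add: \<rho>k' \<pi> less_imp_le_nat)
    have "Poly_Mapping.lookup (\<Sum>i<p. (\<rho> ^^ i) (\<pi> ((\<rho> ^^ (p - i)) f))) m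
        = (\<Sum>i<p. if L ((r ^^ (p - i)) m) then Poly_Mapping.lookup f m else 0)"
      unfolding lookup_sum using lk by (intro sum.cong) auto
    also have "\<dots> = Poly_Mapping.lookup f m"
    proof (cases "m \<in> D")
      case True
      obtain a where a: "a < p" "L ((r ^^ a) m)" "\<And>b. b < p \<Longrightarrow> L ((r ^^ b) m) \<Longrightarrow> b = a" using unique[OF True] by auto
      define a' where "a' = (if a = 0 then 0 else p - a)"
      have "L ((r ^^ (p - i)) m) \<longleftrightarrow> i = a'" if i: "i < p" for i
      proof -
        have "(r ^^ (p - i)) m = (r ^^ ((p - i) mod p)) m" by (simp add: r_mod)
        then have "L ((r ^^ (p - i)) m) \<longleftrightarrow> (p - i) mod p = a" using a p0 by (metis mod_less_divisor)
        also have "\<dots> \<longleftrightarrow> i = a'" using i a(1) unfolding a'_def by (cases "i = 0") auto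
        finally show ?thesis .
      qed
      then have "(\<Sum>i<p. if L ((r ^^ (p - i)) m) then Poly_Mapping.lookup f m else 0)
          = (\<Sum>i<p. if i = a' then Poly_Mapping.lookup f m else 0)" by (intro sum.cong) auto
      also have "\<dots> = Poly_Mapping.lookup f m" using a(1) p0 by (auto simp: a'_def)
      finally show ?thesis .
    next
      case False
      then have z: "Poly_Mapping.lookup f m = 0" using f(1) by (auto simp: in_keys_iff)
      show ?thesis unfolding z by (rule sum.neutral) simp
    qed
    finally show "Poly_Mapping.lookup (\<Sum>i<p. (\<rho> ^^ i) (\<pi> ((\<rho> ^^ (p - i)) f))) m = Poly_Mapping.lookup f m" .
  qed
  finally have "f = \<rho> g - g" by simp
  moreover have "Poly_Mapping.keys g \<subseteq> D"
  proof
    fix m assume m: "m \<in> Poly_Mapping.keys g"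
    show "m \<in> D"
    proof (rule ccontr)
      assume nm: "m \<notin> D"
      have "Poly_Mapping.lookup ((\<rho> ^^ j) (\<pi> ((\<rho> ^^ (p - i)) f))) m = 0" if "i < p" "j < i" for i j
      proof -
        have "(r ^^ (p - (p - i))) ((r ^^ (p - j)) m) \<notin> D" using nm D' by blast
        then have "Poly_Mapping.lookup f ((r ^^ (p - (p - i))) ((r ^^ (p - j)) m)) = 0" using f(1) by (auto simp: in_keys_iff)
        then show ?thesis using that by (simp add: \<rho>k' \<pi>)
      qed
      then have "Poly_Mapping.lookup g m = 0" unfolding g_def lookup_sum by simp
      then show False using m by (simp add: in_keys_iff)
    qed
  qed
  ultimately show ?thesis by blast
qed

context vector_operator begin

lemma unipotent_sum:
  "(\<Sum>i<n. ((\<lambda>v. v + \<Delta> v) ^^ i) v) = (\<Sum>j<n. of_nat (n choose Suc j) *s (\<Delta> ^^ j) v)"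
proof (induction n)
  case (Suc n)
  have "(\<Sum>i<Suc n. ((\<lambda>v. v + \<Delta> v) ^^ i) v)
      = (\<Sum>j<Suc n. of_nat (n choose Suc j) *s (\<Delta> ^^ j) v) + (\<Sum>j<Suc n. of_nat (n choose j) *s (\<Delta> ^^ j) v)"
    using Suc.IH unipotent_binomial[of n v] by (simp add: lessThan_Suc_atMost[symmetric] binomial_eq_0)
  also have "\<dots> = (\<Sum>j<Suc n. of_nat (Suc n choose Suc j) *s (\<Delta> ^^ j) v)"
    unfolding sum.distrib[symmetric] scale_left_distrib[symmetric] by (simp add: add.commute)
  finally show ?case .
qed simp

text \<open>The trace is the quotient of \<open>T\<^sup>p - 1 = \<Delta>\<^sup>p\<close> by \<open>T - 1 = \<Delta>\<close>.\<close>

lemma unipotent_trace: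
  assumes p: "prime p" and char: "CHAR('f) = p"
  shows "(\<Sum>i<p. ((\<lambda>v. v + \<Delta> v) ^^ i) v) = (\<Delta> ^^ (p - 1)) v"
proof -
  have p0: "0 < p" using p prime_gt_0_nat by simp
  have "(\<Sum>j<p. of_nat (p choose Suc j) *s (\<Delta> ^^ j) v) = (\<Sum>j\<in>{p - 1}. of_nat (p choose Suc j) *s (\<Delta> ^^ j) v)"
  proof (rule sum.mono_neutral_right)
    show "\<forall>j\<in>{..<p} - {p - 1}. of_nat (p choose Suc j) *s (\<Delta> ^^ j) v = 0"
    proof
      fix j assume "j \<in> {..<p} - {p - 1}"
      then have "p dvd (p choose Suc j)" using p by (intro dvd_choose_prime) auto
      then have "(of_nat (p choose Suc j) :: 'f) = 0" using of_nat_eq_0_iff_char_dvd[where 'a = 'f] char by simp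
      then show "of_nat (p choose Suc j) *s (\<Delta> ^^ j) v = 0" by simp
    qed
  qed (use p0 in auto)
  then show ?thesis using p0 by (simp add: unipotent_sum)
qed

end

section \<open>Rotation of \<open>p\<close> variables\<close>

text \<open>Indices from \<open>p\<close> on stay fixed, so that this is a permutation of all variables.\<close>

definition cyc_perm :: "nat \<Rightarrow> nat \<Rightarrow> nat"
  where "cyc_perm p i = (if Suc i < p then Suc i else if Suc i = p then 0 else i)"

definition cyc_inv :: "nat \<Rightarrow> nat \<Rightarrow> nat"
  where "cyc_inv p i = (if i = 0 then p - 1 else if i < p then i - 1 else i)"

text \<open>Pulling back exponents along the inverse permutation moves the variables along the permutation.\<close>

definition rot_monomial :: "nat \<Rightarrow> (nat \<Rightarrow>\<^sub>0 nat) \<Rightarrow> (nat \<Rightarrow>\<^sub>0 nat)"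
  where "rot_monomial p m = Poly_Mapping.map_key (cyc_inv p) m"

definition rotate_vars :: "nat \<Rightarrow> 'f::field mpoly \<Rightarrow> 'f mpoly"
  where "rotate_vars p = poly_subst (\<lambda>i. Var (cyc_perm p i))"

lemma cyc_inv_perm: "0 < p \<Longrightarrow> cyc_inv p (cyc_perm p i) = i"
  by (auto simp: cyc_inv_def cyc_perm_def)

lemma cyc_perm_inv: "0 < p \<Longrightarrow> cyc_perm p (cyc_inv p i) = i"
  by (auto simp: cyc_inv_def cyc_perm_def)

lemma cyc_perm_pow: "i < p \<Longrightarrow> (cyc_perm p ^^ k) i = (i + k) mod p"
proof (induction k)
  case (Suc k)
  define x where "x = (i + k) mod p"
  have "x < p" using Suc.prems by (simp add: x_def)
  then have "cyc_perm p x = Suc x mod p" by (cases "Suc x = p") (auto simp: cyc_perm_def)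
  then show ?case using Suc by (simp add: x_def mod_Suc_eq)
qed simp

lemma cyc_perm_order: "(cyc_perm p ^^ p) i = i"
proof (cases "i < p")
  case True
  then show ?thesis using cyc_perm_pow[of i p p] by simp
next
  case False
  have "(cyc_perm p ^^ k) i = i" for k by (induction k) (use False in \<open>auto simp: cyc_perm_def\<close>)
  then show ?thesis by simp
qed

lemma cyc_inv_pow_perm: "0 < p \<Longrightarrow> (cyc_inv p ^^ k) ((cyc_perm p ^^ k) i) = i"
proof (induction k)
  case (Suc k)
  have "(cyc_inv p ^^ Suc k) ((cyc_perm p ^^ Suc k) i) = (cyc_inv p ^^ k) (cyc_inv p (cyc_perm p ((cyc_perm p ^^ k) i)))"
    by (simp only: funpow_Suc_right o_apply funpow.simps(2) funpow_swap1)
  then show ?case using Suc by (simp add: cyc_inv_perm)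
qed simp

lemma inj_cyc_inv: "0 < p \<Longrightarrow> inj (cyc_inv p)"
  by (rule inj_on_inverseI[of _ "cyc_perm p"]) (rule cyc_perm_inv)

lemma lookup_rot_monomial: "0 < p \<Longrightarrow> Poly_Mapping.lookup (rot_monomial p m) i = Poly_Mapping.lookup m (cyc_inv p i)"
  by (simp add: rot_monomial_def map_key.rep_eq inj_cyc_inv)

lemma rot_monomial_add: "0 < p \<Longrightarrow> rot_monomial p (m + n) = rot_monomial p m + rot_monomial p n"
  by (rule poly_mapping_eqI) (simp add: lookup_rot_monomial lookup_add)

lemma rot_monomial_single: "0 < p \<Longrightarrow> rot_monomial p (Poly_Mapping.single i k) = Poly_Mapping.single (cyc_perm p i) k"
  by (rule poly_mapping_eqI) (auto simp: lookup_rot_monomial lookup_single when_def cyc_inv_perm cyc_perm_inv)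

lemma inj_rot_monomial: assumes "0 < p" "rot_monomial p m = rot_monomial p n" shows "m = n"
proof (rule poly_mapping_eqI)
  fix k
  have *: "Poly_Mapping.lookup (rot_monomial p m) (cyc_perm p k) = Poly_Mapping.lookup m k" for m
    using assms(1) by (simp add: lookup_rot_monomial cyc_inv_perm)
  show "Poly_Mapping.lookup m k = Poly_Mapping.lookup n k"
    using *[of m] *[of n] by (simp only: assms(2))
qed

lemma rot_monomial_order: assumes "0 < p" shows "(rot_monomial p ^^ p) m = m"
proof (rule poly_mapping_eqI)
  fix i
  have "Poly_Mapping.lookup ((rot_monomial p ^^ k) m) i = Poly_Mapping.lookup m ((cyc_inv p ^^ k) i)" for k i
  proof (induction k arbitrary: i)
    case (Suc k)
    have "Poly_Mapping.lookup ((rot_monomial p ^^ Suc k) m) i = Poly_Mapping.lookup ((rot_monomial p ^^ k) m) (cyc_inv p i)"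
      using assms by (simp add: lookup_rot_monomial)
    then show ?case using Suc by (simp only: funpow_Suc_right o_apply)
  qed simp
  moreover have "(cyc_inv p ^^ p) i = i"
    using cyc_inv_pow_perm[OF assms, of p i] by (simp add: cyc_perm_order)
  ultimately show "Poly_Mapping.lookup ((rot_monomial p ^^ p) m) i = Poly_Mapping.lookup m i" by simp
qed

lemma eval_monomial_rotate:
  assumes "0 < p"
  shows "eval_monomial (\<lambda>i. Var (cyc_perm p i)) m = (Poly_Mapping.single (rot_monomial p m) 1 :: 'f::field mpoly)"
proof (induction m rule: mpoly_induct)
  case (single i k)
  have "Var j ^ k = (Poly_Mapping.single (Poly_Mapping.single j k) 1 :: 'f mpoly)" for j
    using eval_monomial_Var[of "Poly_Mapping.single j k"] by simp
  then show ?case by (simp add: rot_monomial_single assms)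
qed (simp add: eval_monomial_add mult_single rot_monomial_add assms)

lemma rotate_single: "0 < p \<Longrightarrow> rotate_vars p (Poly_Mapping.single m c) = Poly_Mapping.single (rot_monomial p m) c"
  by (simp add: rotate_vars_def poly_subst_single eval_monomial_rotate fscale_single)

lemma rotate_add: "rotate_vars p (f + g) = rotate_vars p f + rotate_vars p g" by (simp add: rotate_vars_def poly_subst_add)
lemma rotate_mult: "rotate_vars p (f * g) = rotate_vars p f * rotate_vars p g" by (simp add: rotate_vars_def poly_subst_mult)
lemma rotate_power: "rotate_vars p (f ^ k) = rotate_vars p f ^ k" by (simp add: rotate_vars_def poly_subst_power)
lemma rotate_sum: "rotate_vars p (\<Sum>i\<in>I. f i) = (\<Sum>i\<in>I. rotate_vars p (f i))" by (simp add: rotate_vars_def poly_subst_sum)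
lemma rotate_prod: "rotate_vars p (\<Prod>i\<in>I. f i) = (\<Prod>i\<in>I. rotate_vars p (f i))" by (simp add: rotate_vars_def poly_subst_prod)
lemma rotate_fscale: "rotate_vars p (fscale c f) = fscale c (rotate_vars p f)" by (simp add: rotate_vars_def poly_subst_fscale)
lemma rotate_0 [simp]: "rotate_vars p 0 = 0" by (simp add: rotate_vars_def)
lemma rotate_1 [simp]: "rotate_vars p 1 = 1" by (simp add: rotate_vars_def)
lemma rotate_const [simp]: "rotate_vars p (const c) = const c" by (simp add: rotate_vars_def)
lemma rotate_Var [simp]: "rotate_vars p (Var i) = Var (cyc_perm p i)" by (simp add: rotate_vars_def)

lemma lookup_rotate:
  assumes "0 < p" shows "Poly_Mapping.lookup (rotate_vars p f) (rot_monomial p m) = Poly_Mapping.lookup f m"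
proof (induction f rule: mpoly_induct)
  case (single n c)
  have "rot_monomial p n = rot_monomial p m \<longleftrightarrow> n = m" using inj_rot_monomial[OF assms] by blast
  then show ?case by (simp add: rotate_single assms lookup_single)
qed (simp add: rotate_add lookup_add)

lemma rotate_pow: "(rotate_vars p ^^ k) f = poly_subst (\<lambda>i. Var ((cyc_perm p ^^ k) i)) f"
proof (induction k)
  case (Suc k)
  have "rotate_vars p (poly_subst (\<lambda>i. Var ((cyc_perm p ^^ k) i)) f) = poly_subst (\<lambda>i. rotate_vars p (Var ((cyc_perm p ^^ k) i))) f"
    unfolding rotate_vars_def by (rule poly_subst_poly_subst)
  then show ?case by (simp add: Suc)
qed (simp add: poly_subst_Var_id)

lemma rotate_order: "(rotate_vars p ^^ p) f = f"
  by (simp add: rotate_pow cyc_perm_order poly_subst_Var_id)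

lemma rotate_pow_Var: "i < p \<Longrightarrow> (rotate_vars p ^^ k) (Var i) = Var ((i + k) mod p)"
  by (simp add: rotate_pow cyc_perm_pow)

lemma rotate_in_component: "f \<in> sym_component p e \<Longrightarrow> rotate_vars p f \<in> sym_component p e"
  unfolding rotate_vars_def by (rule poly_subst_in_component) (auto intro!: sym_component_Var[simplified] simp: cyc_perm_def)

interpretation rotate_op: vector_operator fscale "\<lambda>f. rotate_vars p f - f" for p
  by unfold_locales (auto simp: rotate_add rotate_fscale fs.scale_right_diff_distrib)

lemma rotate_trace:
  assumes "prime p" "CHAR('f::field) = p"
  shows "((\<lambda>f. rotate_vars p f - f) ^^ (p - 1)) f = (\<Sum>i<p. (rotate_vars p ^^ i) (f :: 'f mpoly))"
  using rotate_op.unipotent_trace[OF assms, of p f] by simp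

text \<open>In the coordinates below, this is \<open>x\<^sub>1\<close>.\<close>

definition var_sum :: "nat \<Rightarrow> 'f::field mpoly" where "var_sum p = (\<Sum>i<p. Var i)"

text \<open>In the coordinates below, this is the norm of \<open>x\<^sub>p\<close>.\<close>

definition var_prod :: "nat \<Rightarrow> 'f::field mpoly" where "var_prod p = (\<Prod>i<p. Var i)"

lemma bij_cyc_perm: "bij_betw (cyc_perm p) {..<p} {..<p}"
  unfolding bij_betw_def
proof
  show inj: "inj_on (cyc_perm p) {..<p}"
    by (auto simp: inj_on_def cyc_perm_def split: if_splits)
  have "cyc_perm p ` {..<p} \<subseteq> {..<p}" by (auto simp: cyc_perm_def)
  then show "cyc_perm p ` {..<p} = {..<p}" using inj by (simp add: card_image card_subset_eq)
qed

lemma rotate_var_sum [simp]: "rotate_vars p (var_sum p) = var_sum p"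
  using sum.reindex_bij_betw[OF bij_cyc_perm, of Var p] by (simp add: var_sum_def rotate_sum)

lemma rotate_var_prod [simp]: "rotate_vars p (var_prod p) = var_prod p"
  using prod.reindex_bij_betw[OF bij_cyc_perm, of Var p] by (simp add: var_prod_def rotate_prod)

lemma var_sum_component: "var_sum p \<in> sym_component p 1"
  unfolding var_sum_def by (intro sym_component_sum sym_component_Var) auto

lemma var_prod_component: "var_prod p \<in> sym_component p p"
proof -
  have "(\<Prod>i<p. Var i) \<in> sym_component p (\<Sum>i<p. 1)"
    by (rule sym_component_prod) (rule sym_component_Var, simp)
  then show ?thesis by (simp add: var_prod_def)
qed

lemma lookup_Var_mult: "Poly_Mapping.lookup (Var i * f) (Poly_Mapping.single i 1 + m) = Poly_Mapping.lookup f m"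
  by (induction f rule: mpoly_induct) (auto simp: algebra_simps lookup_add Var_def mult_single lookup_single when_def)

lemma lookup_Var_mult_0: "Poly_Mapping.lookup m i = 0 \<Longrightarrow> Poly_Mapping.lookup (Var i * f) m = 0"
  by (induction f rule: mpoly_induct) (auto simp: algebra_simps lookup_add Var_def mult_single lookup_single when_def)

text \<open>Every ordering of the variables in a squarefree monomial contributes \<open>1\<close> to its coefficient.\<close>

lemma lookup_var_sum_power:
  "A \<subseteq> {..<p} \<Longrightarrow> Poly_Mapping.lookup (var_sum p ^ card A) (\<Sum>i\<in>A. Poly_Mapping.single i 1) = (of_nat (fact (card A)) :: 'f::field)"
proof (induction "card A" arbitrary: A)
  case 0
  then have "A = {}" using finite_subset[of A "{..<p}"] by simp
  then show ?case by (simp add: lookup_one)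
next
  case (Suc k)
  have fin: "finite A" using Suc.prems finite_subset by auto
  let ?m = "\<lambda>A. \<Sum>i\<in>A. Poly_Mapping.single i (1::nat)"
  have lm: "Poly_Mapping.lookup (?m A) i = (if i \<in> A then 1 else 0)" for i
    using fin by (simp add: lookup_sum lookup_single when_def)
  have "Poly_Mapping.lookup (var_sum p ^ card A) (?m A) = (Poly_Mapping.lookup (\<Sum>i<p. Var i * var_sum p ^ k) (?m A) :: 'f)"
    unfolding Suc.hyps(2)[symmetric] by (simp add: var_sum_def sum_distrib_right)
  also have "\<dots> = (\<Sum>i<p. Poly_Mapping.lookup (Var i * var_sum p ^ k) (?m A))" by (rule lookup_sum)
  also have "\<dots> = (\<Sum>i\<in>A. Poly_Mapping.lookup (Var i * var_sum p ^ k) (?m A))"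
    using Suc.prems by (intro sum.mono_neutral_right) (auto simp: lm intro!: lookup_Var_mult_0 simp del: One_nat_def)
  also have "\<dots> = (\<Sum>i\<in>A. of_nat (fact k))"
  proof (rule sum.cong)
    fix i assume i: "i \<in> A"
    have mA: "?m A = Poly_Mapping.single i 1 + ?m (A - {i})" using fin i by (rule sum.remove)
    have k: "card (A - {i}) = k" using Suc.hyps(2) fin i by simp
    have "Poly_Mapping.lookup (Var i * var_sum p ^ k) (?m A) = (Poly_Mapping.lookup (var_sum p ^ k) (?m (A - {i})) :: 'f)"
      unfolding mA by (rule lookup_Var_mult)
    then show "Poly_Mapping.lookup (Var i * var_sum p ^ k) (?m A) = (of_nat (fact k) :: 'f)"
      using Suc.hyps(1)[of "A - {i}"] Suc.prems k by auto
  qed simp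
  also have "\<dots> = of_nat (fact (card A))" by (simp add: algebra_simps flip: Suc.hyps(2))
  finally show ?case .
qed

text \<open>The exponents of the powers of \<^const>\<open>var_prod\<close>, the only monomials in \<open>p\<close> variables fixed by
  the rotation.\<close>

definition const_exponent :: "nat \<Rightarrow> nat \<Rightarrow> (nat \<Rightarrow>\<^sub>0 nat)"
  where "const_exponent p l = (\<Sum>i<p. Poly_Mapping.single i l)"

lemma lookup_const_exponent: "Poly_Mapping.lookup (const_exponent p l) i = (if i < p then l else 0)"
  by (simp add: const_exponent_def lookup_sum lookup_single when_def)

lemma var_prod_power: "var_prod p ^ l = (Poly_Mapping.single (const_exponent p l) 1 :: 'f::field mpoly)"
proof -
  have "Poly_Mapping.keys (const_exponent p l) \<subseteq> {..<p}" by (auto simp: in_keys_iff lookup_const_exponent split: if_splits)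
  then have "eval_monomial Var (const_exponent p l) = (\<Prod>i<p. (Var i :: 'f mpoly) ^ l)"
    by (subst eval_monomial_superset[of "{..<p}"]) (auto simp: lookup_const_exponent intro!: prod.cong)
  then show ?thesis by (simp add: eval_monomial_Var var_prod_def prod_power_distrib)
qed

definition moved_monomials :: "nat \<Rightarrow> nat \<Rightarrow> (nat \<Rightarrow>\<^sub>0 nat) set"
  where "moved_monomials p e = {m \<in> monomials p e. rot_monomial p m \<noteq> m}"

text \<open>As the rotation has prime order, the monomials that it moves form orbits of length \<open>p\<close>, and their span
  is a free module over the group ring of the rotations.\<close>

definition free_part :: "nat \<Rightarrow> nat \<Rightarrow> 'f::field mpoly set"
  where "free_part p e = {f. Poly_Mapping.keys f \<subseteq> moved_monomials p e}"

lemma free_part_component: "f \<in> free_part p e \<Longrightarrow> f \<in> sym_component p e"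
  by (auto simp: free_part_def moved_monomials_def sym_component_iff)

lemma free_part_0 [simp]: "0 \<in> free_part p e" by (simp add: free_part_def)

lemma free_part_add: "f \<in> free_part p e \<Longrightarrow> g \<in> free_part p e \<Longrightarrow> f + g \<in> free_part p e"
  using keys_add[of f g] by (auto simp: free_part_def)

lemma free_part_diff: "(f :: 'f::field mpoly) \<in> free_part p e \<Longrightarrow> g \<in> free_part p e \<Longrightarrow> f - g \<in> free_part p e"
  unfolding free_part_def by (auto simp: in_keys_iff subset_iff lookup_minus) (metis diff_self)

lemma free_part_fscale: "f \<in> free_part p e \<Longrightarrow> fscale c f \<in> free_part p e"
  by (auto simp: free_part_def in_keys_iff)

lemma rot_monomial_in: assumes "0 < p" "m \<in> monomials p e" shows "rot_monomial p m \<in> monomials p e"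
proof -
  have "Poly_Mapping.single m 1 \<in> (sym_component p e :: rat mpoly set)" using assms by (intro sym_component_single)
  from rotate_in_component[OF this] show ?thesis using assms(1) by (simp add: rotate_single sym_component_iff)
qed

lemma moved_rot: "0 < p \<Longrightarrow> m \<in> moved_monomials p e \<Longrightarrow> rot_monomial p m \<in> moved_monomials p e"
  using inj_rot_monomial rot_monomial_in by (auto simp: moved_monomials_def)

lemma free_part_rotate: assumes "0 < p" "f \<in> free_part p e" shows "rotate_vars p f \<in> free_part p e"
proof -
  have "rotate_vars p f = (\<Sum>m\<in>Poly_Mapping.keys f. Poly_Mapping.single (rot_monomial p m) (Poly_Mapping.lookup f m))"
    by (subst poly_mapping_expand[of f]) (simp add: rotate_sum rotate_single assms)
  moreover have "(\<Sum>m\<in>A. Poly_Mapping.single (rot_monomial p m) (Poly_Mapping.lookup f m)) \<in> free_part p e"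
    if "A \<subseteq> Poly_Mapping.keys f" for A
    using finite_subset[OF that finite_keys] that
  proof (induction A rule: finite_induct)
    case (insert m A)
    have "m \<in> moved_monomials p e" using insert.prems assms(2) by (auto simp: free_part_def)
    then have "Poly_Mapping.single (rot_monomial p m) (Poly_Mapping.lookup f m) \<in> free_part p e"
      using moved_rot[OF assms(1)] by (auto simp: free_part_def)
    then show ?case using insert by (simp add: free_part_add)
  qed simp
  ultimately show ?thesis by simp
qed

lemma free_part_mult_var_prod:
  assumes "0 < p" "f \<in> free_part p e" shows "var_prod p * f \<in> free_part p (e + p)"
  unfolding free_part_def
proof (rule CollectI, rule subsetI)
  fix m assume "m \<in> Poly_Mapping.keys (var_prod p * f)"
  moreover have n: "var_prod p = Poly_Mapping.single (const_exponent p 1) (1::'a)" using var_prod_power[of p 1] by simp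
  ultimately obtain m' where m': "m = const_exponent p 1 + m'" "m' \<in> Poly_Mapping.keys f"
    using keys_mult[of "var_prod p" f] by (auto simp: n)
  have "m' \<in> moved_monomials p e" using m' assms by (auto simp: free_part_def)
  moreover have "rot_monomial p (const_exponent p 1) = const_exponent p 1"
    by (rule poly_mapping_eqI) (use assms in \<open>auto simp: lookup_rot_monomial lookup_const_exponent cyc_inv_def\<close>)
  moreover have "const_exponent p 1 \<in> monomials p p" using var_prod_component[of p, where 'a = rat] var_prod_power[of p 1, where 'f = rat]
    by (simp add: sym_component_iff)
  ultimately show "m \<in> moved_monomials p (e + p)"
    using m' monomials_add[of "const_exponent p 1" p p m' e] assms(1)
    by (auto simp: moved_monomials_def rot_monomial_add add.commute)
qed

text \<open>The operator \<open>(\<rho> - 1)\<^bsup>p-1\<^esup>\<close> is the trace, and on a free module the kernel of the trace is the image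
  of \<open>\<rho> - 1\<close>.\<close>

lemma free_part_trace_zero:
  assumes p: "prime p" "CHAR('f::field) = p" and f: "(f :: 'f mpoly) \<in> free_part p e"
    and z: "((\<lambda>f. rotate_vars p f - f) ^^ (p - 1)) f = 0"
  shows "\<exists>g\<in>free_part p e. f = rotate_vars p g - g"
proof -
  have p0: "0 < p" using p prime_gt_0_nat by blast
  have "\<exists>g. Poly_Mapping.keys g \<subseteq> moved_monomials p e \<and> f = rotate_vars p g - g"
  proof (rule free_permutation_trace_zero[OF p(1), of "rot_monomial p"])
    show "(\<Sum>i<p. (rotate_vars p ^^ i) f) = 0" using z rotate_trace[OF p, of f] by simp
  qed (use f p0 in \<open>auto simp: rot_monomial_order lookup_rotate rotate_add moved_rot moved_monomials_def rot_monomial_in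
      free_part_def dest: inj_rot_monomial\<close>)
  then show ?thesis by (auto simp: free_part_def)
qed

lemma fixed_monomial:
  assumes p: "0 < p" and m: "m \<in> monomials p e" "rot_monomial p m = m"
  shows "\<exists>l. m = const_exponent p l \<and> e = l * p"
proof -
  have cst: "Poly_Mapping.lookup m i = Poly_Mapping.lookup m 0" if "i < p" for i
    using that
  proof (induction i)
    case (Suc i)
    have "Poly_Mapping.lookup m (Suc i) = Poly_Mapping.lookup (rot_monomial p m) (Suc i)" using m(2) by simp
    also have "\<dots> = Poly_Mapping.lookup m i" using Suc.prems p by (simp add: lookup_rot_monomial cyc_inv_def)
    finally show ?case using Suc by simp
  qed simp
  then have "m = const_exponent p (Poly_Mapping.lookup m 0)"
  proof (intro poly_mapping_eqI)
    fix k
    have "k \<notin> Poly_Mapping.keys m" if "\<not> k < p" using that m(1) by (auto simp: monomials_def)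
    then show "Poly_Mapping.lookup m k = Poly_Mapping.lookup (const_exponent p (Poly_Mapping.lookup m 0)) k"
      using cst[of k] by (cases "k < p") (auto simp: lookup_const_exponent in_keys_iff)
  qed
  moreover from this have "e = Poly_Mapping.lookup m 0 * p"
  proof -
    have "e = (\<Sum>i<p. Poly_Mapping.lookup m i)" using m(1) by (simp add: monomials_def total_degree_def)
    also have "\<dots> = (\<Sum>i<p. Poly_Mapping.lookup m 0)"
      by (rule sum.cong[OF refl], rule cst, simp)
    finally show ?thesis by simp
  qed
  ultimately show ?thesis by blast
qed

lemma component_free: "0 < p \<Longrightarrow> \<not> p dvd e \<Longrightarrow> f \<in> sym_component p e \<Longrightarrow> f \<in> free_part p e"
  using fixed_monomial[of p _ e]
  by (auto simp: free_part_def moved_monomials_def sym_component_iff) (metis dvd_triv_right subsetD)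

lemma component_split:
  assumes p: "0 < p" and f: "(f :: 'f::field mpoly) \<in> sym_component p (l * p)"
  shows "f - fscale (Poly_Mapping.lookup f (const_exponent p l)) (var_prod p ^ l) \<in> free_part p (l * p)"
  unfolding free_part_def
proof (rule CollectI, rule subsetI)
  fix m assume m: "m \<in> Poly_Mapping.keys (f - fscale (Poly_Mapping.lookup f (const_exponent p l)) (var_prod p ^ l))"
  have n: "var_prod p ^ l \<in> (sym_component p (l * p) :: 'f mpoly set)" using sym_component_power[OF var_prod_component] .
  have "f - fscale (Poly_Mapping.lookup f (const_exponent p l)) (var_prod p ^ l) \<in> sym_component p (l * p)"
    using f n by (intro sym_component_diff sym_component_fscale)
  then have mm: "m \<in> monomials p (l * p)" using m by (auto simp: sym_component_iff)
  have "m \<noteq> const_exponent p l"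
    using m by (auto simp: in_keys_iff lookup_minus var_prod_power)
  then have "rot_monomial p m \<noteq> m" using fixed_monomial[OF p mm] p by auto
  then show "m \<in> moved_monomials p (l * p)" using mm by (simp add: moved_monomials_def)
qed

lemma lookup_free_part_const_exponent: "0 < p \<Longrightarrow> f \<in> free_part p e \<Longrightarrow> Poly_Mapping.lookup f (const_exponent p l) = 0"
proof (rule ccontr)
  assume p: "0 < p" and f: "f \<in> free_part p e" "Poly_Mapping.lookup f (const_exponent p l) \<noteq> 0"
  have "rot_monomial p (const_exponent p l) = const_exponent p l"
    by (rule poly_mapping_eqI) (use p in \<open>auto simp: lookup_rot_monomial lookup_const_exponent cyc_inv_def\<close>)
  then show False using f by (auto simp: free_part_def moved_monomials_def in_keys_iff)
qed

section \<open>The model algebra in the coordinates \<open>t\<close> and \<open>z\<^sub>i\<close>\<close>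

abbreviation coeff :: "'a::zero poly \<Rightarrow> nat \<Rightarrow> 'a" where "coeff \<equiv> Polynomial.coeff"

abbreviation degree :: "'a::zero poly \<Rightarrow> nat" where "degree \<equiv> Polynomial.degree"

abbreviation tvar :: "'f::field mpoly poly" where "tvar \<equiv> [:0, 1:]"

definition pscale :: "'f::field \<Rightarrow> 'f mpoly poly \<Rightarrow> 'f mpoly poly"
  where "pscale c q = [:const c:] * q"

lemma const_mult: "const (a * b) = const a * const (b::'f::field)"
  by (simp add: mult_single)

lemma const_poly_mult: "[:const a:] * [:const b:] = [:const (a * b):]"
  by (simp add: const_mult)

lemma const_of_nat: "const (of_nat n :: 'f::field) = of_nat n"
  by (rule poly_mapping_eqI) (simp add: lookup_of_nat lookup_single when_def)

lemma vector_space_pscale: "vector_space (pscale :: 'f::field \<Rightarrow> _)"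
  by unfold_locales
    (simp_all add: pscale_def smult_add_right single_add smult_add_left const_mult mult.commute)

lemma pcompose_power': "pcompose (q ^ n) s = pcompose q s ^ n"
  by (induction n) (auto simp: pcompose_mult one_pCons)

text \<open>The action of the generator in coordinates \<open>t = x\<^sub>p\<^sub>+\<^sub>1\<close> and \<open>z\<^sub>i = \<sigma>\<^sup>i x\<^sub>p\<close>: it rotates the \<open>z\<^sub>i\<close> and sends \<open>t\<close> to
  \<open>t + z\<^sub>0\<close>. Polynomials in \<open>t\<close> with coefficients in the \<open>z\<^sub>i\<close> keep the two roles apart.\<close>

definition \<tau> :: "nat \<Rightarrow> 'f::field mpoly poly \<Rightarrow> 'f mpoly poly"
  where "\<tau> p q = pcompose (map_poly (rotate_vars p) q) [:Var 0, 1:]"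

lemma tau_add: "\<tau> p (f + g) = \<tau> p f + \<tau> p g"
proof -
  have "map_poly (rotate_vars p) (f + g) = map_poly (rotate_vars p) f + map_poly (rotate_vars p) g"
    by (rule poly_eqI) (simp add: coeff_map_poly rotate_add)
  then show ?thesis by (simp add: \<tau>_def pcompose_add)
qed

lemma tau_mult: "\<tau> p (f * g) = \<tau> p f * \<tau> p g"
proof -
  have "map_poly (rotate_vars p) (f * g) = map_poly (rotate_vars p) f * map_poly (rotate_vars p) g"
    by (rule poly_eqI) (simp add: coeff_map_poly Polynomial.coeff_mult rotate_sum rotate_mult)
  then show ?thesis by (simp add: \<tau>_def pcompose_mult)
qed

lemma tau_const [simp]: "\<tau> p [:r:] = [:rotate_vars p r:]"
  by (simp add: \<tau>_def map_poly_pCons pcompose_pCons)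

lemma tau_tvar: "\<tau> p tvar = tvar + [:Var 0:]"
  by (simp add: \<tau>_def map_poly_pCons pcompose_pCons)

lemma tau_0 [simp]: "\<tau> p 0 = 0" by (simp add: \<tau>_def)

lemma tau_1 [simp]: "\<tau> p 1 = 1" using tau_const[of p 1] by (simp add: one_pCons)

lemma tau_diff: "\<tau> p (f - g) = \<tau> p f - \<tau> p g"
  using tau_add[of p "f - g" g] by simp

lemma tau_power: "\<tau> p (f ^ k) = \<tau> p f ^ k" by (induction k) (auto simp: tau_mult)

lemma tau_prod: "\<tau> p (\<Prod>i\<in>I. f i) = (\<Prod>i\<in>I. \<tau> p (f i))"
  by (induction I rule: infinite_finite_induct) (auto simp: tau_mult)

lemma tau_sum: "\<tau> p (\<Sum>i\<in>I. f i) = (\<Sum>i\<in>I. \<tau> p (f i))"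
  by (induction I rule: infinite_finite_induct) (auto simp: tau_add)

lemma tau_pow_mult: "(\<tau> p ^^ k) (f * g) = (\<tau> p ^^ k) f * (\<tau> p ^^ k) g"
  by (induction k) (auto simp: tau_mult)

lemma tau_pow_add: "(\<tau> p ^^ k) (f + g) = (\<tau> p ^^ k) f + (\<tau> p ^^ k) g"
  by (induction k) (auto simp: tau_add)

lemma tau_pow_const: "(\<tau> p ^^ k) [:r:] = [:(rotate_vars p ^^ k) r:]"
  by (induction k) auto

lemma tau_pow_1: "(\<tau> p ^^ k) 1 = 1"
  by (induction k) auto

lemma tau_pow_tvar: "(\<tau> p ^^ k) (tvar :: 'f::field mpoly poly) = tvar + [:\<Sum>i<k. (rotate_vars p ^^ i) (Var 0):]"
proof (induction k)
  case (Suc k)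
  have "(\<tau> p ^^ Suc k) (tvar :: 'f mpoly poly) = tvar + [:Var 0:] + [:\<Sum>i<k. (rotate_vars p ^^ Suc i) (Var 0):]"
    by (simp only: funpow.simps(2) o_apply Suc tau_add tau_tvar tau_const rotate_sum)
  then show ?case by (simp add: sum.lessThan_Suc_shift del: sum.lessThan_Suc)
qed simp

text \<open>After a full turn the \<open>z\<^sub>i\<close> are back in place, and \<open>t\<close> has gained each of them once.\<close>

lemma tau_pow_p: assumes "0 < p" shows "(\<tau> p ^^ p) q = pcompose q [:var_sum p, 1:]"
proof (induction q)
  case (pCons c q)
  have xs: "var_sum p = (\<Sum>i<p. (rotate_vars p ^^ i) (Var 0))"
    unfolding var_sum_def using assms by (intro sum.cong) (auto simp: rotate_pow_Var)
  then have t: "(\<tau> p ^^ p) tvar = [:var_sum p, 1:]" by (simp add: tau_pow_tvar xs[symmetric])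
  have "pCons c q = [:c:] + tvar * q" by simp
  then have "(\<tau> p ^^ p) (pCons c q) = [:c:] + [:var_sum p, 1:] * (\<tau> p ^^ p) q"
    by (simp only: tau_pow_add tau_pow_mult tau_pow_const t rotate_order)
  then show ?case using pCons by (simp add: pcompose_pCons)
next
  case 0
  show ?case using tau_pow_const[of p p 0] by (simp add: rotate_order)
qed

lemma tau_pow_p_pow_tvar:
  assumes "0 < p"
  shows "((\<tau> p ^^ p) ^^ k) tvar = tvar + [:of_nat k * var_sum p :: 'f::field mpoly:]"
proof (induction k)
  case (Suc k)
  have "(\<tau> p ^^ p) tvar = tvar + [:var_sum p :: 'f mpoly:]" "(\<tau> p ^^ p) [:r:] = [:r :: 'f mpoly:]" for r
    by (simp_all add: tau_pow_p[OF assms] pcompose_pCons)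
  then have "((\<tau> p ^^ p) ^^ Suc k) tvar = tvar + [:var_sum p :: 'f mpoly:] + [:of_nat k * var_sum p:]"
    by (simp only: funpow.simps(2) o_apply Suc tau_pow_add)
  then show ?case by (simp add: distrib_right)
qed simp

text \<open>The comparison of the second coefficients shows that translation by a nonzero element of a domain fixes
  only polynomials whose degree vanishes in the coefficient ring.\<close>

lemma coeff_shift:
  assumes "degree q \<le> n"
  shows "coeff (pcompose q [:x, 1:]) n = coeff q n \<and>
    (0 < n \<longrightarrow> coeff (pcompose q [:x, 1:]) (n - 1) = coeff q (n - 1) + of_nat n * x * coeff q n)"
  using assms
proof (induction q arbitrary: n)
  case (pCons c q)
  have *: "coeff (pcompose (pCons c q) [:x, 1:]) m
     = (if m = 0 then c else coeff (pcompose q [:x, 1:]) (m - 1)) + x * coeff (pcompose q [:x, 1:]) m" for m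
    by (cases m) (simp_all add: pcompose_pCons add.commute)
  show ?case
  proof (cases "q = 0")
    case True
    then show ?thesis by (auto simp: * coeff_pCons split: nat.splits)
  next
    case False
    then obtain n' where n: "n = Suc n'" "degree q \<le> n'" using pCons.prems by (cases n) auto
    have d: "degree (pcompose q [:x, 1:]) \<le> n'" using n(2) degree_pcompose_le[of q "[:x, 1:]"] by simp
    note IH = pCons.IH[OF n(2)]
    have z: "coeff (pcompose q [:x, 1:]) n = 0" using d n by (intro coeff_eq_0) simp
    show ?thesis
      using IH z n by (cases n') (auto simp: * coeff_pCons algebra_simps)
  qed
qed simp

text \<open>Total degree \<open>d\<close>, where \<open>t\<close> and the variables \<open>z\<^sub>i\<close> have degree \<open>1\<close>.\<close>

definition graded :: "nat \<Rightarrow> nat \<Rightarrow> 'f::field mpoly poly set"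
  where "graded p d = {q. \<forall>i. if i \<le> d then coeff q i \<in> sym_component p (d - i) else coeff q i = 0}"

lemma graded_0 [simp]: "0 \<in> graded p d" by (simp add: graded_def)

lemma graded_add: "f \<in> graded p d \<Longrightarrow> g \<in> graded p d \<Longrightarrow> f + g \<in> graded p d"
  by (auto simp: graded_def sym_component_add)

lemma graded_diff: "f \<in> graded p d \<Longrightarrow> g \<in> graded p d \<Longrightarrow> f - g \<in> graded p d"
  by (auto simp: graded_def sym_component_diff)

lemma graded_sum: "(\<And>i. i \<in> I \<Longrightarrow> f i \<in> graded p d) \<Longrightarrow> (\<Sum>i\<in>I. f i) \<in> graded p d"
  by (induction I rule: infinite_finite_induct) (auto intro: graded_add)

lemma graded_const: "r \<in> sym_component p d \<Longrightarrow> [:r:] \<in> graded p d"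
  by (auto simp: graded_def coeff_pCons split: nat.splits)

lemma graded_tvar: "tvar \<in> graded p 1"
  by (auto simp: graded_def coeff_pCons split: nat.splits)

lemma graded_pscale: "f \<in> graded p d \<Longrightarrow> pscale c f \<in> graded p d"
  using sym_component_fscale[of _ p _ c] by (auto simp: graded_def pscale_def fscale_eq_mult)

lemma graded_mult: assumes f: "f \<in> graded p d" and g: "g \<in> graded p e" shows "f * g \<in> graded p (d + e)"
proof -
  have key: "if i \<le> d + e then coeff f k * coeff g (i - k) \<in> sym_component p (d + e - i) else coeff f k * coeff g (i - k) = 0"
    if "k \<le> i" for i k
  proof (cases "k \<le> d \<and> i - k \<le> e")
    case True
    then have "coeff f k * coeff g (i - k) \<in> sym_component p ((d - k) + (e - (i - k)))"
      using f g by (intro sym_component_mult) (auto simp: graded_def)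
    moreover have "(d - k) + (e - (i - k)) = d + e - i" "i \<le> d + e" using True that by auto
    ultimately show ?thesis by simp
  next
    case False
    then have z: "coeff f k * coeff g (i - k) = 0" using f g unfolding graded_def by (auto simp: not_le)
    show ?thesis unfolding z by simp
  qed
  show ?thesis
    unfolding graded_def
  proof (intro CollectI allI)
    fix i
    have c: "coeff (f * g) i = (\<Sum>k\<le>i. coeff f k * coeff g (i - k))" by (rule Polynomial.coeff_mult)
    show "if i \<le> d + e then coeff (f * g) i \<in> sym_component p (d + e - i) else coeff (f * g) i = 0"
    proof (cases "i \<le> d + e")
      case True
      then show ?thesis unfolding c using key[where i = i] by (auto intro!: sym_component_sum)
    next
      case False
      then have "coeff (f * g) i = 0" unfolding c using key[where i = i] by (intro sum.neutral) auto
      then show ?thesis using False by simp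
    qed
  qed
qed

lemma graded_1 [simp]: "1 \<in> graded p 0"
  using graded_const[of 1 p 0] by (simp add: one_pCons)

lemma graded_power: "f \<in> graded p d \<Longrightarrow> f ^ k \<in> graded p (k * d)"
  by (induction k) (auto intro: graded_mult)

lemma graded_prod: "(\<And>i. i < n \<Longrightarrow> f i \<in> graded p d) \<Longrightarrow> (\<Prod>i<n. f i) \<in> graded p (n * d)"
proof (induction n)
  case (Suc n)
  then have "(\<Prod>i<n. f i) * f n \<in> graded p (n * d + d)" by (intro graded_mult) auto
  then show ?case by (simp add: add.commute)
qed simp

lemma graded_degree: "q \<in> graded p d \<Longrightarrow> degree q \<le> d"
  by (rule degree_le) (auto simp: graded_def)

lemma graded_expand: assumes "q \<in> graded p d" shows "q = (\<Sum>i\<le>d. [:coeff q i:] * tvar ^ i)"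
  using poly_as_sum_of_monoms'[OF graded_degree[OF assms]] by (simp add: monom_altdef)

lemma graded_tau: assumes p: "0 < p" and q: "q \<in> graded p d" shows "\<tau> p q \<in> graded p d"
proof -
  have "\<tau> p q = (\<Sum>i\<le>d. [:rotate_vars p (coeff q i):] * (tvar + [:Var 0:]) ^ i)"
    by (subst graded_expand[OF q]) (simp add: tau_sum tau_mult tau_power tau_tvar del: mult_pCons_left)
  also have "\<dots> \<in> graded p d"
  proof (rule graded_sum)
    fix i assume i: "i \<in> {..d}"
    have "[:rotate_vars p (coeff q i):] \<in> graded p (d - i)"
      using q i by (intro graded_const rotate_in_component) (auto simp: graded_def)
    moreover have "tvar + [:Var 0:] \<in> graded p 1"
      using p by (intro graded_add graded_tvar graded_const sym_component_Var)
    then have "(tvar + [:Var 0:]) ^ i \<in> graded p (i * 1)" by (rule graded_power)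
    ultimately have "[:rotate_vars p (coeff q i):] * (tvar + [:Var 0:]) ^ i \<in> graded p (d - i + i * 1)" by (rule graded_mult)
    then show "[:rotate_vars p (coeff q i):] * (tvar + [:Var 0:]) ^ i \<in> graded p d" using i by simp
  qed
  finally show ?thesis .
qed

lemma graded_tau_pow: "0 < p \<Longrightarrow> q \<in> graded p d \<Longrightarrow> (\<tau> p ^^ k) q \<in> graded p d"
  by (induction k) (auto simp: graded_tau)

interpretation ps: vector_space pscale by (rule vector_space_pscale)

interpretation tau_op: vector_operator pscale "\<lambda>q. \<tau> p q - q" for p
  by unfold_locales (simp_all add: tau_add pscale_def tau_mult right_diff_distrib del: mult_pCons_left)

section \<open>Divisibility by \<open>x\<^sub>1\<close>\<close>

text \<open>In characteristic \<open>p\<close> this is the operator \<open>\<Delta>\<^sup>p\<close>. Unlike \<open>\<Delta>\<close> it is linear over all polynomials in the \<open>z\<^sub>i\<close>.\<close>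

definition D :: "nat \<Rightarrow> 'f::field mpoly poly \<Rightarrow> 'f mpoly poly"
  where "D p q = (\<tau> p ^^ p) q - q"

lemma D_eq: assumes "prime p" "CHAR('f::field) = p"
  shows "D p (q :: 'f mpoly poly) = ((\<lambda>q. \<tau> p q - q) ^^ p) q"
  using tau_op.unipotent_frobenius[OF assms, of p q] by (simp add: D_def)

lemma D_mult_fixed: "(\<tau> p ^^ p) f = f \<Longrightarrow> D p (f * g) = f * D p g"
  by (simp add: D_def tau_pow_mult right_diff_distrib)

lemma tau_pow_var_sum: "(\<tau> p ^^ k) [:var_sum p ^ j:] = [:var_sum p ^ j:]"
proof -
  have "(rotate_vars p ^^ k) (var_sum p ^ j) = var_sum p ^ j" by (induction k) (auto simp: rotate_power)
  then show ?thesis by (simp add: tau_pow_const)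
qed

text \<open>As \<open>\<tau>\<^sup>p\<close> only translates \<open>t\<close> by \<open>x\<^sub>1\<close>, it moves every power of \<open>t\<close> by a multiple of \<open>x\<^sub>1\<close>.\<close>

lemma D_divisible:
  fixes q :: "'f::field mpoly poly"
  assumes p: "0 < p" and q: "q \<in> graded p d"
  shows "\<exists>f. D p q = [:var_sum p:] * f \<and> (if 0 < d then f \<in> graded p (d - 1) else f = 0)"
proof -
  define s :: "'f mpoly poly" where "s = [:var_sum p, 1:]"
  have s: "s - tvar = [:var_sum p:]" "s = tvar + [:var_sum p:]" by (simp_all add: s_def)
  have sg: "s \<in> graded p 1" unfolding s(2) by (intro graded_add graded_tvar graded_const var_sum_component)
  define e where "e i = (\<Sum>k<i. tvar ^ (i - Suc k) * s ^ k)" for i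
  have e: "s ^ i - tvar ^ i = [:var_sum p:] * e i" for i
    unfolding e_def s(1)[symmetric] by (rule power_diff_sumr2)
  define f where "f = (\<Sum>i\<le>d. [:coeff q i:] * e i)"
  have comp: "(\<tau> p ^^ p) q = (\<Sum>i\<le>d. [:coeff q i:] * s ^ i)"
  proof -
    have "pcompose (\<Sum>i\<le>d. [:coeff q i:] * tvar ^ i) s = (\<Sum>i\<le>d. [:coeff q i:] * s ^ i)"
      unfolding pcompose_sum by (intro sum.cong refl) (simp only: pcompose_mult pcompose_const pcompose_power', simp add: pcompose_pCons)
    then show ?thesis using graded_expand[OF q] tau_pow_p[OF p, of q] by (simp add: s_def)
  qed
  have "D p q = (\<Sum>i\<le>d. [:coeff q i:] * (s ^ i - tvar ^ i))"
    unfolding D_def comp right_diff_distrib sum_subtractf graded_expand[OF q, symmetric] by simp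
  then have "D p q = [:var_sum p:] * f"
    unfolding e f_def sum_distrib_left by (simp only: ac_simps)
  moreover have "f \<in> graded p (d - 1)" if d: "0 < d"
    unfolding f_def
  proof (rule graded_sum)
    fix i assume i: "i \<in> {..d}"
    show "[:coeff q i:] * e i \<in> graded p (d - 1)"
    proof (cases "i = 0")
      case False
      have "e i \<in> graded p (i - 1)" unfolding e_def
      proof (rule graded_sum)
        fix k assume k: "k \<in> {..<i}"
        have "tvar ^ (i - Suc k) * s ^ k \<in> graded p ((i - Suc k) * 1 + k * 1)"
          by (intro graded_mult graded_power graded_tvar sg)
        then show "tvar ^ (i - Suc k) * s ^ k \<in> graded p (i - 1)" using k by simp
      qed
      moreover have "[:coeff q i:] \<in> graded p (d - i)" using q i by (intro graded_const) (auto simp: graded_def)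
      ultimately have "[:coeff q i:] * e i \<in> graded p (d - i + (i - 1))" by (intro graded_mult)
      then show ?thesis using i False by simp
    qed (simp add: e_def)
  qed
  moreover have "f = 0" if "d = 0" using that by (simp add: f_def e_def)
  ultimately show ?thesis by auto
qed

lemma D_pow_divisible:
  fixes q :: "'f::field mpoly poly"
  assumes p: "0 < p" and q: "q \<in> graded p d"
  shows "\<exists>f. (D p ^^ j) q = [:var_sum p ^ j:] * f \<and> (if j \<le> d then f \<in> graded p (d - j) else f = 0)"
proof (induction j)
  case (Suc j)
  then obtain f where f: "(D p ^^ j) q = [:var_sum p ^ j:] * f" "if j \<le> d then f \<in> graded p (d - j) else f = 0" by blast
  have D1: "(D p ^^ Suc j) q = [:var_sum p ^ j:] * D p f" using f(1) D_mult_fixed[OF tau_pow_var_sum] by simp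
  have D0: "D p (0 :: 'f mpoly poly) = 0" by (simp add: D_def tau_pow_p p)
  show ?case
  proof (cases "j \<le> d")
    case True
    then obtain g where g: "D p f = [:var_sum p:] * g" "if 0 < d - j then g \<in> graded p (d - j - 1) else g = 0"
      using D_divisible[OF p, of f "d - j"] f(2) by auto
    have "(D p ^^ Suc j) q = [:var_sum p ^ Suc j:] * g" unfolding D1 g(1) by (simp add: mult.commute)
    moreover have "if Suc j \<le> d then g \<in> graded p (d - Suc j) else g = 0"
      using g(2) True by (auto split: if_splits)
    ultimately show ?thesis by blast
  next
    case False
    then have "(D p ^^ Suc j) q = 0" using D1 f(2) D0 by (simp only: if_False mult_zero_right)
    then show ?thesis using False by (intro exI[of _ 0]) auto
  qed
qed (use q in \<open>auto simp: one_pCons[symmetric]\<close>)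

lemma var_sum_nonzero: assumes "0 < p" shows "var_sum p \<noteq> (0 :: 'f::field mpoly)"
proof -
  have "Poly_Mapping.lookup (var_sum p ^ card {0::nat}) (\<Sum>i\<in>{0::nat}. Poly_Mapping.single i 1) = (of_nat (fact (card {0::nat})) :: 'f)"
    using assms by (intro lookup_var_sum_power) auto
  then show ?thesis by auto
qed

section \<open>The ring of \<open>\<tau>\<^sup>p\<close>-invariants\<close>

text \<open>For the translation of \<open>a\<close> by a fixed \<open>b\<close>, these products are what powers are for derivatives: the
  difference operator sends the \<open>k\<close>-th one to \<open>kb\<close> times the preceding one.\<close>

definition falling :: "'a::comm_ring_1 \<Rightarrow> 'a \<Rightarrow> nat \<Rightarrow> 'a"
  where "falling a b k = (\<Prod>i<k. a - of_nat i * b)"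

lemma falling_shift: "falling (a + b) b (Suc k) = falling a b (Suc k) + of_nat (Suc k) * b * falling a b k"
proof -
  have "falling (a + b) b (Suc k) = (a + b) * (\<Prod>i<k. a + b - of_nat (Suc i) * b)"
    unfolding falling_def prod.lessThan_Suc_shift by simp
  also have "(\<Prod>i<k. a + b - of_nat (Suc i) * b) = falling a b k"
    unfolding falling_def by (intro prod.cong) (auto simp: algebra_simps)
  finally show ?thesis by (simp add: falling_def algebra_simps)
qed

lemma tau_of_nat [simp]: "\<tau> p (of_nat n) = of_nat n"
  by (induction n) (auto simp: tau_add)

lemma tau_pow_of_nat: "(\<tau> p ^^ k) (of_nat n) = of_nat n"
  by (induction k) auto

lemma tau_pow_diff: "(\<tau> p ^^ k) (f - g) = (\<tau> p ^^ k) f - (\<tau> p ^^ k) g"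
  by (induction k) (auto simp: tau_diff)

lemma tau_pow_prod: "(\<tau> p ^^ k) (\<Prod>i\<in>I. f i) = (\<Prod>i\<in>I. (\<tau> p ^^ k) (f i))"
  by (induction I rule: infinite_finite_induct) (auto simp: tau_pow_mult tau_pow_1)

lemma tau_pow_sum: "(\<tau> p ^^ k) (\<Sum>i\<in>I. f i) = (\<Sum>i\<in>I. (\<tau> p ^^ k) (f i))"
  by (induction k) (auto simp: tau_sum)

lemma tau_pow_power: "(\<tau> p ^^ k) (f ^ n) = (\<tau> p ^^ k) f ^ n"
  by (induction n) (auto simp: tau_pow_mult tau_pow_1)

lemma tau_pow_falling: "(\<tau> p ^^ k) (falling a b n) = falling ((\<tau> p ^^ k) a) ((\<tau> p ^^ k) b) n"
  by (simp add: falling_def tau_pow_prod tau_pow_diff tau_pow_mult tau_pow_of_nat)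

lemma falling_tau: assumes "\<tau> p a = a + b" "\<tau> p b = b"
  shows "\<tau> p (falling a b (Suc k)) = falling a b (Suc k) + of_nat (Suc k) * b * falling a b k"
  using tau_pow_falling[where k = 1, of p a b "Suc k"] assms falling_shift[of a b k] by simp

definition monic :: "'a::idom poly \<Rightarrow> nat \<Rightarrow> bool"
  where "monic q n \<longleftrightarrow> degree q = n \<and> coeff q n = 1"

lemma monic_mult: assumes "monic f m" "monic g n" shows "monic (f * g) (m + n)"
proof -
  have "f \<noteq> 0" "g \<noteq> 0" using assms by (auto simp: monic_def)
  then show ?thesis
    using assms coeff_mult_degree_sum[of f g] by (simp add: monic_def degree_mult_eq)
qed

lemma monic_1: "monic 1 0" by (simp add: monic_def)

lemma monic_power: "monic f m \<Longrightarrow> monic (f ^ k) (k * m)"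
  by (induction k) (auto simp: monic_1 intro: monic_mult)

lemma monic_add_lower: assumes "monic f m" "degree g < m" shows "monic (f + g) m"
  using assms degree_add_eq_left[of g f] by (simp add: monic_def coeff_eq_0)

lemma monic_falling:
  assumes "monic a n" "degree b = 0" "0 < n"
  shows "monic (falling a b k) (k * n)"
proof (induction k)
  case (Suc k)
  have "degree (- (of_nat k * b)) < n"
    using assms(2,3) degree_mult_le[of "of_nat k" b] by simp
  then have "monic (a + - (of_nat k * b)) n" by (rule monic_add_lower[OF assms(1)])
  then have "monic (falling a b k * (a + - (of_nat k * b))) (k * n + n)" by (rule monic_mult[OF Suc])
  then show ?case by (simp add: falling_def add.commute)
qed (simp add: falling_def monic_1)

lemma falling_graded:
  assumes "a \<in> graded p n" "b \<in> graded p n" shows "falling a b k \<in> graded p (k * n)"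
proof -
  have "of_nat i * b \<in> graded p n" for i
    by (induction i) (auto intro: graded_add assms simp: distrib_right)
  then show ?thesis unfolding falling_def by (intro graded_prod graded_diff assms)
qed

text \<open>The polynomial \<open>t\<^sup>p - x\<^sub>1\<^bsup>p-1\<^esup> t\<close> is invariant under \<open>t \<mapsto> t + x\<^sub>1\<close>, and \<open>\<tau>\<close> adds \<open>u = z\<^sub>0\<^sup>p - x\<^sub>1\<^bsup>p-1\<^esup> z\<^sub>0\<close> to it. The
  coefficient of \<open>z\<^sub>0 \<cdots> z\<^sub>p\<^sub>-\<^sub>1\<close> in \<open>u\<close> is \<open>- (p - 1)!\<close>, and the rest of \<open>u\<close> lies in the free part. Its trace is
  \<open>\<Sum>z\<^sub>i\<^sup>p - x\<^sub>1\<^sup>p = 0\<close>, so it has the form \<open>\<rho> v - v\<close> and disappears after subtraction of \<open>v\<close>.\<close>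

lemma exists_degree_p_generator:
  assumes p: "prime p" and char: "CHAR('f::field) = p"
  shows "\<exists>(K :: 'f mpoly poly) \<beta>. K \<in> graded p p \<and> (\<tau> p ^^ p) K = K \<and> monic K p \<and>
    \<beta> \<noteq> 0 \<and> \<tau> p K = K + [:fscale \<beta> (var_prod p):]"
proof -
  have p0: "0 < p" "1 < p" using p prime_gt_0_nat prime_gt_1_nat by blast+
  have charR: "CHAR('f mpoly) = p" using char CHAR_mpoly[where 'f = 'f] by simp
  have charS: "CHAR('f mpoly poly) = p" using charR by simp
  define K0 :: "'f mpoly poly" where "K0 = tvar ^ p - [:var_sum p ^ (p - 1):] * tvar"
  define u :: "'f mpoly" where "u = Var 0 ^ p - var_sum p ^ (p - 1) * Var 0"
  have K0g: "K0 \<in> graded p p"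
  proof -
    have "tvar ^ p \<in> graded p (p * 1)" by (intro graded_power graded_tvar)
    moreover have "[:var_sum p ^ (p - 1):] * tvar \<in> graded p ((p - 1) * 1 + 1)"
      by (intro graded_mult graded_const sym_component_power var_sum_component graded_tvar)
    ultimately show ?thesis unfolding K0_def using p0 by (intro graded_diff) auto
  qed
  have tauK0: "\<tau> p K0 = K0 + [:u:]"
  proof -
    have "(tvar + [:Var 0:] :: 'f mpoly poly) ^ p = tvar ^ p + [:Var 0:] ^ p"
      by (rule freshmans_dream) (use p charS in auto)
    then have "\<tau> p K0 = tvar ^ p + [:Var 0:] ^ p - [:var_sum p ^ (p - 1):] * (tvar + [:Var 0:])"
      unfolding K0_def by (simp only: tau_diff tau_mult tau_power tau_tvar tau_const rotate_power rotate_var_sum)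
    moreover have "[:Var 0:] ^ p = [:Var 0 ^ p :: 'f mpoly:]" by (simp add: poly_const_pow)
    moreover have "[:u:] = [:Var 0 ^ p:] - [:var_sum p ^ (p - 1):] * [:Var 0:]" by (simp add: u_def mult.commute)
    moreover have "A + B - X * (t + v) = (A - X * t) + (B - X * v)" for A B X t v :: "'f mpoly poly"
      by (simp add: algebra_simps)
    ultimately show ?thesis unfolding K0_def by metis
  qed
  have uc: "u \<in> sym_component p (1 * p)"
  proof -
    have "Var 0 ^ p \<in> (sym_component p (p * 1) :: 'f mpoly set)"
      by (intro sym_component_power sym_component_Var) (use p0 in auto)
    moreover have "var_sum p ^ (p - 1) * Var 0 \<in> (sym_component p ((p - 1) * 1 + 1) :: 'f mpoly set)"
      by (intro sym_component_mult sym_component_power var_sum_component sym_component_Var) (use p0 in auto)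
    ultimately show ?thesis unfolding u_def using p0 by (intro sym_component_diff) auto
  qed
  define \<beta> where "\<beta> = Poly_Mapping.lookup u (const_exponent p 1)"
  have \<beta>: "\<beta> = - of_nat (fact (p - 1))"
  proof -
    have "Poly_Mapping.lookup (Var 0 * Var 0 ^ (p - 1) :: 'f mpoly) (const_exponent p 1) = 0"
    proof -
      have "const_exponent p 1 = Poly_Mapping.single 0 1 + (const_exponent p 1 - Poly_Mapping.single 0 1)"
        by (rule poly_mapping_eqI) (use p0 in \<open>auto simp: lookup_add lookup_minus lookup_const_exponent lookup_single when_def\<close>)
      then have "Poly_Mapping.lookup (Var 0 * Var 0 ^ (p - 1) :: 'f mpoly) (const_exponent p 1)
        = Poly_Mapping.lookup (Var 0 ^ (p - 1) :: 'f mpoly) (const_exponent p 1 - Poly_Mapping.single 0 1)"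
        using lookup_Var_mult[of 0 "Var 0 ^ (p - 1)"] by metis
      also have "\<dots> = Poly_Mapping.lookup (Var 0 * Var 0 ^ (p - 2) :: 'f mpoly) (const_exponent p 1 - Poly_Mapping.single 0 1)"
        using p0 by (metis One_nat_def Suc_1 Suc_diff_Suc power_Suc)
      also have "\<dots> = 0"
        by (rule lookup_Var_mult_0) (simp add: lookup_minus lookup_const_exponent)
      finally show ?thesis .
    qed
    moreover have "Var 0 ^ p = (Var 0 * Var 0 ^ (p - 1) :: 'f mpoly)"
      using p0 by (metis Suc_diff_1 power_Suc)
    moreover have "Poly_Mapping.lookup (Var 0 * var_sum p ^ (p - 1)) (const_exponent p 1) = (of_nat (fact (p - 1)) :: 'f)"
    proof -
      have "const_exponent p 1 = Poly_Mapping.single 0 1 + (\<Sum>i\<in>{..<p} - {0}. Poly_Mapping.single i 1)"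
        unfolding const_exponent_def using p0 by (intro sum.remove) auto
      then have "Poly_Mapping.lookup (Var 0 * var_sum p ^ (p - 1)) (const_exponent p 1)
          = (Poly_Mapping.lookup (var_sum p ^ (p - 1)) (\<Sum>i\<in>{..<p} - {0}. Poly_Mapping.single i 1) :: 'f)"
        by (simp only: lookup_Var_mult)
      also have "\<dots> = of_nat (fact (p - 1))"
        using lookup_var_sum_power[of "{..<p} - {0}" p] p0 by simp
      finally show ?thesis .
    qed
    ultimately show ?thesis unfolding \<beta>_def u_def by (simp add: lookup_minus mult.commute)
  qed
  have \<beta>0: "\<beta> \<noteq> 0"
  proof -
    have "\<not> p dvd fact (p - 1)" using prime_dvd_fact_iff[OF p, of "p - 1"] p0 by simp
    then have "(of_nat (fact (p - 1)) :: 'f) \<noteq> 0" using of_nat_eq_0_iff_char_dvd[where 'a = 'f] char by simp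
    then show ?thesis using \<beta> by simp
  qed
  define u' where "u' = u - fscale \<beta> (var_prod p)"
  have u'f: "u' \<in> free_part p (1 * p)"
    using component_split[OF p0(1) uc] by (simp add: u'_def \<beta>_def)
  have "((\<lambda>f. rotate_vars p f - f) ^^ (p - 1)) u' = 0"
  proof -
    have fx: "(\<Sum>i<p. (rotate_vars p ^^ i) f) = 0" if "rotate_vars p f = f" for f :: "'f mpoly"
    proof -
      have "(rotate_vars p ^^ i) f = f" for i by (induction i) (use that in auto)
      then have "(\<Sum>i<p. (rotate_vars p ^^ i) f) = of_nat p * f" by simp
      also have "(of_nat p :: 'f mpoly) = 0" using charR by (metis of_nat_CHAR)
      finally show ?thesis by simp
    qed
    have r: "(rotate_vars p ^^ i) u' = Var i ^ p - var_sum p ^ (p - 1) * Var i - (rotate_vars p ^^ i) (fscale \<beta> (var_prod p))"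
      if "i < p" for i
    proof -
      have "(rotate_vars p ^^ i) (f - g) = (rotate_vars p ^^ i) f - (rotate_vars p ^^ i) g"
         "(rotate_vars p ^^ i) (f * g) = (rotate_vars p ^^ i) f * (rotate_vars p ^^ i) g"
         "(rotate_vars p ^^ i) (f ^ k) = (rotate_vars p ^^ i) f ^ k" for f g :: "'f mpoly" and k
        unfolding rotate_pow by (simp_all add: poly_subst_diff poly_subst_mult poly_subst_power)
      moreover have "(rotate_vars p ^^ i) (var_sum p) = (var_sum p :: 'f mpoly)" by (induction i) auto
      moreover have "(rotate_vars p ^^ i) (Var 0) = (Var i :: 'f mpoly)" using rotate_pow_Var[OF p0(1), of i] that by simp
      ultimately show ?thesis unfolding u'_def u_def by simp
    qed
    have "(\<Sum>i<p. (rotate_vars p ^^ i) u') = (\<Sum>i<p. Var i ^ p) - var_sum p ^ (p - 1) * var_sum p - (\<Sum>i<p. (rotate_vars p ^^ i) (fscale \<beta> (var_prod p)))"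
      using r by (simp add: sum_subtractf sum_distrib_left[symmetric] var_sum_def[symmetric])
    also have "(\<Sum>i<p. (rotate_vars p ^^ i) (fscale \<beta> (var_prod p))) = 0" by (rule fx) (simp add: rotate_fscale)
    also have "var_sum p ^ (p - 1) * var_sum p = (var_sum p :: 'f mpoly) ^ p" using p0 by (metis Suc_diff_1 power_Suc2)
    also have "(var_sum p :: 'f mpoly) ^ p = (\<Sum>i<p. Var i ^ p)"
      unfolding var_sum_def by (rule freshmans_dream_sum) (use p charR in auto)
    finally show ?thesis using rotate_trace[OF p char, of u'] by simp
  qed
  then obtain v where v: "v \<in> free_part p (1 * p)" "u' = rotate_vars p v - v"
    using free_part_trace_zero[OF p char u'f] by blast
  define K where "K = K0 - [:v:]"
  have vc: "v \<in> sym_component p p" using free_part_component v(1) by fastforce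
  have tauK: "\<tau> p K = K + [:fscale \<beta> (var_prod p):]"
  proof -
    have "u = rotate_vars p v - v + fscale \<beta> (var_prod p)" using v(2) by (simp add: u'_def algebra_simps)
    then have "[:u:] = [:rotate_vars p v:] - [:v:] + [:fscale \<beta> (var_prod p):]" by simp
    then have "\<tau> p K = K0 + ([:rotate_vars p v:] - [:v:] + [:fscale \<beta> (var_prod p):]) - [:rotate_vars p v:]"
      unfolding K_def by (simp only: tau_diff tauK0 tau_const)
    moreover have "a + (r - w + b) - r = a - w + b" for a r w b :: "'f mpoly poly" by simp
    ultimately show ?thesis unfolding K_def by (simp only:)
  qed
  have tauKk: "(\<tau> p ^^ k) K = K + [:of_nat k * fscale \<beta> (var_prod p):]" for k
  proof (induction k)
    case (Suc k)
    have "rotate_vars p (of_nat k * fscale \<beta> (var_prod p)) = of_nat k * fscale \<beta> (var_prod p)"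
      by (induction k) (simp_all add: distrib_right rotate_add rotate_fscale)
    then show ?case using Suc by (simp add: tau_add tauK algebra_simps)
  qed simp
  have "(of_nat p :: 'f mpoly) = 0" using charR by (metis of_nat_CHAR)
  then have 1: "(\<tau> p ^^ p) K = K" using tauKk[of p] by simp
  have 2: "K \<in> graded p p" unfolding K_def by (intro graded_diff K0g graded_const vc)
  have cK: "coeff K p = 1"
  proof -
    obtain n where n: "p = Suc (Suc n)" using less_imp_Suc_add[OF p0(2)] by auto
    have "coeff (tvar ^ p :: 'f mpoly poly) p = 1"
      using Polynomial.coeff_monom[of "1::'f mpoly" p p] by (simp add: monom_altdef)
    moreover have "coeff ([:var_sum p ^ (p - 1):] * tvar :: 'f mpoly poly) p = 0" using n by (simp add: coeff_pCons)
    moreover have "coeff [:v:] p = 0" using n by (simp add: coeff_pCons)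
    ultimately show ?thesis unfolding K_def K0_def by simp
  qed
  have "degree K = p" using graded_degree[OF 2] le_degree[of K p] cK by simp
  then have "monic K p" using cK by (simp add: monic_def)
  then show ?thesis using 1 2 \<beta>0 tauK by blast
qed

lemma funpow_pred:
  assumes "0 < n" shows "(g ^^ n) x = g ((g ^^ (n - 1)) x)" "(g ^^ n) x = (g ^^ (n - 1)) (g x)"
  using assms by (cases n, simp_all add: funpow_swap1)+

lemma funpow_add_apply: "(g ^^ (m + n)) x = (g ^^ n) ((g ^^ m) x)"
  using funpow_add[of n m g] by (simp add: add.commute)

text \<open>The polynomials \<open>fixed_basis j\<close> below are monic of degree \<open>pj\<close> in \<open>t\<close> and form a basis of the
  \<open>\<tau>\<^sup>p\<close>-invariants over the polynomials in the \<open>z\<^sub>i\<close>, and \<open>\<tau> - 1\<close> acts on them like a derivation on powers. The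
  product \<open>K (K - \<nu>) \<cdots> (K - (p - 1) \<nu>)\<close> is invariant under \<open>\<tau>\<close> too; with the norm of \<open>t\<close> in its place, this norm
  appears in the bottom vector of the non-induced summand.\<close>

locale normal_form =
  fixes p :: nat and K :: "'f::field mpoly poly" and \<beta> :: 'f
  assumes p: "prime p" and char: "CHAR('f) = p"
    and K_graded: "K \<in> graded p p" and K_fixed: "(\<tau> p ^^ p) K = K"
    and K_monic: "monic K p"
    and \<beta>: "\<beta> \<noteq> 0" and tau_K: "\<tau> p K = K + [:fscale \<beta> (var_prod p):]"
begin

abbreviation \<Delta> :: "'f mpoly poly \<Rightarrow> 'f mpoly poly" where "\<Delta> \<equiv> \<lambda>q. \<tau> p q - q"

definition \<nu> :: "'f mpoly" where "\<nu> = fscale \<beta> (var_prod p)"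

definition norm_t :: "'f mpoly poly" where "norm_t = (\<Prod>k<p ^ 2. (\<tau> p ^^ k) tvar)"

definition fixed_basis :: "nat \<Rightarrow> 'f mpoly poly" where "fixed_basis j = norm_t ^ (j div p) * falling K [:\<nu>:] (j mod p)"

lemma p0: "0 < p" "1 < p" using p prime_gt_0_nat prime_gt_1_nat by blast+

lemma charS: "CHAR('f mpoly poly) = p" using char CHAR_mpoly[where 'f = 'f] by simp

lemma of_nat_eq_0_poly: "(of_nat n :: 'f mpoly poly) = 0 \<longleftrightarrow> p dvd n"
  using of_nat_eq_0_iff_char_dvd[where 'a = "'f mpoly poly"] charS by simp

lemma of_nat_eq_0_field: "(of_nat n :: 'f) = 0 \<longleftrightarrow> p dvd n"
  using of_nat_eq_0_iff_char_dvd[where 'a = 'f] char by simp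

lemma \<nu>_fixed: "rotate_vars p \<nu> = \<nu>" by (simp add: \<nu>_def rotate_fscale)

lemma \<nu>_component: "\<nu> \<in> sym_component p p" by (simp add: \<nu>_def sym_component_fscale var_prod_component)

lemma tau_pow_square: "(\<tau> p ^^ (p ^ 2)) (q :: 'f mpoly poly) = q"
proof -
  have "((\<tau> p ^^ p) ^^ k) tvar = tvar + [:of_nat k * var_sum p :: 'f mpoly:]" for k
    by (rule tau_pow_p_pow_tvar[OF p0(1)])
  moreover have "(of_nat p :: 'f mpoly) = 0" using charS by (metis of_nat_CHAR semiring_char_poly)
  ultimately have t: "((\<tau> p ^^ p) ^^ p) tvar = (tvar :: 'f mpoly poly)" by simp
  have pp: "(\<tau> p ^^ (p ^ 2)) = (\<tau> p ^^ p) ^^ p" by (simp add: funpow_mult power2_eq_square)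
  have c: "((\<tau> p ^^ p) ^^ k) [:r:] = [:r:]" for k and r :: "'f mpoly"
    by (induction k) (auto simp: tau_pow_p[OF p0(1)])
  show ?thesis
  proof (induction q)
    case 0
    show ?case using c[of p 0] unfolding pp by simp
  next
    case (pCons a q)
    have "pCons a q = [:a:] + tvar * q" by simp
    then have "(\<tau> p ^^ (p ^ 2)) (pCons a q) = (\<tau> p ^^ (p ^ 2)) [:a:] + (\<tau> p ^^ (p ^ 2)) tvar * (\<tau> p ^^ (p ^ 2)) q"
      by (simp only: tau_pow_add tau_pow_mult)
    then show ?case using pCons unfolding pp by (simp add: c t)
  qed
qed

lemma norm_t_tau: "\<tau> p norm_t = norm_t"
proof -
  have "\<tau> p norm_t = (\<Prod>k<p ^ 2. (\<tau> p ^^ Suc k) tvar)" unfolding norm_t_def tau_prod by simp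
  moreover have "(\<Prod>k<Suc (p ^ 2). (\<tau> p ^^ k) tvar) = tvar * (\<Prod>k<p ^ 2. (\<tau> p ^^ Suc k) (tvar :: 'f mpoly poly))"
    unfolding prod.lessThan_Suc_shift by simp
  moreover have "(\<Prod>k<Suc (p ^ 2). (\<tau> p ^^ k) tvar) = norm_t * tvar" unfolding norm_t_def by (simp add: tau_pow_square)
  ultimately show ?thesis by (simp add: mult.commute)
qed

lemma norm_t_graded: "norm_t \<in> graded p (p ^ 2)"
proof -
  have "norm_t \<in> graded p (p ^ 2 * 1)" unfolding norm_t_def by (rule graded_prod) (intro graded_tau_pow graded_tvar p0)
  then show ?thesis by simp
qed

lemma norm_t_monic: "monic norm_t (p ^ 2)"
proof -
  have "monic (\<Prod>k<n. (\<tau> p ^^ k) (tvar :: 'f mpoly poly)) n" for n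
  proof (induction n)
    case (Suc n)
    have "monic ((\<tau> p ^^ n) (tvar :: 'f mpoly poly)) 1" by (simp add: tau_pow_tvar monic_def)
    from monic_mult[OF Suc this] show ?case by simp
  qed (simp add: monic_1)
  then show ?thesis unfolding norm_t_def by blast
qed

lemma tau_K': "\<tau> p K = K + [:\<nu>:]" using tau_K by (simp add: \<nu>_def)

text \<open>The second term vanishes if \<open>p\<close> divides \<open>j\<close>, and then \<open>fixed_basis j\<close> is a power of the norm.\<close>

lemma fixed_basis_tau: "\<tau> p (fixed_basis j) = fixed_basis j + of_nat j * [:\<nu>:] * fixed_basis (j - 1)"
proof (cases "j mod p")
  case 0
  then have "(of_nat j :: 'f mpoly poly) = 0" using of_nat_eq_0_poly by auto
  then show ?thesis using 0 by (simp add: fixed_basis_def tau_power tau_mult norm_t_tau falling_def del: mult_pCons_left mult_pCons_right)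
next
  case (Suc k)
  have j: "j = p * (j div p) + Suc k" using Suc by (metis mult_div_mod_eq)
  have k: "Suc k < p" using Suc p0 by (metis mod_less_divisor)
  have "j - 1 = p * (j div p) + k" using j by simp
  then have j1: "(j - 1) div p = j div p" "(j - 1) mod p = k" using k by (metis Suc_lessD div_mult_self4 div_less add.right_neutral p0(1) less_numeral_extra(3)) (metis Suc_lessD \<open>j - 1 = _\<close> k mod_less mod_mult_self4)
  have "(of_nat j :: 'f mpoly poly) = of_nat (p * (j div p)) + of_nat (Suc k)" by (metis j of_nat_add)
  also have "(of_nat (p * (j div p)) :: 'f mpoly poly) = 0" using of_nat_eq_0_poly by simp
  finally have jk: "(of_nat j :: 'f mpoly poly) = of_nat (Suc k)" by simp
  have "\<tau> p (falling K [:\<nu>:] (Suc k)) = falling K [:\<nu>:] (Suc k) + of_nat (Suc k) * [:\<nu>:] * falling K [:\<nu>:] k"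
    by (rule falling_tau[OF tau_K']) (simp add: \<nu>_fixed)
  then show ?thesis unfolding fixed_basis_def j1 Suc jk tau_mult tau_power norm_t_tau by (simp only: distrib_left ac_simps)
qed

lemma div_mod_square: "j div p * p ^ 2 + j mod p * p = p * j"
proof -
  have "a * p ^ 2 + b * p = (p * a + b) * p" for a b
    by (simp add: power2_eq_square algebra_simps)
  then have "j div p * p ^ 2 + j mod p * p = (p * (j div p) + j mod p) * p" .
  also have "\<dots> = j * p" by (simp only: mult_div_mod_eq)
  finally show ?thesis by (simp only: mult.commute)
qed

lemma fixed_basis_graded: "fixed_basis j \<in> graded p (p * j)"
proof -
  have "fixed_basis j \<in> graded p (j div p * p ^ 2 + j mod p * p)"
    unfolding fixed_basis_def by (intro graded_mult graded_power norm_t_graded falling_graded K_graded graded_const \<nu>_component)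
  also have "j div p * p ^ 2 + j mod p * p = p * j"
    by (rule div_mod_square)
  finally show ?thesis .
qed

lemma fixed_basis_monic: "monic (fixed_basis j) (p * j)"
proof -
  have "monic (fixed_basis j) (j div p * p ^ 2 + j mod p * p)"
    unfolding fixed_basis_def by (intro monic_mult monic_power norm_t_monic monic_falling K_monic) (use p0 in auto)
  then show ?thesis by (simp only: div_mod_square)
qed

lemma degree_fixed_basis: "degree (fixed_basis j) = p * j" and coeff_fixed_basis: "coeff (fixed_basis j) (p * j) = 1"
  using fixed_basis_monic[of j] by (simp_all add: monic_def)

lemma fixed_basis_fixed: "(\<tau> p ^^ p) (fixed_basis j) = fixed_basis j"
proof -
  have "(\<tau> p ^^ k) norm_t = norm_t" for k by (induction k) (auto simp: norm_t_tau)
  moreover have "(\<tau> p ^^ p) [:\<nu>:] = [:\<nu>:]" by (simp add: tau_pow_p[OF p0(1)])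
  ultimately show ?thesis unfolding fixed_basis_def by (simp only: tau_pow_mult tau_pow_power tau_pow_falling K_fixed)
qed

lemma const_fixed: "(\<tau> p ^^ p) [:r:] = [:r :: 'f mpoly:]" by (simp add: tau_pow_p[OF p0(1)])

text \<open>The possible coefficients of \<open>fixed_basis j\<close> in an element of degree \<open>e\<close>.\<close>

definition coeff_space :: "nat \<Rightarrow> nat \<Rightarrow> 'f mpoly set"
  where "coeff_space e j = (if p * j \<le> e then sym_component p (e - p * j) else {0})"

definition free_coeff_space :: "nat \<Rightarrow> nat \<Rightarrow> 'f mpoly set"
  where "free_coeff_space e j = (if p * j \<le> e then free_part p (e - p * j) else {0})"

definition \<Phi> :: "nat \<Rightarrow> (nat \<Rightarrow> 'f mpoly) \<Rightarrow> 'f mpoly poly"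
  where "\<Phi> J r = (\<Sum>j<J. fixed_basis j * [:r j:])"

lemma \<Phi>_Suc: "\<Phi> (Suc J) r = \<Phi> J r + fixed_basis J * [:r J:]" unfolding \<Phi>_def by (rule sum.lessThan_Suc)

lemma \<Phi>_0: "\<Phi> 0 r = 0" by (simp add: \<Phi>_def)

lemma \<Phi>_add: "\<Phi> J (\<lambda>j. r j + s j) = \<Phi> J r + \<Phi> J s"
proof -
  have "[:r j + s j:] = [:r j:] + [:s j:]" for j by simp
  then show ?thesis unfolding \<Phi>_def by (simp only: distrib_left sum.distrib)
qed

lemma \<Phi>_diff: "\<Phi> J (\<lambda>j. r j - s j) = \<Phi> J r - \<Phi> J s"
  using \<Phi>_add[of J "\<lambda>j. r j - s j" s] by simp

lemma \<Phi>_cong: "(\<And>j. j < J \<Longrightarrow> r j = s j) \<Longrightarrow> \<Phi> J r = \<Phi> J s"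
  unfolding \<Phi>_def by (rule sum.cong) auto

lemma \<Phi>_graded: assumes "\<And>j. r j \<in> coeff_space e j" shows "\<Phi> J r \<in> graded p e"
  unfolding \<Phi>_def
proof (rule graded_sum)
  fix j
  show "fixed_basis j * [:r j:] \<in> graded p e"
  proof (cases "p * j \<le> e")
    case True
    then have "fixed_basis j * [:r j:] \<in> graded p (p * j + (e - p * j))"
      using assms[of j] by (intro graded_mult fixed_basis_graded graded_const) (simp add: coeff_space_def)
    then show ?thesis using True by simp
  next
    case False
    then show ?thesis using assms[of j] by (simp add: coeff_space_def)
  qed
qed

lemma \<Phi>_fixed: "(\<tau> p ^^ p) (\<Phi> J r) = \<Phi> J r"
  unfolding \<Phi>_def by (simp only: tau_pow_sum tau_pow_mult fixed_basis_fixed const_fixed)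

lemma degree_\<Phi>: "\<Phi> J r \<noteq> 0 \<Longrightarrow> degree (\<Phi> J r) < p * J"
proof (induction J)
  case (Suc J)
  have "degree (fixed_basis J * [:r J:]) \<le> p * J" using degree_mult_le[of "fixed_basis J" "[:r J:]"] degree_fixed_basis by simp
  moreover have "degree (\<Phi> J r) \<le> p * J" using Suc by (cases "\<Phi> J r = 0") auto
  ultimately have "degree (\<Phi> (Suc J) r) \<le> p * J" unfolding \<Phi>_Suc by (intro degree_add_le)
  then show ?case using p0 by simp
qed (simp add: \<Phi>_0)

lemma coeff_\<Phi>: "coeff (\<Phi> (Suc J) r) (p * J) = r J"
proof -
  have "coeff (\<Phi> J r) (p * J) = 0" using degree_\<Phi>[of J r] by (cases "\<Phi> J r = 0") (auto intro: coeff_eq_0)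
  then show ?thesis unfolding \<Phi>_Suc using coeff_fixed_basis[of J] by simp
qed

lemma \<Phi>_unique: "\<Phi> J r = 0 \<Longrightarrow> j < J \<Longrightarrow> r j = 0"
proof (induction J)
  case (Suc J)
  have "r J = 0" using coeff_\<Phi>[of J r] Suc.prems by simp
  then show ?case using Suc by (cases "j = J") (auto simp: \<Phi>_Suc)
qed simp

text \<open>Division by \<open>fixed_basis k\<close>: translation by \<open>x\<^sub>1\<close> changes the coefficient of \<open>t\<^bsup>n-1\<^esup>\<close> by \<open>n x\<^sub>1\<close> times the leading
  coefficient, so an invariant has degree \<open>n = pk\<close>, and its leading term can be removed.\<close>

lemma fixed_normal_form:
  assumes "f \<in> graded p e" "(\<tau> p ^^ p) f = f"
  shows "\<exists>r. (\<forall>j. r j \<in> coeff_space e j) \<and> f = \<Phi> (Suc (e div p)) r"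
  using assms
proof (induction "if f = 0 then 0 else Suc (degree f)" arbitrary: f rule: less_induct)
  case less
  show ?case
  proof (cases "f = 0")
    case True
    have "\<Phi> J (\<lambda>_. 0) = 0" for J by (simp add: \<Phi>_def)
    then show ?thesis using True by (intro exI[of _ "\<lambda>_. 0"]) (auto simp: coeff_space_def)
  next
    case False
    define d where "d = degree f"
    have pd: "p dvd d"
    proof (cases "d = 0")
      case False
      have "coeff f (d - 1) = coeff f (d - 1) + of_nat d * var_sum p * coeff f d"
        using coeff_shift[of f d "var_sum p"] less.prems(2) False tau_pow_p[OF p0(1), of f] by (simp add: d_def)
      then have "of_nat d * var_sum p * coeff f d = 0" by simp
      moreover have "coeff f d \<noteq> 0" using \<open>f \<noteq> 0\<close> by (simp add: d_def)
      ultimately have "(of_nat d :: 'f mpoly) = 0" using var_sum_nonzero[OF p0(1), where 'f = 'f] by simp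
      then show ?thesis using of_nat_eq_0_iff_char_dvd[where 'a = "'f mpoly"] CHAR_mpoly[where 'f = 'f] char by simp
    qed simp
    then obtain k where k: "d = p * k" by auto
    define c where "c = coeff f d"
    have de: "d \<le> e" using graded_degree[OF less.prems(1)] by (simp add: d_def)
    have c: "c \<in> sym_component p (e - p * k)" using less.prems(1) de k by (auto simp: c_def graded_def)
    define g where "g = f - fixed_basis k * [:c:]"
    have Gc: "fixed_basis k * [:c:] \<in> graded p e"
      using graded_mult[OF fixed_basis_graded graded_const[OF c], of k] k de by simp
    have gg: "g \<in> graded p e" unfolding g_def by (rule graded_diff[OF less.prems(1) Gc])
    have gf: "(\<tau> p ^^ p) g = g"
      unfolding g_def by (simp only: tau_pow_diff tau_pow_mult fixed_basis_fixed const_fixed less.prems(2))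
    have dG: "degree (fixed_basis k * [:c:]) \<le> d" using degree_mult_le[of "fixed_basis k" "[:c:]"] degree_fixed_basis k by simp
    have "coeff (fixed_basis k * [:c:]) d = c" using coeff_fixed_basis[of k] k by simp
    then have cg: "coeff g d = 0" by (simp add: g_def c_def)
    have dg: "degree g \<le> d" unfolding g_def using dG by (intro degree_diff_le) (simp add: d_def)
    have "g \<noteq> 0 \<Longrightarrow> degree g \<noteq> d" using cg leading_coeff_0_iff by blast
    then have "(if g = 0 then 0 else Suc (degree g)) < (if f = 0 then 0 else Suc (degree f))"
      using dg \<open>f \<noteq> 0\<close> by (auto simp: d_def)
    then obtain r where r: "\<forall>j. r j \<in> coeff_space e j" "g = \<Phi> (Suc (e div p)) r" using less.hyps[OF _ gg gf] by blast
    define s where "s j = (if j = k then c else 0)" for j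
    have ks: "k < Suc (e div p)" using de k p0 by (simp add: less_Suc_eq_le less_eq_div_iff_mult_less_eq mult.commute)
    have "\<Phi> (Suc (e div p)) s = (\<Sum>j\<in>{k}. fixed_basis j * [:s j:])"
      unfolding \<Phi>_def using ks by (intro sum.mono_neutral_right) (auto simp: s_def)
    then have ps: "\<Phi> (Suc (e div p)) s = fixed_basis k * [:c:]" by (simp add: s_def)
    have "f = \<Phi> (Suc (e div p)) (\<lambda>j. r j + s j)"
      unfolding \<Phi>_add r(2)[symmetric] ps by (simp add: g_def)
    moreover have "r j + s j \<in> coeff_space e j" for j
      using r(1)[rule_format, of j] c k de by (auto simp: s_def coeff_space_def intro: sym_component_add)
    ultimately show ?thesis by (intro exI[of _ "\<lambda>j. r j + s j"]) simp
  qed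
qed

lemma \<Delta>_\<Phi>: "\<Delta> (\<Phi> (Suc J) r) = \<Phi> J (\<lambda>j. rotate_vars p (r j) - r j + of_nat (Suc j) * \<nu> * rotate_vars p (r (Suc j)))
    + fixed_basis J * [:rotate_vars p (r J) - r J:]"
proof (induction J)
  case 0
  have "\<tau> p (fixed_basis 0) = fixed_basis 0" using fixed_basis_tau[of 0] by simp
  then have "\<Delta> (\<Phi> (Suc 0) r) = fixed_basis 0 * ([:rotate_vars p (r 0):] - [:r 0:])"
    by (simp only: \<Phi>_Suc \<Phi>_0 tau_mult tau_const right_diff_distrib add_0_left)
  then show ?case by (simp add: \<Phi>_0)
next
  case (Suc J)
  have of: "of_nat n = [:of_nat n :: 'f mpoly:]" for n by (simp add: of_nat_poly)
  have "\<Delta> (\<Phi> (Suc (Suc J)) r) = \<Delta> (\<Phi> (Suc J) r) + \<Delta> (fixed_basis (Suc J) * [:r (Suc J):])"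
    unfolding \<Phi>_Suc[of "Suc J"] by (simp add: tau_add)
  also have "\<Delta> (fixed_basis (Suc J) * [:r (Suc J):])
    = fixed_basis (Suc J) * [:rotate_vars p (r (Suc J)) - r (Suc J):] + fixed_basis J * [:of_nat (Suc J) * \<nu> * rotate_vars p (r (Suc J)):]"
  proof -
    have "\<tau> p (fixed_basis (Suc J) * [:r (Suc J):]) = (fixed_basis (Suc J) + of_nat (Suc J) * [:\<nu>:] * fixed_basis J) * [:rotate_vars p (r (Suc J)):]"
      using fixed_basis_tau[of "Suc J"] by (simp only: tau_mult tau_const) simp
    also have "\<dots> = fixed_basis (Suc J) * [:rotate_vars p (r (Suc J)):] + fixed_basis J * (of_nat (Suc J) * [:\<nu>:] * [:rotate_vars p (r (Suc J)):])"
      by (simp only: distrib_right) (simp only: ac_simps)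
    also have "of_nat (Suc J) * [:\<nu>:] * [:rotate_vars p (r (Suc J)):] = [:of_nat (Suc J) * \<nu> * rotate_vars p (r (Suc J)):]"
      unfolding of by simp
    finally have t: "\<tau> p (fixed_basis (Suc J) * [:r (Suc J):]) = fixed_basis (Suc J) * [:rotate_vars p (r (Suc J)):] + fixed_basis J * [:of_nat (Suc J) * \<nu> * rotate_vars p (r (Suc J)):]" .
    have "[:rotate_vars p (r (Suc J)) - r (Suc J):] = [:rotate_vars p (r (Suc J)):] - [:r (Suc J):]" by simp
    then show ?thesis unfolding t by (simp only: right_diff_distrib) (simp only: algebra_simps)
  qed
  finally have *: "\<Delta> (\<Phi> (Suc (Suc J)) r) = \<Phi> J (\<lambda>j. rotate_vars p (r j) - r j + of_nat (Suc j) * \<nu> * rotate_vars p (r (Suc j)))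
      + fixed_basis J * [:rotate_vars p (r J) - r J:]
      + (fixed_basis (Suc J) * [:rotate_vars p (r (Suc J)) - r (Suc J):] + fixed_basis J * [:of_nat (Suc J) * \<nu> * rotate_vars p (r (Suc J)):])"
    unfolding Suc.IH .
  have "[:rotate_vars p (r J) - r J + of_nat (Suc J) * \<nu> * rotate_vars p (r (Suc J)):]
      = [:rotate_vars p (r J) - r J:] + [:of_nat (Suc J) * \<nu> * rotate_vars p (r (Suc J)):]" by simp
  then show ?case unfolding * \<Phi>_Suc[of J] by (simp only: distrib_left ac_simps)
qed

section \<open>The action of \<open>\<tau>\<close> on the \<open>\<tau>\<^sup>p\<close>-invariants\<close>

definition free_comb :: "nat \<Rightarrow> nat \<Rightarrow> 'f mpoly poly set"
  where "free_comb e J = {\<Phi> J r | r. \<forall>j. r j \<in> free_coeff_space e j}"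

lemma free_coeff_space_subset: "r \<in> free_coeff_space e j \<Longrightarrow> r \<in> coeff_space e j"
  by (auto simp: free_coeff_space_def coeff_space_def free_part_component split: if_splits)

lemma free_coeff_space_0 [simp]: "0 \<in> free_coeff_space e j" by (simp add: free_coeff_space_def)

lemma free_coeff_space_add: "r \<in> free_coeff_space e j \<Longrightarrow> s \<in> free_coeff_space e j \<Longrightarrow> r + s \<in> free_coeff_space e j"
  by (auto simp: free_coeff_space_def free_part_add split: if_splits)

lemma free_coeff_space_diff: "r \<in> free_coeff_space e j \<Longrightarrow> s \<in> free_coeff_space e j \<Longrightarrow> r - s \<in> free_coeff_space e j"
  by (auto simp: free_coeff_space_def free_part_diff split: if_splits)

lemma free_coeff_space_rotate: "r \<in> free_coeff_space e j \<Longrightarrow> rotate_vars p r \<in> free_coeff_space e j"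
  using free_part_rotate[OF p0(1)] by (auto simp: free_coeff_space_def split: if_splits)

lemma free_coeff_space_of_nat: "r \<in> free_coeff_space e j \<Longrightarrow> of_nat n * r \<in> free_coeff_space e j"
  by (induction n) (auto simp: distrib_right intro: free_coeff_space_add)

lemma free_coeff_space_shift: assumes "r \<in> free_coeff_space e (Suc j)" shows "\<nu> * r \<in> free_coeff_space e j"
proof (cases "p * Suc j \<le> e")
  case True
  then have "var_prod p * r \<in> free_part p (e - p * Suc j + p)"
    using assms by (intro free_part_mult_var_prod p0) (simp add: free_coeff_space_def)
  moreover have "e - p * Suc j + p = e - p * j" "p * j \<le> e" using True by auto
  moreover have "\<nu> * r = fscale \<beta> (var_prod p * r)" by (simp add: \<nu>_def fscale_eq_mult mult.assoc)
  ultimately show ?thesis by (simp add: free_coeff_space_def free_part_fscale)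
next
  case False
  then have "r = 0" using assms by (simp add: free_coeff_space_def)
  then show ?thesis by simp
qed

lemma free_comb_I: "(\<And>j. r j \<in> free_coeff_space e j) \<Longrightarrow> \<Phi> J r \<in> free_comb e J"
  unfolding free_comb_def by blast

lemma free_comb_zero: "0 \<in> free_comb e J"
proof -
  have "\<Phi> J (\<lambda>_. 0) = 0" by (simp add: \<Phi>_def)
  then show ?thesis using free_comb_I[of "\<lambda>_. 0" e J] by simp
qed

lemma free_comb_E: assumes "f \<in> free_comb e J" obtains r where "\<And>j. r j \<in> free_coeff_space e j" "f = \<Phi> J r"
  using assms unfolding free_comb_def by blast

lemma free_comb_diff: assumes "f \<in> free_comb e J" "g \<in> free_comb e J" shows "f - g \<in> free_comb e J"
proof -
  obtain r s where "\<And>j. r j \<in> free_coeff_space e j" "f = \<Phi> J r" "\<And>j. s j \<in> free_coeff_space e j" "g = \<Phi> J s"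
    using assms free_comb_E by metis
  then show ?thesis using free_comb_I[of "\<lambda>j. r j - s j" e J] by (simp add: \<Phi>_diff free_coeff_space_diff)
qed

lemma free_comb_top:
  assumes "f \<in> free_comb e (Suc J)"
  obtains f' r where "f' \<in> free_comb e J" "r \<in> free_coeff_space e J" "f = f' + fixed_basis J * [:r:]"
  using assms by (elim free_comb_E) (metis free_comb_I \<Phi>_Suc)

lemma free_comb_top_I: assumes "f' \<in> free_comb e J" "r \<in> free_coeff_space e J" shows "f' + fixed_basis J * [:r:] \<in> free_comb e (Suc J)"
proof -
  obtain s where s: "\<And>j. s j \<in> free_coeff_space e j" "f' = \<Phi> J s" using assms(1) free_comb_E by metis
  have "\<Phi> (Suc J) (s(J := r)) = f' + fixed_basis J * [:r:]"
    unfolding \<Phi>_Suc s(2) using \<Phi>_cong[of J "s(J := r)" s] by simp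
  moreover have "(s(J := r)) j \<in> free_coeff_space e j" for j using s(1) assms(2) by simp
  ultimately show ?thesis using free_comb_I by metis
qed

lemma free_comb_Delta_top:
  assumes "f' \<in> free_comb e J" "r \<in> free_coeff_space e J"
  shows "\<exists>g\<in>free_comb e J. \<Delta> (f' + fixed_basis J * [:r:]) = g + fixed_basis J * [:rotate_vars p r - r:]"
proof -
  obtain s where s: "\<And>j. s j \<in> free_coeff_space e j" "f' = \<Phi> J s" using assms(1) free_comb_E by metis
  let ?s = "s(J := r)"
  have S: "?s j \<in> free_coeff_space e j" for j using s(1) assms(2) by simp
  have "f' + fixed_basis J * [:r:] = \<Phi> (Suc J) ?s"
    unfolding \<Phi>_Suc s(2) using \<Phi>_cong[of J "s(J := r)" s] by simp
  then have "\<Delta> (f' + fixed_basis J * [:r:]) = \<Phi> J (\<lambda>j. rotate_vars p (?s j) - ?s j + of_nat (Suc j) * \<nu> * rotate_vars p (?s (Suc j)))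
      + fixed_basis J * [:rotate_vars p r - r:]"
    using \<Delta>_\<Phi>[of J ?s] by simp
  moreover have "rotate_vars p (?s j) - ?s j + of_nat (Suc j) * \<nu> * rotate_vars p (?s (Suc j)) \<in> free_coeff_space e j" for j
    unfolding mult.assoc by (intro free_coeff_space_add free_coeff_space_diff free_coeff_space_rotate free_coeff_space_of_nat free_coeff_space_shift S)
  then have "\<Phi> J (\<lambda>j. rotate_vars p (?s j) - ?s j + of_nat (Suc j) * \<nu> * rotate_vars p (?s (Suc j))) \<in> free_comb e J"
    by (rule free_comb_I)
  ultimately show ?thesis by (rule bexI)
qed

lemma free_comb_Delta: "f \<in> free_comb e J \<Longrightarrow> \<Delta> f \<in> free_comb e J"
proof (induction J)
  case 0
  then have "f = 0" by (auto simp: free_comb_def \<Phi>_0)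
  then show ?case using free_comb_zero by simp
next
  case (Suc J)
  obtain f' r where f: "f' \<in> free_comb e J" "r \<in> free_coeff_space e J" "f = f' + fixed_basis J * [:r:]" using free_comb_top[OF Suc.prems] by blast
  obtain g where g: "g \<in> free_comb e J" "\<Delta> f = g + fixed_basis J * [:rotate_vars p r - r:]" using free_comb_Delta_top[OF f(1,2)] f(3) by blast
  show ?case unfolding g(2) using g(1) f(2) by (intro free_comb_top_I free_coeff_space_diff free_coeff_space_rotate)
qed

lemma free_comb_Delta_pow: "f \<in> free_comb e J \<Longrightarrow> (\<Delta> ^^ k) f \<in> free_comb e J"
  by (induction k) (auto intro: free_comb_Delta)

lemma free_comb_graded: "f \<in> free_comb e J \<Longrightarrow> f \<in> graded p e"
  by (elim free_comb_E) (auto intro: \<Phi>_graded free_coeff_space_subset)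

lemma free_comb_fixed: "f \<in> free_comb e J \<Longrightarrow> (\<tau> p ^^ p) f = f"
  by (elim free_comb_E) (simp add: \<Phi>_fixed)

lemma Delta_p: "(\<Delta> ^^ p) q = (\<tau> p ^^ p) q - q"
  using D_eq[OF p char, of q] by (simp add: D_def)

lemma Delta_pow_diff: "(\<Delta> ^^ k) (f - g) = (\<Delta> ^^ k) f - (\<Delta> ^^ k) g"
  by (induction k) (auto simp: tau_diff)

lemma Delta_pow_add: "(\<Delta> ^^ k) (f + g) = (\<Delta> ^^ k) f + (\<Delta> ^^ k) g"
  by (induction k) (auto simp: tau_add)

lemma Delta_pow_0 [simp]: "(\<Delta> ^^ k) 0 = 0"
  by (induction k) auto

text \<open>The number of terms filters these combinations. On the coefficient of the top one, \<open>\<tau>\<close> acts as the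
  rotation alone, and there an element of trace zero is a difference. Subtracting the corresponding
  element of the image of \<open>\<Delta>\<close> lowers the number of terms.\<close>

lemma free_comb_free: "f \<in> free_comb e J \<Longrightarrow> (\<Delta> ^^ (p - 1)) f = 0 \<Longrightarrow> \<exists>g\<in>free_comb e J. f = \<Delta> g"
proof (induction J arbitrary: f)
  case 0
  then have "f = 0" by (auto simp: free_comb_def \<Phi>_0)
  then show ?case using free_comb_zero by force
next
  case (Suc J)
  obtain f' r where f: "f' \<in> free_comb e J" "r \<in> free_coeff_space e J" "f = f' + fixed_basis J * [:r:]" using free_comb_top[OF Suc.prems(1)] by blast
  let ?\<delta> = "\<lambda>r. rotate_vars p r - r"
  have "\<exists>g\<in>free_comb e J. (\<Delta> ^^ k) f = g + fixed_basis J * [:(?\<delta> ^^ k) r:] \<and> (?\<delta> ^^ k) r \<in> free_coeff_space e J" for k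
  proof (induction k)
    case (Suc k)
    then obtain g where g: "g \<in> free_comb e J" "(\<Delta> ^^ k) f = g + fixed_basis J * [:(?\<delta> ^^ k) r:]" "(?\<delta> ^^ k) r \<in> free_coeff_space e J" by blast
    obtain h where h: "h \<in> free_comb e J" "\<Delta> ((\<Delta> ^^ k) f) = h + fixed_basis J * [:rotate_vars p ((?\<delta> ^^ k) r) - (?\<delta> ^^ k) r:]"
      using free_comb_Delta_top[OF g(1,3)] unfolding g(2)[symmetric] by blast
    have "rotate_vars p ((?\<delta> ^^ k) r) - (?\<delta> ^^ k) r \<in> free_coeff_space e J" using g(3) by (intro free_coeff_space_diff free_coeff_space_rotate)
    then show ?case using h by auto
  qed (use f in auto)
  from this[of "p - 1"] obtain g where g: "g \<in> free_comb e J" "0 = g + fixed_basis J * [:(?\<delta> ^^ (p - 1)) r:]" using Suc.prems(2) by auto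
  obtain s where s: "\<And>j. s j \<in> free_coeff_space e j" "g = \<Phi> J s" using g(1) free_comb_E by metis
  define S where "S = s(J := (?\<delta> ^^ (p - 1)) r)"
  have "\<Phi> (Suc J) S = 0" unfolding \<Phi>_Suc using g(2) s(2) \<Phi>_cong[of J S s] by (simp add: S_def)
  then have rz: "(?\<delta> ^^ (p - 1)) r = 0" using \<Phi>_unique[of "Suc J" S J] by (simp add: S_def)
  have "\<exists>v\<in>free_coeff_space e J. r = ?\<delta> v"
  proof (cases "p * J \<le> e")
    case True
    then show ?thesis using free_part_trace_zero[OF p char _ rz] f(2) by (simp add: free_coeff_space_def)
  next
    case False
    then have "r = ?\<delta> 0" using f(2) by (simp add: free_coeff_space_def)
    then show ?thesis using free_coeff_space_0 by blast
  qed
  then obtain v where v: "v \<in> free_coeff_space e J" "r = ?\<delta> v" by blast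
  define h where "h = fixed_basis J * [:v:]"
  have hQ: "0 + h \<in> free_comb e (Suc J)" unfolding h_def by (rule free_comb_top_I[OF free_comb_zero v(1)])
  obtain q where q: "q \<in> free_comb e J" "\<Delta> (0 + h) = q + fixed_basis J * [:r:]"
    using free_comb_Delta_top[OF free_comb_zero v(1)] unfolding h_def v(2) by blast
  have fh: "f - \<Delta> h \<in> free_comb e J" using free_comb_diff[OF f(1) q(1)] q(2) f(3) by simp
  have "(\<Delta> ^^ (p - 1)) (\<Delta> h) = (\<Delta> ^^ p) h"
    by (rule funpow_pred(2)[OF p0(1), symmetric])
  also have "\<dots> = 0" using Delta_p[of h] free_comb_fixed[OF hQ] by simp
  finally have "(\<Delta> ^^ (p - 1)) (f - \<Delta> h) = 0" using Suc.prems(2) by (simp add: Delta_pow_diff)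
  then obtain g' where g': "g' \<in> free_comb e J" "f - \<Delta> h = \<Delta> g'" using Suc.IH[OF fh] by blast
  have "f = \<Delta> (g' + fixed_basis J * [:v:])" using g'(2) by (simp add: h_def tau_add algebra_simps)
  moreover have "g' + fixed_basis J * [:v:] \<in> free_comb e (Suc J)" by (rule free_comb_top_I[OF g'(1) v(1)])
  ultimately show ?case by blast
qed

text \<open>The coefficient of \<open>fixed_basis j\<close> has degree \<open>e - pj\<close>, which is not divisible by \<open>p\<close> either. So there are
  no monomials fixed by the rotation.\<close>

lemma fixed_free:
  assumes e: "\<not> p dvd e" and f: "f \<in> graded p e" "(\<Delta> ^^ (p - 1)) f = 0"
  shows "\<exists>g\<in>graded p e. (\<tau> p ^^ p) g = g \<and> f = \<Delta> g"
proof -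
  have "(\<Delta> ^^ p) f = \<Delta> ((\<Delta> ^^ (p - 1)) f)" by (rule funpow_pred(1)[OF p0(1)])
  then have "(\<tau> p ^^ p) f = f" using Delta_p[of f] f(2) by simp
  then obtain r where r: "\<forall>j. r j \<in> coeff_space e j" "f = \<Phi> (Suc (e div p)) r" using fixed_normal_form f by blast
  have "r j \<in> free_coeff_space e j" for j
  proof (cases "p * j \<le> e")
    case True
    then have "\<not> p dvd e - p * j" using e by (metis dvd_diffD dvd_triv_left)
    then show ?thesis using r(1)[rule_format, of j] component_free[OF p0(1)] True by (simp add: free_coeff_space_def coeff_space_def)
  qed (use r(1)[rule_format, of j] in \<open>simp add: free_coeff_space_def coeff_space_def\<close>)
  then have "f \<in> free_comb e (Suc (e div p))" using r(2) free_comb_I by blast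
  then show ?thesis using free_comb_free f(2) free_comb_graded free_comb_fixed by blast
qed

text \<open>For \<open>e = Bp\<close>, the products \<open>fixed_basis j * var_prod\<^bsup>B-j\<^esup>\<close> with \<open>j \<le> B\<close> span a complement of the free
  combinations in the invariants of degree \<open>e\<close>. Under \<open>\<Delta>\<close> they behave like the monomials \<open>X\<^sup>j\<close> under \<open>\<beta> d/dX\<close>.\<close>

definition norm_comb :: "nat \<Rightarrow> (nat \<Rightarrow> 'f) \<Rightarrow> 'f mpoly poly"
  where "norm_comb B \<alpha> = \<Phi> (Suc B) (\<lambda>j. fscale (\<alpha> j) (var_prod p ^ (B - j)))"

definition deriv :: "(nat \<Rightarrow> 'f) \<Rightarrow> (nat \<Rightarrow> 'f)"
  where "deriv \<alpha> j = of_nat (Suc j) * \<beta> * \<alpha> (Suc j)"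

lemma degree_split: "B * p - p * j = (B - j) * p"
  by (simp add: diff_mult_distrib mult.commute[of p j])

lemma norm_comb_coeff_space: "j \<le> B \<Longrightarrow> fscale c (var_prod p ^ (B - j)) \<in> coeff_space (B * p) j"
proof -
  assume j: "j \<le> B"
  have "var_prod p ^ (B - j) \<in> (sym_component p ((B - j) * p) :: 'f mpoly set)" by (rule sym_component_power[OF var_prod_component])
  moreover have "p * j \<le> B * p" using j by (simp add: mult.commute)
  ultimately show ?thesis unfolding coeff_space_def degree_split by (simp add: sym_component_fscale)
qed

lemma norm_comb_graded: "norm_comb B \<alpha> \<in> graded p (B * p)"
proof -
  have "norm_comb B \<alpha> = \<Phi> (Suc B) (\<lambda>j. if j \<le> B then fscale (\<alpha> j) (var_prod p ^ (B - j)) else 0)"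
    unfolding norm_comb_def by (rule \<Phi>_cong) simp
  also have "\<dots> \<in> graded p (B * p)"
  proof (rule \<Phi>_graded)
    fix j
    show "(if j \<le> B then fscale (\<alpha> j) (var_prod p ^ (B - j)) else 0) \<in> coeff_space (B * p) j"
      using norm_comb_coeff_space[of j B "\<alpha> j"] by (auto simp: coeff_space_def)
  qed
  finally show ?thesis .
qed

lemma norm_comb_fixed: "(\<tau> p ^^ p) (norm_comb B \<alpha>) = norm_comb B \<alpha>" unfolding norm_comb_def by (rule \<Phi>_fixed)

lemma Delta_norm_comb: assumes "\<alpha> (Suc B) = 0" shows "\<Delta> (norm_comb B \<alpha>) = norm_comb B (deriv \<alpha>)"
proof -
  have fx: "rotate_vars p (fscale c (var_prod p ^ k)) = (fscale c (var_prod p ^ k) :: 'f mpoly)" for c k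
    by (simp add: rotate_fscale rotate_power)
  have st: "of_nat (Suc j) * \<nu> * fscale (\<alpha> (Suc j)) (var_prod p ^ (B - Suc j)) = fscale (deriv \<alpha> j) (var_prod p ^ (B - j))" if "j < B" for j
  proof -
    have "B - j = Suc (B - Suc j)" using that by simp
    moreover have "(of_nat (Suc j) :: 'f mpoly) = const (of_nat (Suc j))" by (rule const_of_nat[symmetric])
    ultimately show ?thesis
      unfolding \<nu>_def fscale_eq_mult deriv_def const_mult by (simp only: power_Suc ac_simps)
  qed
  have "\<Delta> (norm_comb B \<alpha>) = \<Phi> B (\<lambda>j. of_nat (Suc j) * \<nu> * fscale (\<alpha> (Suc j)) (var_prod p ^ (B - Suc j)))"
    unfolding norm_comb_def \<Delta>_\<Phi> fx by (simp del: of_nat_Suc)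
  also have "\<dots> = \<Phi> B (\<lambda>j. fscale (deriv \<alpha> j) (var_prod p ^ (B - j)))" by (rule \<Phi>_cong) (rule st)
  also have "\<dots> = norm_comb B (deriv \<alpha>)" unfolding norm_comb_def \<Phi>_Suc using assms by (simp add: deriv_def)
  finally show ?thesis .
qed

lemma deriv_pow: "(deriv ^^ k) \<alpha> j = \<beta> ^ k * of_nat (\<Prod>i<k. Suc (j + i)) * \<alpha> (j + k)"
proof (induction k arbitrary: j)
  case (Suc k)
  have "(\<Prod>i<Suc k. Suc (j + i)) = Suc j * (\<Prod>i<k. Suc (Suc j + i))"
    unfolding prod.lessThan_Suc_shift by simp
  moreover have "(deriv ^^ Suc k) \<alpha> j = of_nat (Suc j) * \<beta> * (\<beta> ^ k * of_nat (\<Prod>i<k. Suc (Suc j + i)) * \<alpha> (Suc j + k))"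
    unfolding funpow.simps(2) o_apply deriv_def[of "(deriv ^^ k) \<alpha>"] Suc ..
  ultimately show ?case by (simp only: of_nat_mult power_Suc add_Suc add_Suc_right ac_simps)
qed simp

lemma Delta_pow_norm_comb: assumes "\<And>j. B < j \<Longrightarrow> \<alpha> j = 0" shows "(\<Delta> ^^ k) (norm_comb B \<alpha>) = norm_comb B ((deriv ^^ k) \<alpha>)"
proof (induction k)
  case (Suc k)
  have "(deriv ^^ k) \<alpha> (Suc B) = 0" using assms by (simp add: deriv_pow)
  then show ?case using Suc Delta_norm_comb by simp
qed simp

lemma norm_comb_add: "norm_comb B (\<lambda>j. \<alpha> j + \<gamma> j) = norm_comb B \<alpha> + norm_comb B \<gamma>"
  unfolding norm_comb_def \<Phi>_add[symmetric] by (simp add: fs.scale_left_distrib)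

lemma norm_comb_scale: "norm_comb B (\<lambda>j. c * \<alpha> j) = [:const c:] * norm_comb B \<alpha>"
  unfolding norm_comb_def \<Phi>_def sum_distrib_left
proof (rule sum.cong[OF refl])
  fix j
  have "[:fscale (c * \<alpha> j) (var_prod p ^ (B - j)):] = [:const c:] * [:fscale (\<alpha> j) (var_prod p ^ (B - j)):]"
    by (simp add: fscale_eq_mult const_mult mult.assoc)
  then show "fixed_basis j * [:fscale (c * \<alpha> j) (var_prod p ^ (B - j)):] = [:const c:] * (fixed_basis j * [:fscale (\<alpha> j) (var_prod p ^ (B - j)):])"
    by (simp only: ac_simps)
qed

lemma norm_comb_free_comb_independent:
  assumes "norm_comb B \<alpha> + q = 0" "q \<in> free_comb e (Suc B)" "j \<le> B" shows "\<alpha> j = 0"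
proof -
  obtain r where r: "\<And>j. r j \<in> free_coeff_space e j" "q = \<Phi> (Suc B) r" using assms(2) free_comb_E by metis
  have "\<Phi> (Suc B) (\<lambda>j. fscale (\<alpha> j) (var_prod p ^ (B - j)) + r j) = 0"
    unfolding \<Phi>_add using assms(1) r(2) by (simp add: norm_comb_def)
  then have "fscale (\<alpha> j) (var_prod p ^ (B - j)) + r j = 0" using \<Phi>_unique[of "Suc B" _ j] assms(3) by fastforce
  moreover have "Poly_Mapping.lookup (r j) (const_exponent p (B - j)) = 0"
    using r(1)[of j] lookup_free_part_const_exponent[OF p0(1)] by (auto simp: free_coeff_space_def split: if_splits)
  ultimately have "Poly_Mapping.lookup (fscale (\<alpha> j) (var_prod p ^ (B - j))) (const_exponent p (B - j)) = 0"
    by (metis add.right_neutral lookup_add lookup_zero)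
  then show ?thesis by (simp add: var_prod_power)
qed

lemma fixed_split:
  assumes f: "f \<in> graded p (B * p)" "(\<tau> p ^^ p) f = f"
  shows "\<exists>\<alpha> q. (\<forall>j>B. \<alpha> j = 0) \<and> q \<in> free_comb (B * p) (Suc B) \<and> f = norm_comb B \<alpha> + q"
proof -
  have "B * p div p = B" using p0 by simp
  then obtain r where r: "\<forall>j. r j \<in> coeff_space (B * p) j" "f = \<Phi> (Suc B) r" using fixed_normal_form[OF f] by auto
  define \<alpha> where "\<alpha> j = (if j \<le> B then Poly_Mapping.lookup (r j) (const_exponent p (B - j)) else 0)" for j
  define s where "s j = (if j \<le> B then r j - fscale (\<alpha> j) (var_prod p ^ (B - j)) else 0)" for j
  have "s j \<in> free_coeff_space (B * p) j" for j
  proof (cases "j \<le> B")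
    case True
    note eq = degree_split[of B j]
    have le: "p * j \<le> B * p" using True by (simp add: mult.commute)
    have "r j \<in> sym_component p ((B - j) * p)" using r(1)[rule_format, of j] le by (simp add: coeff_space_def eq)
    then have "r j - fscale (\<alpha> j) (var_prod p ^ (B - j)) \<in> free_part p ((B - j) * p)"
      using component_split[OF p0(1)] True by (simp add: \<alpha>_def)
    then show ?thesis using True le by (simp add: s_def free_coeff_space_def eq)
  qed (simp add: s_def)
  then have "\<Phi> (Suc B) s \<in> free_comb (B * p) (Suc B)" by (rule free_comb_I)
  moreover have "f = norm_comb B \<alpha> + \<Phi> (Suc B) s"
    unfolding norm_comb_def \<Phi>_add[symmetric] r(2) by (rule \<Phi>_cong) (simp add: s_def)
  ultimately show ?thesis by (intro exI[of _ \<alpha>] exI[of _ "\<Phi> (Suc B) s"]) (simp add: \<alpha>_def)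
qed

lemma prod_nonzero: assumes "\<And>i. i < k \<Longrightarrow> \<not> p dvd Suc (j + i)" shows "(of_nat (\<Prod>i<k. Suc (j + i)) :: 'f) \<noteq> 0"
  using assms p unfolding of_nat_eq_0_field by (subst prime_dvd_prod_iff) auto

lemma fixed_basis_eq_norm_comb: "fixed_basis B = norm_comb B (\<lambda>j. if j = B then 1 else 0)"
proof -
  have "norm_comb B (\<lambda>j. if j = B then 1 else 0) = (\<Sum>j\<in>{B}. fixed_basis j * [:fscale (if j = B then 1 else 0) (var_prod p ^ (B - j)):])"
    unfolding norm_comb_def \<Phi>_def by (rule sum.mono_neutral_right) auto
  then show ?thesis by simp
qed

text \<open>A polynomial in \<open>X\<close> that is killed by the \<open>(p-1)\<close>-st derivative has no \<open>X\<^sup>j\<close> with \<open>j \<equiv> -1\<close> modulo \<open>p\<close>. All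
  other \<open>X\<^sup>j\<close> with \<open>j < B\<close> are derivatives of polynomials of degree at most \<open>B\<close>, so that only \<open>X\<^sup>B\<close> is left.\<close>

lemma fixed_defect:
  assumes f: "f \<in> graded p (B * p)" "(\<Delta> ^^ (p - 1)) f = 0"
  shows "\<exists>g\<in>graded p (B * p). \<exists>c. (\<tau> p ^^ p) g = g \<and> f = \<Delta> g + [:const c:] * fixed_basis B \<and> (B mod p = p - 1 \<longrightarrow> c = 0)"
proof -
  have "(\<Delta> ^^ p) f = \<Delta> ((\<Delta> ^^ (p - 1)) f)" by (rule funpow_pred(1)[OF p0(1)])
  then have "(\<tau> p ^^ p) f = f" using Delta_p[of f] f(2) by simp
  then obtain \<alpha> q where \<alpha>: "\<forall>j>B. \<alpha> j = 0" and q: "q \<in> free_comb (B * p) (Suc B)" and fe: "f = norm_comb B \<alpha> + q"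
    using fixed_split f by blast
  have z: "norm_comb B ((deriv ^^ (p - 1)) \<alpha>) + (\<Delta> ^^ (p - 1)) q = 0"
    using f(2) Delta_pow_norm_comb[of B \<alpha> "p - 1"] \<alpha> unfolding fe Delta_pow_add by simp
  have dz: "(deriv ^^ (p - 1)) \<alpha> j = 0" if "j \<le> B" for j
    by (rule norm_comb_free_comb_independent[OF z free_comb_Delta_pow[OF q] that])
  have "norm_comb B ((deriv ^^ (p - 1)) \<alpha>) = 0"
    unfolding norm_comb_def \<Phi>_def using dz by (intro sum.neutral) simp
  then have "(\<Delta> ^^ (p - 1)) q = 0" using z by simp
  then obtain g where g: "g \<in> free_comb (B * p) (Suc B)" "q = \<Delta> g" using free_comb_free[OF q] by blast
  have a0: "\<alpha> j = 0" if j: "j mod p = p - 1" "j \<le> B" for j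
  proof -
    define l where "l = j - (p - 1)"
    have jl: "j = l + (p - 1)" using j(1) by (metis l_def le_add_diff_inverse2 mod_less_eq_dividend)
    have pl: "p dvd l" using j(1) p0 by (metis jl add_diff_cancel_right' dvd_minus_mod l_def)
    have "\<not> p dvd Suc (l + i)" if "i < p - 1" for i
    proof
      assume "p dvd Suc (l + i)"
      then have "p dvd Suc i" using pl by (metis add_Suc_right dvd_add_right_iff)
      then show False using that by (auto dest: dvd_imp_le)
    qed
    then have "(of_nat (\<Prod>i<p - 1. Suc (l + i)) :: 'f) \<noteq> 0" by (rule prod_nonzero)
    moreover have "(deriv ^^ (p - 1)) \<alpha> l = 0" using dz[of l] jl j by simp
    ultimately show ?thesis using \<beta> unfolding deriv_pow jl by simp
  qed
  define \<gamma> where "\<gamma> j = (if 0 < j \<and> j \<le> B then \<alpha> (j - 1) / (of_nat j * \<beta>) else 0)" for j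
  have \<gamma>: "deriv \<gamma> j = \<alpha> j" if "j < B" for j
  proof (cases "p dvd Suc j")
    case True
    then have "j mod p = p - 1" using p0 by (metis Suc_diff_1 diff_Suc_1 dvd_imp_mod_0 mod_Suc nat.distinct(1))
    then have "\<alpha> j = 0" using a0 that by simp
    then show ?thesis by (simp add: deriv_def \<gamma>_def)
  next
    case False
    then have "(of_nat (Suc j) :: 'f) \<noteq> 0" using of_nat_eq_0_field by blast
    then show ?thesis using \<beta> that by (simp add: deriv_def \<gamma>_def del: of_nat_Suc)
  qed
  have "norm_comb B \<alpha> = \<Delta> (norm_comb B \<gamma>) + [:const (\<alpha> B):] * fixed_basis B"
  proof -
    have "\<Delta> (norm_comb B \<gamma>) + [:const (\<alpha> B):] * fixed_basis B = norm_comb B (\<lambda>j. deriv \<gamma> j + \<alpha> B * (if j = B then 1 else 0))"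
      unfolding norm_comb_add norm_comb_scale fixed_basis_eq_norm_comb[symmetric] using Delta_norm_comb[of \<gamma> B] by (simp add: \<gamma>_def)
    also have "\<dots> = norm_comb B \<alpha>" unfolding norm_comb_def
    proof (rule \<Phi>_cong)
      fix j assume "j < Suc B"
      then have "deriv \<gamma> j + \<alpha> B * (if j = B then 1 else 0) = \<alpha> j"
        using \<gamma>[of j] by (cases "j = B") (auto simp: deriv_def \<gamma>_def)
      then show "fscale (deriv \<gamma> j + \<alpha> B * (if j = B then 1 else 0)) (var_prod p ^ (B - j)) = fscale (\<alpha> j) (var_prod p ^ (B - j))"
        by simp
    qed
    finally show ?thesis by simp
  qed
  then have "f = \<Delta> (norm_comb B \<gamma> + g) + [:const (\<alpha> B):] * fixed_basis B" unfolding fe g(2) by (simp add: tau_add)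
  moreover have "norm_comb B \<gamma> + g \<in> graded p (B * p)" by (intro graded_add norm_comb_graded free_comb_graded[OF g(1)])
  moreover have "(\<tau> p ^^ p) (norm_comb B \<gamma> + g) = norm_comb B \<gamma> + g" using norm_comb_fixed free_comb_fixed[OF g(1)] by (simp add: tau_pow_add)
  moreover have "B mod p = p - 1 \<longrightarrow> \<alpha> B = 0" using a0 by simp
  ultimately show ?thesis by blast
qed

text \<open>The derivative of order \<open>b + 1\<close> of a polynomial in \<open>X\<close> of degree at most \<open>B = ap + b\<close> has no term \<open>X\<^bsup>ap\<^esup>\<close>, but
  the derivative of order \<open>b\<close> of \<open>X\<^sup>B\<close> is a nonzero multiple of it.\<close>

lemma fixed_pure:
  assumes B: "B = a * p + b" "b < p" and f: "f \<in> graded p (B * p)" "(\<tau> p ^^ p) f = f" and c: "c \<noteq> 0"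
  shows "(\<Delta> ^^ Suc b) f \<noteq> [:const c:] * (\<Delta> ^^ b) (fixed_basis B)"
proof
  assume eq: "(\<Delta> ^^ Suc b) f = [:const c:] * (\<Delta> ^^ b) (fixed_basis B)"
  obtain \<alpha> q where \<alpha>: "\<forall>j>B. \<alpha> j = 0" and q: "q \<in> free_comb (B * p) (Suc B)" and fe: "f = norm_comb B \<alpha> + q"
    using fixed_split f by blast
  let ?\<epsilon> = "\<lambda>j. if j = B then 1 else 0 :: 'f"
  have fixed_basis: "(\<Delta> ^^ b) (fixed_basis B) = norm_comb B ((deriv ^^ b) ?\<epsilon>)" unfolding fixed_basis_eq_norm_comb by (rule Delta_pow_norm_comb) simp
  have "norm_comb B ((deriv ^^ Suc b) \<alpha>) + (\<Delta> ^^ Suc b) q = [:const c:] * norm_comb B ((deriv ^^ b) ?\<epsilon>)"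
    using eq Delta_pow_norm_comb[of B \<alpha> "Suc b"] \<alpha> unfolding fe Delta_pow_add fixed_basis by simp
  moreover have "norm_comb B (\<lambda>j. (deriv ^^ Suc b) \<alpha> j + (- c) * (deriv ^^ b) ?\<epsilon> j) =
      norm_comb B ((deriv ^^ Suc b) \<alpha>) - [:const c:] * norm_comb B ((deriv ^^ b) ?\<epsilon>)"
    unfolding norm_comb_add norm_comb_scale by (simp add: single_uminus)
  moreover have "X + Z = W \<Longrightarrow> V = X - W \<Longrightarrow> V + Z = 0" for X Z W V :: "'f mpoly poly"
    by (drule sym[of "X + Z"]) simp
  ultimately have "norm_comb B (\<lambda>j. (deriv ^^ Suc b) \<alpha> j + (- c) * (deriv ^^ b) ?\<epsilon> j) + (\<Delta> ^^ Suc b) q = 0"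
    by blast
  then have "(deriv ^^ Suc b) \<alpha> (a * p) + (- c) * (deriv ^^ b) ?\<epsilon> (a * p) = 0"
    by (rule norm_comb_free_comb_independent[OF _ free_comb_Delta_pow[OF q]]) (simp add: B)
  moreover have "(deriv ^^ Suc b) \<alpha> (a * p) = 0" unfolding deriv_pow using \<alpha> B by simp
  moreover have "(of_nat (\<Prod>i<b. Suc (a * p + i)) :: 'f) \<noteq> 0"
  proof (rule prod_nonzero)
    fix i assume i: "i < b"
    show "\<not> p dvd Suc (a * p + i)"
    proof
      assume "p dvd Suc (a * p + i)"
      then have "p dvd Suc i" by (metis add_Suc_right dvd_add_right_iff dvd_triv_right)
      then show False using i B(2) by (auto dest: dvd_imp_le)
    qed
  qed
  moreover have "(deriv ^^ b) ?\<epsilon> (a * p) = \<beta> ^ b * of_nat (\<Prod>i<b. Suc (a * p + i))"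
    unfolding deriv_pow using B(1) by (simp del: of_nat_prod of_nat_Suc)
  ultimately have "(- c) * (\<beta> ^ b * P) = 0 \<and> P \<noteq> 0" if "P = of_nat (\<Prod>i<b. Suc (a * p + i))" for P
    unfolding that by (metis add_0)
  then show False using c \<beta> by auto
qed

text \<open>The derivative of order \<open>b\<close> of \<open>X\<^sup>B\<close> is a multiple of \<open>X\<^bsup>ap\<^esup>\<close>, which has derivative zero.\<close>

lemma Delta_pow_fixed_basis:
  assumes B: "B = a * p + b" "b < p"
  shows "\<exists>c. c \<noteq> 0 \<and> (\<Delta> ^^ b) (fixed_basis B) = [:const c:] * (norm_t ^ a * [:var_prod p ^ b:])" "(\<Delta> ^^ Suc b) (fixed_basis B) = 0"
proof -
  let ?\<epsilon> = "\<lambda>j. if j = B then 1 else 0 :: 'f"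
  have fixed_basis: "(\<Delta> ^^ k) (fixed_basis B) = norm_comb B ((deriv ^^ k) ?\<epsilon>)" for k unfolding fixed_basis_eq_norm_comb by (rule Delta_pow_norm_comb) simp
  have nd: "\<not> p dvd Suc (a * p + i)" if i: "i < b" for i
  proof
    assume "p dvd Suc (a * p + i)"
    then have "p dvd Suc i" by (metis add_Suc_right dvd_add_right_iff dvd_triv_right)
    then show False using i B(2) by (auto dest: dvd_imp_le)
  qed
  define c where "c = (deriv ^^ b) ?\<epsilon> (a * p)"
  have c0: "c \<noteq> 0" unfolding c_def deriv_pow using prod_nonzero[OF nd, of b] \<beta> B by simp
  have z: "(deriv ^^ b) ?\<epsilon> j = 0" if "j \<noteq> a * p" for j unfolding deriv_pow using that B by auto
  have "norm_comb B ((deriv ^^ b) ?\<epsilon>) = (\<Sum>j\<in>{a * p}. fixed_basis j * [:fscale ((deriv ^^ b) ?\<epsilon> j) (var_prod p ^ (B - j)):])"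
    unfolding norm_comb_def \<Phi>_def
  proof (rule sum.mono_neutral_right)
    show "{a * p} \<subseteq> {..<Suc B}" using B by simp
    show "\<forall>j\<in>{..<Suc B} - {a * p}. fixed_basis j * [:fscale ((deriv ^^ b) ?\<epsilon> j) (var_prod p ^ (B - j)):] = 0" by (simp add: z)
  qed simp
  also have "\<dots> = fixed_basis (a * p) * [:fscale c (var_prod p ^ b):]" using B by (simp add: c_def)
  also have "fixed_basis (a * p) = norm_t ^ a" using p0 by (simp add: fixed_basis_def falling_def)
  also have "[:fscale c (var_prod p ^ b):] = [:const c:] * [:var_prod p ^ b:]" by (simp add: fscale_eq_mult)
  finally have "(\<Delta> ^^ b) (fixed_basis B) = [:const c:] * (norm_t ^ a * [:var_prod p ^ b:])" unfolding fixed_basis by (simp only: ac_simps)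
  then show "\<exists>c. c \<noteq> 0 \<and> (\<Delta> ^^ b) (fixed_basis B) = [:const c:] * (norm_t ^ a * [:var_prod p ^ b:])" using c0 by blast
  have "(deriv ^^ Suc b) ?\<epsilon> j = 0" for j
  proof (cases "j + Suc b = B")
    case True
    then have "Suc j = a * p" using B by simp
    moreover have "(\<Prod>i<Suc b. Suc (j + i)) = Suc j * (\<Prod>i<b. Suc (j + Suc i))"
      unfolding prod.lessThan_Suc_shift by simp
    ultimately have "p dvd (\<Prod>i<Suc b. Suc (j + i))" by simp
    then have "(of_nat (\<Prod>i<Suc b. Suc (j + i)) :: 'f) = 0" using of_nat_eq_0_field by blast
    then show ?thesis unfolding deriv_pow by simp
  next
    case False
    then show ?thesis unfolding deriv_pow by simp
  qed
  then show "(\<Delta> ^^ Suc b) (fixed_basis B) = 0" unfolding fixed_basis norm_comb_def \<Phi>_def by (intro sum.neutral) simp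
qed

section \<open>The layers of a homogeneous component\<close>

definition tfall :: "nat \<Rightarrow> 'f mpoly poly" where "tfall k = falling tvar [:var_sum p:] k"

lemma tfall_graded: "tfall k \<in> graded p k"
  using falling_graded[OF graded_tvar graded_const[OF var_sum_component], of p k] by (simp add: tfall_def)

lemma Delta_p_eq_D: "\<Delta> ^^ p = D p"
  using D_eq[OF p char] by auto

lemma Delta_mult_p: "(\<Delta> ^^ (p * j)) x = (D p ^^ j) x"
  by (simp add: Delta_p_eq_D[symmetric] funpow_mult)

lemma D_pow_fixed_mult: "(\<tau> p ^^ p) f = f \<Longrightarrow> (D p ^^ j) (f * g) = f * (D p ^^ j) g"
  by (induction j) (auto simp: D_mult_fixed)

text \<open>The \<open>\<tau>\<^sup>p\<close>-invariants act as scalars, and \<open>\<tau>\<^sup>p\<close> translates \<open>t\<close> by \<open>x\<^sub>1\<close>.\<close>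

lemma D_tfall:
  assumes g: "(\<tau> p ^^ p) g = g"
  shows "(D p ^^ j) (tfall j * g) = of_nat (fact j) * [:var_sum p ^ j:] * g"
proof (induction j)
  case (Suc j)
  let ?x = "[:var_sum p:] :: 'f mpoly poly"
  have t: "(\<tau> p ^^ p) tvar = tvar + ?x" by (simp add: tau_pow_p[OF p0(1)] pcompose_pCons)
  have "(\<tau> p ^^ p) (tfall (Suc j)) = falling (tvar + ?x) ?x (Suc j)"
    unfolding tfall_def tau_pow_falling t const_fixed ..
  also have "\<dots> = tfall (Suc j) + of_nat (Suc j) * ?x * tfall j" unfolding tfall_def by (rule falling_shift)
  finally have t': "(\<tau> p ^^ p) (tfall (Suc j)) = tfall (Suc j) + of_nat (Suc j) * ?x * tfall j" .
  have "D p (tfall (Suc j) * g) = (of_nat (Suc j) * ?x) * (tfall j * g)"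
    unfolding D_def tau_pow_mult g t' by (simp only: distrib_right add_diff_cancel_left' mult.assoc)
  moreover have "(\<tau> p ^^ p) (of_nat (Suc j) * ?x) = of_nat (Suc j) * ?x"
    by (simp only: tau_pow_mult tau_pow_of_nat const_fixed)
  ultimately have "(D p ^^ Suc j) (tfall (Suc j) * g) = (of_nat (Suc j) * ?x) * (D p ^^ j) (tfall j * g)"
    by (simp only: funpow_Suc_right o_apply D_pow_fixed_mult)
  moreover have "[:var_sum p ^ Suc j:] = ?x * [:var_sum p ^ j:]" by simp
  ultimately show ?case unfolding Suc by (simp only: fact_Suc of_nat_mult of_nat_id ac_simps)
qed (simp add: tfall_def falling_def one_pCons[symmetric])

lemma tau_var_sum_power: "\<tau> p [:var_sum p ^ j:] = [:var_sum p ^ j :: 'f mpoly:]"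
  using tau_pow_var_sum[of 1 p j] by simp

lemma Delta_pow_var_sum: "(\<Delta> ^^ k) ([:var_sum p ^ j:] * f) = [:var_sum p ^ j:] * (\<Delta> ^^ k) f"
proof (induction k)
  case (Suc k)
  then show ?case by (simp only: funpow.simps(2) o_apply tau_mult tau_var_sum_power right_diff_distrib)
qed simp

lemma var_sum_power_nonzero: "[:var_sum p ^ j:] \<noteq> (0 :: 'f mpoly poly)"
  using var_sum_nonzero[OF p0(1), where 'f = 'f] by simp

lemma D_pow_order: "p \<le> j \<Longrightarrow> (D p ^^ j) (q :: 'f mpoly poly) = 0"
proof -
  assume "p \<le> j"
  have "(\<Delta> ^^ (p * p)) q = 0"
    using tau_op.unipotent_frobenius2[OF p char, of p q] tau_pow_square[of q] by (simp add: power2_eq_square)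
  then have "(D p ^^ p) q = 0" by (simp add: Delta_mult_p)
  moreover have "(D p ^^ j) q = (D p ^^ (j - p)) ((D p ^^ p) q)"
    using \<open>p \<le> j\<close> by (metis comp_apply funpow_add le_add_diff_inverse2)
  moreover have "(D p ^^ k) 0 = (0 :: 'f mpoly poly)" for k
    unfolding Delta_mult_p[symmetric] by simp
  ultimately show ?thesis by simp
qed

lemma fact_nonzero: "j < p \<Longrightarrow> (of_nat (fact j) :: 'f) \<noteq> 0"
  using of_nat_eq_0_field prime_dvd_fact_iff[OF p] by (metis not_le)

lemma of_nat_const: "(of_nat n :: 'f mpoly poly) = [:const (of_nat n):]"
  by (simp add: of_nat_poly const_of_nat)

text \<open>A preimage of \<open>x\<^sub>1\<^sup>j g\<close> under \<open>\<Delta>\<^bsup>pj\<^esup>\<close>, for a \<open>\<tau>\<^sup>p\<close>-invariant \<open>g\<close> and \<open>j < p\<close>.\<close>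

definition lift :: "nat \<Rightarrow> 'f mpoly poly \<Rightarrow> 'f mpoly poly"
  where "lift j g = [:const (inverse (of_nat (fact j))):] * (tfall j * g)"

lemma D_lift:
  assumes "(\<tau> p ^^ p) g = g" "j < p" shows "(D p ^^ j) (lift j g) = [:var_sum p ^ j:] * g"
proof -
  have "(D p ^^ j) (lift j g) = ([:const (inverse (of_nat (fact j))):] * of_nat (fact j)) * ([:var_sum p ^ j:] * g)"
    unfolding lift_def D_pow_fixed_mult[OF const_fixed] D_tfall[OF assms(1)] by (simp only: mult.assoc)
  also have "[:const (inverse (of_nat (fact j))):] * of_nat (fact j) = (1 :: 'f mpoly poly)"
    unfolding of_nat_const const_poly_mult left_inverse[OF fact_nonzero[OF assms(2)]] by (simp add: one_pCons)
  finally show ?thesis by simp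
qed

lemma lift_graded: assumes "g \<in> graded p e" shows "lift j g \<in> graded p (j + e)"
  unfolding lift_def using graded_pscale[OF graded_mult[OF tfall_graded assms]] by (simp add: pscale_def)

text \<open>Division by \<open>x\<^sub>1\<^sup>j\<close> turns the layer \<open>j\<close> of degree \<open>d\<close> into a question on \<open>\<tau>\<^sup>p\<close>-invariants of degree \<open>d - j\<close>.\<close>

lemma layer_quotient:
  assumes x: "x \<in> graded p d" "(\<Delta> ^^ (p * j + (p - 1))) x = 0" and j: "j \<le> d"
  obtains f where "(\<Delta> ^^ (p * j)) x = [:var_sum p ^ j:] * f" "f \<in> graded p (d - j)" "(\<Delta> ^^ (p - 1)) f = 0"
proof -
  obtain f where f: "(D p ^^ j) x = [:var_sum p ^ j:] * f" "f \<in> graded p (d - j)"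
    using D_pow_divisible[OF p0(1) x(1), of j] j by auto
  have "(\<Delta> ^^ (p * j + (p - 1))) x = (\<Delta> ^^ (p - 1)) ((\<Delta> ^^ (p * j)) x)" by (rule funpow_add_apply)
  then have "[:var_sum p ^ j:] * (\<Delta> ^^ (p - 1)) f = 0" using x(2) f(1) by (simp only: Delta_mult_p Delta_pow_var_sum)
  then have "(\<Delta> ^^ (p - 1)) f = 0" using var_sum_power_nonzero[of j] by (simp only: mult_eq_0_iff simp_thms)
  then show ?thesis using that f by (simp add: Delta_mult_p)
qed

lemma Delta_lift:
  assumes "(\<tau> p ^^ p) g = g" "j < p" shows "(\<Delta> ^^ (p * j + 1)) (lift j g) = [:var_sum p ^ j:] * \<Delta> g"
proof -
  have "(\<Delta> ^^ (p * j + 1)) (lift j g) = \<Delta> ((D p ^^ j) (lift j g))" by (simp add: Delta_mult_p)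
  then show ?thesis unfolding D_lift[OF assms] by (simp only: tau_mult tau_var_sum_power right_diff_distrib)
qed

text \<open>For \<open>j < p\<close> the degree \<open>d - j\<close> is divisible by \<open>p\<close> only if \<open>j = c\<close>; the layers from \<open>p\<close> on
  and those above \<open>d\<close> are zero.\<close>

lemma graded_layer_induced:
  assumes d: "d = B * p + c" "c < p" and j: "j \<noteq> c"
    and x: "x \<in> graded p d" "(\<Delta> ^^ (p * j + (p - 1))) x = 0"
  shows "\<exists>y\<in>graded p d. (\<Delta> ^^ (p * j)) x = (\<Delta> ^^ (p * j + 1)) y"
proof (cases "j < p \<and> j \<le> d")
  case True
  obtain f where f: "(\<Delta> ^^ (p * j)) x = [:var_sum p ^ j:] * f" "f \<in> graded p (d - j)" "(\<Delta> ^^ (p - 1)) f = 0"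
    using layer_quotient[OF x] True by blast
  have "\<not> p dvd d - j"
  proof
    assume "p dvd d - j"
    then have "d mod p = j mod p" using True by (metis mod_eq_dvd_iff_nat)
    then show False using d j True by simp
  qed
  then obtain g where g: "g \<in> graded p (d - j)" "(\<tau> p ^^ p) g = g" "f = \<Delta> g" using fixed_free f by blast
  have "lift j g \<in> graded p d" using lift_graded[OF g(1), of j] True by simp
  moreover have "(\<Delta> ^^ (p * j)) x = (\<Delta> ^^ (p * j + 1)) (lift j g)"
    unfolding f(1) g(3) using Delta_lift[OF g(2), of j] True by simp
  ultimately show ?thesis by blast
next
  case False
  then have "(\<Delta> ^^ (p * j)) x = 0"
    using D_pow_order[of j x] D_pow_divisible[OF p0(1) x(1), of j] by (auto simp: Delta_mult_p not_less not_le)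
  then have "(\<Delta> ^^ (p * j)) x = (\<Delta> ^^ (p * j + 1)) 0" using Delta_pow_0[of "p * j + 1"] by simp
  then show ?thesis using graded_0 by blast
qed

text \<open>The generator of the non-induced summand, which lives in the layer \<open>c\<close>.\<close>

definition summand_gen :: "nat \<Rightarrow> nat \<Rightarrow> 'f mpoly poly" where "summand_gen B c = lift c (fixed_basis B)"

lemma summand_gen_graded: "summand_gen B c \<in> graded p (B * p + c)"
  using lift_graded[OF fixed_basis_graded, of c B] by (simp add: summand_gen_def add.commute mult.commute)

lemma D_pow_summand_gen: "c < p \<Longrightarrow> (\<Delta> ^^ (p * c)) (summand_gen B c) = [:var_sum p ^ c:] * fixed_basis B"
  unfolding summand_gen_def Delta_mult_p by (rule D_lift[OF fixed_basis_fixed])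

lemma graded_layer_defect:
  assumes d: "d = B * p + c" "c < p"
    and x: "x \<in> graded p d" "(\<Delta> ^^ (p * c + (p - 1))) x = 0"
  shows "\<exists>y\<in>graded p d. \<exists>\<alpha>. (\<Delta> ^^ (p * c)) x = (\<Delta> ^^ (p * c + 1)) y + [:const \<alpha>:] * (\<Delta> ^^ (p * c)) (summand_gen B c) \<and>
    (B mod p = p - 1 \<longrightarrow> \<alpha> = 0)"
proof -
  obtain f where f: "(\<Delta> ^^ (p * c)) x = [:var_sum p ^ c:] * f" "f \<in> graded p (d - c)" "(\<Delta> ^^ (p - 1)) f = 0"
    using layer_quotient[OF x] d by auto
  obtain g \<alpha> where g: "g \<in> graded p (B * p)" "(\<tau> p ^^ p) g = g" "f = \<Delta> g + [:const \<alpha>:] * fixed_basis B" "B mod p = p - 1 \<longrightarrow> \<alpha> = 0"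
    using fixed_defect[of f B] f d by auto
  have "lift c g \<in> graded p d" using lift_graded[OF g(1), of c] d by (simp add: add.commute)
  moreover have "(\<Delta> ^^ (p * c)) x = (\<Delta> ^^ (p * c + 1)) (lift c g) + [:const \<alpha>:] * (\<Delta> ^^ (p * c)) (summand_gen B c)"
    unfolding f(1) g(3) Delta_lift[OF g(2) d(2)] D_pow_summand_gen[OF d(2)] by (simp only: distrib_left ac_simps)
  ultimately show ?thesis using g(4) by blast
qed

lemma summand_gen_bottom:
  assumes B: "B = a * p + b" "b < p" and c: "c < p"
  shows "\<exists>\<gamma>. \<gamma> \<noteq> 0 \<and> (\<Delta> ^^ (p * c + b)) (summand_gen B c) = [:const \<gamma>:] * (norm_t ^ a * [:var_prod p ^ b:] * [:var_sum p ^ c:])"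
    "(\<Delta> ^^ (p * c + b + 1)) (summand_gen B c) = 0"
proof -
  have *: "(\<Delta> ^^ (p * c + k)) (summand_gen B c) = [:var_sum p ^ c:] * (\<Delta> ^^ k) (fixed_basis B)" for k
  proof -
    have "(\<Delta> ^^ (p * c + k)) (summand_gen B c) = (\<Delta> ^^ k) ((\<Delta> ^^ (p * c)) (summand_gen B c))" by (rule funpow_add_apply)
    then show ?thesis unfolding D_pow_summand_gen[OF c] Delta_pow_var_sum .
  qed
  obtain \<gamma> where g: "\<gamma> \<noteq> 0" "(\<Delta> ^^ b) (fixed_basis B) = [:const \<gamma>:] * (norm_t ^ a * [:var_prod p ^ b:])" using Delta_pow_fixed_basis(1)[OF B] by blast
  have "(\<Delta> ^^ (p * c + b)) (summand_gen B c) = [:const \<gamma>:] * (norm_t ^ a * [:var_prod p ^ b:] * [:var_sum p ^ c:])"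
    unfolding * g(2) by (simp only: ac_simps)
  then show "\<exists>\<gamma>. \<gamma> \<noteq> 0 \<and> (\<Delta> ^^ (p * c + b)) (summand_gen B c) = [:const \<gamma>:] * (norm_t ^ a * [:var_prod p ^ b:] * [:var_sum p ^ c:])"
    using g(1) by blast
  have "(\<Delta> ^^ (p * c + Suc b)) (summand_gen B c) = 0" unfolding * Delta_pow_fixed_basis(2)[OF B] by simp
  then show "(\<Delta> ^^ (p * c + b + 1)) (summand_gen B c) = 0" by simp
qed

text \<open>An element \<open>y\<close> as excluded here would be killed by \<open>\<Delta>\<^bsup>pc+p\<^esup>\<close>. Then \<open>\<Delta>\<^bsup>pc\<^esup> y\<close> is \<open>x\<^sub>1\<^sup>c\<close> times a \<open>\<tau>\<^sup>p\<close>-invariant, for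
  which the equation is impossible by comparison of coefficients (\<open>fixed_pure\<close>).\<close>

lemma summand_gen_pure:
  assumes d: "d = B * p + c" and B: "B = a * p + b" "b + 1 < p" and c: "c < p" and y: "y \<in> graded p d"
  shows "(\<Delta> ^^ (p * c + b)) (summand_gen B c) \<noteq> (\<Delta> ^^ (p * c + b + 1)) y"
proof
  assume eq: "(\<Delta> ^^ (p * c + b)) (summand_gen B c) = (\<Delta> ^^ (p * c + b + 1)) y"
  have "(\<Delta> ^^ (p * c + p)) y = (\<Delta> ^^ (p - b - 1)) ((\<Delta> ^^ (p * c + b + 1)) y)"
  proof -
    have "p * c + p = (p * c + b + 1) + (p - b - 1)" using B by simp
    then show ?thesis by (simp only: funpow_add_apply[symmetric])
  qed
  also have "\<dots> = (\<Delta> ^^ (p - b - 2)) ((\<Delta> ^^ (p * c + b + 1)) (summand_gen B c))"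
  proof -
    have "p - b - 1 = Suc (p - b - 2)" using B by simp
    then have "(\<Delta> ^^ (p - b - 1)) ((\<Delta> ^^ (p * c + b)) (summand_gen B c)) = (\<Delta> ^^ (p - b - 2)) (\<Delta> ((\<Delta> ^^ (p * c + b)) (summand_gen B c)))"
      by (simp only: funpow_Suc_right o_apply)
    then show ?thesis unfolding eq[symmetric] by simp
  qed
  also have "\<dots> = 0" using summand_gen_bottom(2)[of B a b c] B c by (simp only: Delta_pow_0)
  finally have z: "(\<Delta> ^^ (p * c + p)) y = 0" .
  have cd: "c \<le> d" using d by simp
  obtain f where f: "(D p ^^ c) y = [:var_sum p ^ c:] * f" "f \<in> graded p (d - c)"
    using D_pow_divisible[OF p0(1) y, of c] cd by auto
  have "(\<Delta> ^^ (p * c + p)) y = (\<Delta> ^^ p) ((\<Delta> ^^ (p * c)) y)" by (rule funpow_add_apply)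
  then have "[:var_sum p ^ c:] * (\<Delta> ^^ p) f = 0" using z f(1) by (simp only: Delta_mult_p Delta_pow_var_sum)
  then have "(\<Delta> ^^ p) f = 0" using var_sum_power_nonzero[of c] by (simp only: mult_eq_0_iff simp_thms)
  then have ff: "(\<tau> p ^^ p) f = f" using Delta_p[of f] by simp
  have "(\<Delta> ^^ (p * c + b + 1)) y = (\<Delta> ^^ Suc b) ((\<Delta> ^^ (p * c)) y)"
    using funpow_add_apply[of "p * c" "Suc b" \<Delta> y] by simp
  then have 1: "(\<Delta> ^^ (p * c + b + 1)) y = [:var_sum p ^ c:] * (\<Delta> ^^ Suc b) f" unfolding Delta_mult_p f(1) Delta_pow_var_sum .
  have "(\<Delta> ^^ (p * c + b)) (summand_gen B c) = (\<Delta> ^^ b) ((\<Delta> ^^ (p * c)) (summand_gen B c))" by (rule funpow_add_apply)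
  then have 2: "(\<Delta> ^^ (p * c + b)) (summand_gen B c) = [:var_sum p ^ c:] * (\<Delta> ^^ b) (fixed_basis B)" unfolding D_pow_summand_gen[OF c] Delta_pow_var_sum .
  have "(\<Delta> ^^ Suc b) f = (\<Delta> ^^ b) (fixed_basis B)"
    using eq var_sum_power_nonzero[of c] unfolding 1 2 by (simp only: mult_cancel_left simp_thms)
  moreover have "(\<Delta> ^^ Suc b) f \<noteq> [:const 1:] * (\<Delta> ^^ b) (fixed_basis B)"
    using fixed_pure[of B a b f 1] B f(2) ff d by simp
  ultimately show False by (simp add: one_pCons[symmetric])
qed

end

section \<open>The action on the symmetric algebra\<close>

text \<open>The transposed \<open>k\<close>-th power of the Jordan matrix, applied to the \<open>i\<close>-th variable.\<close>

definition jordan_form :: "nat \<Rightarrow> nat \<Rightarrow> nat \<Rightarrow> 'f::field mpoly"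
  where "jordan_form n k i = (\<Sum>j<n. fscale (Poly_Mapping.lookup ((jordan ^^ k) (basis_vec j)) i) (Var j))"

definition jordan_subst :: "nat \<Rightarrow> nat \<Rightarrow> 'f::field mpoly \<Rightarrow> 'f mpoly"
  where "jordan_subst n k = poly_subst (jordan_form n k)"

lemma jordan_pow_linear:
  "(jordan ^^ k) (\<Sum>i\<in>I. fscale (c i) (v i)) = (\<Sum>i\<in>I. fscale (c i) ((jordan ^^ k) (v i)))"
proof (induction k)
  case (Suc k)
  have j0: "jordan 0 = 0" using jordan_fscale[of 0 0] by simp
  have "jordan (\<Sum>i\<in>I. fscale (c i) (u i)) = (\<Sum>i\<in>I. fscale (c i) (jordan (u i)))" for u
    by (induction I rule: infinite_finite_induct) (auto simp: j0 jordan_add jordan_fscale)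
  then show ?case using Suc by simp
qed simp

lemma jordan_pow_V_space: "v \<in> V_space m \<Longrightarrow> (jordan ^^ k) v \<in> V_space m"
  by (induction k) (auto simp: V_space_iff lookup_jordan)

lemma basis_vec_V_space: "j < n \<Longrightarrow> basis_vec j \<in> V_space n"
  by (auto simp: V_space_def)

lemma jordan_subst_comp: "jordan_subst n k (jordan_subst n l f) = jordan_subst n (k + l) (f :: 'f::field mpoly)"
proof -
  have "poly_subst (jordan_form n k) (jordan_form n l i) = (jordan_form n (k + l) i :: 'f mpoly)" for i
  proof -
    let ?J = "\<lambda>k i j. Poly_Mapping.lookup ((jordan ^^ k) (basis_vec j)) i :: 'f"
    have J: "?J (k + l) i h = (\<Sum>j<n. ?J l i j * ?J k j h)" if "h < n" for h
    proof -
      have e: "(jordan ^^ k) (basis_vec h) = (\<Sum>j<n. fscale (?J k j h) (basis_vec j))"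
        by (rule V_space_expand) (intro jordan_pow_V_space basis_vec_V_space that)
      have "(jordan ^^ (k + l)) (basis_vec h) = (jordan ^^ l) ((jordan ^^ k) (basis_vec h))" by (rule funpow_add_apply)
      also have "\<dots> = (\<Sum>j<n. fscale (?J k j h) ((jordan ^^ l) (basis_vec j)))" by (subst e) (rule jordan_pow_linear)
      finally show ?thesis by (simp add: lookup_sum mult.commute)
    qed
    have "poly_subst (jordan_form n k) (jordan_form n l i) = (\<Sum>j<n. \<Sum>h<n. fscale (?J l i j * ?J k j h) (Var h))"
      by (simp add: jordan_form_def poly_subst_sum poly_subst_fscale fs.scale_sum_right)
    also have "\<dots> = (\<Sum>h<n. \<Sum>j<n. fscale (?J l i j * ?J k j h) (Var h))" by (rule sum.swap)
    also have "\<dots> = (\<Sum>h<n. fscale (?J (k + l) i h) (Var h))"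
      by (intro sum.cong refl) (simp add: J fs.scale_sum_left)
    finally show ?thesis by (simp add: jordan_form_def)
  qed
  then show ?thesis unfolding jordan_subst_def poly_subst_poly_subst by simp
qed

lemma jordan_subst_0: assumes "f \<in> sym_component n d" shows "jordan_subst n 0 f = f"
proof -
  have "jordan_form n 0 i = Var i" if "i < n" for i
  proof -
    have "jordan_form n 0 i = (\<Sum>j<n. if j = i then Var i else 0)"
      unfolding jordan_form_def by (rule sum.cong) (auto simp: lookup_single when_def)
    then show ?thesis using that by simp
  qed
  then have "jordan_subst n 0 f = poly_subst Var f"
    unfolding jordan_subst_def using assms by (intro poly_subst_cong) (auto simp: sym_component_def)
  then show ?thesis by (simp add: poly_subst_Var_id)
qed

lemma jordan_subst_mod:
  assumes "prime p" "CHAR('f::field) = p" "n \<le> p ^ 2" "k mod p ^ 2 = l mod p ^ 2"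
  shows "jordan_subst n k = (jordan_subst n l :: 'f mpoly \<Rightarrow> 'f mpoly)"
proof -
  have per: "(jordan ^^ (p ^ 2 * q)) v = v" if "v \<in> (V_space n :: (nat \<Rightarrow>\<^sub>0 'f) set)" for v q
    using jordan_order[OF assms(1-3) that] by (induction q) (simp_all add: funpow_add)
  then have "(jordan ^^ k) (basis_vec j) = (jordan ^^ (k mod p ^ 2)) (basis_vec j :: nat \<Rightarrow>\<^sub>0 'f)" if "j < n" for j k
    using funpow_add_apply[of "p ^ 2 * (k div p ^ 2)" "k mod p ^ 2" jordan "basis_vec j :: nat \<Rightarrow>\<^sub>0 'f"]
    unfolding per[OF basis_vec_V_space[OF that]] by (simp only: mult_div_mod_eq)
  from this[where k = k] this[where k = l] have "jordan_form n k i = (jordan_form n l i :: 'f mpoly)" for i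
    unfolding jordan_form_def assms(4) by (intro sum.cong refl) simp
  then show ?thesis unfolding jordan_subst_def by presburger
qed

lemma jordan_form_component: "jordan_form n k i \<in> sym_component n 1"
  unfolding jordan_form_def by (intro sym_component_sum sym_component_fscale sym_component_Var) auto

lemma jordan_subst_component: "f \<in> sym_component n d \<Longrightarrow> jordan_subst n k f \<in> sym_component n d"
  unfolding jordan_subst_def by (rule poly_subst_in_component[OF _ jordan_form_component])

lemma sym_act_eq: "sym_act G (V_act G \<sigma>) n g = jordan_subst n (exponent G \<sigma> (inv\<^bsub>G\<^esub> g))"
  by (simp add: sym_act_def jordan_subst_def jordan_form_def[abs_def] V_act_def)

lemma sym_component_p2_module:
  assumes p: "prime p" "CHAR('f::field) = p" and G: "group G" "\<sigma> \<in> carrier G" "generate G {\<sigma>} = carrier G" "order G = p ^ 2"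
    and n: "n \<le> p ^ 2"
  shows "p2_module fscale G \<sigma> p (sym_act G (V_act G \<sigma>) n) (sym_act G (V_act G \<sigma>) n \<sigma>)
    (sym_component n d :: 'f mpoly set) ((\<lambda>m. Poly_Mapping.single m 1) ` monomials n d)"
proof -
  interpret G: group G by fact
  let ?T = "sym_act G (V_act G \<sigma>) n \<sigma> :: 'f mpoly \<Rightarrow> 'f mpoly"
  \<comment> \<open>The contragredient action uses inverses: \<open>\<sigma>\<close> acts by the power \<open>E\<close> of the Jordan matrix.\<close>
  define E where "E = exponent G \<sigma> (inv\<^bsub>G\<^esub> \<sigma>)"
  have T: "?T = jordan_subst n E" by (simp add: sym_act_eq E_def)
  have p2: "0 < p ^ 2" using p(1) prime_gt_0_nat by simp
  note Gp = G.generator_pow[OF G(2,3,4) p2]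
  have Tk: "(?T ^^ k) f = jordan_subst n (E * k) f" if "f \<in> sym_component n d" for f k d
    unfolding T using that by (induction k) (auto simp: jordan_subst_0 jordan_subst_comp)
  show ?thesis
  proof (unfold_locales)
    fix g and f :: "'f mpoly" assume g: "g \<in> carrier G" and f: "f \<in> sym_component n d"
    have "\<sigma> [^]\<^bsub>G\<^esub> (exponent G \<sigma> (inv\<^bsub>G\<^esub> g)) = inv\<^bsub>G\<^esub> g" using Gp(1) g by simp
    also have "\<dots> = inv\<^bsub>G\<^esub> (\<sigma> [^]\<^bsub>G\<^esub> exponent G \<sigma> g)" using Gp(1)[OF g] by simp
    also have "\<dots> = (inv\<^bsub>G\<^esub> \<sigma>) [^]\<^bsub>G\<^esub> exponent G \<sigma> g" using G.nat_pow_inv[OF G(2)] by simp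
    also have "\<dots> = (\<sigma> [^]\<^bsub>G\<^esub> E) [^]\<^bsub>G\<^esub> exponent G \<sigma> g" using Gp(1)[of "inv\<^bsub>G\<^esub> \<sigma>"] G(2) by (simp add: E_def)
    also have "\<dots> = \<sigma> [^]\<^bsub>G\<^esub> (E * exponent G \<sigma> g)" by (rule G.nat_pow_pow[OF G(2)])
    finally have "exponent G \<sigma> (inv\<^bsub>G\<^esub> g) mod p ^ 2 = (E * exponent G \<sigma> g) mod p ^ 2" unfolding Gp(2) .
    then have "jordan_subst n (exponent G \<sigma> (inv\<^bsub>G\<^esub> g)) f = jordan_subst n (E * exponent G \<sigma> g) f"
      using jordan_subst_mod[OF p n] by metis
    then show "sym_act G (V_act G \<sigma>) n g f = (?T ^^ exponent G \<sigma> g) f" unfolding Tk[OF f] by (simp add: sym_act_eq)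
  next
    fix f :: "'f mpoly" assume f: "f \<in> sym_component n d"
    have "(?T ^^ (p ^ 2)) f = jordan_subst n 0 f"
      unfolding Tk[OF f] using jordan_subst_mod[OF p n, of "E * p ^ 2" 0] by simp
    then show "(?T ^^ (p ^ 2)) f = f" using jordan_subst_0[OF f] by simp
    show "?T f \<in> sym_component n d" unfolding T by (rule jordan_subst_component[OF f])
  next
    show "fs.subspace (sym_component n d :: 'f mpoly set)"
      by (auto simp: fs.subspace_def sym_component_add sym_component_fscale)
    show "(sym_component n d :: 'f mpoly set) \<subseteq> fs.span ((\<lambda>m. Poly_Mapping.single m 1) ` monomials n d)"
      using sym_component_span by blast
  qed (use p G finite_monomials in
      \<open>auto simp: T jordan_subst_def poly_subst_add poly_subst_fscale\<close>)
qed

text \<open>For a family instead of a set: that its members are distinct is part of the conclusion.\<close>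

lemma (in vector_space) spanning_family_independent:
  assumes S: "finite S" and B: "independent B" "card B = card S" "B \<subseteq> span (v ` S)"
    and a: "(\<Sum>m\<in>S. scale (a m) (v m)) = 0" "m \<in> S"
  shows "a m = 0"
proof (rule ccontr)
  assume "a m \<noteq> 0"
  let ?V = "v ` (S - {m})"
  have "scale (a m) (v m) + (\<Sum>k\<in>S - {m}. scale (a k) (v k)) = 0"
    using a(1) unfolding sum.remove[OF S a(2)] .
  then have "scale (a m) (v m) = - (\<Sum>k\<in>S - {m}. scale (a k) (v k))" by (simp add: eq_neg_iff_add_eq_0)
  also have "\<dots> \<in> span ?V" by (intro span_neg span_sum span_scale span_base) auto
  finally have "scale (inverse (a m)) (scale (a m) (v m)) \<in> span ?V" by (rule span_scale)
  then have "v m \<in> span ?V" using \<open>a m \<noteq> 0\<close> by simp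
  moreover have "v ` S = insert (v m) ?V" using a(2) by auto
  ultimately have "span (v ` S) = span ?V" by (simp add: span_redundant)
  then have "card B \<le> card ?V" using independent_span_bound[of ?V B] B S by simp
  also have "\<dots> \<le> card (S - {m})" using S by (intro card_image_le) simp
  also have "\<dots> < card S" by (rule card_Diff1_less[OF S a(2)])
  finally show False using B(2) by simp
qed

lemma monomial_basis_independent: "fs.independent ((\<lambda>m. Poly_Mapping.single m (1::'f::field)) ` A)"
  unfolding fs.independent_explicit_finite_subsets
proof (intro allI impI ballI)
  fix S u v assume S: "S \<subseteq> (\<lambda>m. Poly_Mapping.single m (1::'f)) ` A" "finite S" "(\<Sum>v\<in>S. fscale (u v) v) = 0" "v \<in> S"
  obtain m where m: "v = Poly_Mapping.single m 1" using S by auto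
  have "Poly_Mapping.lookup (\<Sum>v\<in>S. fscale (u v) v) m = (\<Sum>x\<in>S. if x = v then u x else 0)"
    unfolding lookup_sum
  proof (rule sum.cong[OF refl])
    fix x assume "x \<in> S"
    then obtain k where k: "x = Poly_Mapping.single k 1" using S(1) by auto
    have "x = v \<longleftrightarrow> k = m" unfolding k m by (metis lookup_single_eq lookup_single_not_eq zero_neq_one)
    then show "Poly_Mapping.lookup (fscale (u x) x) m = (if x = v then u x else 0)"
      by (auto simp: k lookup_single when_def)
  qed
  then show "u v = 0" using S by simp
qed

lemma card_monomials_1: "card (monomials n 1) \<le> n"
proof -
  have "monomials n 1 \<subseteq> (\<lambda>i. Poly_Mapping.single i 1) ` {..<n}"
  proof
    fix m assume m: "m \<in> monomials n 1"
    then have "(\<Sum>i<n. Poly_Mapping.lookup m i) = 1" by (simp add: monomials_def total_degree_def)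
    then obtain i where i: "i < n" "Poly_Mapping.lookup m i = 1" "\<And>j. j < n \<Longrightarrow> j \<noteq> i \<Longrightarrow> Poly_Mapping.lookup m j = 0"
      using sum_eq_1_iff[of "{..<n}" "Poly_Mapping.lookup m"] by auto
    have "m = Poly_Mapping.single i 1"
    proof (rule poly_mapping_eqI)
      fix k
      have "\<not> k < n \<Longrightarrow> Poly_Mapping.lookup m k = 0" using m by (auto simp: monomials_def in_keys_iff)
      then show "Poly_Mapping.lookup m k = Poly_Mapping.lookup (Poly_Mapping.single i 1) k"
        using i by (cases "k < n") (auto simp: lookup_single when_def)
    qed
    then show "m \<in> (\<lambda>i. Poly_Mapping.single i 1) ` {..<n}" using i by blast
  qed
  then have "card (monomials n 1) \<le> card ((\<lambda>i. Poly_Mapping.single i (1::nat)) ` {..<n})" by (intro card_mono) auto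
  also have "\<dots> \<le> n" using card_image_le[of "{..<n}"] by simp
  finally show ?thesis .
qed

lemma graded_prod': "finite I \<Longrightarrow> (\<And>i. i \<in> I \<Longrightarrow> f i \<in> graded p (d i)) \<Longrightarrow> (\<Prod>i\<in>I. f i) \<in> graded p (\<Sum>i\<in>I. d i)"
  by (induction I rule: finite_induct) (auto intro: graded_mult)

lemma coeff_const_tvar: "coeff ([:r:] * tvar ^ k) i = (if i = k then r else 0)"
  using Polynomial.coeff_monom[of r k i] by (auto simp: monom_altdef)

text \<open>A monomial in \<open>p + 1\<close> variables is read as one in the model algebra, the last variable being \<open>t\<close>.\<close>

lemma graded_monomial_expand:
  assumes q: "q \<in> graded p (d::nat)"
  shows "q = (\<Sum>m\<in>monomials (p + 1) d. pscale (Poly_Mapping.lookup (coeff q (Poly_Mapping.lookup m p)) (m - Poly_Mapping.single p (Poly_Mapping.lookup m p)))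
      ([:Poly_Mapping.single (m - Poly_Mapping.single p (Poly_Mapping.lookup m p)) (1::'f::field):] * tvar ^ Poly_Mapping.lookup m p))"
    (is "q = ?R")
proof (rule poly_eqI, rule poly_mapping_eqI)
  fix i and m' :: "nat \<Rightarrow>\<^sub>0 nat"
  let ?r = "\<lambda>m. m - Poly_Mapping.single p (Poly_Mapping.lookup m p)"
  let ?n = "m' + Poly_Mapping.single p i"
  have key: "?r m = m' \<and> Poly_Mapping.lookup m p = i \<longleftrightarrow> m = ?n \<and> Poly_Mapping.lookup m' p = 0" for m
  proof
    assume a: "?r m = m' \<and> Poly_Mapping.lookup m p = i"
    then have "Poly_Mapping.lookup m' p = 0" by (auto simp: lookup_minus)
    moreover have "m = ?n" using a by (intro poly_mapping_eqI) (auto simp: lookup_add lookup_minus lookup_single when_def)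
    ultimately show "m = ?n \<and> Poly_Mapping.lookup m' p = 0" by simp
  next
    assume a: "m = ?n \<and> Poly_Mapping.lookup m' p = 0"
    then have "?r m = m'" by (intro poly_mapping_eqI) (auto simp: lookup_add lookup_minus lookup_single when_def)
    then show "?r m = m' \<and> Poly_Mapping.lookup m p = i" using a by (simp add: lookup_add)
  qed
  have "Poly_Mapping.lookup (coeff ?R i) m'
      = (\<Sum>m\<in>monomials (p + 1) d. if ?r m = m' \<and> Poly_Mapping.lookup m p = i then Poly_Mapping.lookup (coeff q i) m' else 0)"
    unfolding coeff_sum lookup_sum
  proof (rule sum.cong[OF refl])
    fix m
    have "pscale c ([:Poly_Mapping.single (?r m) 1:] * tvar ^ k) = [:Poly_Mapping.single (?r m) (c::'f):] * tvar ^ k" for c k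
    proof -
      have "[:const c:] * [:Poly_Mapping.single (?r m) 1:] = [:Poly_Mapping.single (?r m) c:]" by (simp add: mult_single)
      then show ?thesis by (simp only: pscale_def mult.assoc[symmetric])
    qed
    then show "Poly_Mapping.lookup (coeff (pscale (Poly_Mapping.lookup (coeff q (Poly_Mapping.lookup m p)) (?r m))
        ([:Poly_Mapping.single (?r m) 1:] * tvar ^ Poly_Mapping.lookup m p)) i) m'
      = (if ?r m = m' \<and> Poly_Mapping.lookup m p = i then Poly_Mapping.lookup (coeff q i) m' else 0)"
      by (auto simp only: coeff_const_tvar lookup_single when_def lookup_zero split: if_splits)
  qed
  also have "\<dots> = (\<Sum>m\<in>monomials (p + 1) d. if m = ?n then (if Poly_Mapping.lookup m' p = 0 then Poly_Mapping.lookup (coeff q i) m' else 0) else 0)"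
    unfolding key by (intro sum.cong) auto
  also have "\<dots> = (if ?n \<in> monomials (p + 1) d \<and> Poly_Mapping.lookup m' p = 0 then Poly_Mapping.lookup (coeff q i) m' else 0)"
    using finite_monomials[of "p + 1" d] by simp
  also have "\<dots> = Poly_Mapping.lookup (coeff q i) m'"
  proof (cases "Poly_Mapping.lookup (coeff q i) m' = 0")
    case False
    then have "coeff q i \<noteq> 0" by auto
    then have i: "i \<le> d" "coeff q i \<in> sym_component p (d - i)" using q by (auto simp: graded_def split: if_splits)
    then have m': "m' \<in> monomials p (d - i)" using False by (auto simp: sym_component_iff in_keys_iff)
    then have "p \<notin> Poly_Mapping.keys m'" by (auto simp: monomials_def)
    then have l: "Poly_Mapping.lookup m' p = 0" by (simp add: in_keys_iff)
    have "total_degree (p + 1) ?n = (\<Sum>j<p. Poly_Mapping.lookup ?n j) + Poly_Mapping.lookup ?n p"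
      by (simp add: total_degree_def)
    also have "\<dots> = (\<Sum>j<p. Poly_Mapping.lookup m' j) + i"
      using l by (auto simp: lookup_add lookup_single when_def intro!: sum.cong)
    also have "\<dots> = d" using m' i by (simp add: monomials_def total_degree_def)
    finally have td: "total_degree (p + 1) ?n = d" .
    have "Poly_Mapping.keys ?n \<subseteq> {..<p + 1}"
      using keys_add[of m' "Poly_Mapping.single p i"] m' by (auto simp: monomials_def split: if_splits)
    then have "?n \<in> monomials (p + 1) d" using td by (simp add: monomials_def)
    then show ?thesis using l by simp
  qed simp
  finally show "Poly_Mapping.lookup (coeff q i) m' = Poly_Mapping.lookup (coeff ?R i) m'" by (rule sym)
qed

section \<open>Coordinates adapted to a generator\<close>

text \<open>The orbit of \<open>y\<close> consists of the sums \<open>y + z\<^sub>0 + \<dots> + z\<^sub>k\<^sub>-\<^sub>1\<close>, where \<open>z\<^sub>i = T\<^sup>i (T y - y)\<close> depends only on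
  \<open>i\<close> modulo \<open>p\<close>. As the orbit spans the linear forms in \<open>p + 1\<close> variables, the \<open>p + 1\<close> forms
  \<open>y, z\<^sub>0, \<dots>, z\<^sub>p\<^sub>-\<^sub>1\<close> can serve as variables, and in these \<open>T\<close> acts as \<open>\<tau>\<close>.\<close>

locale generator_coordinates =
  fixes p :: nat and T :: "'f::field mpoly \<Rightarrow> 'f mpoly" and h :: "nat \<Rightarrow> 'f mpoly" and y :: "'f mpoly"
  assumes p0: "0 < p"
    and T: "T = poly_subst h"
    and T_component: "\<And>d f. f \<in> sym_component (p + 1) d \<Longrightarrow> T f \<in> sym_component (p + 1) d"
    and y: "y \<in> sym_component (p + 1) 1"
    and period: "(T ^^ p) (T y - y) = T y - y"
    and span: "sym_component (p + 1) 1 \<subseteq> fs.span (range (\<lambda>k. (T ^^ k) y))"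
begin

text \<open>The value \<open>0\<close> from \<open>p\<close> on agrees with \<^const>\<open>cyc_perm\<close>, which fixes these indices.\<close>

definition z :: "nat \<Rightarrow> 'f mpoly" where "z i = (if i < p then (T ^^ i) (T y - y) else 0)"

definition \<Psi> :: "'f mpoly poly \<Rightarrow> 'f mpoly" where "\<Psi> q = poly (map_poly (poly_subst z) q) y"

lemma T_add: "T (f + g) = T f + T g" and T_mult: "T (f * g) = T f * T g" and T_diff: "T (f - g) = T f - T g"
  by (simp_all add: T poly_subst_add poly_subst_mult poly_subst_diff)

lemma T_0: "T 0 = 0" using T_diff[of 0 0] by simp

lemma \<Psi>_add: "\<Psi> (f + g) = \<Psi> f + \<Psi> g"
proof -
  have "map_poly (poly_subst z) (f + g) = map_poly (poly_subst z) f + map_poly (poly_subst z) g"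
    by (rule poly_eqI) (simp add: coeff_map_poly poly_subst_add)
  then show ?thesis by (simp add: \<Psi>_def)
qed

lemma \<Psi>_mult: "\<Psi> (f * g) = \<Psi> f * \<Psi> g"
proof -
  have "map_poly (poly_subst z) (f * g) = map_poly (poly_subst z) f * map_poly (poly_subst z) g"
    by (rule poly_eqI) (simp add: coeff_map_poly Polynomial.coeff_mult poly_subst_sum poly_subst_mult)
  then show ?thesis by (simp add: \<Psi>_def)
qed

lemma \<Psi>_const: "\<Psi> [:r:] = poly_subst z r" by (simp add: \<Psi>_def map_poly_pCons)

lemma \<Psi>_tvar: "\<Psi> tvar = y" by (simp add: \<Psi>_def map_poly_pCons)

lemma \<Psi>_0 [simp]: "\<Psi> 0 = 0" by (simp add: \<Psi>_def)

lemma \<Psi>_1 [simp]: "\<Psi> 1 = 1" using \<Psi>_const[of 1] by (simp add: one_pCons)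

lemma \<Psi>_diff: "\<Psi> (f - g) = \<Psi> f - \<Psi> g" using \<Psi>_add[of "f - g" g] by simp

lemma \<Psi>_sum: "\<Psi> (\<Sum>i\<in>I. f i) = (\<Sum>i\<in>I. \<Psi> (f i))"
  by (induction I rule: infinite_finite_induct) (auto simp: \<Psi>_add)

lemma \<Psi>_prod: "\<Psi> (\<Prod>i\<in>I. f i) = (\<Prod>i\<in>I. \<Psi> (f i))"
  by (induction I rule: infinite_finite_induct) (auto simp: \<Psi>_mult)

lemma \<Psi>_power: "\<Psi> (f ^ k) = \<Psi> f ^ k"
  by (induction k) (auto simp: \<Psi>_mult)

lemma \<Psi>_scale: "\<Psi> (pscale c q) = fscale c (\<Psi> q)"
  unfolding pscale_def \<Psi>_mult \<Psi>_const by (simp add: fscale_eq_mult)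

lemma z_cyc: "z (cyc_perm p i) = T (z i)"
proof -
  have "(T ^^ Suc i) (T y - y) = T ((T ^^ i) (T y - y))" by simp
  then show ?thesis using period p0 by (auto simp: z_def cyc_perm_def T_0)
qed

lemma \<Psi>_equivariant: "\<Psi> (\<tau> p q) = T (\<Psi> q)"
proof (induction q)
  case 0
  then show ?case using tau_pow_const[of 1 p 0] by (simp add: T_0)
next
  case (pCons a q)
  have s: "pCons a q = [:a:] + tvar * q" by simp
  have c: "poly_subst z (rotate_vars p a) = T (poly_subst z a)"
  proof -
    have "poly_subst z (rotate_vars p a) = poly_subst (\<lambda>i. poly_subst h (z i)) a"
      unfolding rotate_vars_def poly_subst_poly_subst by (simp add: z_cyc flip: fun_cong[OF T])
    then show ?thesis by (simp only: fun_cong[OF T] poly_subst_poly_subst)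
  qed
  have z0: "z 0 = T y - y" using p0 by (simp add: z_def)
  have "\<Psi> (\<tau> p (pCons a q)) = poly_subst z (rotate_vars p a) + (y + z 0) * \<Psi> (\<tau> p q)"
    unfolding s tau_add tau_mult tau_const tau_tvar \<Psi>_add \<Psi>_mult \<Psi>_const \<Psi>_tvar by simp
  also have "\<dots> = T (\<Psi> ([:a:] + tvar * q))"
    unfolding c pCons.IH z0 \<Psi>_add \<Psi>_mult \<Psi>_const \<Psi>_tvar T_add T_mult by simp
  finally show ?case unfolding s .
qed

lemma \<Psi>_equivariant_pow: "\<Psi> ((\<tau> p ^^ k) q) = (T ^^ k) (\<Psi> q)"
  by (induction k) (auto simp: \<Psi>_equivariant)

lemma \<Psi>_Delta_pow: "\<Psi> (((\<lambda>q. \<tau> p q - q) ^^ k) q) = ((\<lambda>f. T f - f) ^^ k) (\<Psi> q)"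
  by (induction k) (auto simp: \<Psi>_equivariant \<Psi>_diff)

lemma z_component: "z i \<in> sym_component (p + 1) 1"
proof -
  have "(T ^^ i) (T y - y) \<in> sym_component (p + 1) 1"
    by (induction i) (auto intro: T_component sym_component_diff y simp del: One_nat_def Suc_eq_plus1 add_Suc_right)
  then show ?thesis by (simp add: z_def)
qed

lemma \<Psi>_component: assumes "q \<in> graded p d" shows "\<Psi> q \<in> sym_component (p + 1) d"
proof -
  have "\<Psi> q = (\<Sum>i\<le>d. poly_subst z (coeff q i) * y ^ i)"
    by (subst graded_expand[OF assms]) (simp only: \<Psi>_sum \<Psi>_mult \<Psi>_const \<Psi>_power \<Psi>_tvar)
  also have "\<dots> \<in> sym_component (p + 1) d"
  proof (rule sym_component_sum)
    fix i assume i: "i \<in> {..d}"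
    have "poly_subst z (coeff q i) \<in> sym_component (p + 1) (d - i)"
      by (rule poly_subst_in_component[where n = p, OF _ z_component]) (use assms i in \<open>auto simp: graded_def\<close>)
    then have "poly_subst z (coeff q i) * y ^ i \<in> sym_component (p + 1) (d - i + i * 1)"
      by (intro sym_component_mult sym_component_power y)
    then show "poly_subst z (coeff q i) * y ^ i \<in> sym_component (p + 1) d" using i by simp
  qed
  finally show ?thesis .
qed

lemma \<Psi>_image_subspace: "fs.subspace (\<Psi> ` graded p d)"
proof (rule fs.subspaceI)
  show "0 \<in> \<Psi> ` graded p d" using imageI[OF graded_0, of \<Psi> p d] by simp
next
  fix f g assume "f \<in> \<Psi> ` graded p d" "g \<in> \<Psi> ` graded p d"
  then obtain u v where "u \<in> graded p d" "v \<in> graded p d" "f = \<Psi> u" "g = \<Psi> v" by blast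
  then show "f + g \<in> \<Psi> ` graded p d" using imageI[OF graded_add, of u p d v \<Psi>] by (simp add: \<Psi>_add)
next
  fix c f assume "f \<in> \<Psi> ` graded p d"
  then obtain u where "u \<in> graded p d" "f = \<Psi> u" by blast
  then show "fscale c f \<in> \<Psi> ` graded p d" using imageI[OF graded_pscale, of u p d \<Psi> c] by (simp add: \<Psi>_scale)
qed

text \<open>The orbit of \<open>y\<close> lies in the image, so every variable does, and products of variables follow.\<close>

lemma \<Psi>_surj: "sym_component (p + 1) d \<subseteq> \<Psi> ` graded p d"
proof -
  have "range (\<lambda>k. (T ^^ k) y) \<subseteq> \<Psi> ` graded p 1"
  proof clarify
    fix k
    have "(\<tau> p ^^ k) tvar \<in> graded p 1" by (rule graded_tau_pow[OF p0 graded_tvar])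
    then show "(T ^^ k) y \<in> \<Psi> ` graded p 1"
      by (rule image_eqI[rotated]) (simp only: \<Psi>_equivariant_pow \<Psi>_tvar)
  qed
  then have "sym_component (p + 1) 1 \<subseteq> \<Psi> ` graded p 1"
    by (rule subset_trans[OF span fs.span_minimal[OF _ \<Psi>_image_subspace]])
  then have ex: "\<exists>g. g \<in> graded p 1 \<and> \<Psi> g = Var i" if "i < p + 1" for i
  proof -
    have "Var i \<in> \<Psi> ` graded p 1"
      using \<open>sym_component (p + 1) 1 \<subseteq> \<Psi> ` graded p 1\<close> sym_component_Var[OF that] by (rule subsetD)
    then obtain u where u: "Var i = \<Psi> u" "u \<in> graded p 1" by (rule imageE)
    show ?thesis by (rule exI[of _ u], rule conjI[OF u(2) u(1)[symmetric]])
  qed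
  define g where "g i = (SOME g. g \<in> graded p 1 \<and> \<Psi> g = Var i)" for i
  have g: "g i \<in> graded p 1 \<and> \<Psi> (g i) = Var i" if "i < p + 1" for i
    unfolding g_def by (rule someI_ex[OF ex[OF that]])
  have "(\<lambda>m. Poly_Mapping.single m (1::'f)) ` monomials (p + 1) d \<subseteq> \<Psi> ` graded p d"
  proof clarify
    fix m assume m: "m \<in> monomials (p + 1) d"
    define f where "f = (\<Prod>i<p + 1. g i ^ Poly_Mapping.lookup m i)"
    have "f \<in> graded p (\<Sum>i<p + 1. Poly_Mapping.lookup m i * 1)"
      unfolding f_def by (rule graded_prod'[OF finite_lessThan], rule graded_power, rule conjunct1, rule g) simp
    then have "f \<in> graded p d" using m by (simp add: monomials_def total_degree_def)
    moreover have "\<Psi> f = (\<Prod>i<p + 1. Var i ^ Poly_Mapping.lookup m i)"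
      unfolding f_def \<Psi>_prod \<Psi>_power by (rule prod.cong) (use g in auto)
    moreover have "\<dots> = eval_monomial Var m"
      using m by (intro eval_monomial_superset[symmetric]) (auto simp: monomials_def)
    ultimately show "Poly_Mapping.single m (1::'f) \<in> \<Psi> ` graded p d" by (metis eval_monomial_Var image_eqI)
  qed
  then show ?thesis
    unfolding sym_component_span by (rule fs.span_minimal[OF _ \<Psi>_image_subspace])
qed

text \<open>A component of the model algebra is spanned by as many monomials as there are in the component onto
  which it is mapped.\<close>

lemma \<Psi>_inj: assumes q: "q \<in> graded p d" "\<Psi> q = 0" shows "q = 0"
proof -
  let ?S = "monomials (p + 1) d"
  let ?r = "\<lambda>m :: nat \<Rightarrow>\<^sub>0 nat. m - Poly_Mapping.single p (Poly_Mapping.lookup m p)"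
  define a where "a q m = Poly_Mapping.lookup (coeff q (Poly_Mapping.lookup m p)) (?r m)" for q :: "'f mpoly poly" and m
  define e where "e m = [:Poly_Mapping.single (?r m) (1::'f):] * tvar ^ Poly_Mapping.lookup m p" for m
  have ex: "q = (\<Sum>m\<in>?S. pscale (a q m) (e m))" if "q \<in> graded p d" for q
    unfolding a_def e_def by (rule graded_monomial_expand[OF that])
  have \<Psi>ex: "\<Psi> q = (\<Sum>m\<in>?S. fscale (a q m) (\<Psi> (e m)))" if "q \<in> graded p d" for q
    by (subst ex[OF that]) (simp add: \<Psi>_sum \<Psi>_scale)
  let ?B = "(\<lambda>m. Poly_Mapping.single m (1::'f)) ` ?S"
  have "?B \<subseteq> fs.span ((\<lambda>m. \<Psi> (e m)) ` ?S)"
  proof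
    fix f assume "f \<in> ?B"
    then have "f \<in> sym_component (p + 1) d" by (auto intro: sym_component_single)
    then obtain u where u: "u \<in> graded p d" "f = \<Psi> u" using \<Psi>_surj by blast
    show "f \<in> fs.span ((\<lambda>m. \<Psi> (e m)) ` ?S)"
      unfolding u(2) \<Psi>ex[OF u(1)] by (intro fs.span_sum fs.span_scale fs.span_base) auto
  qed
  moreover have "card ?B = card ?S"
    by (rule card_image, rule inj_onI) (metis lookup_single_eq lookup_single_not_eq zero_neq_one)
  ultimately have "a q m = 0" if "m \<in> ?S" for m
    using fs.spanning_family_independent[where v = "\<lambda>m. \<Psi> (e m)" and a = "a q", OF finite_monomials monomial_basis_independent _ _ _ that]
      \<Psi>ex[OF q(1)] q(2) by simp
  then show ?thesis using ex[OF q(1)] by (simp add: pscale_def)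
qed

lemma \<Psi>_eq: "f \<in> graded p d \<Longrightarrow> g \<in> graded p d \<Longrightarrow> \<Psi> f = \<Psi> g \<Longrightarrow> f = g"
  using \<Psi>_inj[of "f - g" d] graded_diff[of f p d g] by (simp add: \<Psi>_diff)

lemma z_orbit: assumes "0 < p" shows "(T ^^ k) (T y - y) = z (k mod p)"
proof -
  have "(T ^^ k) (z 0) = \<Psi> ((\<tau> p ^^ k) [:Var 0:])" by (simp add: \<Psi>_equivariant_pow \<Psi>_const)
  also have "\<dots> = z (k mod p)"
  proof -
    have "(rotate_vars p ^^ k) (Var 0 :: 'f mpoly) = Var (k mod p)" using rotate_pow_Var[of 0 p k] assms by simp
    then show ?thesis by (simp add: tau_pow_const \<Psi>_const)
  qed
  finally show ?thesis using assms by (simp add: z_def)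
qed

lemma inj_z: "inj_on z {..<p}"
proof (rule inj_onI)
  fix i j assume ij: "i \<in> {..<p}" "j \<in> {..<p}" "z i = z j"
  have "[:Var i:] = [:Var j :: 'f mpoly:]"
    by (rule \<Psi>_eq[of _ 1]) (use ij in \<open>auto intro: graded_const sym_component_Var simp: \<Psi>_const simp del: One_nat_def\<close>)
  then have "Poly_Mapping.single i (1::nat) = Poly_Mapping.single j 1" by (simp add: Var_def)
      (metis lookup_single_eq lookup_single_not_eq zero_neq_one)
  then show "i = j" by (metis lookup_single_eq lookup_single_not_eq zero_neq_one)
qed

text \<open>From \<open>T\<^sup>k y\<close> one recovers \<open>k\<close> modulo \<open>p\<close> through \<open>T\<^sup>k (T y - y) = z\<^bsub>k mod p\<^esub>\<close>, and the quotient by \<open>p\<close> through the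
  multiple of \<open>x\<^sub>1\<close> that full turns add.\<close>

lemma inj_y: assumes "prime p" "CHAR('f) = p" shows "inj_on (\<lambda>k. (T ^^ k) y) {..<p ^ 2}"
proof (rule inj_onI)
  have key: False if kl: "k < l" "l < p ^ 2" "(T ^^ k) y = (T ^^ l) y" for k l
  proof -
    have p0': "0 < p" by (rule p0)
    have tk: "(\<tau> p ^^ k) tvar = ((\<tau> p ^^ l) tvar :: 'f mpoly poly)"
      by (rule \<Psi>_eq[of _ 1]) (use kl(3) in \<open>auto intro: graded_tau_pow[OF p0] graded_tvar simp: \<Psi>_equivariant_pow \<Psi>_tvar simp del: One_nat_def\<close>)
    have "(\<tau> p ^^ k) (\<tau> p tvar) = (\<tau> p ^^ l) (\<tau> p (tvar :: 'f mpoly poly))" using tk by (metis funpow_swap1)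
    then have "(\<tau> p ^^ k) [:Var 0:] = ((\<tau> p ^^ l) [:Var 0:] :: 'f mpoly poly)"
      using tk by (simp add: tau_tvar tau_pow_add del: pCons_0_0 add_pCons)
    then have "Var (k mod p) = (Var (l mod p) :: 'f mpoly)"
    proof -
      have r: "(rotate_vars p ^^ k) (Var 0 :: 'f mpoly) = Var (k mod p)" for k
        using rotate_pow_Var[of 0 p k] p0 by simp
      have "(rotate_vars p ^^ k) (Var 0) = (rotate_vars p ^^ l) (Var 0 :: 'f mpoly)"
        using \<open>(\<tau> p ^^ k) [:Var 0:] = _\<close> by (simp add: tau_pow_const)
      then show ?thesis unfolding r .
    qed
    then have "z (k mod p) = z (l mod p)" by (metis poly_subst_Var)
    then have m: "k mod p = l mod p" using inj_z p0 by (simp add: inj_on_def)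
    define a where "a = (l - k) div p"
    have "p dvd l - k" using m kl(1) by (metis less_imp_le_nat mod_eq_dvd_iff_nat)
    then have la: "l = k + p * a" using kl(1) by (simp add: a_def)
    have "((\<tau> p ^^ p) ^^ a) tvar = tvar + [:of_nat a * var_sum p :: 'f mpoly:]"
      by (rule tau_pow_p_pow_tvar[OF p0])
    then have "(\<tau> p ^^ (p * a)) tvar = tvar + [:of_nat a * var_sum p :: 'f mpoly:]" by (simp add: funpow_mult)
    then have "(\<tau> p ^^ l) tvar = (\<tau> p ^^ k) tvar + (\<tau> p ^^ k) [:of_nat a * var_sum p :: 'f mpoly:]"
      unfolding la funpow_add by (simp only: o_apply tau_pow_add)
    then have "(\<tau> p ^^ k) [:of_nat a * var_sum p :: 'f mpoly:] = 0" using tk by simp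
    moreover have "(rotate_vars p ^^ k) (of_nat a * var_sum p) = (of_nat a * var_sum p :: 'f mpoly)"
    proof (induction k)
      case (Suc k)
      have "rotate_vars p (of_nat a * var_sum p) = (of_nat a * var_sum p :: 'f mpoly)"
        by (induction a) (simp_all add: distrib_right rotate_add)
      then show ?case using Suc by simp
    qed simp
    ultimately have "(of_nat a :: 'f mpoly) = 0" using var_sum_nonzero[OF p0, where 'f = 'f] by (simp add: tau_pow_const)
    then have "p dvd a" using of_nat_eq_0_iff_char_dvd[where 'a = "'f mpoly"] CHAR_mpoly[where 'f = 'f] assms(2) by simp
    moreover have "0 < a" using la kl(1) by (cases a) auto
    ultimately have "p * p \<le> p * a" by (intro mult_le_mono dvd_imp_le order_refl)
    then show False using la kl(2) unfolding power2_eq_square by linarith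
  qed
  fix k l assume "k \<in> {..<p ^ 2}" "l \<in> {..<p ^ 2}" "(T ^^ k) y = (T ^^ l) y"
  then show "k = l" using key[of k l] key[of l k] by (metis lessThan_iff nat_neq_iff)
qed

end

section \<open>The components as modules\<close>

text \<open>The vectors \<open>v, \<Delta> v, \<Delta>\<^sup>2 v, \<dots>\<close> up to the last nonzero one are independent.\<close>

lemma (in p2_module) pow_card_eq_0:
  assumes v: "v \<in> M" and n: "card B \<le> n"
  shows "(\<Delta> ^^ n) v = 0"
proof (cases "v = 0")
  case False
  define m where "m = (LEAST m. (\<Delta> ^^ m) v = 0)"
  have m: "(\<Delta> ^^ m) v = 0" unfolding m_def by (rule LeastI[of _ "p ^ 2"]) (rule nilpotent[OF v])
  have "0 < m"
  proof (rule ccontr)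
    assume "\<not> 0 < m"
    then show False using m False by simp
  qed
  moreover have "(\<Delta> ^^ (m - 1)) v \<noteq> 0" using not_less_Least[of "m - 1" "\<lambda>m. (\<Delta> ^^ m) v = 0"] \<open>0 < m\<close> by (simp add: m_def)
  ultimately have "block_gen v m" using m by (simp add: block_gen_def)
  then have "m = dim (cyc v m)" by (simp add: dim_block)
  also have "\<dots> \<le> card B"
  proof (rule dim_le_card[OF _ finB])
    have "cyc v m \<subseteq> M"
      unfolding cyc_def by (rule span_minimal[OF _ subM]) (auto intro: stable_pow[OF stable_M v])
    then show "cyc v m \<subseteq> span B" using MB by blast
  qed
  finally show ?thesis using n pow_eq_0_mono[OF m] by simp
qed simp

lemma (in vector_space) span_scale_single: assumes "c \<noteq> 0" shows "span {scale c v} = span {v}"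
proof (intro equalityI span_minimal subspace_span)
  show "{scale c v} \<subseteq> span {v}" by (simp add: span_scale span_base)
  have "scale (inverse c) (scale c v) \<in> span {scale c v}" by (intro span_scale span_base) simp
  then show "{v} \<subseteq> span {scale c v}" using assms by simp
qed

lemma (in p2_module) decomposition_subset:
  assumes "indecomposable_decomposition scale G act M k N" "i < k" shows "N i \<subseteq> M"
  by (rule decompositionD[OF assms(1)]) (use assms(2) in blast)

lemma graded_Delta_pow: assumes "0 < p" "q \<in> graded p d" shows "((\<lambda>q. \<tau> p q - q) ^^ k) q \<in> graded p d"
proof (induction k)
  case (Suc k)
  then show ?case using graded_diff[OF graded_tau_pow[OF assms(1) Suc, of 1] Suc] by simp
qed (simp add: assms)

locale sym_algebra_module = G: group G
  for G :: "('g, 'x) monoid_scheme" (structure) +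
  fixes \<sigma> :: 'g and p :: nat and y :: "'f::field mpoly"
  assumes p: "prime p" and char: "CHAR('f) = p"
    and \<sigma>: "\<sigma> \<in> carrier G" and gen: "generate G {\<sigma>} = carrier G" and order: "order G = p ^ 2"
    and y_gen: "module_generator fscale G (sym_act G (V_act G \<sigma>) (p + 1)) (sym_component (p + 1) 1) y"
begin

abbreviation act :: "'g \<Rightarrow> 'f mpoly \<Rightarrow> 'f mpoly" where "act \<equiv> sym_act G (V_act G \<sigma>) (p + 1)"

abbreviation M :: "nat \<Rightarrow> 'f mpoly set" where "M d \<equiv> sym_component (p + 1) d"

abbreviation monomial_basis :: "nat \<Rightarrow> 'f mpoly set"
  where "monomial_basis d \<equiv> (\<lambda>m. Poly_Mapping.single m 1) ` monomials (p + 1) d"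

lemma p_gt: "0 < p" "1 < p" using p prime_gt_0_nat prime_gt_1_nat by blast+

lemma component_p2_module: "p2_module fscale G \<sigma> p act (act \<sigma>) (M d) (monomial_basis d)"
proof (rule sym_component_p2_module[OF p char G.is_group \<sigma> gen order])
  have "p + 1 \<le> 2 * p" using p_gt by simp
  also have "\<dots> \<le> p ^ 2" using p_gt by (simp add: power2_eq_square)
  finally show "p + 1 \<le> p ^ 2" .
qed

lemma generator_coordinates:
  "generator_coordinates p (act \<sigma>) (jordan_form (p + 1) (exponent G \<sigma> (inv \<sigma>))) y"
proof -
  interpret P: p2_module fscale G \<sigma> p act "act \<sigma>" "M 1" "monomial_basis 1" by (rule component_p2_module)
  have y: "y \<in> M 1" and span: "fs.span ((\<lambda>g. act g y) ` carrier G) = M 1"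
    using y_gen by (simp_all add: module_generator_def)
  show ?thesis
  proof
    show "0 < p" by (rule p_gt)
    show "act \<sigma> = poly_subst (jordan_form (p + 1) (exponent G \<sigma> (inv \<sigma>)))"
      by (simp only: sym_act_eq jordan_subst_def)
    fix d and f :: "'f mpoly" assume f: "f \<in> M d"
    interpret Q: p2_module fscale G \<sigma> p act "act \<sigma>" "M d" "monomial_basis d" by (rule component_p2_module)
    show "act \<sigma> f \<in> M d" by (rule Q.TM[OF f])
  next
    show "y \<in> M 1" by (rule y)
    have "card (monomial_basis 1) \<le> p + 1"
      using card_image_le[OF finite_monomials] card_monomials_1 by (rule order_trans)
    then have "(P.\<Delta> ^^ (p + 1)) y = 0" by (rule P.pow_card_eq_0[OF y])
    then have "(P.\<Delta> ^^ p) (P.\<Delta> y) = 0" by (simp only: Suc_eq_plus1[symmetric] funpow_Suc_right o_apply)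
    then show "((act \<sigma>) ^^ p) (act \<sigma> y - y) = act \<sigma> y - y" using P.T_frobenius(1)[of "act \<sigma> y - y"] by simp
    have "(\<lambda>g. act g y) ` carrier G \<subseteq> range (\<lambda>k. (act \<sigma> ^^ k) y)"
    proof (rule image_subsetI)
      fix g assume g: "g \<in> carrier G"
      show "act g y \<in> range (\<lambda>k. (act \<sigma> ^^ k) y)" unfolding P.act_eq[OF g y] by (rule rangeI)
    qed
    then show "M 1 \<subseteq> fs.span (range (\<lambda>k. (act \<sigma> ^^ k) y))" using fs.span_mono span by metis
  qed
qed

lemma act_orbit:
  assumes f: "f \<in> M d" shows "(\<lambda>g. act g f) ` carrier G = (\<lambda>k. (act \<sigma> ^^ k) f) ` {..<p ^ 2}"
proof -
  interpret P: p2_module fscale G \<sigma> p act "act \<sigma>" "M d" "monomial_basis d" by (rule component_p2_module)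
  show ?thesis
  proof (intro equalityI image_subsetI)
    fix g assume g: "g \<in> carrier G"
    have "act g f = (act \<sigma> ^^ (exponent G \<sigma> g mod p ^ 2)) f"
      unfolding P.act_eq[OF g f] by (rule P.Tpow_mod[OF f, symmetric])
    then show "act g f \<in> (\<lambda>k. (act \<sigma> ^^ k) f) ` {..<p ^ 2}" by (rule image_eqI) (simp add: p_gt)
  next
    fix k
    have "(act \<sigma> ^^ k) f = act (\<sigma> [^] k) f" by (rule P.act_pow[OF f, symmetric])
    then show "(act \<sigma> ^^ k) f \<in> (\<lambda>g. act g f) ` carrier G" by (rule image_eqI) (simp add: \<sigma>)
  qed
qed

end

locale sym_algebra_normal_form = sym_algebra_module G \<sigma> p y + NF: normal_form p K \<beta>
  for G :: "('g, 'x) monoid_scheme" (structure) and \<sigma> p and y :: "'f::field mpoly" and K and \<beta> :: 'f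
begin

sublocale C: generator_coordinates p "act \<sigma>" "jordan_form (p + 1) (exponent G \<sigma> (inv \<sigma>))" y
  by (rule generator_coordinates)

abbreviation \<Delta> :: "'f mpoly \<Rightarrow> 'f mpoly" where "\<Delta> \<equiv> \<lambda>f. act \<sigma> f - f"

sublocale V: vector_operator fscale \<Delta>
proof -
  interpret P: p2_module fscale G \<sigma> p act "act \<sigma>" "M 0" "monomial_basis 0" by (rule component_p2_module)
  show "vector_operator fscale \<Delta>" by (rule P.vector_operator_axioms)
qed

lemma \<Psi>_pow_eq: "C.\<Psi> ((NF.\<Delta> ^^ k) q) = (\<Delta> ^^ k) (C.\<Psi> q)"
  by (rule C.\<Psi>_Delta_pow)

lemma component_lift:
  assumes "f \<in> M d" obtains q where "q \<in> graded p d" "C.\<Psi> q = f"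
proof -
  have "f \<in> C.\<Psi> ` graded p d" using C.\<Psi>_surj assms by (rule subsetD)
  then obtain q where "f = C.\<Psi> q" "q \<in> graded p d" by (rule imageE)
  then show ?thesis using that by simp
qed

lemma pow_lift_eq_0:
  assumes q: "q \<in> graded p d" and 0: "(\<Delta> ^^ k) (C.\<Psi> q) = 0"
  shows "(NF.\<Delta> ^^ k) q = 0"
proof (rule C.\<Psi>_inj)
  show "(NF.\<Delta> ^^ k) q \<in> graded p d" by (rule graded_Delta_pow[OF p_gt(1) q])
  show "C.\<Psi> ((NF.\<Delta> ^^ k) q) = 0" using 0 by (simp only: \<Psi>_pow_eq)
qed

lemma component_layer_induced:
  assumes d: "d = B * p + c" "c < p" and j: "j \<noteq> c \<or> B mod p = p - 1"
  shows "V.layer_induced p j (M d)"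
  unfolding V.layer_induced_def
proof (intro ballI impI)
  fix f assume f: "f \<in> M d" "(\<Delta> ^^ (p * j + (p - 1))) f = 0"
  obtain q where q: "q \<in> graded p d" "C.\<Psi> q = f" using component_lift[OF f(1)] .
  have 0: "(NF.\<Delta> ^^ (p * j + (p - 1))) q = 0" using pow_lift_eq_0[OF q(1)] f(2) q(2) by simp
  have "\<exists>r\<in>graded p d. (NF.\<Delta> ^^ (p * j)) q = (NF.\<Delta> ^^ (p * j + 1)) r"
  proof (cases "j = c")
    case True
    then have "B mod p = p - 1" using j by simp
    then show ?thesis using NF.graded_layer_defect[OF d q(1)] 0 True by fastforce
  next
    case False
    then show ?thesis using NF.graded_layer_induced[OF d _ q(1) 0] by blast
  qed
  then obtain r where r: "r \<in> graded p d" "(NF.\<Delta> ^^ (p * j)) q = (NF.\<Delta> ^^ (p * j + 1)) r" by (rule bexE)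
  have "(\<Delta> ^^ (p * j)) f = (\<Delta> ^^ (p * j + 1)) (C.\<Psi> r)"
    using arg_cong[OF r(2), of C.\<Psi>] by (simp only: \<Psi>_pow_eq q(2))
  then show "(\<Delta> ^^ (p * j)) f \<in> (\<Delta> ^^ (p * j + 1)) ` M d"
    by (rule image_eqI) (rule C.\<Psi>_component[OF r(1)])
qed

lemma component_layer_defect:
  assumes d: "d = B * p + c" "c < p" and f: "f \<in> M d" "(\<Delta> ^^ (p * c + (p - 1))) f = 0"
  shows "\<exists>g\<in>M d. \<exists>\<alpha>. (\<Delta> ^^ (p * c)) f = (\<Delta> ^^ (p * c + 1)) g + fscale \<alpha> ((\<Delta> ^^ (p * c)) (C.\<Psi> (NF.summand_gen B c)))"
proof -
  obtain q where q: "q \<in> graded p d" "C.\<Psi> q = f" using component_lift[OF f(1)] .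
  have 0: "(NF.\<Delta> ^^ (p * c + (p - 1))) q = 0" using pow_lift_eq_0[OF q(1)] f(2) q(2) by simp
  obtain r \<alpha> where r: "r \<in> graded p d"
    "(NF.\<Delta> ^^ (p * c)) q = (NF.\<Delta> ^^ (p * c + 1)) r + [:const \<alpha>:] * (NF.\<Delta> ^^ (p * c)) (NF.summand_gen B c)"
    using NF.graded_layer_defect[OF d q(1) 0] by blast
  have "(\<Delta> ^^ (p * c)) f = (\<Delta> ^^ (p * c + 1)) (C.\<Psi> r) + fscale \<alpha> ((\<Delta> ^^ (p * c)) (C.\<Psi> (NF.summand_gen B c)))"
    using arg_cong[OF r(2), of C.\<Psi>]
    by (simp only: C.\<Psi>_add \<Psi>_pow_eq q(2) pscale_def[symmetric] C.\<Psi>_scale)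
  then show ?thesis using C.\<Psi>_component[OF r(1)] by blast
qed

lemma component_pure:
  assumes d: "d = (a * p + b) * p + c" and bc: "b + 1 < p" "c < p"
  defines "w \<equiv> C.\<Psi> (NF.summand_gen (a * p + b) c)"
  shows "w \<in> M d" "(\<Delta> ^^ (p * c + b + 1)) w = 0" "(\<Delta> ^^ (p * c + b)) w \<notin> (\<Delta> ^^ (p * c + b + 1)) ` M d"
proof -
  have gr: "NF.summand_gen (a * p + b) c \<in> graded p d" unfolding d by (rule NF.summand_gen_graded)
  show "w \<in> M d" unfolding w_def by (rule C.\<Psi>_component[OF gr])
  have b: "b < p" using bc by simp
  show "(\<Delta> ^^ (p * c + b + 1)) w = 0"
    using arg_cong[OF NF.summand_gen_bottom(2)[OF refl b bc(2)], of C.\<Psi>] by (simp only: w_def \<Psi>_pow_eq C.\<Psi>_0)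
  show "(\<Delta> ^^ (p * c + b)) w \<notin> (\<Delta> ^^ (p * c + b + 1)) ` M d"
  proof
    assume "(\<Delta> ^^ (p * c + b)) w \<in> (\<Delta> ^^ (p * c + b + 1)) ` M d"
    then obtain f where f: "(\<Delta> ^^ (p * c + b)) w = (\<Delta> ^^ (p * c + b + 1)) f" "f \<in> M d" by (rule imageE)
    obtain q where q: "q \<in> graded p d" "C.\<Psi> q = f" using component_lift[OF f(2)] .
    have "(NF.\<Delta> ^^ (p * c + b)) (NF.summand_gen (a * p + b) c) = (NF.\<Delta> ^^ (p * c + b + 1)) q"
    proof (rule C.\<Psi>_eq)
      show "C.\<Psi> ((NF.\<Delta> ^^ (p * c + b)) (NF.summand_gen (a * p + b) c)) = C.\<Psi> ((NF.\<Delta> ^^ (p * c + b + 1)) q)"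
        using f(1) by (simp only: \<Psi>_pow_eq q(2) w_def)
    qed (rule graded_Delta_pow[OF p_gt(1) gr], rule graded_Delta_pow[OF p_gt(1) q(1)])
    then show False using NF.summand_gen_pure[OF d refl bc q(1)] by blast
  qed
qed

lemma norm_y: "orbit_norm G act y = C.\<Psi> NF.norm_t"
proof -
  have "orbit_norm G act y = (\<Prod>k<p ^ 2. (act \<sigma> ^^ k) y)"
    unfolding orbit_norm_def act_orbit[OF C.y] by (simp only: prod.reindex[OF C.inj_y[OF p char]] o_def)
  also have "\<dots> = C.\<Psi> NF.norm_t" unfolding NF.norm_t_def C.\<Psi>_prod C.\<Psi>_equivariant_pow C.\<Psi>_tvar ..
  finally show ?thesis .
qed

text \<open>The orbit consists of only \<open>p\<close> elements, as \<open>\<sigma>\<^sup>p\<close> fixes them.\<close>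

lemma norm_Delta_y: "orbit_norm G act (\<Delta> y) = C.\<Psi> [:var_prod p:]"
proof -
  have z: "\<Delta> y \<in> M 1" using C.z_component[of 0] p_gt(1) unfolding C.z_def by (simp only: if_True funpow_0)
  have "(\<lambda>g. act g (\<Delta> y)) ` carrier G = C.z ` {..<p}"
    unfolding act_orbit[OF z] C.z_orbit[OF p_gt(1)]
  proof (intro equalityI image_subsetI)
    fix i assume i: "i \<in> {..<p}"
    have "C.z i = C.z (i mod p)" using i by simp
    moreover have "i \<in> {..<p ^ 2}" using i p_gt by (simp add: power2_eq_square less_le_trans[of i p "p * p"])
    ultimately show "C.z i \<in> (\<lambda>k. C.z (k mod p)) ` {..<p ^ 2}" by (rule image_eqI)
  qed (simp add: p_gt)
  then have "orbit_norm G act (\<Delta> y) = (\<Prod>i<p. C.z i)"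
    unfolding orbit_norm_def by (simp only: prod.reindex[OF C.inj_z] o_def)
  also have "\<dots> = C.\<Psi> [:var_prod p:]"
    unfolding C.\<Psi>_const var_prod_def by (simp add: poly_subst_prod)
  finally show ?thesis .
qed

lemma Delta_pow_y: "(\<Delta> ^^ p) y = C.\<Psi> [:var_sum p:]"
proof -
  have "(\<Delta> ^^ p) y = (act \<sigma> ^^ p) y - y"
    using p2_module.T_frobenius(1)[OF component_p2_module, of y] by simp
  also have "\<dots> = C.\<Psi> ((\<tau> p ^^ p) tvar) - C.\<Psi> tvar" unfolding C.\<Psi>_equivariant_pow C.\<Psi>_tvar ..
  also have "\<dots> = C.\<Psi> ((\<tau> p ^^ p) tvar - tvar)" by (rule C.\<Psi>_diff[symmetric])
  also have "(\<tau> p ^^ p) tvar - tvar = [:var_sum p :: 'f mpoly:]" by (simp add: tau_pow_p[OF p_gt(1)] pcompose_pCons)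
  finally show ?thesis .
qed

lemma bottom_component:
  assumes "b < p" "c < p"
  shows "\<exists>\<gamma>. \<gamma> \<noteq> 0 \<and> (\<Delta> ^^ (p * c + b)) (C.\<Psi> (NF.summand_gen (a * p + b) c)) =
    fscale \<gamma> (orbit_norm G act y ^ a * orbit_norm G act (\<Delta> y) ^ b * ((\<Delta> ^^ p) y) ^ c)"
proof -
  obtain \<gamma> where \<gamma>: "\<gamma> \<noteq> 0" "(NF.\<Delta> ^^ (p * c + b)) (NF.summand_gen (a * p + b) c) =
      [:const \<gamma>:] * (NF.norm_t ^ a * [:var_prod p ^ b:] * [:var_sum p ^ c:])"
    using NF.summand_gen_bottom(1)[OF refl assms] by blast
  have "[:r ^ k:] = [:r:] ^ k" for r :: "'f mpoly" and k by (simp add: poly_const_pow)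
  then have "(\<Delta> ^^ (p * c + b)) (C.\<Psi> (NF.summand_gen (a * p + b) c)) = 
      fscale \<gamma> (C.\<Psi> NF.norm_t ^ a * C.\<Psi> [:var_prod p:] ^ b * C.\<Psi> [:var_sum p:] ^ c)"
    using arg_cong[OF \<gamma>(2), of C.\<Psi>]
    by (simp only: \<Psi>_pow_eq pscale_def[symmetric] C.\<Psi>_scale C.\<Psi>_mult C.\<Psi>_power)
  then show ?thesis using \<gamma>(1) unfolding norm_y norm_Delta_y Delta_pow_y by blast
qed

lemma exists_decomposition: "\<exists>k N. indecomposable_decomposition fscale G act (M d) k N"
proof -
  interpret P: p2_module fscale G \<sigma> p act "act \<sigma>" "M d" "monomial_basis d" by (rule component_p2_module)
  show ?thesis using P.complement_decomposition[OF P.stable_M subset_refl] .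
qed

lemma noninduced_unique:
  assumes dec: "indecomposable_decomposition fscale G act (M d) k N"
    and ij: "i < k" "\<not> properly_induced fscale G act (N i)" "j < k" "\<not> properly_induced fscale G act (N j)"
  shows "i = j"
proof -
  interpret P: p2_module fscale G \<sigma> p act "act \<sigma>" "M d" "monomial_basis d" by (rule component_p2_module)
  have d: "d = (d div p) * p + d mod p" "d mod p < p" using p_gt by simp_all
  show ?thesis
    by (rule P.at_most_one_noninduced[OF dec component_layer_induced[OF d] component_layer_defect[OF d] ij]) simp
qed

lemma noninduced_summand:
  assumes d: "d = (a * p + b) * p + c" and bc: "b + 1 < p" "c < p"
    and dec: "indecomposable_decomposition fscale G act (M d) k N"
  shows "\<exists>i<k. \<not> properly_induced fscale G act (N i) \<and>
    FG_isomorphic G fscale act (N i) fscale (V_act G \<sigma>) (V_space (c * p + b + 1) :: (nat \<Rightarrow>\<^sub>0 'f) set)"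
proof -
  interpret P: p2_module fscale G \<sigma> p act "act \<sigma>" "M d" "monomial_basis d" by (rule component_p2_module)
  note w = component_pure[OF d bc]
  have m: "p * c + b + 1 - 1 = p * c + b" by simp
  obtain i v where i: "i < k" "V.block_gen v (p * c + b + 1)" "N i = V.cyc v (p * c + b + 1)"
    using P.summand_of_pure_size[OF dec w(1) _ w(2), unfolded m, OF _ w(3)] by auto
  have sub: "V.cyc v (p * c + b + 1) \<subseteq> M d"
    using dec i(1,3) P.decomposition_subset by metis
  have "\<not> p dvd p * c + (b + 1)" unfolding dvd_add_right_iff[OF dvd_triv_left] using bc(1) by (intro nat_dvd_not_less) simp_all
  then have "\<not> properly_induced fscale G act (N i)"
    unfolding i(3) P.block_properly_induced_iff[OF i(2) sub] by (simp add: add.assoc)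
  moreover have "FG_isomorphic G fscale act (N i) fscale (V_act G \<sigma>) (V_space (c * p + b + 1) :: (nat \<Rightarrow>\<^sub>0 'f) set)"
    using P.block_isomorphic_V_space[OF i(2) sub] unfolding i(3) by (simp only: mult.commute)
  ultimately show ?thesis using i(1) by blast
qed

lemma noninduced_summand_socle:
  assumes d: "d = (a * p + b) * p + c" and bc: "b + 1 < p" "c < p"
  shows "\<exists>k N i. indecomposable_decomposition fscale G act (M d) k N \<and> i < k \<and> \<not> properly_induced fscale G act (N i) \<and>
    socle fscale G act (N i) = fixed_space G act (N i) \<and>
    fixed_space G act (N i) =
      fs.span {orbit_norm G act y ^ a * orbit_norm G act (\<Delta> y) ^ b * ((\<Delta> ^^ p) y) ^ c}"
proof -
  interpret P: p2_module fscale G \<sigma> p act "act \<sigma>" "M d" "monomial_basis d" by (rule component_p2_module)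
  note w = component_pure[OF d bc]
  define u where "u = C.\<Psi> (NF.summand_gen (a * p + b) c)"
  have m: "p * c + b + 1 - 1 = p * c + b" by simp
  obtain k N i where dec: "indecomposable_decomposition fscale G act (M d) k N" and
    i: "i < k" "N i = V.cyc u (p * c + b + 1)" "V.block_gen u (p * c + b + 1)"
    using P.pure_block_decomposition[OF w(1) _ w(2), unfolded m, OF _ w(3)] unfolding u_def by auto
  have sub: "V.cyc u (p * c + b + 1) \<subseteq> M d"
    using dec i(1,2) P.decomposition_subset by metis
  have "\<not> p dvd p * c + (b + 1)" unfolding dvd_add_right_iff[OF dvd_triv_left] using bc(1) by (intro nat_dvd_not_less) simp_all
  then have n: "\<not> properly_induced fscale G act (N i)"
    unfolding i(2) P.block_properly_induced_iff[OF i(3) sub] by (simp add: add.assoc)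
  have b: "b < p" using bc by simp
  obtain \<gamma> where \<gamma>: "\<gamma> \<noteq> 0" "(\<Delta> ^^ (p * c + b)) u =
      fscale \<gamma> (orbit_norm G act y ^ a * orbit_norm G act (\<Delta> y) ^ b * ((\<Delta> ^^ p) y) ^ c)"
    using bottom_component[OF b bc(2), of a] unfolding u_def by blast
  have "socle fscale G act (N i) = fs.span {(\<Delta> ^^ (p * c + b)) u}"
    using P.socle_block[OF i(3) sub] unfolding i(2) m .
  moreover have "fixed_space G act (N i) = fs.span {(\<Delta> ^^ (p * c + b)) u}"
    using P.fixed_space_block[OF i(3) sub] unfolding i(2) m .
  ultimately show ?thesis using dec i(1) n unfolding \<gamma>(2) fs.span_scale_single[OF \<gamma>(1)] by blast
qed

lemma induced_component:
  assumes d: "d = B * p + c" "c < p" and B: "B mod p = p - 1"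
  shows "properly_induced fscale G act (M d)"
proof -
  interpret P: p2_module fscale G \<sigma> p act "act \<sigma>" "M d" "monomial_basis d" by (rule component_p2_module)
  show ?thesis by (rule P.layers_induced_properly_induced) (rule component_layer_induced[OF d], rule disjI2, rule B)
qed

end

section \<open>The decomposition theorem\<close>

theorem theorem1p3:
  fixes G :: "('g, 'x) monoid_scheme"
    and \<sigma> :: 'g
    and p d :: nat
    and y :: "'f::field mpoly"
  assumes "prime p"
    and "CHAR('f) = p"
    and "group G"
    and "G \<cong> integer_mod_group (p ^ 2)"
    and "\<sigma> \<in> carrier G"
    and "generate G {\<sigma>} = carrier G"
    and "module_generator fscale G (sym_act G (V_act G \<sigma>) (p + 1)) (sym_component (p + 1) 1) y"
  shows
    "let act = sym_act G (V_act G \<sigma>) (p + 1);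
         M = (sym_component (p + 1) d :: 'f mpoly set);
         x = (\<lambda>i. (Delta act \<sigma> ^^ (p + 1 - i)) y);
         induced = properly_induced fscale G act;
         decomposition = indecomposable_decomposition fscale G act M
     in
       (\<exists>k N. decomposition k N) \<and>
       (\<forall>k N. decomposition k N \<longrightarrow> card {i. i < k \<and> \<not> induced (N i)} \<le> 1) \<and>
       (\<forall>a b c. d = a * p ^ 2 + b * p + c \<and> b < p \<and> c < p \<longrightarrow>
         (b \<le> p - 2 \<longrightarrow>
           (\<forall>k N. decomposition k N \<longrightarrow>
             card {i. i < k \<and> \<not> induced (N i)} = 1 \<and>
             (\<forall>i<k. \<not> induced (N i) \<longrightarrow>
               FG_isomorphic G fscale act (N i)
                 fscale (V_act G \<sigma>) (V_space (c * p + b + 1) :: (nat \<Rightarrow>\<^sub>0 'f) set))) \<and>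
           (\<exists>k N i. decomposition k N \<and> i < k \<and> \<not> induced (N i) \<and>
             socle fscale G act (N i) = fixed_space G act (N i) \<and>
             fixed_space G act (N i) =
               module.span fscale
                 {orbit_norm G act (x (p + 1)) ^ a * orbit_norm G act (x p) ^ b * x 1 ^ c})) \<and>
         (b = p - 1 \<longrightarrow> induced M))"
proof -
  have p: "prime p" and char: "CHAR('f) = p" and \<sigma>: "\<sigma> \<in> carrier G" and gen: "generate G {\<sigma>} = carrier G"
    by fact+
  interpret G: group G by fact
  have order: "order G = p ^ 2"
    using iso_same_card[OF \<open>G \<cong> integer_mod_group (p ^ 2)\<close>] prime_gt_0_nat[OF p]
    by (simp add: order_def carrier_integer_mod_group nat_power_eq)
  obtain K \<beta> where K: "normal_form p (K :: 'f mpoly poly) \<beta>"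
    using exists_degree_p_generator[OF p char] p char unfolding normal_form_def by blast
  interpret S: sym_algebra_normal_form G \<sigma> p y K \<beta>
    by (intro sym_algebra_normal_form.intro sym_algebra_module.intro sym_algebra_module_axioms.intro K
        G.is_group p char \<sigma> gen order \<open>module_generator _ _ _ _ y\<close>)
  have D: "Delta S.act \<sigma> = S.\<Delta>" by (rule ext) (rule Delta_def)
  have x: "(S.\<Delta> ^^ (p + 1 - (p + 1))) y = y" "(S.\<Delta> ^^ (p + 1 - p)) y = S.\<Delta> y" "(S.\<Delta> ^^ (p + 1 - 1)) y = (S.\<Delta> ^^ p) y"
    by simp_all
  let ?ind = "properly_induced fscale G S.act" and ?dec = "indecomposable_decomposition fscale G S.act (S.M d)"
  have le1: "card {i. i < k \<and> \<not> ?ind (N i)} \<le> 1" if "?dec k N" for k N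
    using S.noninduced_unique[OF that] by (auto simp: card_le_Suc0_iff_eq)
  have main: "(b \<le> p - 2 \<longrightarrow>
      (\<forall>k N. ?dec k N \<longrightarrow> card {i. i < k \<and> \<not> ?ind (N i)} = 1 \<and>
        (\<forall>i<k. \<not> ?ind (N i) \<longrightarrow>
          FG_isomorphic G fscale S.act (N i) fscale (V_act G \<sigma>) (V_space (c * p + b + 1) :: (nat \<Rightarrow>\<^sub>0 'f) set))) \<and>
      (\<exists>k N i. ?dec k N \<and> i < k \<and> \<not> ?ind (N i) \<and>
        socle fscale G S.act (N i) = fixed_space G S.act (N i) \<and>
        fixed_space G S.act (N i) = fs.span {orbit_norm G S.act y ^ a * orbit_norm G S.act (S.\<Delta> y) ^ b * ((S.\<Delta> ^^ p) y) ^ c})) \<and>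
    (b = p - 1 \<longrightarrow> ?ind (S.M d))"
    if abc: "d = a * p ^ 2 + b * p + c" "b < p" "c < p" for a b c
  proof (intro conjI impI allI)
    have d: "d = (a * p + b) * p + c" using abc(1) by (simp add: power2_eq_square distrib_right)
    {
      assume "b \<le> p - 2"
      then have b: "b + 1 < p" using prime_gt_1_nat[OF p] by simp
      show "\<exists>k N i. ?dec k N \<and> i < k \<and> \<not> ?ind (N i) \<and>
        socle fscale G S.act (N i) = fixed_space G S.act (N i) \<and>
        fixed_space G S.act (N i) = fs.span {orbit_norm G S.act y ^ a * orbit_norm G S.act (S.\<Delta> y) ^ b * ((S.\<Delta> ^^ p) y) ^ c}"
        by (rule S.noninduced_summand_socle[OF d b abc(3)])
      fix k N assume dec: "?dec k N"
      obtain i where i: "i < k" "\<not> ?ind (N i)"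
        "FG_isomorphic G fscale S.act (N i) fscale (V_act G \<sigma>) (V_space (c * p + b + 1) :: (nat \<Rightarrow>\<^sub>0 'f) set)"
        using S.noninduced_summand[OF d b abc(3) dec] by blast
      have "{i. i < k \<and> \<not> ?ind (N i)} = {i}" using S.noninduced_unique[OF dec _ _ i(1,2)] i(1,2) by blast
      then show "card {i. i < k \<and> \<not> ?ind (N i)} = 1" by simp
      fix j assume "j < k" "\<not> ?ind (N j)"
      then have "j = i" using S.noninduced_unique[OF dec _ _ i(1,2)] by blast
      then show "FG_isomorphic G fscale S.act (N j) fscale (V_act G \<sigma>) (V_space (c * p + b + 1) :: (nat \<Rightarrow>\<^sub>0 'f) set)"
        using i(3) by simp
    next
      assume "b = p - 1"
      moreover have "(a * p + b) mod p = b" using abc(2) by simp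
      ultimately have "(a * p + b) mod p = p - 1" by (rule trans[rotated])
      then show "?ind (S.M d)" by (rule S.induced_component[OF d abc(3)])
    }
  qed
  show ?thesis
    unfolding Let_def D x
  proof (rule conjI[OF S.exists_decomposition], rule conjI)
    show "\<forall>k N. ?dec k N \<longrightarrow> card {i. i < k \<and> \<not> ?ind (N i)} \<le> 1" by (intro allI impI le1)
  qed (intro allI impI, elim conjE, rule main)
qed

end
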